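(* Let $p>0$ and let $\phi\colon\mathbb D\to\mathbb D$ be a non-constant analytic map. If the composition operator $C_\phi f=f\circ\phi$ belongs to the Schatten class $S_p(H^2)$ on the Hardy space, then $C_\phi\in S_{p/2}(\mathfrak B^2)$ on the Bergman space.
   Context: $\mathbb D$ is the open unit disk of $\mathbb C$. $H^2$ is the space of analytic $f(z)=\sum_{k\ge0} c_kz^k$ on $\mathbb D$ with $\|f\|_{H^2}^2=\sum_k|c_k|^2<\infty$; $\mathfrak B^2$ is the space of analytic $f$ on $\mathbb D$ with $\|f\|_{\mathfrak B^2}^2=\int_{\mathbb D}|f|^2\,dA<\infty$, where $dA=dx\,dy/\pi$. For a Hilbert space $H$ and $p>0$, $S_p(H)$ is the set of compact operators $T$ on $H$ with $\sum_{n\ge1}a_n(T)^p<\infty$, where $a_n(T)=\inf\{\|T-R\|:\operatorname{rank}R<n\}$ are the approximation (equivalently singular) numbers. *)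

theory Defs
  imports
    "HOL-Complex_Analysis.Complex_Analysis"
    "HOL-Library.Function_Algebras"
begin

text \<open>
  A Hilbert space of analytic functions on the unit disk is given by a carrier \<open>H\<close> and a norm \<open>N\<close>.
  Its elements are total functions that vanish off the disk, so that HOL equality is equality on the
  disk, \<open>H\<close> is a complex-linear subspace of \<open>complex \<Rightarrow> complex\<close> and \<open>N\<close> is a norm on it.
\<close>

abbreviation unit_disk :: "complex set" where
  "unit_disk \<equiv> ball 0 1"

definition hardy_space :: "(complex \<Rightarrow> complex) set" where
  "hardy_space = {f. f holomorphic_on unit_disk \<and> (\<forall>z. z \<notin> unit_disk \<longrightarrow> f z = 0) \<and>
     summable (\<lambda>k. (cmod (fps_nth (fps_expansion f 0) k))\<^sup>2)}"

definition hardy_norm :: "(complex \<Rightarrow> complex) \<Rightarrow> real" where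
  "hardy_norm f = sqrt (\<Sum>k. (cmod (fps_nth (fps_expansion f 0) k))\<^sup>2)"

definition bergman_space :: "(complex \<Rightarrow> complex) set" where
  "bergman_space = {f. f holomorphic_on unit_disk \<and> (\<forall>z. z \<notin> unit_disk \<longrightarrow> f z = 0) \<and>
     set_integrable lborel unit_disk (\<lambda>z. (cmod (f z))\<^sup>2)}"

definition bergman_norm :: "(complex \<Rightarrow> complex) \<Rightarrow> real" where
  "bergman_norm f = sqrt ((LINT z:unit_disk|lborel. (cmod (f z))\<^sup>2) / pi)"

definition composition_operator ::
    "(complex \<Rightarrow> complex) \<Rightarrow> (complex \<Rightarrow> complex) \<Rightarrow> (complex \<Rightarrow> complex)" where
  "composition_operator \<phi> f = (\<lambda>z. if z \<in> unit_disk then f (\<phi> z) else 0)"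

definition cscale :: "complex \<Rightarrow> (complex \<Rightarrow> complex) \<Rightarrow> (complex \<Rightarrow> complex)" where
  "cscale c f = (\<lambda>z. c * f z)"

interpretation cfun: vector_space cscale
  by standard (simp_all add: cscale_def fun_eq_iff algebra_simps)

text \<open>
  Operators are functions on all of \<open>complex \<Rightarrow> complex\<close>, but everything below depends only on their
  values on the carrier.
\<close>

definition bounded_operator :: "(complex \<Rightarrow> complex) set \<Rightarrow> ((complex \<Rightarrow> complex) \<Rightarrow> real) \<Rightarrow>
    ((complex \<Rightarrow> complex) \<Rightarrow> (complex \<Rightarrow> complex)) \<Rightarrow> bool" where
  "bounded_operator H N T \<longleftrightarrow>
     (\<forall>f\<in>H. T f \<in> H) \<and>
     (\<forall>f\<in>H. \<forall>g\<in>H. T (f + g) = T f + T g) \<and>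
     (\<forall>c. \<forall>f\<in>H. T (cscale c f) = cscale c (T f)) \<and>
     (\<exists>C. \<forall>f\<in>H. N (T f) \<le> C * N f)"

definition operator_norm :: "(complex \<Rightarrow> complex) set \<Rightarrow> ((complex \<Rightarrow> complex) \<Rightarrow> real) \<Rightarrow>
    ((complex \<Rightarrow> complex) \<Rightarrow> (complex \<Rightarrow> complex)) \<Rightarrow> real" where
  "operator_norm H N T = (SUP f\<in>{f \<in> H. N f \<le> 1}. N (T f))"

definition compact_operator :: "(complex \<Rightarrow> complex) set \<Rightarrow> ((complex \<Rightarrow> complex) \<Rightarrow> real) \<Rightarrow>
    ((complex \<Rightarrow> complex) \<Rightarrow> (complex \<Rightarrow> complex)) \<Rightarrow> bool" where
  "compact_operator H N T \<longleftrightarrow>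
     bounded_operator H N T \<and>
     (\<forall>F :: nat \<Rightarrow> complex \<Rightarrow> complex. (\<forall>n. F n \<in> H \<and> N (F n) \<le> 1) \<longrightarrow>
        (\<exists>r g. strict_mono r \<and> g \<in> H \<and> (\<lambda>n. N (T (F (r n)) - g)) \<longlonglongrightarrow> 0))"

text \<open>
  The rank is the complex dimension of the range, expressed through a basis because \<^const>\<open>cfun.dim\<close>
  is \<open>0\<close> on infinite-dimensional spaces.
\<close>

definition rank_less :: "(complex \<Rightarrow> complex) set \<Rightarrow>
    ((complex \<Rightarrow> complex) \<Rightarrow> (complex \<Rightarrow> complex)) \<Rightarrow> nat \<Rightarrow> bool" where
  "rank_less H R n \<longleftrightarrow>
     (\<exists>B. finite B \<and> \<not> cfun.dependent B \<and> cfun.span B = R ` H \<and> card B < n)"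

definition approximation_number :: "(complex \<Rightarrow> complex) set \<Rightarrow> ((complex \<Rightarrow> complex) \<Rightarrow> real) \<Rightarrow>
    nat \<Rightarrow> ((complex \<Rightarrow> complex) \<Rightarrow> (complex \<Rightarrow> complex)) \<Rightarrow> real" where
  "approximation_number H N n T =
     (INF R\<in>{R. bounded_operator H N R \<and> rank_less H R n}. operator_norm H N (\<lambda>f. T f - R f))"

definition schatten_class :: "real \<Rightarrow> (complex \<Rightarrow> complex) set \<Rightarrow> ((complex \<Rightarrow> complex) \<Rightarrow> real) \<Rightarrow>
    ((complex \<Rightarrow> complex) \<Rightarrow> (complex \<Rightarrow> complex)) set" where
  "schatten_class p H N =
     {T. compact_operator H N T \<and> summable (\<lambda>n. approximation_number H N (Suc n) T powr p)}"

end

theory Submission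
  imports Defs "Jordan_Normal_Form.Determinant"
begin

text \<open>
  The disk is cut into dyadic cells. On the Bergman side, the Littlewood--Paley inequality bounds
  \<open>f \<circ> \<phi>\<close> by the masses \<open>\<tau> n\<close> of the cells under the pull-back of \<open>|\<phi>'|\<^sup>2 (1 - |z|\<^sup>2)\<^sup>2 dA\<close>.
  Imposing \<open>J\<close> vanishing Taylor coefficients at the centre of a cell gains a factor \<open>2\<^sup>-\<^sup>J\<close> on it, so
  spending the conditions greedily shows that \<open>C\<^sub>\<phi>\<close> is in \<open>S\<^sub>q(\<BB>\<^sup>2)\<close> as soon as
  \<open>\<Sum> \<tau> n\<^sup>q\<^sup>/\<^sup>2 < \<infinity>\<close>.

  On the Hardy side, a cell with \<open>\<tau> n > 0\<close> contains a point \<open>w\<close> whose fibre satisfies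
  \<open>\<Sum> (1 - |z|\<^sup>2) / (1 - |w|\<^sup>2) \<ge> const \<sqrt>\<tau> n\<close>. Testing \<open>C\<^sub>\<phi>\<close> on the Takenaka--Malmquist functions of
  such points, and comparing Gram determinants, bounds the product of these ratios over \<open>k\<close> cells by
  the product of the first \<open>k\<close> squared approximation numbers, up to a factor \<open>const\<^sup>k\<close> because the
  cells of one colour are separated. Carleman's inequality turns the bound on products into
  \<open>\<Sum> \<tau> n\<^sup>p\<^sup>/\<^sup>4 < \<infinity>\<close>, which is the case \<open>q = p / 2\<close> above.
\<close>

text \<open>Why the exponent halves: on the Hardy side a cell is measured by its fibre sum of
  \<open>1 - |z|^2\<close> relative to \<open>1 - |w|^2\<close>, and products of these ratios are
  controlled by products of squared approximation numbers. The mass \<open>\<tau>\<close> uses the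
  same fibres with the squared weight. A sum of squares is at most the square of the sum, so
  \<open>sqrt \<tau>\<close> is at most a constant times the ratio at some point of the cell. On the
  Bergman side \<open>\<tau>\<close> itself controls squared approximation numbers. Thus, on
  geometric average, Bergman numbers are dominated by squares of Hardy numbers, and the power
  \<open>p / 2\<close> of the former matches the power \<open>p\<close> of the latter.

  The obstacle is that the images of the test functions under \<open>C\<close> are not orthogonal,
  so they cannot be compared with approximation numbers one at a time. Gram determinants need no
  orthogonality of the images: they only need a lower bound for the distance of each image from the
  span of the later ones. The price is a comparison of products instead of terms, and constants that
  grow geometrically with the number of cells, which Carleman's inequality tolerates.\<close>

hide_const (open) Matrix.vec_index

section \<open>Gram determinants and approximation numbers\<close>

text \<open>Gaussian elimination on the last unknown. If some equation \<open>b\<close> contains it,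
  solving \<open>b\<close> for it leaves one equation and one unknown fewer; otherwise the last unit
  vector is a solution. Elimination may make rows coincide, which only lowers the cardinality of the
  set.\<close>

lemma homogeneous_system_nontrivial:
  fixes S :: "(nat \<Rightarrow> complex) set"
  assumes "finite S" "card S < n"
  shows "\<exists>c. (\<exists>i<n. c i \<noteq> 0) \<and> (\<forall>a\<in>S. (\<Sum>i<n. a i * c i) = 0)"
  using assms
proof (induction n arbitrary: S)
  case 0
  then show ?case by simp
next
  case (Suc n)
  show ?case
  proof (cases "\<forall>a\<in>S. a n = 0")
    case True
    show ?thesis
      by (rule exI[of _ "\<lambda>i. if i = n then 1 else 0"]) (use True in \<open>auto intro!: exI[of _ n] sum.neutral\<close>)
  next
    case False
    then obtain b where b: "b \<in> S" "b n \<noteq> 0" by blast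
    define S' where "S' = (\<lambda>a i. a i - a n / b n * b i) ` (S - {b})"
    have "card S' \<le> card (S - {b})" "finite S'"
      using Suc.prems by (auto simp: S'_def intro!: card_image_le)
    moreover have "card (S - {b}) < n"
      using Suc.prems b by (metis Suc_less_eq card_Suc_Diff1)
    ultimately obtain c where c: "\<exists>i<n. c i \<noteq> 0" "\<And>a. a \<in> S' \<Longrightarrow> (\<Sum>i<n. a i * c i) = 0"
      using Suc.IH[of S'] by auto
    define d where "d = (\<lambda>i. if i = n then - (\<Sum>i<n. b i * c i) / b n else c i)"
    have sumd: "(\<Sum>i<Suc n. a i * d i) = (\<Sum>i<n. a i * c i) - a n / b n * (\<Sum>i<n. b i * c i)" for a
      by (simp add: d_def)
    have "(\<Sum>i<Suc n. a i * d i) = 0" if "a \<in> S" for a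
    proof (cases "a = b")
      case True
      then show ?thesis using b sumd[of b] by simp
    next
      case False
      then have "(\<Sum>i<n. (a i - a n / b n * b i) * c i) = 0"
        using that by (intro c(2)) (auto simp: S'_def)
      moreover have "(\<Sum>i<n. (a i - a n / b n * b i) * c i) = (\<Sum>i<n. a i * c i) - a n / b n * (\<Sum>i<n. b i * c i)"
        by (simp add: left_diff_distrib sum_subtractf sum_distrib_left mult.assoc)
      ultimately show ?thesis using sumd by simp
    qed
    moreover have "\<exists>i<Suc n. d i \<noteq> 0"
      using c(1) unfolding d_def by (metis less_SucI less_not_refl2)
    ultimately show ?thesis by blast
  qed
qed

text \<open>The common frame for the Hardy and the Bergman space. It is pre-Hilbert, since the only
  projections taken are onto spans of finitely many vectors, and all laws are relative to the
  carrier \<open>V\<close>.\<close>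

locale complex_ip_space =
  fixes V :: "(complex \<Rightarrow> complex) set"
    and ip :: "(complex \<Rightarrow> complex) \<Rightarrow> (complex \<Rightarrow> complex) \<Rightarrow> complex"
    and nrm :: "(complex \<Rightarrow> complex) \<Rightarrow> real"
  assumes subspace: "cfun.subspace V"
    and ip_add_left: "\<And>f g h. f \<in> V \<Longrightarrow> g \<in> V \<Longrightarrow> h \<in> V \<Longrightarrow> ip (f + g) h = ip f h + ip g h"
    and ip_scale_left: "\<And>c f h. f \<in> V \<Longrightarrow> h \<in> V \<Longrightarrow> ip (cscale c f) h = c * ip f h"
    and ip_cnj: "\<And>f g. f \<in> V \<Longrightarrow> g \<in> V \<Longrightarrow> cnj (ip f g) = ip g f"
    and ip_nrm: "\<And>f. f \<in> V \<Longrightarrow> ip f f = of_real ((nrm f)\<^sup>2)"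
    and nrm_nonneg: "\<And>f. f \<in> V \<Longrightarrow> 0 \<le> nrm f"
    and nrm_zeroD: "\<And>f. f \<in> V \<Longrightarrow> nrm f = 0 \<Longrightarrow> f = 0"
begin

lemma V_zero: "0 \<in> V" and V_add: "f \<in> V \<Longrightarrow> g \<in> V \<Longrightarrow> f + g \<in> V"
  and V_scale: "f \<in> V \<Longrightarrow> cscale c f \<in> V" and V_diff: "f \<in> V \<Longrightarrow> g \<in> V \<Longrightarrow> f - g \<in> V"
  and V_sum: "(\<And>i. i \<in> I \<Longrightarrow> v i \<in> V) \<Longrightarrow> sum v I \<in> V"
  using subspace cfun.subspace_0 cfun.subspace_add cfun.subspace_scale cfun.subspace_diff cfun.subspace_sum
  by blast+

lemma ip_zero_left: "h \<in> V \<Longrightarrow> ip 0 h = 0"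
  using ip_scale_left[of 0 h 0] V_zero by simp

lemma ip_zero_right: "h \<in> V \<Longrightarrow> ip h 0 = 0"
  using ip_zero_left[of h] ip_cnj[of 0 h] V_zero by (metis complex_cnj_zero)

lemma ip_diff_left: "f \<in> V \<Longrightarrow> g \<in> V \<Longrightarrow> h \<in> V \<Longrightarrow> ip (f - g) h = ip f h - ip g h"
  using ip_add_left[of "f - g" g h] V_diff by simp

lemma ip_add_right: "f \<in> V \<Longrightarrow> g \<in> V \<Longrightarrow> h \<in> V \<Longrightarrow> ip h (f + g) = ip h f + ip h g"
  using ip_add_left ip_cnj V_add by (metis complex_cnj_add)

lemma ip_scale_right: "f \<in> V \<Longrightarrow> h \<in> V \<Longrightarrow> ip h (cscale c f) = cnj c * ip h f"
  using ip_scale_left ip_cnj V_scale by (metis complex_cnj_mult)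

lemma ip_diff_right: "f \<in> V \<Longrightarrow> g \<in> V \<Longrightarrow> h \<in> V \<Longrightarrow> ip h (f - g) = ip h f - ip h g"
  using ip_add_right[of "f - g" g h] V_diff by simp

lemma ip_sum_left:
  "finite I \<Longrightarrow> (\<And>i. i \<in> I \<Longrightarrow> v i \<in> V) \<Longrightarrow> h \<in> V \<Longrightarrow> ip (\<Sum>i\<in>I. v i) h = (\<Sum>i\<in>I. ip (v i) h)"
  by (induction I rule: finite_induct) (auto simp: ip_zero_left ip_add_left V_sum)

lemma ip_sum_right:
  "finite I \<Longrightarrow> (\<And>i. i \<in> I \<Longrightarrow> v i \<in> V) \<Longrightarrow> h \<in> V \<Longrightarrow> ip h (\<Sum>i\<in>I. v i) = (\<Sum>i\<in>I. ip h (v i))"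
  by (induction I rule: finite_induct) (auto simp: ip_zero_right ip_add_right V_sum)

lemma nrm_zero: "nrm 0 = 0"
  using ip_nrm[OF V_zero] ip_zero_left[OF V_zero] by simp

lemma nrm_scale: "f \<in> V \<Longrightarrow> nrm (cscale c f) = cmod c * nrm f"
proof -
  assume f: "f \<in> V"
  have "complex_of_real ((nrm (cscale c f))\<^sup>2) = c * cnj c * of_real ((nrm f)\<^sup>2)"
    using ip_nrm[OF V_scale[OF f], of c] ip_nrm[OF f]
    by (metis (no_types, lifting) ip_scale_left ip_scale_right f V_scale mult.assoc)
  also have "\<dots> = of_real ((cmod c * nrm f)\<^sup>2)"
    by (simp add: complex_norm_square power_mult_distrib flip: complex_norm_square)
  finally have "(nrm (cscale c f))\<^sup>2 = (cmod c * nrm f)\<^sup>2"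
    using of_real_eq_iff by blast
  then show ?thesis using nrm_nonneg[OF f] nrm_nonneg[OF V_scale[OF f]] by (simp add: power2_eq_iff_nonneg)
qed

lemma nrm_add_orthogonal:
  assumes "f \<in> V" "g \<in> V" "ip f g = 0"
  shows "(nrm (f + g))\<^sup>2 = (nrm f)\<^sup>2 + (nrm g)\<^sup>2"
proof -
  have "ip g f = 0" using assms ip_cnj[of f g] by simp
  then have "complex_of_real ((nrm (f + g))\<^sup>2) = of_real ((nrm f)\<^sup>2 + (nrm g)\<^sup>2)"
    using assms ip_nrm[of "f + g"] ip_nrm[of f] ip_nrm[of g] by (simp add: ip_add_left ip_add_right V_add)
  then show ?thesis using of_real_eq_iff by blast
qed

text \<open>One Gram-Schmidt step per vector. The vectors may be dependent, so the coefficients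
  exist without being unique.\<close>

lemma projection_exists:
  fixes v :: "nat \<Rightarrow> complex \<Rightarrow> complex"
  assumes "\<And>i. i < n \<Longrightarrow> v i \<in> V" "x \<in> V"
  shows "\<exists>c. \<forall>j<n. ip (x - (\<Sum>i<n. cscale (c i) (v i))) (v j) = 0"
  using assms
proof (induction n arbitrary: x)
  case 0
  then show ?case by simp
next
  case (Suc n)
  have vV: "v i \<in> V" if "i \<le> n" for i using Suc.prems that by simp
  define L where "L = (\<lambda>c. \<Sum>i<n. cscale (c i) (v i))"
  have LV: "L c \<in> V" for c using vV by (auto simp: L_def intro!: V_sum V_scale)
  have ex: "\<exists>a. \<forall>j<n. ip (y - L a) (v j) = 0" if "y \<in> V" for y
    unfolding L_def by (rule Suc.IH) (use Suc.prems that in auto)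
  obtain a where a: "\<And>j. j < n \<Longrightarrow> ip (x - L a) (v j) = 0"
    using ex[OF Suc.prems(2)] by blast
  obtain b where b: "\<And>j. j < n \<Longrightarrow> ip (v n - L b) (v j) = 0"
    using ex[OF vV[OF order.refl]] by blast
  define y where "y = v n - L b"
  \<comment> \<open>If \<open>v n\<close> lies in the span of the earlier vectors, \<open>y\<close>
    is 0 and the quotient is 0 by convention; \<open>zy\<close> settles this case
    separately.\<close>
  define t where "t = ip (x - L a) y / ip y y"
  have yV: "y \<in> V" using vV LV by (auto simp: y_def intro!: V_diff)
  have xV: "x - L a \<in> V" using Suc.prems LV by (auto intro!: V_diff)
  define z where "z = x - L a - cscale t y"
  have zV: "z \<in> V" using xV yV by (auto simp: z_def intro!: V_diff V_scale)
  have z0: "ip z (v j) = 0" if "j < n" for j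
    using a[OF that] b[OF that] that vV yV xV by (simp add: z_def ip_diff_left ip_scale_left V_scale y_def)
  have zL: "ip z (L c) = 0" for c
    unfolding L_def by (subst ip_sum_right) (use zV vV z0 in \<open>auto simp: V_scale ip_scale_right\<close>)
  have zy: "ip z y = 0"
  proof (cases "y = 0")
    case True
    then show ?thesis using ip_zero_right zV by simp
  next
    case False
    then have "ip y y \<noteq> 0" using ip_nrm[OF yV] nrm_zeroD[OF yV] by auto
    then show ?thesis using xV yV by (simp add: z_def ip_diff_left ip_scale_left V_scale t_def)
  qed
  have "ip z (v n) = ip z (y + L b)" by (simp add: y_def)
  then have zn: "ip z (v n) = 0" using zy zL zV yV LV by (simp add: ip_add_right)
  define c where "c = (\<lambda>i. if i = n then t else a i - t * b i)"
  have "(\<Sum>i<Suc n. cscale (c i) (v i)) = L a + cscale t y"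
    by (simp add: c_def L_def y_def cfun.scale_left_diff_distrib cfun.scale_right_diff_distrib
        sum_subtractf cfun.scale_sum_right)
  then have eq: "x - (\<Sum>i<Suc n. cscale (c i) (v i)) = z" unfolding z_def by (metis diff_diff_add)
  have "\<forall>j<Suc n. ip z (v j) = 0" using z0 zn by (simp add: less_Suc_eq)
  then show ?case unfolding eq[symmetric] by blast
qed

section \<open>Gram determinants\<close>

definition gram :: "nat \<Rightarrow> (nat \<Rightarrow> complex \<Rightarrow> complex) \<Rightarrow> complex mat" where
  "gram n v = mat n n (\<lambda>(i,j). ip (v j) (v i))"

lemma gram_carrier [simp]: "gram n v \<in> carrier_mat n n"
  by (simp add: gram_def)

text \<open>With \<open>D\<close> the adjoint of \<open>C\<close>, the new matrix is
  \<open>D * (gram n v * C)\<close>; the index order in \<open>gram\<close> makes \<open>C\<close>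
  act from the right.\<close>

lemma gram_change_basis:
  assumes v: "\<And>i. i < n \<Longrightarrow> v i \<in> V" and C: "C \<in> carrier_mat n n"
    and u: "\<And>j. j < n \<Longrightarrow> u j = (\<Sum>i<n. cscale (C $$ (i,j)) (v i))"
  shows "det (gram n u) = of_real ((cmod (det C))\<^sup>2) * det (gram n v)"
proof -
  interpret cnj: comm_ring_hom cnj by standard auto
  define D where "D = transpose_mat (map_mat cnj C)"
  have D: "D \<in> carrier_mat n n" using C by (simp add: D_def)
  have "gram n u = D * (gram n v * C)"
  proof (rule eq_matI)
    fix i j assume "i < dim_row (D * (gram n v * C))" "j < dim_col (D * (gram n v * C))"
    then have ij: "i < n" "j < n" using C D by auto
    have "ip (u j) (u i) = (\<Sum>a<n. C $$ (a,j) * (\<Sum>b<n. cnj (C $$ (b,i)) * ip (v a) (v b)))"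
    proof -
      have s: "(\<Sum>b<n. cscale (C $$ (b,i)) (v b)) \<in> V" using v by (auto intro!: V_sum V_scale)
      have "ip (u j) (u i) = (\<Sum>a<n. C $$ (a,j) * ip (v a) (\<Sum>b<n. cscale (C $$ (b,i)) (v b)))"
        unfolding u[OF ij(1)] u[OF ij(2)] using v s
        by (subst ip_sum_left) (auto simp: V_scale ip_scale_left)
      also have "\<dots> = (\<Sum>a<n. C $$ (a,j) * (\<Sum>b<n. cnj (C $$ (b,i)) * ip (v a) (v b)))"
      proof (intro sum.cong refl arg_cong2[where f = "(*)"])
        fix a assume "a \<in> {..<n}"
        then show "ip (v a) (\<Sum>b<n. cscale (C $$ (b,i)) (v b)) = (\<Sum>b<n. cnj (C $$ (b,i)) * ip (v a) (v b))"
          using v by (subst ip_sum_right) (auto simp: V_scale ip_scale_right)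
      qed
      finally show ?thesis .
    qed
    also have "\<dots> = (\<Sum>b<n. cnj (C $$ (b,i)) * (\<Sum>a<n. ip (v a) (v b) * C $$ (a,j)))"
      by (simp add: sum_distrib_left) (subst sum.swap, simp add: mult_ac)
    also have "\<dots> = (D * (gram n v * C)) $$ (i,j)"
      using ij C D by (auto simp: scalar_prod_def D_def gram_def atLeast0LessThan intro!: sum.cong)
    finally show "gram n u $$ (i,j) = (D * (gram n v * C)) $$ (i,j)" using ij by (simp add: gram_def)
  qed (use C D in \<open>auto simp: gram_def\<close>)
  moreover have "det D = cnj (det C)"
    unfolding D_def using C by (subst det_transpose) (auto simp: cnj.hom_det)
  ultimately have "det (gram n u) = cnj (det C) * (det (gram n v) * det C)"
    using C D by (metis det_mult gram_carrier mult_carrier_mat)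
  then show ?thesis by (simp add: complex_norm_square mult_ac del: of_real_power)
qed

lemma det_gram_orthogonal:
  assumes "\<And>i. i < n \<Longrightarrow> v i \<in> V" "\<And>i j. i < n \<Longrightarrow> j < n \<Longrightarrow> i \<noteq> j \<Longrightarrow> ip (v j) (v i) = 0"
  shows "det (gram n v) = of_real (\<Prod>i<n. (nrm (v i))\<^sup>2)"
proof -
  have "det (gram n v) = prod_list (diag_mat (gram n v))"
    by (rule det_upper_triangular[of _ n]) (use assms in \<open>auto simp: gram_def upper_triangular_def\<close>)
  also have "\<dots> = (\<Prod>i<n. gram n v $$ (i,i))"
    by (simp add: prod_list_diag_prod gram_def atLeast0LessThan)
  also have "\<dots> = of_real (\<Prod>i<n. (nrm (v i))\<^sup>2)"
    using assms by (simp add: gram_def ip_nrm)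
  finally show ?thesis .
qed

text \<open>Volume is height times base. The unitriangular \<open>C\<close> replaces
  \<open>v 0\<close> by its component orthogonal to the other vectors without changing the
  determinant, and then only the diagonal entry survives in the first row.\<close>

lemma det_gram_Suc:
  assumes v: "\<And>i. i \<le> n \<Longrightarrow> v i \<in> V"
    and orth: "\<And>j. j < n \<Longrightarrow> ip (v 0 - (\<Sum>i<n. cscale (c i) (v (Suc i)))) (v (Suc j)) = 0"
  shows "det (gram (Suc n) v) =
    of_real ((nrm (v 0 - (\<Sum>i<n. cscale (c i) (v (Suc i)))))\<^sup>2) * det (gram n (\<lambda>i. v (Suc i)))"
proof -
  define p where "p = v 0 - (\<Sum>i<n. cscale (c i) (v (Suc i)))"
  define u where "u = (\<lambda>j. if j = 0 then p else v j)"
  define C where "C = mat (Suc n) (Suc n) (\<lambda>(i,j). if i = j then 1 else if j = 0 then - c (i - 1) else 0)"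
  have C: "C \<in> carrier_mat (Suc n) (Suc n)" by (simp add: C_def)
  have pV: "p \<in> V" using v by (auto simp: p_def intro!: V_diff V_sum V_scale)
  have "det C = prod_list (diag_mat C)"
    by (rule det_lower_triangular[of "Suc n"]) (auto simp: C_def)
  also have "\<dots> = 1"
    by (simp add: prod_list_diag_prod C_def)
  finally have detC: "det C = 1" .
  have "u j = (\<Sum>i<Suc n. cscale (C $$ (i,j)) (v i))" if j: "j < Suc n" for j
  proof (cases "j = 0")
    case True
    have "(\<Sum>i<Suc n. cscale (C $$ (i,0)) (v i)) = v 0 + (\<Sum>i<n. cscale (- c i) (v (Suc i)))"
      by (subst sum.lessThan_Suc_shift) (simp add: C_def)
    then show ?thesis using True by (simp add: u_def p_def sum_negf)
  next
    case False
    then have "(\<Sum>i<Suc n. cscale (C $$ (i,j)) (v i)) = (\<Sum>i<Suc n. if i = j then v i else 0)"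
      using j by (intro sum.cong) (auto simp: C_def)
    then show ?thesis using False j by (simp add: u_def)
  qed
  then have "det (gram (Suc n) u) = det (gram (Suc n) v)"
    using gram_change_basis[of "Suc n" v C u] v C detC by simp
  moreover have "det (gram (Suc n) u) = (\<Sum>j<Suc n. gram (Suc n) u $$ (0,j) * cofactor (gram (Suc n) u) 0 j)"
    by (rule laplace_expansion_row) auto
  moreover have "\<dots> = gram (Suc n) u $$ (0,0) * cofactor (gram (Suc n) u) 0 0"
  proof -
    have "gram (Suc n) u $$ (0, Suc j) = 0" if "j < n" for j
    proof -
      have "ip p (v (Suc j)) = 0" using orth[OF that] by (simp add: p_def)
      then have "ip (v (Suc j)) p = 0" using ip_cnj[OF pV v[of "Suc j"]] that by simp
      then show ?thesis using that by (simp add: gram_def u_def)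
    qed
    then show ?thesis by (subst sum.lessThan_Suc_shift) simp
  qed
  moreover have "gram (Suc n) u $$ (0,0) = of_real ((nrm p)\<^sup>2)"
    using pV by (simp add: gram_def u_def ip_nrm)
  moreover have "mat_delete (gram (Suc n) u) 0 0 = gram n (\<lambda>i. v (Suc i))"
    by (rule eq_matI) (auto simp: mat_delete_def gram_def u_def)
  ultimately show ?thesis by (simp add: cofactor_def p_def)
qed

text \<open>Iterates \<open>det_gram_Suc\<close> on orthogonal projections, so \<open>d k\<close> is
  the distance of \<open>v k\<close> from the span of the later vectors. The later vectors are the
  right ones for the application, where the later test functions vanish at the \<open>k\<close>-th
  point.\<close>

lemma det_gram_distances:
  assumes "\<And>i. i < n \<Longrightarrow> v i \<in> V"
  shows "\<exists>d. (\<forall>k<n. 0 \<le> d k \<and> d k \<le> nrm (v k) \<and>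
      (\<exists>c. d k = nrm (v k - (\<Sum>j\<in>{Suc k..<n}. cscale (c j) (v j))))) \<and>
      det (gram n v) = of_real (\<Prod>k<n. (d k)\<^sup>2)"
  using assms
proof (induction n arbitrary: v)
  case 0
  then show ?case by (auto simp: gram_def)
next
  case (Suc n)
  have "\<exists>d. (\<forall>k<n. 0 \<le> d k \<and> d k \<le> nrm (v (Suc k)) \<and>
      (\<exists>c. d k = nrm (v (Suc k) - (\<Sum>j\<in>{Suc k..<n}. cscale (c j) (v (Suc j)))))) \<and>
      det (gram n (\<lambda>i. v (Suc i))) = of_real (\<Prod>k<n. (d k)\<^sup>2)"
    by (rule Suc.IH) (use Suc.prems in auto)
  then obtain d where d: "\<And>k. k < n \<Longrightarrow> 0 \<le> d k \<and> d k \<le> nrm (v (Suc k)) \<and>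
      (\<exists>c. d k = nrm (v (Suc k) - (\<Sum>j\<in>{Suc k..<n}. cscale (c j) (v (Suc j)))))"
    "det (gram n (\<lambda>i. v (Suc i))) = of_real (\<Prod>k<n. (d k)\<^sup>2)"
    by blast
  have "\<exists>c. \<forall>j<n. ip (v 0 - (\<Sum>i<n. cscale (c i) (v (Suc i)))) (v (Suc j)) = 0"
    by (rule projection_exists) (use Suc.prems in auto)
  then obtain c where c: "\<And>j. j < n \<Longrightarrow> ip (v 0 - (\<Sum>i<n. cscale (c i) (v (Suc i)))) (v (Suc j)) = 0" by blast
  define p where "p = v 0 - (\<Sum>i<n. cscale (c i) (v (Suc i)))"
  define D where "D = (\<lambda>k. case k of 0 \<Rightarrow> nrm p | Suc k \<Rightarrow> d k)"
  have pV: "p \<in> V" using Suc.prems by (auto simp: p_def intro!: V_diff V_sum V_scale)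
  have sV: "(\<Sum>i<n. cscale (c i) (v (Suc i))) \<in> V" using Suc.prems by (auto intro!: V_sum V_scale)
  have "ip p (\<Sum>i<n. cscale (c i) (v (Suc i))) = 0"
    by (subst ip_sum_right) (use pV c Suc.prems in \<open>auto simp: V_scale ip_scale_right p_def\<close>)
  then have "(nrm (v 0))\<^sup>2 = (nrm p)\<^sup>2 + (nrm (\<Sum>i<n. cscale (c i) (v (Suc i))))\<^sup>2"
    using nrm_add_orthogonal[OF pV sV] by (simp add: p_def)
  then have "(nrm p)\<^sup>2 \<le> (nrm (v 0))\<^sup>2" by simp
  then have pv: "nrm p \<le> nrm (v 0)" using nrm_nonneg[of "v 0"] Suc.prems by (auto intro: power2_le_imp_le)
  have "0 \<le> D k \<and> D k \<le> nrm (v k) \<and>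
      (\<exists>c. D k = nrm (v k - (\<Sum>j\<in>{Suc k..<Suc n}. cscale (c j) (v j))))" if k: "k < Suc n" for k
  proof (cases k)
    case 0
    have "(\<Sum>j\<in>{Suc 0..<Suc n}. cscale (c (j - 1)) (v j)) = (\<Sum>i<n. cscale (c i) (v (Suc i)))"
      by (subst sum.shift_bounds_Suc_ivl) (simp add: atLeast0LessThan)
    then show ?thesis using 0 pv nrm_nonneg[OF pV] by (auto simp: D_def p_def intro!: exI[of _ "\<lambda>j. c (j - 1)"])
  next
    case (Suc m)
    then have "m < n" using k by simp
    from d(1)[OF this] obtain b where b: "0 \<le> d m" "d m \<le> nrm (v (Suc m))"
      "d m = nrm (v (Suc m) - (\<Sum>j\<in>{Suc m..<n}. cscale (b j) (v (Suc j))))" by blast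
    have "(\<Sum>j\<in>{Suc (Suc m)..<Suc n}. cscale (b (j - 1)) (v j)) = (\<Sum>j\<in>{Suc m..<n}. cscale (b j) (v (Suc j)))"
      by (subst sum.shift_bounds_Suc_ivl) simp
    then have "d m = nrm (v (Suc m) - (\<Sum>j\<in>{Suc (Suc m)..<Suc n}. cscale (b (j - 1)) (v j)))"
      using b(3) by simp
    then show ?thesis using b(1,2) Suc by (auto simp: D_def intro!: exI[of _ "\<lambda>j. b (j - 1)"])
  qed
  moreover have "det (gram (Suc n) v) = of_real (\<Prod>k<Suc n. (D k)\<^sup>2)"
    using det_gram_Suc[of n v c] Suc.prems c d(2)
    by (subst prod.lessThan_Suc_shift) (simp add: D_def p_def)
  ultimately show ?case by blast
qed

lemma gram_singular:
  assumes v: "\<And>i. i < n \<Longrightarrow> v i \<in> V" and 0: "(\<Sum>i<n. cscale (c i) (v i)) = 0" and nz: "\<exists>i<n. c i \<noteq> 0"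
  shows "det (gram n v) = 0"
proof -
  define x where "x = Matrix.vec n c"
  have x: "x \<in> carrier_vec n" "x \<noteq> 0\<^sub>v n" using nz by (auto simp: x_def vec_eq_iff)
  have "gram n v *\<^sub>v x = 0\<^sub>v n"
  proof (rule eq_vecI)
    fix i assume "i < dim_vec (0\<^sub>v n :: complex Matrix.vec)"
    then have i: "i < n" by simp
    have "0 = ip (\<Sum>j<n. cscale (c j) (v j)) (v i)" using 0 v[OF i] by (simp add: ip_zero_left)
    also have "\<dots> = (\<Sum>j<n. c j * ip (v j) (v i))"
      by (subst ip_sum_left) (use v i in \<open>auto simp: V_scale ip_scale_left\<close>)
    also have "\<dots> = Matrix.vec_index (gram n v *\<^sub>v x) i"
      using i by (auto simp: scalar_prod_def x_def gram_def atLeast0LessThan mult.commute intro!: sum.cong)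
    finally show "Matrix.vec_index (gram n v *\<^sub>v x) i = Matrix.vec_index (0\<^sub>v n) i" using i by simp
  qed (simp add: gram_def)
  then show ?thesis using x det_0_iff_vec_prod_zero[OF gram_carrier[of n v]] by blast
qed

section \<open>Finite-rank operators and the product inequality\<close>

lemma operator_sum:
  assumes T: "bounded_operator V nrm T"
  shows "finite I \<Longrightarrow> (\<And>i. i \<in> I \<Longrightarrow> v i \<in> V) \<Longrightarrow>
    T (\<Sum>i\<in>I. cscale (c i) (v i)) = (\<Sum>i\<in>I. cscale (c i) (T (v i)))"
proof (induction I rule: finite_induct)
  case empty
  have "T (cscale 0 0) = cscale 0 (T 0)"
    using T V_zero unfolding bounded_operator_def by blast
  then show ?case unfolding sum.empty cfun.scale_zero_left .
next
  case (insert i I)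
  have "T (cscale (c i) (v i) + (\<Sum>i\<in>I. cscale (c i) (v i))) =
      T (cscale (c i) (v i)) + T (\<Sum>i\<in>I. cscale (c i) (v i))"
    using T insert.prems unfolding bounded_operator_def by (simp add: V_scale V_sum)
  also have "T (cscale (c i) (v i)) = cscale (c i) (T (v i))"
    using T insert.prems unfolding bounded_operator_def by simp
  finally show ?case using insert by simp
qed

lemma operator_diff:
  assumes T: "bounded_operator V nrm T" and "f \<in> V" "g \<in> V"
  shows "T (f - g) = T f - T g"
proof -
  have "T (f - g + g) = T (f - g) + T g"
    using assms V_diff unfolding bounded_operator_def by blast
  then show ?thesis by simp
qed

text \<open>
  Choosing the vectors in decreasing order of \<open>k\<close>, the \<open>k\<close> conditions from the kernel of \<open>R k\<close> and the
  \<open>n - 1 - k\<close> orthogonality conditions leave room for a nonzero vector.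
\<close>

lemma orthogonal_kernel_vectors:
  fixes e :: "nat \<Rightarrow> complex \<Rightarrow> complex" and n :: nat
  defines "u c \<equiv> \<Sum>i<n. cscale (c i) (e i)"
  assumes e: "\<And>i. i < n \<Longrightarrow> e i \<in> V"
    and R: "\<And>k. k < n \<Longrightarrow> bounded_operator V nrm (R k)"
    and rank: "\<And>k. k < n \<Longrightarrow> \<exists>B. finite B \<and> card B \<le> k \<and> R k ` V \<subseteq> cfun.span B"
  shows "m \<le> n \<Longrightarrow> \<exists>C. \<forall>k. n - m \<le> k \<and> k < n \<longrightarrow>
    (\<exists>i<n. C k i \<noteq> 0) \<and> R k (u (C k)) = 0 \<and> (\<forall>j. k < j \<and> j < n \<longrightarrow> ip (u (C k)) (u (C j)) = 0)"
proof (induction m)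
  case 0
  then show ?case by auto
next
  case (Suc m)
  obtain C where C: "\<forall>k. n - m \<le> k \<and> k < n \<longrightarrow>
    (\<exists>i<n. C k i \<noteq> 0) \<and> R k (u (C k)) = 0 \<and> (\<forall>j. k < j \<and> j < n \<longrightarrow> ip (u (C k)) (u (C j)) = 0)"
    using Suc.IH[OF Suc_leD[OF Suc.prems]] by blast
  define l where "l = n - Suc m"
  have l: "l < n" "n - m = Suc l" using Suc.prems by (auto simp: l_def)
  obtain B where B: "finite B" "card B \<le> l" "R l ` V \<subseteq> cfun.span B" using rank[OF l(1)] by blast
  have "\<exists>w. R l (e i) = (\<Sum>b\<in>B. cscale (w b) b)" if "i < n" for i
    using B e[OF that] cfun.span_finite[OF B(1)] by blast
  then have "\<forall>i. \<exists>w. i < n \<longrightarrow> R l (e i) = (\<Sum>b\<in>B. cscale (w b) b)" by blast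
  from choice[OF this] obtain w where w: "\<And>i. i < n \<Longrightarrow> R l (e i) = (\<Sum>b\<in>B. cscale (w i b) b)" by blast
  have uV: "u c \<in> V" for c unfolding u_def by (intro V_sum V_scale) (use e in auto)
  define S where "S = (\<lambda>b i. w i b) ` B \<union> (\<lambda>j i. ip (e i) (u (C j))) ` {l<..<n}"
  have "card S \<le> card B + card {l<..<n}"
    unfolding S_def by (intro order.trans[OF card_Un_le] add_mono card_image_le B) auto
  then have "finite S" "card S < n" using B l by (auto simp: S_def)
  from homogeneous_system_nontrivial[OF this] obtain c where c: "\<exists>i<n. c i \<noteq> 0"
    "\<And>a. a \<in> S \<Longrightarrow> (\<Sum>i<n. a i * c i) = 0" by blast
  have "R l (u c) = (\<Sum>i<n. cscale (c i) (R l (e i)))"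
    unfolding u_def by (rule operator_sum[OF R[OF l(1)]]) (use e in auto)
  also have "\<dots> = (\<Sum>i<n. \<Sum>b\<in>B. cscale (c i * w i b) b)"
    by (intro sum.cong) (auto simp: w cfun.scale_sum_right)
  also have "\<dots> = (\<Sum>b\<in>B. cscale (\<Sum>i<n. w i b * c i) b)"
    by (subst sum.swap) (simp add: cfun.scale_sum_left mult.commute)
  also have "\<dots> = 0"
    using c(2) by (intro sum.neutral) (auto simp: S_def)
  finally have R0: "R l (u c) = 0" .
  have orth: "ip (u c) (u (C j)) = 0" if "l < j" "j < n" for j
  proof -
    have "ip (u c) (u (C j)) = (\<Sum>i<n. ip (e i) (u (C j)) * c i)"
      using e uV[of "C j"] unfolding u_def[of c]
      by (subst ip_sum_left) (auto simp: V_scale ip_scale_left mult.commute)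
    also have "\<dots> = 0" using c(2)[of "\<lambda>i. ip (e i) (u (C j))"] that by (auto simp: S_def)
    finally show ?thesis .
  qed
  define C' where "C' = C(l := c)"
  have C'l: "C' l = c" by (simp add: C'_def)
  have C'ne: "C' k = C k" if "k \<noteq> l" for k
    using that by (simp add: C'_def)
  have "(\<exists>i<n. C' k i \<noteq> 0) \<and> R k (u (C' k)) = 0 \<and>
      (\<forall>j. k < j \<and> j < n \<longrightarrow> ip (u (C' k)) (u (C' j)) = 0)" if k: "l \<le> k" "k < n" for k
  proof (cases "k = l")
    case True
    have "ip (u (C' l)) (u (C' j)) = 0" if "l < j" "j < n" for j
      using orth[OF that] C'l C'ne[of j] that by simp
    then show ?thesis unfolding True using c(1) R0 unfolding C'l by blast
  next
    case False
    then have "n - m \<le> k" using k l by simp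
    moreover have "ip (u (C' k)) (u (C' j)) = 0" if "k < j" "j < n" for j
      using C C'ne[of k] C'ne[of j] that k False \<open>n - m \<le> k\<close> by auto
    ultimately show ?thesis using C C'ne[OF False] k(2) by simp
  qed
  then show ?case unfolding l_def[symmetric] by blast
qed

text \<open>On the Gram determinant of orthogonal vectors from the kernels of the \<open>R k\<close> the operator acts as
  \<open>T - R k\<close>, while changing to the basis \<open>e\<close> multiplies the determinants before and after applying
  \<open>T\<close> by the same factor.\<close>

theorem prod_distances_le_prod_approximations:
  fixes e :: "nat \<Rightarrow> complex \<Rightarrow> complex" and n :: nat
  assumes e: "\<And>i. i < n \<Longrightarrow> e i \<in> V" and e1: "\<And>i. i < n \<Longrightarrow> nrm (e i) \<le> 1"
    and T: "bounded_operator V nrm T"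
    and R: "\<And>k. k < n \<Longrightarrow> bounded_operator V nrm (R k)"
    and rank: "\<And>k. k < n \<Longrightarrow> \<exists>B. finite B \<and> card B \<le> k \<and> R k ` V \<subseteq> cfun.span B"
    and approx: "\<And>k f. k < n \<Longrightarrow> f \<in> V \<Longrightarrow> nrm (T f - R k f) \<le> \<alpha> k * nrm f"
    and \<alpha>: "\<And>k. k < n \<Longrightarrow> 0 \<le> \<alpha> k"
    and \<delta>: "\<And>k. k < n \<Longrightarrow> 0 \<le> \<delta> k"
    and dist: "\<And>k c. k < n \<Longrightarrow> \<delta> k \<le> nrm (T (e k - (\<Sum>j\<in>{Suc k..<n}. cscale (c j) (e j))))"
  shows "(\<Prod>k<n. \<delta> k) \<le> (\<Prod>k<n. \<alpha> k)"
proof (cases "\<exists>k<n. \<delta> k = 0")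
  case True
  then have "(\<Prod>k<n. \<delta> k) = 0" by (intro prod_zero) auto
  moreover have "0 \<le> (\<Prod>k<n. \<alpha> k)" using \<alpha> by (intro prod_nonneg) auto
  ultimately show ?thesis by linarith
next
  case False
  then have \<delta>pos: "0 < \<delta> k" if "k < n" for k using \<delta>[OF that] that by force
  define u where "u c = (\<Sum>i<n. cscale (c i) (e i))" for c
  obtain C where C: "\<And>k. k < n \<Longrightarrow> (\<exists>i<n. C k i \<noteq> 0)" "\<And>k. k < n \<Longrightarrow> R k (u (C k)) = 0"
    "\<And>k j. k < j \<Longrightarrow> j < n \<Longrightarrow> ip (u (C k)) (u (C j)) = 0"
  proof -
    have "\<exists>C. \<forall>k. n - n \<le> k \<and> k < n \<longrightarrow> (\<exists>i<n. C k i \<noteq> 0) \<and> R k (u (C k)) = 0 \<and>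
        (\<forall>j. k < j \<and> j < n \<longrightarrow> ip (u (C k)) (u (C j)) = 0)"
      unfolding u_def by (rule orthogonal_kernel_vectors) (use e R rank in auto)
    then obtain C where
      C: "\<forall>k. n - n \<le> k \<and> k < n \<longrightarrow> (\<exists>i<n. C k i \<noteq> 0) \<and> R k (u (C k)) = 0 \<and>
        (\<forall>j. k < j \<and> j < n \<longrightarrow> ip (u (C k)) (u (C j)) = 0)" ..
    show ?thesis
    proof (rule that[of C])
      show "\<exists>i<n. C k i \<noteq> 0" "R k (u (C k)) = 0" if "k < n" for k
        using C[rule_format, of k] that by simp_all
      show "ip (u (C k)) (u (C j)) = 0" if "k < j" "j < n" for k j
        using C[rule_format, of k] that by simp
    qed
  qed
  define M where "M = mat n n (\<lambda>(i,j). C j i)"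
  have M: "M \<in> carrier_mat n n" by (simp add: M_def)
  have TV: "T f \<in> V" if "f \<in> V" for f using T that by (auto simp: bounded_operator_def)
  have uV: "u c \<in> V" for c using e by (auto simp: u_def intro!: V_sum V_scale)
  have Tu: "T (u c) = (\<Sum>i<n. cscale (c i) (T (e i)))" for c
    unfolding u_def by (rule operator_sum[OF T]) (use e in auto)
  obtain d where d: "\<And>k. k < n \<Longrightarrow> \<exists>c. d k = nrm (T (e k) - (\<Sum>j\<in>{Suc k..<n}. cscale (c j) (T (e j))))"
     "det (gram n (\<lambda>i. T (e i))) = of_real (\<Prod>k<n. (d k)\<^sup>2)"
    using det_gram_distances[of n "\<lambda>i. T (e i)", OF TV[OF e]] by blast
  have d_ge: "\<delta> k \<le> d k" if k: "k < n" for k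
  proof -
    obtain c where "d k = nrm (T (e k) - (\<Sum>j\<in>{Suc k..<n}. cscale (c j) (T (e j))))" using d(1)[OF k] by blast
    moreover have "T (e k - (\<Sum>j\<in>{Suc k..<n}. cscale (c j) (e j))) =
        T (e k) - (\<Sum>j\<in>{Suc k..<n}. cscale (c j) (T (e j)))"
    proof -
      have "(\<Sum>j\<in>{Suc k..<n}. cscale (c j) (e j)) \<in> V" by (intro V_sum V_scale) (use e in auto)
      moreover have "T (\<Sum>j\<in>{Suc k..<n}. cscale (c j) (e j)) = (\<Sum>j\<in>{Suc k..<n}. cscale (c j) (T (e j)))"
        by (rule operator_sum[OF T]) (use e in auto)
      ultimately show ?thesis using operator_diff[OF T e[OF k]] by simp
    qed
    ultimately show ?thesis using dist[OF k, of c] by simp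
  qed
  \<comment> \<open>The determinant is a product of squares of numbers not below
    \<open>\<delta> k > 0\<close>. Hence \<open>T\<close> kills no nontrivial combination of the
    \<open>e i\<close>, and the kernel vectors \<open>u (C k)\<close> are nonzero.\<close>
  have nonsing: "det (gram n (\<lambda>i. T (e i))) \<noteq> 0"
  proof -
    have "0 < (\<Prod>k<n. (d k)\<^sup>2)" using d_ge \<delta>pos by (intro prod_pos) (use order.strict_trans2 in fastforce)
    then show ?thesis unfolding d(2) by (metis of_real_eq_0_iff less_irrefl)
  qed
  have u_ne: "u (C k) \<noteq> 0" if k: "k < n" for k
  proof
    assume "u (C k) = 0"
    then have "T (u (C k)) = 0" using operator_diff[OF T V_zero V_zero] by simp
    then have "det (gram n (\<lambda>i. T (e i))) = 0"
      using gram_singular[of n "\<lambda>i. T (e i)" "C k"] C(1)[OF k] TV e by (auto simp: Tu)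
    with nonsing show False by simp
  qed
  define D where "D = (cmod (det M))\<^sup>2"
  define nu where "nu = (\<Prod>k<n. (nrm (u (C k)))\<^sup>2)"
  have nu_pos: "0 < nu" unfolding nu_def
    using u_ne nrm_zeroD[OF uV] by (intro prod_pos) auto
  have "det (gram n (\<lambda>k. u (C k))) = of_real nu"
    unfolding nu_def
  proof (rule det_gram_orthogonal)
    show "ip (u (C j)) (u (C i)) = 0" if "i < n" "j < n" "i \<noteq> j" for i j
      using C(3)[of i j] C(3)[of j i] that ip_cnj[OF uV uV, of "C i" "C j"] by (cases "i < j") auto
  qed (rule uV)
  moreover have "det (gram n (\<lambda>k. u (C k))) = of_real D * det (gram n e)"
    unfolding D_def by (rule gram_change_basis[OF e M]) (auto simp: u_def M_def)
  moreover obtain d' where d': "\<And>k. k < n \<Longrightarrow> 0 \<le> d' k" "\<And>k. k < n \<Longrightarrow> d' k \<le> nrm (e k)"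
    "det (gram n e) = of_real (\<Prod>k<n. (d' k)\<^sup>2)"
    using det_gram_distances[of n e, OF e] by blast
  ultimately have "complex_of_real nu = of_real (D * (\<Prod>k<n. (d' k)\<^sup>2))"
    by (simp only: of_real_mult)
  then have nuD: "nu = D * (\<Prod>k<n. (d' k)\<^sup>2)"
    by (simp only: of_real_eq_iff)
  \<comment> \<open>Hadamard's inequality: vectors in the unit ball have Gram determinant at most 1.
    Therefore \<open>D\<close>, the factor of the change of basis, is at least the product
    \<open>nu\<close> of the squared norms of the kernel vectors.\<close>
  have "(\<Prod>k<n. (d' k)\<^sup>2) \<le> 1"
  proof (rule prod_le_1)
    show "0 \<le> (d' k)\<^sup>2 \<and> (d' k)\<^sup>2 \<le> 1" if "k \<in> {..<n}" for k
      using d'(1,2)[of k] e1[of k] that by (simp add: power_le_one)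
  qed
  then have D_ge: "nu \<le> D" "0 < D"
    using nuD nu_pos by (auto simp: D_def mult_left_le zero_less_mult_iff)
  obtain d2 where d2: "\<And>k. k < n \<Longrightarrow> 0 \<le> d2 k" "\<And>k. k < n \<Longrightarrow> d2 k \<le> nrm (T (u (C k)))"
    "det (gram n (\<lambda>k. T (u (C k)))) = of_real (\<Prod>k<n. (d2 k)\<^sup>2)"
    using det_gram_distances[of n "\<lambda>k. T (u (C k))", OF TV[OF uV]] by blast
  have "det (gram n (\<lambda>k. T (u (C k)))) = of_real D * det (gram n (\<lambda>i. T (e i)))"
    unfolding D_def by (rule gram_change_basis[OF TV[OF e] M]) (auto simp: Tu M_def)
  then have "(\<Prod>k<n. (d2 k)\<^sup>2) = D * (\<Prod>k<n. (d k)\<^sup>2)"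
    by (simp only: d2(3) d(2) flip: of_real_mult) (simp only: of_real_eq_iff)
  moreover have "(\<Prod>k<n. (d2 k)\<^sup>2) \<le> (\<Prod>k<n. (\<alpha> k * nrm (u (C k)))\<^sup>2)"
  proof (rule prod_mono)
    fix k assume "k \<in> {..<n}"
    then have k: "k < n" by simp
    have "d2 k \<le> nrm (T (u (C k)) - R k (u (C k)))" using d2(2)[OF k] C(2)[OF k] by simp
    also have "\<dots> \<le> \<alpha> k * nrm (u (C k))" by (rule approx[OF k uV])
    finally show "0 \<le> (d2 k)\<^sup>2 \<and> (d2 k)\<^sup>2 \<le> (\<alpha> k * nrm (u (C k)))\<^sup>2"
      using d2(1)[OF k] by (simp add: power_mono)
  qed
  moreover have "(\<Prod>k<n. (\<alpha> k * nrm (u (C k)))\<^sup>2) = (\<Prod>k<n. \<alpha> k)\<^sup>2 * nu"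
    by (simp only: nu_def power_mult_distrib prod.distrib prod_power_distrib)
  moreover have "(\<Prod>k<n. \<alpha> k)\<^sup>2 * nu \<le> (\<Prod>k<n. \<alpha> k)\<^sup>2 * D"
    using D_ge by (intro mult_left_mono) auto
  ultimately have "D * (\<Prod>k<n. (d k)\<^sup>2) \<le> (\<Prod>k<n. \<alpha> k)\<^sup>2 * D" by linarith
  then have "(\<Prod>k<n. d k)\<^sup>2 \<le> (\<Prod>k<n. \<alpha> k)\<^sup>2"
    using D_ge(2) unfolding prod_power_distrib[of d] mult.commute[of D] by (rule mult_right_le_imp_le)
  then have "(\<Prod>k<n. d k) \<le> (\<Prod>k<n. \<alpha> k)"
    by (rule power2_le_imp_le) (intro prod_nonneg, use \<alpha> in auto)
  moreover have "(\<Prod>k<n. \<delta> k) \<le> (\<Prod>k<n. d k)"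
    using d_ge \<delta> by (intro prod_mono) auto
  ultimately show ?thesis by simp
qed

text \<open>Stands in for the triangle inequality: it is used to bound the norm of a difference by
  the norms of the two terms.\<close>

lemma parallelogram:
  assumes "f \<in> V" "g \<in> V"
  shows "(nrm (f + g))\<^sup>2 + (nrm (f - g))\<^sup>2 = 2 * (nrm f)\<^sup>2 + 2 * (nrm g)\<^sup>2"
proof -
  have "complex_of_real ((nrm (f + g))\<^sup>2 + (nrm (f - g))\<^sup>2) = of_real (2 * (nrm f)\<^sup>2 + 2 * (nrm g)\<^sup>2)"
    unfolding of_real_add of_real_mult
    unfolding ip_nrm[OF V_add[OF assms], symmetric] ip_nrm[OF V_diff[OF assms], symmetric]
      ip_nrm[OF assms(1), symmetric] ip_nrm[OF assms(2), symmetric]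
    using assms by (simp add: ip_add_left ip_add_right ip_diff_left ip_diff_right V_add V_diff)
  then show ?thesis by (simp only: of_real_eq_iff)
qed

section \<open>Approximation numbers\<close>

lemma bounded_operator_bound:
  assumes "bounded_operator V nrm T"
  obtains C where "0 \<le> C" "\<And>f. f \<in> V \<Longrightarrow> nrm (T f) \<le> C * nrm f"
proof -
  obtain C where C: "\<forall>f\<in>V. nrm (T f) \<le> C * nrm f" using assms unfolding bounded_operator_def by blast
  have "nrm (T f) \<le> max C 0 * nrm f" if f: "f \<in> V" for f
  proof -
    have "C * nrm f \<le> max C 0 * nrm f" by (rule mult_right_mono) (use nrm_nonneg[OF f] in auto)
    then show ?thesis using C[rule_format, OF f] by linarith
  qed
  then show ?thesis using that[of "max C 0"] by simp
qed

lemma operator_scale: "bounded_operator V nrm T \<Longrightarrow> f \<in> V \<Longrightarrow> T (cscale c f) = cscale c (T f)"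
  by (simp add: bounded_operator_def)

lemma operator_zero: assumes "bounded_operator V nrm T" shows "T 0 = 0"
  using operator_scale[OF assms V_zero, of 0] unfolding cfun.scale_zero_left .

lemma bounded_operator_range: "bounded_operator V nrm T \<Longrightarrow> f \<in> V \<Longrightarrow> T f \<in> V"
  by (simp add: bounded_operator_def)

lemma diff_operator_bdd_above:
  assumes "bounded_operator V nrm T" "bounded_operator V nrm R"
  shows "bdd_above ((\<lambda>f. nrm (T f - R f)) ` {f \<in> V. nrm f \<le> 1})"
proof -
  obtain C where C: "0 \<le> C" "\<And>f. f \<in> V \<Longrightarrow> nrm (T f) \<le> C * nrm f"
    by (rule bounded_operator_bound[OF assms(1)]) blast
  obtain D where D: "0 \<le> D" "\<And>f. f \<in> V \<Longrightarrow> nrm (R f) \<le> D * nrm f"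
    by (rule bounded_operator_bound[OF assms(2)]) blast
  show ?thesis
  proof (rule bdd_aboveI2[where M = "sqrt (2 * C\<^sup>2 + 2 * D\<^sup>2)"])
    fix f assume "f \<in> {f \<in> V. nrm f \<le> 1}"
    then have f: "f \<in> V" "nrm f \<le> 1" by auto
    note TR = bounded_operator_range[OF assms(1) f(1)] bounded_operator_range[OF assms(2) f(1)]
    have "nrm (T f) \<le> C * 1" using C(2)[OF f(1)] mult_left_mono[OF f(2) C(1)] by linarith
    then have T1: "(nrm (T f))\<^sup>2 \<le> C\<^sup>2" using nrm_nonneg[OF TR(1)] by (intro power_mono) auto
    have "nrm (R f) \<le> D * 1" using D(2)[OF f(1)] mult_left_mono[OF f(2) D(1)] by linarith
    then have R1: "(nrm (R f))\<^sup>2 \<le> D\<^sup>2" using nrm_nonneg[OF TR(2)] by (intro power_mono) auto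
    have "(nrm (T f - R f))\<^sup>2 \<le> 2 * C\<^sup>2 + 2 * D\<^sup>2"
      using parallelogram[OF TR] T1 R1 zero_le_power2[of "nrm (T f + R f)"] by linarith
    then show "nrm (T f - R f) \<le> sqrt (2 * C\<^sup>2 + 2 * D\<^sup>2)" by (rule real_le_rsqrt)
  qed
qed

lemma operator_norm_diff_nonneg:
  assumes "bounded_operator V nrm T" "bounded_operator V nrm R"
  shows "0 \<le> operator_norm V nrm (\<lambda>f. T f - R f)"
proof -
  have "nrm (T 0 - R 0) \<le> operator_norm V nrm (\<lambda>f. T f - R f)"
    unfolding operator_norm_def
    by (rule cSUP_upper[OF _ diff_operator_bdd_above[OF assms]]) (simp add: V_zero nrm_zero)
  moreover have "0 \<le> nrm (T 0 - R 0)"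
    by (intro nrm_nonneg V_diff bounded_operator_range[OF assms(1)] bounded_operator_range[OF assms(2)] V_zero)
  ultimately show ?thesis by linarith
qed

lemma approximation_number_nonneg_of_nonempty:
  assumes "bounded_operator V nrm T" "{R. bounded_operator V nrm R \<and> rank_less V R n} \<noteq> {}"
  shows "0 \<le> approximation_number V nrm n T"
  unfolding approximation_number_def using operator_norm_diff_nonneg[OF assms(1)] assms(2)
  by (intro cINF_greatest) auto

lemma approximation_number_le:
  assumes T: "bounded_operator V nrm T" and R: "bounded_operator V nrm R" "rank_less V R n"
    and le: "\<And>f. f \<in> V \<Longrightarrow> nrm f \<le> 1 \<Longrightarrow> nrm (T f - R f) \<le> B"
  shows "approximation_number V nrm n T \<le> B"
proof -
  have "approximation_number V nrm n T \<le> operator_norm V nrm (\<lambda>f. T f - R f)"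
    unfolding approximation_number_def
  proof (rule cINF_lower)
    show "bdd_below ((\<lambda>R. operator_norm V nrm (\<lambda>f. T f - R f)) ` {R. bounded_operator V nrm R \<and> rank_less V R n})"
      using operator_norm_diff_nonneg[OF T] by (intro bdd_belowI2[where m = 0]) auto
  qed (use R in simp)
  also have "\<dots> \<le> B"
    unfolding operator_norm_def using V_zero nrm_zero le by (intro cSUP_least) auto
  finally show ?thesis .
qed

lemma zero_operator: "bounded_operator V nrm (\<lambda>_. 0)" "rank_less V (\<lambda>_. 0) (Suc n)"
proof -
  show "bounded_operator V nrm (\<lambda>_. 0)"
    unfolding bounded_operator_def using V_zero nrm_zero by (auto intro!: exI[of _ 0])
  have "(\<lambda>_::complex \<Rightarrow> complex. 0 :: complex \<Rightarrow> complex) ` V = {0}" using V_zero by auto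
  then show "rank_less V (\<lambda>_. 0) (Suc n)"
    unfolding rank_less_def by (intro exI[of _ "{}"]) (simp add: cfun.dependent_explicit)
qed

lemma approximation_number_nonneg:
  "bounded_operator V nrm T \<Longrightarrow> 0 \<le> approximation_number V nrm (Suc n) T"
  using zero_operator(1) zero_operator(2)[of n] by (intro approximation_number_nonneg_of_nonempty) auto

text \<open>The infimum over operators is only approached, hence the slack \<open>e\<close>;
  homogeneity turns the supremum over the unit ball into a bound for every \<open>f\<close>.\<close>

lemma near_optimal_approximation:
  assumes T: "bounded_operator V nrm T" and e: "0 < e"
  obtains R where "bounded_operator V nrm R" "rank_less V R (Suc n)"
    "\<And>f. f \<in> V \<Longrightarrow> nrm (T f - R f) \<le> (approximation_number V nrm (Suc n) T + e) * nrm f"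
proof -
  define S where "S = {R. bounded_operator V nrm R \<and> rank_less V R (Suc n)}"
  have "(\<lambda>_. 0) \<in> S" using zero_operator(1) zero_operator(2)[of n] by (simp add: S_def)
  then have ne: "S \<noteq> {}" by blast
  have bb: "bdd_below ((\<lambda>R. operator_norm V nrm (\<lambda>f. T f - R f)) ` S)"
    using operator_norm_diff_nonneg[OF T] by (intro bdd_belowI2[where m = 0]) (auto simp: S_def)
  have "(INF R\<in>S. operator_norm V nrm (\<lambda>f. T f - R f)) < approximation_number V nrm (Suc n) T + e"
    using e by (simp add: approximation_number_def S_def)
  then have "\<exists>R\<in>S. operator_norm V nrm (\<lambda>f. T f - R f) < approximation_number V nrm (Suc n) T + e"
    by (simp only: cINF_less_iff[OF ne bb])
  then obtain R where R: "bounded_operator V nrm R" "rank_less V R (Suc n)"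
    "operator_norm V nrm (\<lambda>f. T f - R f) < approximation_number V nrm (Suc n) T + e"
    unfolding S_def by blast
  have "nrm (T f - R f) \<le> (approximation_number V nrm (Suc n) T + e) * nrm f" if f: "f \<in> V" for f
  proof (cases "nrm f = 0")
    case True
    then have "f = 0" using nrm_zeroD f by blast
    then show ?thesis using nrm_zero operator_zero[OF T] operator_zero[OF R(1)] by simp
  next
    case False
    then have pos: "0 < nrm f" using nrm_nonneg[OF f] by simp
    define g where "g = cscale (of_real (1 / nrm f)) f"
    have gV: "g \<in> V" using f by (simp add: g_def V_scale)
    have g1: "nrm g = 1" using pos by (simp add: g_def nrm_scale[OF f] norm_divide)
    have "nrm (T g - R g) \<le> operator_norm V nrm (\<lambda>f. T f - R f)"
      unfolding operator_norm_def by (rule cSUP_upper[OF _ diff_operator_bdd_above[OF T R(1)]]) (simp add: gV g1)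
    moreover have "T g - R g = cscale (of_real (1 / nrm f)) (T f - R f)"
    proof -
      have "T g = cscale (of_real (1 / nrm f)) (T f)" "R g = cscale (of_real (1 / nrm f)) (R f)"
        unfolding g_def by (rule operator_scale[OF T f], rule operator_scale[OF R(1) f])
      then show ?thesis by (simp only: cfun.scale_right_diff_distrib)
    qed
    moreover have "nrm (cscale (of_real (1 / nrm f)) (T f - R f)) = nrm (T f - R f) / nrm f"
      using pos V_diff[OF bounded_operator_range[OF T f] bounded_operator_range[OF R(1) f]]
      by (simp add: nrm_scale norm_divide)
    ultimately have "nrm (T f - R f) / nrm f \<le> operator_norm V nrm (\<lambda>f. T f - R f)"
      by simp
    with R(3) have "nrm (T f - R f) / nrm f \<le> approximation_number V nrm (Suc n) T + e" by linarith
    then show ?thesis using pos by (simp add: divide_le_eq)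
  qed
  then show ?thesis by (rule that[OF R(1,2)])
qed

text \<open>The preceding inequality for near-optimal \<open>R k\<close>, with the slack sent to 0.
  It speaks about products of the first approximation numbers rather than about individual
  ones.\<close>

lemma prod_distances_le_prod_approximation_numbers:
  fixes e :: "nat \<Rightarrow> complex \<Rightarrow> complex" and n :: nat
  assumes e: "\<And>i. i < n \<Longrightarrow> e i \<in> V" and e1: "\<And>i. i < n \<Longrightarrow> nrm (e i) \<le> 1"
    and T: "bounded_operator V nrm T"
    and \<delta>: "\<And>k. k < n \<Longrightarrow> 0 \<le> \<delta> k"
    and dist: "\<And>k c. k < n \<Longrightarrow> \<delta> k \<le> nrm (T (e k - (\<Sum>j\<in>{Suc k..<n}. cscale (c j) (e j))))"
  shows "(\<Prod>k<n. \<delta> k) \<le> (\<Prod>k<n. approximation_number V nrm (Suc k) T)"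
proof -
  define a where "a k = approximation_number V nrm (Suc k) T" for k
  have bound: "(\<Prod>k<n. \<delta> k) \<le> (\<Prod>k<n. a k + \<epsilon>)" if \<epsilon>: "0 < \<epsilon>" for \<epsilon>
  proof -
    have "\<exists>R. bounded_operator V nrm R \<and> rank_less V R (Suc k) \<and>
        (\<forall>f\<in>V. nrm (T f - R f) \<le> (a k + \<epsilon>) * nrm f)" for k
      unfolding a_def
    proof (rule near_optimal_approximation[OF T \<epsilon>, of k])
      fix R assume "bounded_operator V nrm R" "rank_less V R (Suc k)"
        "\<And>f. f \<in> V \<Longrightarrow> nrm (T f - R f) \<le> (approximation_number V nrm (Suc k) T + \<epsilon>) * nrm f"
      then show "\<exists>R. bounded_operator V nrm R \<and> rank_less V R (Suc k) \<and>
          (\<forall>f\<in>V. nrm (T f - R f) \<le> (approximation_number V nrm (Suc k) T + \<epsilon>) * nrm f)"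
        by (intro exI[of _ R]) simp
    qed
    then have "\<forall>k. \<exists>R. bounded_operator V nrm R \<and> rank_less V R (Suc k) \<and>
        (\<forall>f\<in>V. nrm (T f - R f) \<le> (a k + \<epsilon>) * nrm f)" ..
    from choice[OF this] obtain R where R: "\<forall>k. bounded_operator V nrm (R k) \<and> rank_less V (R k) (Suc k) \<and>
        (\<forall>f\<in>V. nrm (T f - R k f) \<le> (a k + \<epsilon>) * nrm f)" ..
    show ?thesis
    proof (rule prod_distances_le_prod_approximations[where e = e and T = T and R = R])
      show "\<exists>B. finite B \<and> card B \<le> k \<and> R k ` V \<subseteq> cfun.span B" for k
      proof -
        obtain B where "finite B" "cfun.span B = R k ` V" "card B < Suc k"
          using R unfolding rank_less_def by blast
        then show ?thesis by (intro exI[of _ B]) auto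
      qed
      show "0 \<le> a k + \<epsilon>" for k
        using approximation_number_nonneg[OF T, of k] \<epsilon> by (simp add: a_def)
    qed (use assms R in auto)
  qed
  have "((\<lambda>\<epsilon>. \<Prod>k<n. a k + \<epsilon>) \<longlongrightarrow> (\<Prod>k<n. a k + 0)) (at_right 0)"
    by (intro tendsto_intros)
  moreover have "\<forall>\<^sub>F \<epsilon> in at_right 0. (\<Prod>k<n. \<delta> k) \<le> (\<Prod>k<n. a k + \<epsilon>)"
    using bound by (simp add: eventually_at_filter)
  ultimately show ?thesis
    unfolding a_def using tendsto_lowerbound[of "\<lambda>\<epsilon>. \<Prod>k<n. a k + \<epsilon>" _ "at_right 0" "\<Prod>k<n. \<delta> k"]
    by (simp add: a_def)
qed

text \<open>Take \<open>R = T \<circ> P\<close> with \<open>P\<close> the orthogonal projection onto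
  the span of the \<open>y i\<close>. Its rank is at most \<open>N\<close>, and
  \<open>T f - R f = T (f - P f)\<close> is covered by \<open>le\<close>. The index is
  \<open>Suc N\<close> because \<open>rank_less\<close> is strict.\<close>

lemma approximation_number_le_on_orthogonal_complement:
  fixes y :: "nat \<Rightarrow> complex \<Rightarrow> complex"
  assumes T: "bounded_operator V nrm T" and y: "\<And>i. i < N \<Longrightarrow> y i \<in> V" and B: "0 \<le> B"
    and le: "\<And>f. f \<in> V \<Longrightarrow> (\<And>i. i < N \<Longrightarrow> ip f (y i) = 0) \<Longrightarrow> nrm (T f) \<le> B * nrm f"
  shows "approximation_number V nrm (Suc N) T \<le> B"
proof -
  define L where "L c = (\<Sum>i<N. cscale (c i) (y i))" for c
  have LV: "L c \<in> V" for c unfolding L_def by (intro V_sum V_scale) (use y in auto)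
  have L_add: "L c + L d = L (\<lambda>i. c i + d i)" for c d
    by (simp add: L_def cfun.scale_left_distrib sum.distrib)
  have L_scale: "cscale a (L c) = L (\<lambda>i. a * c i)" for a c
    by (simp add: L_def cfun.scale_sum_right)
  have L_diff: "L c - L d = L (\<lambda>i. c i - d i)" for c d
    by (simp add: L_def cfun.scale_left_diff_distrib sum_subtractf)
  define orth where "orth f p \<longleftrightarrow> (\<forall>j<N. ip (f - p) (y j) = 0)" for f p
  have ortho_L: "ip g (L c) = 0" if "g \<in> V" "\<And>j. j < N \<Longrightarrow> ip g (y j) = 0" for g c
    unfolding L_def by (subst ip_sum_right) (use that y in \<open>auto simp: V_scale ip_scale_right\<close>)
  have ex: "\<exists>c. orth f (L c)" if "f \<in> V" for f
    unfolding orth_def L_def by (rule projection_exists) (use y that in auto)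
  \<comment> \<open>For dependent \<open>y i\<close> the coefficients are not determined, so they
    are chosen; \<open>uniq\<close> shows that the projection does not depend on the choice, and
    linearity follows from that.\<close>
  define P where "P f = L (SOME c. orth f (L c))" for f
  have P: "orth f (P f)" if "f \<in> V" for f
    unfolding P_def by (rule someI_ex[OF ex[OF that]])
  have PV: "P f \<in> V" for f by (simp add: P_def LV)
  have PL: "\<exists>c. P f = L c" for f by (auto simp: P_def)
  have uniq: "P f = L c" if f: "f \<in> V" and o: "orth f (L c)" for f c
  proof -
    obtain d where d: "P f = L d" using PL by blast
    define q where "q = L (\<lambda>i. c i - d i)"
    have q: "q = (f - P f) - (f - L c)" by (simp add: q_def d L_diff[symmetric])
    have qV: "q \<in> V" by (simp add: q_def LV)
    have "ip q (y j) = 0" if "j < N" for j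
      unfolding q using P[OF f] o f y that PV LV by (simp add: orth_def ip_diff_left V_diff)
    then have "ip q q = 0" using ortho_L[OF qV, of "\<lambda>i. c i - d i"] by (simp add: q_def[symmetric])
    then have "q = 0" using ip_nrm[OF qV] nrm_zeroD[OF qV] by simp
    then show ?thesis unfolding q by simp
  qed
  have P_add: "P (f + g) = P f + P g" if fg: "f \<in> V" "g \<in> V" for f g
  proof -
    obtain c d where cd: "P f = L c" "P g = L d" using PL by blast
    have e: "f + g - (P f + P g) = (f - P f) + (g - P g)" by simp
    have "orth (f + g) (P f + P g)"
      unfolding orth_def e using P[OF fg(1)] P[OF fg(2)] fg y PV by (simp add: orth_def ip_add_left V_diff)
    then show ?thesis using uniq[of "f + g"] fg unfolding cd L_add by (simp add: V_add)
  qed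
  have P_scale: "P (cscale a f) = cscale a (P f)" if f: "f \<in> V" for a f
  proof -
    obtain c where c: "P f = L c" using PL by blast
    have e: "cscale a f - cscale a (P f) = cscale a (f - P f)" by (simp add: cfun.scale_right_diff_distrib)
    have "orth (cscale a f) (cscale a (P f))"
      unfolding orth_def e using P[OF f] f y PV by (simp add: orth_def ip_scale_left V_diff)
    then show ?thesis using uniq[of "cscale a f"] f unfolding c L_scale by (simp add: V_scale)
  qed
  have pyth: "(nrm f)\<^sup>2 = (nrm (f - P f))\<^sup>2 + (nrm (P f))\<^sup>2" if f: "f \<in> V" for f
  proof -
    obtain c where c: "P f = L c" using PL by blast
    have "ip (f - P f) (L c) = 0"
      by (rule ortho_L[OF V_diff[OF f PV]]) (use P[OF f] in \<open>simp add: orth_def\<close>)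
    then have "ip (f - P f) (P f) = 0" unfolding c .
    from nrm_add_orthogonal[OF V_diff[OF f PV] PV this] show ?thesis by simp
  qed
  define R where "R f = T (P f)" for f
  obtain C where C: "0 \<le> C" "\<And>f. f \<in> V \<Longrightarrow> nrm (T f) \<le> C * nrm f"
    by (rule bounded_operator_bound[OF T]) blast
  have nP: "nrm (P f) \<le> nrm f" if f: "f \<in> V" for f
  proof (rule power2_le_imp_le)
    show "(nrm (P f))\<^sup>2 \<le> (nrm f)\<^sup>2" using pyth[OF f] by simp
  qed (rule nrm_nonneg[OF f])
  have R_add: "R (f + g) = R f + R g" if "f \<in> V" "g \<in> V" for f g
    using T PV[of f] PV[of g] unfolding R_def P_add[OF that] bounded_operator_def by blast
  have R_scale: "R (cscale a f) = cscale a (R f)" if "f \<in> V" for a f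
    unfolding R_def P_scale[OF that] by (rule operator_scale[OF T PV])
  have R: "bounded_operator V nrm R"
    unfolding bounded_operator_def
  proof (intro conjI ballI allI)
    show "R f \<in> V" for f unfolding R_def by (rule bounded_operator_range[OF T PV])
    have "nrm (R f) \<le> C * nrm f" if "f \<in> V" for f
      unfolding R_def by (rule order.trans[OF C(2)[OF PV] mult_left_mono[OF nP[OF that] C(1)]])
    then show "\<exists>C. \<forall>f\<in>V. nrm (R f) \<le> C * nrm f" by blast
  qed (use R_add R_scale in auto)
  have "rank_less V R (Suc N)"
  proof -
    have sub: "cfun.subspace (R ` V)"
      unfolding cfun.subspace_def
    proof (intro conjI ballI allI)
      have "R 0 = 0" by (rule operator_zero[OF R])
      then show "0 \<in> R ` V" using V_zero by (metis image_eqI)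
      show "x + z \<in> R ` V" if x: "x \<in> R ` V" and z: "z \<in> R ` V" for x z
      proof -
        obtain f where "x = R f" "f \<in> V" using x by (rule imageE)
        moreover obtain g where "z = R g" "g \<in> V" using z by (rule imageE)
        ultimately show ?thesis using R_add V_add by (intro image_eqI[of _ _ "f + g"]) auto
      qed
      show "cscale a x \<in> R ` V" if x: "x \<in> R ` V" for a x
      proof -
        obtain f where "x = R f" "f \<in> V" using x by (rule imageE)
        then show ?thesis using R_scale V_scale by (intro image_eqI[of _ _ "cscale a f"]) auto
      qed
    qed
    \<comment> \<open>\<open>rank_less\<close> asks for a basis of the exact range, while the
      spanning vectors \<open>T (y i)\<close> may be dependent.\<close>
    obtain b where b: "b \<subseteq> R ` V" "\<not> cfun.dependent b" "R ` V \<subseteq> cfun.span b"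
      by (rule cfun.maximal_independent_subset[of "R ` V"])
    define S where "S = (\<lambda>i. T (y i)) ` {..<N}"
    have "R ` V \<subseteq> cfun.span S"
    proof
      fix x assume "x \<in> R ` V"
      then obtain f where f: "x = R f" by blast
      obtain c where c: "P f = L c" using PL by blast
      have "x = (\<Sum>i<N. cscale (c i) (T (y i)))"
        unfolding f R_def c L_def by (rule operator_sum[OF T]) (use y in auto)
      also have "\<dots> \<in> cfun.span S"
        by (intro cfun.span_sum cfun.span_scale cfun.span_base) (auto simp: S_def)
      finally show "x \<in> cfun.span S" .
    qed
    then have "b \<subseteq> cfun.span S" using b(1) by (rule order.trans[rotated])
    moreover have "finite S" by (simp add: S_def)
    ultimately have "finite b \<and> card b \<le> card S" using b(2) by (intro cfun.independent_span_bound)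
    moreover have "card S \<le> N" unfolding S_def using card_image_le[of "{..<N}" "\<lambda>i. T (y i)"] by simp
    ultimately have fb: "finite b" "card b < Suc N" by auto
    have "cfun.span b \<subseteq> R ` V" by (rule cfun.span_minimal[OF b(1) sub])
    then have "cfun.span b = R ` V" using b(3) by (rule equalityI)
    then show ?thesis unfolding rank_less_def using fb b(2) by (intro exI[of _ b]) simp
  qed
  then show ?thesis
  proof (rule approximation_number_le[OF T R])
    fix f assume f: "f \<in> V" "nrm f \<le> 1"
    have e: "T f - R f = T (f - P f)" unfolding R_def using operator_diff[OF T f(1) PV] by simp
    have "nrm (T f - R f) \<le> B * nrm (f - P f)"
      unfolding e using P[OF f(1)] by (intro le V_diff f PV) (simp add: orth_def)
    also have "\<dots> \<le> B * 1"
    proof (rule mult_left_mono[OF _ B])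
      have "(nrm (f - P f))\<^sup>2 \<le> (nrm f)\<^sup>2" using pyth[OF f(1)] by simp
      then have "nrm (f - P f) \<le> nrm f" by (rule power2_le_imp_le) (rule nrm_nonneg[OF f(1)])
      then show "nrm (f - P f) \<le> 1" using f(2) by simp
    qed
    finally show "nrm (T f - R f) \<le> B" by simp
  qed
qed

lemma approximation_number_antimono:
  assumes T: "bounded_operator V nrm T" and le: "m \<le> n"
  shows "approximation_number V nrm (Suc n) T \<le> approximation_number V nrm (Suc m) T"
  unfolding approximation_number_def
proof (rule cINF_superset_mono)
  show "{R. bounded_operator V nrm R \<and> rank_less V R (Suc m)} \<noteq> {}"
    using zero_operator(1) zero_operator(2)[of m] by auto
  show "bdd_below ((\<lambda>R. operator_norm V nrm (\<lambda>f. T f - R f)) ` {R. bounded_operator V nrm R \<and> rank_less V R (Suc n)})"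
    using operator_norm_diff_nonneg[OF T] by (intro bdd_belowI2[where m = 0]) auto
  show "{R. bounded_operator V nrm R \<and> rank_less V R (Suc m)} \<subseteq> {R. bounded_operator V nrm R \<and> rank_less V R (Suc n)}"
    using le unfolding rank_less_def by (auto intro: less_le_trans)
qed auto

end

section \<open>The Hardy space\<close>

abbreviation taylor_coeff :: "(complex \<Rightarrow> complex) \<Rightarrow> nat \<Rightarrow> complex" where
  "taylor_coeff f k \<equiv> fps_nth (fps_expansion f 0) k"

lemma taylor_coeff_sums: "f holomorphic_on unit_disk \<Longrightarrow> z \<in> unit_disk \<Longrightarrow> (\<lambda>k. taylor_coeff f k * z ^ k) sums f z"
  using holomorphic_power_series[of f 0 1 z] by (simp add: fps_expansion_def)

lemma taylor_coeff_eqI: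
  assumes "\<And>z. z \<in> unit_disk \<Longrightarrow> (\<lambda>k. c k * z ^ k) sums f z"
  shows "taylor_coeff f k = c k"
proof -
  have "f has_fps_expansion Abs_fps c"
  proof (rule has_fps_expansionI)
    have "\<forall>\<^sub>F u in nhds 0. u \<in> unit_disk" by (rule eventually_nhds_in_open) auto
    then show "\<forall>\<^sub>F u in nhds 0. (\<lambda>n. fps_nth (Abs_fps c) n * u ^ n) sums f u"
      by eventually_elim (use assms in auto)
  qed
  then have "fps_expansion f 0 = Abs_fps c" by (rule fps_expansion_eqI)
  then show ?thesis by simp
qed

lemma holomorphic_on_disk_sumsI:
  "(\<And>z. z \<in> unit_disk \<Longrightarrow> (\<lambda>k. c k * z ^ k) sums f z) \<Longrightarrow> f holomorphic_on unit_disk"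
  using power_series_holomorphic[of 0 1 c f] by simp

lemma taylor_coeff_add:
  assumes "f holomorphic_on unit_disk" "g holomorphic_on unit_disk"
  shows "taylor_coeff (f + g) k = taylor_coeff f k + taylor_coeff g k"
  by (rule taylor_coeff_eqI) (use sums_add[OF taylor_coeff_sums[OF assms(1)] taylor_coeff_sums[OF assms(2)]] in \<open>auto simp: algebra_simps\<close>)

lemma taylor_coeff_scale:
  assumes "f holomorphic_on unit_disk"
  shows "taylor_coeff (cscale c f) k = c * taylor_coeff f k"
  by (rule taylor_coeff_eqI) (use sums_mult[OF taylor_coeff_sums[OF assms], of _ c] in \<open>auto simp: cscale_def algebra_simps\<close>)

text \<open>Applied with one and the same \<open>q\<close> to the numerator \<open>z - a\<close> and
  to the denominator \<open>1 - cnj a * z\<close> of a Moebius factor.\<close>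

lemma taylor_coeff_linear_factor:
  assumes q: "q holomorphic_on unit_disk" and f: "\<And>z. z \<in> unit_disk \<Longrightarrow> f z = (\<alpha> + \<beta> * z) * q z"
  shows "taylor_coeff f k = \<alpha> * taylor_coeff q k + (if k = 0 then 0 else \<beta> * taylor_coeff q (k - 1))"
proof (rule taylor_coeff_eqI)
  fix z :: complex assume z: "z \<in> unit_disk"
  have s: "(\<lambda>k. taylor_coeff q k * z ^ k) sums q z" by (rule taylor_coeff_sums[OF q z])
  have "(\<lambda>k. \<beta> * z * (taylor_coeff q k * z ^ k)) sums (\<beta> * z * q z)" by (rule sums_mult[OF s])
  then have "(\<lambda>k. (\<lambda>k. if k = 0 then 0 else \<beta> * taylor_coeff q (k - 1) * z ^ k) (Suc k)) sums (\<beta> * z * q z)"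
    by (simp add: mult_ac)
  then have "(\<lambda>k. if k = 0 then 0 else \<beta> * taylor_coeff q (k - 1) * z ^ k) sums (\<beta> * z * q z)"
    by (subst (asm) sums_Suc_iff) simp
  from sums_add[OF sums_mult[OF s, of \<alpha>] this]
  have "(\<lambda>k. \<alpha> * (taylor_coeff q k * z ^ k) + (if k = 0 then 0 else \<beta> * taylor_coeff q (k - 1) * z ^ k)) sums f z"
    using f[OF z] by (simp add: algebra_simps)
  then show "(\<lambda>k. (\<alpha> * taylor_coeff q k + (if k = 0 then 0 else \<beta> * taylor_coeff q (k - 1))) * z ^ k) sums f z"
    by (rule sums_cong[THEN iffD1, rotated]) (simp add: algebra_simps)
qed

lemma summable_product_l2:
  fixes a b :: "nat \<Rightarrow> complex" and w :: "nat \<Rightarrow> real"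
  assumes w: "\<And>k. 0 \<le> w k" and "summable (\<lambda>k. w k * (cmod (a k))\<^sup>2)" "summable (\<lambda>k. w k * (cmod (b k))\<^sup>2)"
  shows "summable (\<lambda>k. of_real (w k) * a k * cnj (b k))"
proof (rule summable_comparison_test'[of _ 0])
  show "summable (\<lambda>k. w k * (cmod (a k))\<^sup>2 + w k * (cmod (b k))\<^sup>2)" by (intro summable_add assms)
  fix k
  have "cmod (a k) * cmod (b k) \<le> (cmod (a k))\<^sup>2 + (cmod (b k))\<^sup>2"
    using sum_squares_bound[of "cmod (a k)" "cmod (b k)"]
      mult_nonneg_nonneg[OF norm_ge_zero[of "a k"] norm_ge_zero[of "b k"]] by linarith
  then have "w k * (cmod (a k) * cmod (b k)) \<le> w k * ((cmod (a k))\<^sup>2 + (cmod (b k))\<^sup>2)"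
    using w by (rule mult_left_mono)
  then show "norm (of_real (w k) * a k * cnj (b k)) \<le> w k * (cmod (a k))\<^sup>2 + w k * (cmod (b k))\<^sup>2"
    using w[of k] by (simp add: norm_mult distrib_left mult.assoc)
qed

text \<open>Analytic functions on the disk with a weighted square norm on their Taylor coefficients: the
  weights \<open>1\<close> and \<open>1 / (k + 1)\<close> give the Hardy and the Bergman space.\<close>

definition wspace :: "(nat \<Rightarrow> real) \<Rightarrow> (complex \<Rightarrow> complex) set" where
  "wspace w = {f. f holomorphic_on unit_disk \<and> (\<forall>z. z \<notin> unit_disk \<longrightarrow> f z = 0) \<and>
     summable (\<lambda>k. w k * (cmod (taylor_coeff f k))\<^sup>2)}"

definition wnorm :: "(nat \<Rightarrow> real) \<Rightarrow> (complex \<Rightarrow> complex) \<Rightarrow> real" where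
  "wnorm w f = sqrt (\<Sum>k. w k * (cmod (taylor_coeff f k))\<^sup>2)"

definition wip :: "(nat \<Rightarrow> real) \<Rightarrow> (complex \<Rightarrow> complex) \<Rightarrow> (complex \<Rightarrow> complex) \<Rightarrow> complex" where
  "wip w f g = (\<Sum>k. of_real (w k) * taylor_coeff f k * cnj (taylor_coeff g k))"

lemma wspace_holomorphic: "f \<in> wspace w \<Longrightarrow> f holomorphic_on unit_disk"
  by (simp add: wspace_def)

lemma wnorm_sq: "f \<in> wspace w \<Longrightarrow> (\<And>k. 0 \<le> w k) \<Longrightarrow> (wnorm w f)\<^sup>2 = (\<Sum>k. w k * (cmod (taylor_coeff f k))\<^sup>2)"
  unfolding wnorm_def wspace_def by (subst real_sqrt_pow2) (auto intro!: suminf_nonneg)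

lemma complex_ip_space_wspace:
  assumes w: "\<And>k. 0 < w k"
  shows "complex_ip_space (wspace w) (wip w) (wnorm w)"
proof
  have w': "0 \<le> w k" for k using w[of k] by simp
  have summ: "summable (\<lambda>k. of_real (w k) * taylor_coeff f k * cnj (taylor_coeff g k))" if "f \<in> wspace w" "g \<in> wspace w" for f g
    using that w' by (intro summable_product_l2) (auto simp: wspace_def)
  show sub: "cfun.subspace (wspace w)"
    unfolding cfun.subspace_def
  proof (intro conjI ballI allI)
    have "taylor_coeff 0 k = 0" for k by (rule taylor_coeff_eqI) (simp add: zero_fun_def)
    then show "0 \<in> wspace w" by (simp add: wspace_def zero_fun_def holomorphic_on_const)
  next
    fix f g assume fg: "f \<in> wspace w" "g \<in> wspace w"
    have "summable (\<lambda>k. w k * (cmod (taylor_coeff f k + taylor_coeff g k))\<^sup>2)"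
    proof (rule summable_comparison_test'[of _ 0])
      show "summable (\<lambda>k. 2 * (w k * (cmod (taylor_coeff f k))\<^sup>2) + 2 * (w k * (cmod (taylor_coeff g k))\<^sup>2))"
        using fg by (intro summable_add summable_mult) (auto simp: wspace_def)
      fix k
      have "(cmod (taylor_coeff f k + taylor_coeff g k))\<^sup>2 \<le> (cmod (taylor_coeff f k) + cmod (taylor_coeff g k))\<^sup>2"
        by (intro power_mono norm_triangle_ineq) auto
      also have "\<dots> \<le> 2 * (cmod (taylor_coeff f k))\<^sup>2 + 2 * (cmod (taylor_coeff g k))\<^sup>2"
        using sum_squares_bound[of "cmod (taylor_coeff f k)" "cmod (taylor_coeff g k)"] by (simp add: power2_sum)
      finally have "w k * (cmod (taylor_coeff f k + taylor_coeff g k))\<^sup>2 \<le> w k * (2 * (cmod (taylor_coeff f k))\<^sup>2 + 2 * (cmod (taylor_coeff g k))\<^sup>2)"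
        by (rule mult_left_mono[OF _ w'])
      then show "norm (w k * (cmod (taylor_coeff f k + taylor_coeff g k))\<^sup>2) \<le>
          2 * (w k * (cmod (taylor_coeff f k))\<^sup>2) + 2 * (w k * (cmod (taylor_coeff g k))\<^sup>2)"
        using w'[of k] by (simp add: algebra_simps)
    qed
    moreover have "(\<lambda>z. f z + g z) holomorphic_on unit_disk"
      using fg by (intro holomorphic_intros) (auto simp: wspace_def)
    ultimately show "f + g \<in> wspace w"
      using fg taylor_coeff_add[of f g] unfolding wspace_def by (auto simp: plus_fun_def)
  next
    fix c f assume f: "f \<in> wspace w"
    have "(\<lambda>z. c * f z) holomorphic_on unit_disk"
      using f by (intro holomorphic_intros) (auto simp: wspace_def)
    moreover have "summable (\<lambda>k. (cmod c)\<^sup>2 * (w k * (cmod (taylor_coeff f k))\<^sup>2))"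
      using f by (intro summable_mult) (auto simp: wspace_def)
    ultimately show "cscale c f \<in> wspace w"
      using f taylor_coeff_scale[of f c] unfolding wspace_def
      by (auto simp: cscale_def norm_mult power_mult_distrib mult_ac)
  qed
  fix f g h :: "complex \<Rightarrow> complex" and c :: complex
  show "wip w (f + g) h = wip w f h + wip w g h" if "f \<in> wspace w" "g \<in> wspace w" "h \<in> wspace w"
    unfolding wip_def using that summ[of f h] summ[of g h]
    by (subst suminf_add) (auto simp: taylor_coeff_add wspace_holomorphic algebra_simps)
  show "wip w (cscale c f) h = c * wip w f h" if "f \<in> wspace w" "h \<in> wspace w"
    unfolding wip_def using that summ[of f h]
    by (subst suminf_mult[symmetric]) (auto simp: taylor_coeff_scale wspace_holomorphic mult_ac)
  show "cnj (wip w f g) = wip w g f" if "f \<in> wspace w" "g \<in> wspace w"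
    unfolding wip_def using summ[OF that]
    by (subst bounded_linear.suminf[OF bounded_linear_cnj]) (auto simp: mult_ac)
  show "wip w f f = of_real ((wnorm w f)\<^sup>2)" if "f \<in> wspace w"
  proof -
    have "(\<lambda>k. w k * (cmod (taylor_coeff f k))\<^sup>2) sums (wnorm w f)\<^sup>2"
      unfolding wnorm_sq[OF that w'] using that by (auto simp: wspace_def)
    then have "(\<lambda>k. complex_of_real (w k * (cmod (taylor_coeff f k))\<^sup>2)) sums of_real ((wnorm w f)\<^sup>2)"
      by (rule sums_of_real)
    moreover have "complex_of_real (w k * (cmod (taylor_coeff f k))\<^sup>2) = of_real (w k) * taylor_coeff f k * cnj (taylor_coeff f k)" for k
      unfolding of_real_mult complex_norm_square by (simp add: mult.assoc)
    ultimately have "(\<lambda>k. of_real (w k) * taylor_coeff f k * cnj (taylor_coeff f k)) sums complex_of_real ((wnorm w f)\<^sup>2)"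
      by (simp only:)
    then show ?thesis unfolding wip_def by (rule sums_unique[symmetric])
  qed
  show "0 \<le> wnorm w f" if "f \<in> wspace w"
    using that unfolding wnorm_def wspace_def by (auto intro!: suminf_nonneg mult_nonneg_nonneg w')
  show "f = 0" if f: "f \<in> wspace w" and 0: "wnorm w f = 0"
  proof
    fix z
    have "(\<Sum>k. w k * (cmod (taylor_coeff f k))\<^sup>2) = 0" using wnorm_sq[OF f w'] 0 by simp
    then have "\<forall>k. w k * (cmod (taylor_coeff f k))\<^sup>2 = 0"
      using f w' by (subst (asm) suminf_eq_zero_iff) (auto simp: wspace_def)
    then have "taylor_coeff f k = 0" for k using w[of k] by (metis less_irrefl mult_eq_0_iff norm_eq_zero power_eq_0_iff)
    then show "f z = 0 z"
      using taylor_coeff_sums[OF wspace_holomorphic[OF f], of z] f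
      by (cases "z \<in> unit_disk") (auto simp: wspace_def zero_fun_def sums_iff)
  qed
qed

section \<open>Hardy space estimates and Blaschke factors\<close>

lemma hardy_space_wspace: "hardy_space = wspace (\<lambda>_. 1)"
  by (simp add: hardy_space_def wspace_def)

lemma hardy_norm_wnorm: "hardy_norm = wnorm (\<lambda>_. 1)"
  by (simp add: hardy_norm_def wnorm_def fun_eq_iff)

lemma complex_ip_space_hardy: "complex_ip_space hardy_space (wip (\<lambda>_. 1)) hardy_norm"
  using complex_ip_space_wspace[of "\<lambda>_. 1"] unfolding hardy_space_wspace hardy_norm_wnorm by simp

interpretation hardy: complex_ip_space hardy_space "wip (\<lambda>_. 1)" hardy_norm
  by (rule complex_ip_space_hardy)

lemma hardy_norm_sq: "f \<in> hardy_space \<Longrightarrow> (hardy_norm f)\<^sup>2 = (\<Sum>k. (cmod (taylor_coeff f k))\<^sup>2)"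
  unfolding hardy_space_wspace hardy_norm_wnorm using wnorm_sq[of f "\<lambda>_. 1"] by simp

lemma hardy_partial_sum_le: "f \<in> hardy_space \<Longrightarrow> (\<Sum>k\<le>K. (cmod (taylor_coeff f k))\<^sup>2) \<le> (hardy_norm f)\<^sup>2"
  unfolding hardy_norm_sq by (rule sum_le_suminf) (auto simp: hardy_space_def)

lemma hardy_spaceI:
  assumes "f holomorphic_on unit_disk" "\<And>z. z \<notin> unit_disk \<Longrightarrow> f z = 0"
    and "\<And>K. (\<Sum>k\<le>K. (cmod (taylor_coeff f k))\<^sup>2) \<le> B\<^sup>2" and "0 \<le> B"
  shows "f \<in> hardy_space" "hardy_norm f \<le> B"
proof -
  have b: "(\<Sum>k<K. (cmod (taylor_coeff f k))\<^sup>2) \<le> B\<^sup>2" for K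
    using assms(3)[of K] by (intro order.trans[OF _ assms(3)[of K]] sum_mono2) auto
  have s: "summable (\<lambda>k. (cmod (taylor_coeff f k))\<^sup>2)"
    by (rule summableI_nonneg_bounded[of _ "B\<^sup>2"]) (use b in auto)
  then show f: "f \<in> hardy_space" using assms by (auto simp: hardy_space_def)
  have "(hardy_norm f)\<^sup>2 \<le> B\<^sup>2"
    unfolding hardy_norm_sq[OF f] by (rule suminf_le_const[OF s b])
  then show "hardy_norm f \<le> B" using assms(4) by (rule power2_le_imp_le)
qed

text \<open>The coefficients of \<open>(z - a) q\<close> and \<open>(1 - cnj a z) q\<close> differ in modulus by a telescoping term.\<close>

lemma moebius_telescope:
  fixes q :: "nat \<Rightarrow> complex" and a :: complex
  defines "g k \<equiv> - a * q k + (if k = 0 then 0 else 1 * q (k - 1))"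
    and "h k \<equiv> 1 * q k + (if k = 0 then 0 else - cnj a * q (k - 1))"
  shows "(\<Sum>k\<le>K. (cmod (h k))\<^sup>2) = (\<Sum>k\<le>K. (cmod (g k))\<^sup>2) + (1 - (cmod a)\<^sup>2) * (cmod (q K))\<^sup>2"
proof (induction K)
  case 0
  show ?case by (simp add: g_def h_def norm_mult power_mult_distrib algebra_simps)
next
  case (Suc K)
  have "(cmod (q (Suc K) - cnj a * q K))\<^sup>2 - (cmod (q K - a * q (Suc K)))\<^sup>2 =
      (1 - (cmod a)\<^sup>2) * ((cmod (q (Suc K)))\<^sup>2 - (cmod (q K))\<^sup>2)"
    unfolding cmod_power2 by (simp add: power2_eq_square algebra_simps)
  then show ?case using Suc.IH by (simp add: g_def h_def algebra_simps)
qed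

text \<open>Multiplication by the Blaschke factor with zero \<open>a\<close>, up to a unimodular
  constant.\<close>

definition moebius_mult :: "complex \<Rightarrow> (complex \<Rightarrow> complex) \<Rightarrow> complex \<Rightarrow> complex" where
  "moebius_mult a f = (\<lambda>z. if z \<in> unit_disk then (z - a) / (1 - cnj a * z) * f z else 0)"

lemma one_minus_cnj_mult_ne_0: "cmod a < 1 \<Longrightarrow> cmod z < 1 \<Longrightarrow> 1 - cnj a * z \<noteq> 0"
proof
  assume a: "cmod a < 1" "cmod z < 1" and "1 - cnj a * z = 0"
  then have "cnj a * z = 1" by simp
  then have "cmod a * cmod z = 1" by (metis complex_mod_cnj norm_mult norm_one)
  moreover have "cmod a * cmod z \<le> cmod a * 1" using a by (intro mult_left_mono) auto
  ultimately show False using a by simp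
qed

text \<open>The factor has modulus 1 on the circle, but boundary values are avoided: with
  \<open>q = f / (1 - cnj a * z)\<close>, the partial sums of squared coefficients of
  \<open>f\<close> and of the product differ by the nonnegative remainder of
  \<open>moebius_telescope\<close>.\<close>

lemma moebius_mult_hardy:
  assumes f: "f \<in> hardy_space" and a: "cmod a < 1"
  shows "moebius_mult a f \<in> hardy_space" "hardy_norm (moebius_mult a f) \<le> hardy_norm f"
proof -
  define q where "q = (\<lambda>z. f z / (1 - cnj a * z))"
  have fh: "f holomorphic_on unit_disk" using f by (simp add: hardy_space_def)
  have q: "q holomorphic_on unit_disk"
    unfolding q_def using a one_minus_cnj_mult_ne_0[OF a] by (intro holomorphic_intros fh) auto
  have tg: "taylor_coeff (moebius_mult a f) k = - a * taylor_coeff q k + (if k = 0 then 0 else 1 * taylor_coeff q (k - 1))" for k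
    by (rule taylor_coeff_linear_factor[OF q]) (simp add: moebius_mult_def q_def)
  have tf: "taylor_coeff f k = 1 * taylor_coeff q k + (if k = 0 then 0 else - cnj a * taylor_coeff q (k - 1))" for k
    by (rule taylor_coeff_linear_factor[OF q]) (use one_minus_cnj_mult_ne_0[OF a] in \<open>auto simp: q_def\<close>)
  have hol: "moebius_mult a f holomorphic_on unit_disk"
  proof (rule holomorphic_transform)
    show "(\<lambda>z. (z - a) * q z) holomorphic_on unit_disk" by (intro holomorphic_intros q)
  qed (simp add: moebius_mult_def q_def)
  have bd: "(\<Sum>k\<le>K. (cmod (taylor_coeff (moebius_mult a f) k))\<^sup>2) \<le> (hardy_norm f)\<^sup>2" for K
  proof -
    have "0 \<le> (1 - (cmod a)\<^sup>2) * (cmod (taylor_coeff q K))\<^sup>2"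
      using a by (intro mult_nonneg_nonneg) (auto simp: power_le_one)
    then have "(\<Sum>k\<le>K. (cmod (taylor_coeff (moebius_mult a f) k))\<^sup>2) \<le> (\<Sum>k\<le>K. (cmod (taylor_coeff f k))\<^sup>2)"
      unfolding tg tf using moebius_telescope[of "taylor_coeff q" a K] by linarith
    also have "\<dots> \<le> (hardy_norm f)\<^sup>2" by (rule hardy_partial_sum_le[OF f])
    finally show ?thesis .
  qed
  show "moebius_mult a f \<in> hardy_space" "hardy_norm (moebius_mult a f) \<le> hardy_norm f"
    using hardy_spaceI[OF hol _ bd hardy.nrm_nonneg[OF f]] by (auto simp: moebius_mult_def)
qed

text \<open>Now the remainder in \<open>moebius_telescope\<close> has the unfavourable sign, so it
  must vanish in the limit. The work is to show that the coefficients of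
  \<open>q = g / (z - a)\<close> tend to 0 while \<open>q\<close> is only known to be
  holomorphic.\<close>

lemma moebius_divide_hardy:
  assumes g: "g \<in> hardy_space" and a: "cmod a < 1" and ga: "g a = 0"
  obtains h where "h \<in> hardy_space" "hardy_norm h \<le> hardy_norm g" "g = moebius_mult a h"
proof -
  have gh: "g holomorphic_on unit_disk" using g by (simp add: hardy_space_def)
  define q where "q = (\<lambda>z. if z = a then deriv g a else (g z - g a) / (z - a))"
  have q: "q holomorphic_on unit_disk"
    unfolding q_def by (rule pole_lemma_open[OF gh]) auto
  have gq: "g z = (z - a) * q z" for z by (simp add: q_def ga)
  have tg: "taylor_coeff g k = - a * taylor_coeff q k + (if k = 0 then 0 else 1 * taylor_coeff q (k - 1))" for k
    by (rule taylor_coeff_linear_factor[OF q]) (simp add: gq)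
  define h where "h = (\<lambda>z. if z \<in> unit_disk then (1 - cnj a * z) * q z else 0)"
  have th: "taylor_coeff h k = 1 * taylor_coeff q k + (if k = 0 then 0 else - cnj a * taylor_coeff q (k - 1))" for k
    by (rule taylor_coeff_linear_factor[OF q]) (simp add: h_def)
  have hol: "h holomorphic_on unit_disk"
  proof (rule holomorphic_transform)
    show "(\<lambda>z. (1 - cnj a * z) * q z) holomorphic_on unit_disk" by (intro holomorphic_intros q)
  qed (simp add: h_def)
  have "(\<lambda>k. (cmod (taylor_coeff g k))\<^sup>2) \<longlonglongrightarrow> 0"
    using g by (intro summable_LIMSEQ_zero) (auto simp: hardy_space_def)
  then have g0: "(\<lambda>k. cmod (taylor_coeff g k)) \<longlonglongrightarrow> 0"
    using tendsto_real_sqrt[of "\<lambda>k. (cmod (taylor_coeff g k))\<^sup>2" 0 sequentially] by simp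
  have qa0: "(\<lambda>k. taylor_coeff q k * a ^ k) \<longlonglongrightarrow> 0"
    using taylor_coeff_sums[OF q, of a] a by (intro summable_LIMSEQ_zero) (auto simp: sums_iff)
  \<comment> \<open>Comparing coefficients in \<open>g = (z - a) * q\<close> expresses the
    \<open>k\<close>-th coefficient of \<open>q\<close> as the next one of \<open>g\<close> plus
    \<open>a\<close> times the next one of \<open>q\<close>. Iteration gives a geometric series and
    a tail that vanishes because the series of \<open>q\<close> converges at
    \<open>a\<close>.\<close>
  have step: "cmod (taylor_coeff q k) \<le> e / (1 - cmod a)" if e: "\<And>j. k < j \<Longrightarrow> cmod (taylor_coeff g j) \<le> e" for k e
  proof -
    have e0: "0 \<le> e" using e[of "Suc k"] by (meson lessI norm_ge_zero order.trans)
    have *: "cmod (taylor_coeff q k) \<le> (\<Sum>i<m. e * cmod a ^ i) + cmod a ^ m * cmod (taylor_coeff q (k + m))" for m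
    proof (induction m)
      case (Suc m)
      have "cmod (taylor_coeff q (k + m)) = cmod (taylor_coeff g (Suc (k + m)) + a * taylor_coeff q (Suc (k + m)))" by (subst tg) simp
      also have "\<dots> \<le> e + cmod a * cmod (taylor_coeff q (k + Suc m))"
        using e[of "Suc (k + m)"] by (intro order.trans[OF norm_triangle_ineq]) (simp add: norm_mult)
      finally have "cmod a ^ m * cmod (taylor_coeff q (k + m)) \<le> cmod a ^ m * (e + cmod a * cmod (taylor_coeff q (k + Suc m)))"
        by (intro mult_left_mono) auto
      then show ?case using Suc.IH by (simp add: algebra_simps)
    qed simp
    have "(\<lambda>m. cmod a ^ m * cmod (taylor_coeff q (k + m))) \<longlonglongrightarrow> 0"
    proof (cases "a = 0")
      case True
      have "(\<lambda>m. cmod a ^ Suc m * cmod (taylor_coeff q (k + Suc m))) \<longlonglongrightarrow> 0" using True by simp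
      then show ?thesis by (rule LIMSEQ_imp_Suc)
    next
      case False
      have "(\<lambda>m. taylor_coeff q (m + k) * a ^ (m + k)) \<longlonglongrightarrow> 0" by (rule LIMSEQ_ignore_initial_segment[OF qa0])
      then have "(\<lambda>m. cmod (taylor_coeff q (m + k) * a ^ (m + k))) \<longlonglongrightarrow> 0" by (rule tendsto_norm_zero)
      then have "(\<lambda>m. cmod (taylor_coeff q (m + k) * a ^ (m + k)) / cmod a ^ k) \<longlonglongrightarrow> 0 / cmod a ^ k"
        by (rule tendsto_divide) (use False in auto)
      then show ?thesis using False by (simp add: norm_mult norm_power power_add add.commute mult_ac)
    qed
    moreover have "(\<lambda>m. \<Sum>i<m. e * cmod a ^ i) \<longlonglongrightarrow> e * (1 / (1 - cmod a))"
      using sums_mult[OF geometric_sums[of "cmod a"], of e] a unfolding sums_def by simp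
    ultimately have "(\<lambda>m. (\<Sum>i<m. e * cmod a ^ i) + cmod a ^ m * cmod (taylor_coeff q (k + m))) \<longlonglongrightarrow> e * (1 / (1 - cmod a)) + 0"
      by (intro tendsto_add)
    from LIMSEQ_le_const[OF this] * show ?thesis by fastforce
  qed
  have q0: "(\<lambda>k. cmod (taylor_coeff q k)) \<longlonglongrightarrow> 0"
  proof (rule LIMSEQ_I)
    fix r :: real assume r: "0 < r"
    define e where "e = r / 2 * (1 - cmod a)"
    have "0 < e" using r a by (simp add: e_def)
    then obtain N where N: "\<And>k. k \<ge> N \<Longrightarrow> cmod (taylor_coeff g k) < e"
      using LIMSEQ_D[OF g0, of e] by auto
    have "cmod (taylor_coeff q k) < r" if "k \<ge> N" for k
    proof -
      have "cmod (taylor_coeff q k) \<le> e / (1 - cmod a)"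
        by (rule step) (use N that in \<open>simp add: less_imp_le\<close>)
      also have "\<dots> = r / 2" using a by (simp add: e_def field_simps)
      finally show ?thesis using r by simp
    qed
    then show "\<exists>no. \<forall>n\<ge>no. norm (cmod (taylor_coeff q n) - 0) < r" by auto
  qed
  have bd: "(\<Sum>k\<le>K. (cmod (taylor_coeff h k))\<^sup>2) \<le> (hardy_norm g)\<^sup>2" for K
  proof -
    \<comment> \<open>The partial sum is extended to \<open>L\<close> before telescoping, so that
      \<open>L\<close> can go to infinity with \<open>K\<close> fixed.\<close>
    have "(\<Sum>k\<le>K. (cmod (taylor_coeff h k))\<^sup>2) \<le> (hardy_norm g)\<^sup>2 + (1 - (cmod a)\<^sup>2) * (cmod (taylor_coeff q L))\<^sup>2" if "L \<ge> K" for L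
    proof -
      have "(\<Sum>k\<le>K. (cmod (taylor_coeff h k))\<^sup>2) \<le> (\<Sum>k\<le>L. (cmod (taylor_coeff h k))\<^sup>2)"
        using that by (intro sum_mono2) auto
      also have "\<dots> = (\<Sum>k\<le>L. (cmod (taylor_coeff g k))\<^sup>2) + (1 - (cmod a)\<^sup>2) * (cmod (taylor_coeff q L))\<^sup>2"
        unfolding tg th by (rule moebius_telescope)
      also have "(\<Sum>k\<le>L. (cmod (taylor_coeff g k))\<^sup>2) \<le> (hardy_norm g)\<^sup>2" by (rule hardy_partial_sum_le[OF g])
      finally show ?thesis by simp
    qed
    moreover have "(\<lambda>L. (hardy_norm g)\<^sup>2 + (1 - (cmod a)\<^sup>2) * (cmod (taylor_coeff q L))\<^sup>2) \<longlonglongrightarrow>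
        (hardy_norm g)\<^sup>2 + (1 - (cmod a)\<^sup>2) * 0\<^sup>2"
      by (intro tendsto_intros q0)
    ultimately show ?thesis
      using LIMSEQ_le_const[of _ "(hardy_norm g)\<^sup>2 + (1 - (cmod a)\<^sup>2) * 0\<^sup>2" "\<Sum>k\<le>K. (cmod (taylor_coeff h k))\<^sup>2"] by fastforce
  qed
  have "g = moebius_mult a h"
    using one_minus_cnj_mult_ne_0[OF a] g
    by (auto simp: fun_eq_iff moebius_mult_def h_def gq hardy_space_def)
  moreover note hardy_spaceI[OF hol _ bd hardy.nrm_nonneg[OF g]]
  ultimately show ?thesis using that[of h] by (auto simp: h_def)
qed

lemma taylor_coeff_0: "f holomorphic_on unit_disk \<Longrightarrow> taylor_coeff f 0 = f 0"
  using taylor_coeff_sums[of f 0] by (simp add: powser_sums_zero_iff)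

lemma hardy_value_0_le:
  assumes f: "f \<in> hardy_space"
  shows "cmod (f 0) \<le> hardy_norm f"
proof (rule power2_le_imp_le)
  show "(cmod (f 0))\<^sup>2 \<le> (hardy_norm f)\<^sup>2"
    using hardy_partial_sum_le[OF f, of 0] taylor_coeff_0[of f] f by (simp add: hardy_space_def)
  show "0 \<le> hardy_norm f" by (rule hardy.nrm_nonneg[OF f])
qed

text \<open>Each zero \<open>a\<close> is divided out without increasing the norm and costs a factor
  \<open>|a|\<close> at the origin. The product is the modulus at 0 of the finite Blaschke product
  with zeros \<open>Z\<close>.\<close>

lemma hardy_zeros:
  assumes "finite Z" "Z \<subseteq> unit_disk" "g \<in> hardy_space" "\<And>z. z \<in> Z \<Longrightarrow> g z = 0"
  shows "cmod (g 0) \<le> (\<Prod>z\<in>Z. cmod z) * hardy_norm g"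
  using assms
proof (induction Z arbitrary: g rule: finite_induct)
  case empty
  then show ?case using hardy_value_0_le by simp
next
  case (insert a Z)
  have a: "cmod a < 1" using insert.prems by auto
  obtain h where h: "h \<in> hardy_space" "hardy_norm h \<le> hardy_norm g" "g = moebius_mult a h"
    using moebius_divide_hardy[OF insert.prems(2) a insert.prems(3)] by auto
  have "h z = 0" if z: "z \<in> Z" for z
  proof -
    have "(z - a) / (1 - cnj a * z) * h z = 0"
      using insert.prems(3)[of z] z insert.prems(1) by (auto simp: h(3) moebius_mult_def)
    moreover have "z \<noteq> a" using z insert.hyps by auto
    moreover have "1 - cnj a * z \<noteq> 0" using z insert.prems(1) by (intro one_minus_cnj_mult_ne_0 a) auto
    ultimately show ?thesis by auto
  qed
  then have "cmod (h 0) \<le> (\<Prod>z\<in>Z. cmod z) * hardy_norm h"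
    using insert.IH[OF _ h(1)] insert.prems by auto
  also have "\<dots> \<le> (\<Prod>z\<in>Z. cmod z) * hardy_norm g"
    by (intro mult_left_mono h prod_nonneg) auto
  finally have "cmod a * cmod (h 0) \<le> cmod a * ((\<Prod>z\<in>Z. cmod z) * hardy_norm g)"
    by (rule mult_left_mono) auto
  moreover have "cmod (g 0) = cmod a * cmod (h 0)" by (simp add: h(3) moebius_mult_def norm_mult)
  ultimately show ?case using insert.hyps by (simp add: mult.assoc)
qed

definition disk_one :: "complex \<Rightarrow> complex" where
  "disk_one = (\<lambda>z. if z \<in> unit_disk then 1 else 0)"

lemma taylor_coeff_disk_one: "taylor_coeff disk_one k = (if k = 0 then 1 else 0)"
proof (rule taylor_coeff_eqI)
  fix z :: complex assume "z \<in> unit_disk"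
  moreover have "(\<lambda>k. (if k = 0 then 1 else 0) * z ^ k) sums 1"
    using sums_single[of 0 "\<lambda>_. 1::complex"] by (rule sums_cong[THEN iffD1, rotated]) auto
  ultimately show "(\<lambda>k. (if k = 0 then 1 else 0) * z ^ k) sums disk_one z" by (simp add: disk_one_def)
qed

lemma disk_one_hardy: "disk_one \<in> hardy_space"
proof -
  have "disk_one holomorphic_on unit_disk"
    by (rule holomorphic_transform[of "\<lambda>_. 1"]) (auto simp: disk_one_def)
  moreover have "summable (\<lambda>k. (cmod (taylor_coeff disk_one k))\<^sup>2)"
    by (rule summable_finite[of "{0}"]) (auto simp: taylor_coeff_disk_one)
  ultimately show ?thesis by (auto simp: hardy_space_def disk_one_def)
qed

text \<open>\<open>F - c\<close> vanishes on \<open>Z\<close>, so by \<open>hardy_zeros\<close> its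
  constant term is small compared with its norm and cannot cancel \<open>c\<close> for free. The
  bound is sharp: for the Blaschke product \<open>B\<close> of \<open>Z\<close>, equality holds at
  \<open>c * (1 - cnj (B 0) * B)\<close>.\<close>

lemma hardy_constant_on_finite:
  assumes Z: "finite Z" "Z \<subseteq> unit_disk" and F: "F \<in> hardy_space" and FZ: "\<And>z. z \<in> Z \<Longrightarrow> F z = c"
  shows "(cmod c)\<^sup>2 * (1 - (\<Prod>z\<in>Z. cmod z)\<^sup>2) \<le> (hardy_norm F)\<^sup>2"
proof -
  define b where "b = (\<Prod>z\<in>Z. cmod z)"
  define G where "G = F - cscale c disk_one"
  have G: "G \<in> hardy_space" unfolding G_def by (intro hardy.V_diff hardy.V_scale F disk_one_hardy)
  have hol: "F holomorphic_on unit_disk" "G holomorphic_on unit_disk" "disk_one holomorphic_on unit_disk"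
    using F G disk_one_hardy by (auto simp: hardy_space_def)
  have "F = G + cscale c disk_one" by (simp add: G_def)
  then have tF: "taylor_coeff F k = taylor_coeff G k + (if k = 0 then c else 0)" for k
    using taylor_coeff_add[OF hol(2), of "cscale c disk_one" k] taylor_coeff_scale[OF hol(3), of c k] taylor_coeff_disk_one[of k]
      holomorphic_on_mult[OF holomorphic_on_const hol(3), of c] by (simp add: cscale_def)
  have G0: "cmod (G 0) \<le> b * hardy_norm G"
    unfolding b_def using Z(2) FZ by (intro hardy_zeros Z G) (auto simp: G_def disk_one_def cscale_def)
  have head: "(hardy_norm f)\<^sup>2 = (cmod (taylor_coeff f 0))\<^sup>2 + (\<Sum>k. (cmod (taylor_coeff f (Suc k)))\<^sup>2)" if "f \<in> hardy_space" for f
    unfolding hardy_norm_sq[OF that] using that by (subst suminf_split_head) (auto simp: hardy_space_def)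
  have nF: "(hardy_norm F)\<^sup>2 = (cmod (G 0 + c))\<^sup>2 + (hardy_norm G)\<^sup>2 - (cmod (G 0))\<^sup>2"
    unfolding head[OF F] head[OF G] by (simp add: tF taylor_coeff_0[OF hol(2)])
  define x where "x = cmod (G 0)"
  define y where "y = hardy_norm G"
  define m where "m = cmod c"
  have xy: "0 \<le> x" "x \<le> b * y" "0 \<le> y" "0 \<le> m"
    using G0 hardy.nrm_nonneg[OF G] by (auto simp: x_def y_def m_def)
  have "\<bar>m - x\<bar> \<le> cmod (G 0 + c)"
    unfolding m_def x_def using norm_triangle_ineq3[of c "- G 0"] by (simp add: add.commute)
  then have "\<bar>m - x\<bar>\<^sup>2 \<le> (cmod (G 0 + c))\<^sup>2"
    by (rule power_mono) simp
  \<comment> \<open>Since \<open>x \<le> b * y\<close>, the right side minus the left side is at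
    least the square of \<open>y - b * m\<close>.\<close>
  moreover have "m\<^sup>2 * (1 - b\<^sup>2) \<le> (m - x)\<^sup>2 + y\<^sup>2 - x\<^sup>2"
  proof -
    have "m * x \<le> m * (b * y)" using xy by (intro mult_left_mono) auto
    moreover have "0 \<le> (y - b * m)\<^sup>2" by simp
    ultimately show ?thesis by (simp add: power2_diff power_mult_distrib algebra_simps)
  qed
  ultimately show ?thesis
    unfolding nF b_def[symmetric] x_def[symmetric] y_def[symmetric] m_def[symmetric] power2_abs by linarith
qed

section \<open>Takenaka-Malmquist functions and the lower bound on fibres\<close>

definition hardy_kernel :: "complex \<Rightarrow> complex \<Rightarrow> complex" where
  "hardy_kernel w = (\<lambda>z. if z \<in> unit_disk then of_real (sqrt (1 - (cmod w)\<^sup>2)) / (1 - cnj w * z) else 0)"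

lemma hardy_kernel:
  assumes w: "cmod w < 1"
  shows "hardy_kernel w \<in> hardy_space" "hardy_norm (hardy_kernel w) \<le> 1"
proof -
  define s where "s = sqrt (1 - (cmod w)\<^sup>2)"
  have w2: "(cmod w)\<^sup>2 < 1" using w by (simp add: power_less_one_iff abs_square_less_1)
  have s2: "s\<^sup>2 = 1 - (cmod w)\<^sup>2" using w2 by (simp add: s_def)
  have sums: "(\<lambda>k. of_real s * cnj w ^ k * z ^ k) sums hardy_kernel w z" if z: "z \<in> unit_disk" for z
  proof -
    have "cmod (cnj w * z) < 1"
      using w z mult_strict_mono'[of "cmod w" 1 "cmod z" 1] by (simp add: norm_mult)
    from sums_mult[OF geometric_sums[OF this], of "of_real s"] show ?thesis
      using z by (simp add: hardy_kernel_def s_def power_mult_distrib mult_ac)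
  qed
  have tck: "taylor_coeff (hardy_kernel w) k = of_real s * cnj w ^ k" for k
    by (rule taylor_coeff_eqI) (rule sums)
  have hol: "hardy_kernel w holomorphic_on unit_disk"
    by (rule holomorphic_on_disk_sumsI) (rule sums)
  have bd: "(\<Sum>k\<le>K. (cmod (taylor_coeff (hardy_kernel w) k))\<^sup>2) \<le> 1\<^sup>2" for K
  proof -
    have "(\<Sum>k\<le>K. (cmod (taylor_coeff (hardy_kernel w) k))\<^sup>2) = s\<^sup>2 * (\<Sum>k<Suc K. ((cmod w)\<^sup>2) ^ k)"
      by (simp add: tck norm_mult norm_power power_mult_distrib sum_distrib_left lessThan_Suc_atMost
          power_mult[symmetric] mult.commute del: sum.lessThan_Suc)
    also have "\<dots> = 1 - ((cmod w)\<^sup>2) ^ Suc K"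
      unfolding s2 using w2 by (subst sum_gp_strict) (auto simp: divide_simps)
    also have "\<dots> \<le> 1\<^sup>2" by simp
    finally show ?thesis .
  qed
  show "hardy_kernel w \<in> hardy_space" "hardy_norm (hardy_kernel w) \<le> 1"
    using hardy_spaceI[OF hol _ bd] by (auto simp: hardy_kernel_def)
qed

text \<open>With \<open>f = hardy_kernel (w n)\<close>, the normalised Szego kernel at
  \<open>w n\<close>, this is the \<open>n\<close>-th Takenaka-Malmquist function of the points
  \<open>w\<close>, up to a unimodular constant.\<close>

fun blaschke_mult :: "(nat \<Rightarrow> complex) \<Rightarrow> nat \<Rightarrow> (complex \<Rightarrow> complex) \<Rightarrow> complex \<Rightarrow> complex" where
  "blaschke_mult w 0 f = f"
| "blaschke_mult w (Suc n) f = moebius_mult (w n) (blaschke_mult w n f)"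

lemma blaschke_mult_hardy:
  assumes "f \<in> hardy_space" "\<And>i. i < n \<Longrightarrow> cmod (w i) < 1"
  shows "blaschke_mult w n f \<in> hardy_space \<and> hardy_norm (blaschke_mult w n f) \<le> hardy_norm f"
  using assms(2)
proof (induction n)
  case (Suc n)
  then have IH: "blaschke_mult w n f \<in> hardy_space" "hardy_norm (blaschke_mult w n f) \<le> hardy_norm f"
    by auto
  then show ?case using moebius_mult_hardy[OF IH(1), of "w n"] Suc.prems[of n] by auto
qed (use assms(1) in simp)

lemma blaschke_mult_value:
  "z \<in> unit_disk \<Longrightarrow> blaschke_mult w n f z = (\<Prod>i<n. (z - w i) / (1 - cnj (w i) * z)) * f z"
  by (induction n) (auto simp: moebius_mult_def)

text \<open>For \<open>j > k\<close> the function \<open>e j\<close> vanishes at \<open>w k\<close>,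
  so subtracting combinations of later functions keeps the value \<open>c k = e k (w k)\<close>.
  After composition this is the constant value on the fibre \<open>Z k\<close>, and
  \<open>hardy_constant_on_finite\<close> bounds the norm from below. The factor
  \<open>1 / (1 - |w k|^2)\<close> and the pseudo-hyperbolic distances make up
  \<open>|c k|^2\<close>.\<close>

theorem hardy_fiber_product_bound:
  fixes w :: "nat \<Rightarrow> complex" and Z :: "nat \<Rightarrow> complex set" and n :: nat
  assumes T: "bounded_operator hardy_space hardy_norm (composition_operator \<phi>)"
    and w: "\<And>k. k < n \<Longrightarrow> cmod (w k) < 1"
    and Z: "\<And>k. k < n \<Longrightarrow> finite (Z k)" "\<And>k. k < n \<Longrightarrow> Z k \<subseteq> unit_disk"
      "\<And>k z. k < n \<Longrightarrow> z \<in> Z k \<Longrightarrow> \<phi> z = w k"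
  shows "(\<Prod>k<n. (1 - (\<Prod>z\<in>Z k. cmod z)\<^sup>2) / (1 - (cmod (w k))\<^sup>2) *
      (\<Prod>i<k. (cmod ((w k - w i) / (1 - cnj (w i) * w k)))\<^sup>2))
    \<le> (\<Prod>k<n. (approximation_number hardy_space hardy_norm (Suc k) (composition_operator \<phi>))\<^sup>2)"
proof -
  define e where "e k = blaschke_mult w k (hardy_kernel (w k))" for k
  define q where "q k = 1 - (\<Prod>z\<in>Z k. cmod z)\<^sup>2" for k
  define c where "c k = e k (w k)" for k
  define \<delta> where "\<delta> k = cmod (c k) * sqrt (q k)" for k
  define a where "a k = approximation_number hardy_space hardy_norm (Suc k) (composition_operator \<phi>)" for k
  have q0: "0 \<le> q k" if "k < n" for k
  proof -
    have "0 \<le> (\<Prod>z\<in>Z k. cmod z)" by (intro prod_nonneg) auto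
    moreover have "(\<Prod>z\<in>Z k. cmod z) \<le> 1" using Z(2)[OF that] by (intro prod_le_1) auto
    ultimately show ?thesis by (simp add: q_def power_le_one)
  qed
  have e: "e k \<in> hardy_space \<and> hardy_norm (e k) \<le> 1" if k: "k < n" for k
  proof -
    have "cmod (w i) < 1" if "i < k" for i using w that k by auto
    then show ?thesis
      using blaschke_mult_hardy[OF hardy_kernel(1)[OF w[OF k]], of k w] hardy_kernel(2)[OF w[OF k]]
      by (auto simp: e_def)
  qed
  have e_zero: "e j (w k) = 0" if "k < j" "k < n" for j k
    using w[OF that(2)] that(1) unfolding e_def by (subst blaschke_mult_value) auto
  have "(\<Prod>k<n. \<delta> k) \<le> (\<Prod>k<n. a k)"
    unfolding a_def
  proof (rule hardy.prod_distances_le_prod_approximation_numbers[where e = e and T = "composition_operator \<phi>"])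
    show "bounded_operator hardy_space hardy_norm (composition_operator \<phi>)" by (rule T)
    show "e i \<in> hardy_space" "hardy_norm (e i) \<le> 1" if "i < n" for i using e[OF that] by auto
    show "0 \<le> \<delta> k" if "k < n" for k using q0[OF that] by (simp add: \<delta>_def)
    fix k and d :: "nat \<Rightarrow> complex" assume k: "k < n"
    define f where "f = e k - (\<Sum>j\<in>{Suc k..<n}. cscale (d j) (e j))"
    define F where "F = composition_operator \<phi> f"
    have f: "f \<in> hardy_space"
      unfolding f_def using e k by (intro hardy.V_diff hardy.V_sum hardy.V_scale) auto
    have F: "F \<in> hardy_space" unfolding F_def by (rule hardy.bounded_operator_range[OF T f])
    have sum0: "finite J \<Longrightarrow> (\<forall>j\<in>J. k < j) \<Longrightarrow> (\<Sum>j\<in>J. cscale (d j) (e j)) (w k) = 0" for J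
    proof (induction J rule: finite_induct)
      case (insert j J)
      then show ?case using e_zero[of k j] k by (simp add: cscale_def)
    qed simp
    have "F z = c k" if z: "z \<in> Z k" for z
    proof -
      have "F z = f (w k)" using z Z(2,3)[OF k] by (auto simp: F_def composition_operator_def)
      also have "\<dots> = c k" using sum0[of "{Suc k..<n}"] by (simp add: f_def c_def)
      finally show ?thesis .
    qed
    from hardy_constant_on_finite[OF Z(1,2)[OF k] F this]
    have "(\<delta> k)\<^sup>2 \<le> (hardy_norm F)\<^sup>2"
      using q0[OF k] by (simp add: \<delta>_def power_mult_distrib q_def)
    then have "\<delta> k \<le> hardy_norm F" by (rule power2_le_imp_le) (rule hardy.nrm_nonneg[OF F])
    then show "\<delta> k \<le> hardy_norm (composition_operator \<phi> (e k - (\<Sum>j\<in>{Suc k..<n}. cscale (d j) (e j))))"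
      unfolding F_def f_def .
  qed
  moreover have "0 \<le> (\<Prod>k<n. \<delta> k)" using q0 by (intro prod_nonneg) (auto simp: \<delta>_def)
  ultimately have "(\<Prod>k<n. \<delta> k)\<^sup>2 \<le> (\<Prod>k<n. a k)\<^sup>2" by (rule power_mono)
  moreover have "(\<delta> k)\<^sup>2 = q k / (1 - (cmod (w k))\<^sup>2) *
      (\<Prod>i<k. (cmod ((w k - w i) / (1 - cnj (w i) * w k)))\<^sup>2)" if k: "k < n" for k
  proof -
    define r where "r = 1 - (cmod (w k))\<^sup>2"
    have r: "0 < r" using w[OF k] by (simp add: r_def power_less_one_iff abs_square_less_1)
    have "1 - cnj (w k) * w k = of_real r"
      unfolding r_def using complex_norm_square[of "w k"] by (simp add: mult.commute)
    then have "cmod (hardy_kernel (w k) (w k)) = sqrt r / r"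
      using w[OF k] r by (simp add: hardy_kernel_def norm_divide r_def[symmetric])
    then have hk: "(cmod (hardy_kernel (w k) (w k)))\<^sup>2 = 1 / r"
      using r by (simp add: power_divide power2_eq_square[of r])
    have "c k = (\<Prod>i<k. (w k - w i) / (1 - cnj (w i) * w k)) * hardy_kernel (w k) (w k)"
      unfolding c_def e_def using w[OF k] by (subst blaschke_mult_value) auto
    then have "(cmod (c k))\<^sup>2 = (\<Prod>i<k. (cmod ((w k - w i) / (1 - cnj (w i) * w k)))\<^sup>2) / r"
      by (simp add: norm_mult power_mult_distrib hk prod_norm[symmetric] prod_power_distrib)
    then show ?thesis using q0[OF k] by (simp add: \<delta>_def power_mult_distrib r_def)
  qed
  ultimately show ?thesis
    unfolding prod_power_distrib a_def q_def by simp
qed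

section \<open>Area integrals over fibres\<close>

text \<open>Changes of variables are carried out in \<open>real^2\<close>, where a derivative is a
  matrix with a determinant; the integrals are stated on the complex plane.\<close>

definition to_R2 :: "complex \<Rightarrow> real^2" where
  "to_R2 z = vector [Re z, Im z]"

definition of_R2 :: "real^2 \<Rightarrow> complex" where
  "of_R2 x = Complex (x $ 1) (x $ 2)"

lemma of_to_R2 [simp]: "of_R2 (to_R2 z) = z" and to_of_R2 [simp]: "to_R2 (of_R2 x) = x"
  by (simp_all add: to_R2_def of_R2_def Finite_Cartesian_Product.vec_eq_iff forall_2 complex_eq_iff)

lemma linear_to_R2: "bounded_linear to_R2"
  by (rule linear_conv_bounded_linear[THEN iffD1], rule linearI)
    (simp_all add: to_R2_def Finite_Cartesian_Product.vec_eq_iff forall_2)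

lemma linear_of_R2: "bounded_linear of_R2"
  by (rule linear_conv_bounded_linear[THEN iffD1], rule linearI)
    (simp_all add: of_R2_def complex_eq_iff)

lemma to_R2_image: "to_R2 ` A = of_R2 -` A"
  by (auto simp: image_iff) (metis to_of_R2)

lemma of_R2_measurable [measurable]: "of_R2 \<in> borel_measurable borel"
  and to_R2_measurable [measurable]: "to_R2 \<in> borel_measurable borel"
  using linear_of_R2 linear_to_R2
  by (auto intro!: borel_measurable_continuous_onI linear_continuous_on)

lemma lborel_distr_to_R2: "distr lborel borel to_R2 = lborel"
proof (rule lborel_eqI[symmetric])
  fix l u :: "real^2" assume lu: "\<And>b. b \<in> Basis \<Longrightarrow> l \<bullet> b \<le> u \<bullet> b"
  have B: "(Basis :: (real^2) set) = {axis 1 1, axis 2 1}"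
    by (auto simp: Basis_vec_def UNIV_2)
  have le: "l $ 1 \<le> u $ 1" "l $ 2 \<le> u $ 2"
    using lu[of "axis 1 1"] lu[of "axis 2 1"] by (simp_all add: B inner_axis)
  have "to_R2 -` box l u = box (of_R2 l) (of_R2 u)"
    by (auto simp: mem_box_cart forall_2 to_R2_def in_box_complex_iff of_R2_def)
  then have "emeasure (distr lborel borel to_R2) (box l u) = emeasure lborel (box (of_R2 l) (of_R2 u))"
    by (subst emeasure_distr) auto
  also have "\<dots> = (\<Prod>b\<in>Basis. (of_R2 u - of_R2 l) \<bullet> b)"
    by (rule emeasure_lborel_box) (use le in \<open>auto simp: Basis_complex_def of_R2_def inner_complex_def\<close>)
  also have "\<dots> = ennreal (\<Prod>b\<in>Basis. (u - l) \<bullet> b)"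
    by (simp add: Basis_complex_def B of_R2_def inner_axis axis_eq_axis inner_complex_def)
  finally show "emeasure (distr lborel borel to_R2) (box l u) = (\<Prod>b\<in>Basis. (u - l) \<bullet> b)" .
qed simp

lemma nn_integral_to_R2:
  assumes [measurable]: "f \<in> borel_measurable borel"
  shows "(\<integral>\<^sup>+x. f x \<partial>lborel) = (\<integral>\<^sup>+z. f (to_R2 z) \<partial>lborel)"
  by (subst lborel_distr_to_R2[symmetric], subst nn_integral_distr) auto

lemma det_matrix_complex_mult:
  "Determinants.det (matrix (\<lambda>h. to_R2 (d * of_R2 h))) = (cmod d)\<^sup>2"
  unfolding cmod_power2 by (simp add: det_2 matrix_def to_R2_def of_R2_def axis_def power2_eq_square)

text \<open>The Jacobian of a holomorphic map is the squared modulus of its derivative. The compact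
  set \<open>K\<close> bounds it on \<open>E\<close>, so that it is integrable and the change of
  variables applies.\<close>

lemma emeasure_holomorphic_inj_image:
  assumes \<phi>: "\<phi> holomorphic_on S" "open S" and K: "compact K" "K \<subseteq> S"
    and E: "E \<in> sets borel" "E \<subseteq> K" and inj: "inj_on \<phi> E"
  shows "to_R2 ` \<phi> ` E \<in> sets lebesgue"
    "emeasure lebesgue (to_R2 ` \<phi> ` E) = (\<integral>\<^sup>+z. ennreal ((cmod (deriv \<phi> z))\<^sup>2) * indicator E z \<partial>lborel)"
proof -
  define g where "g x = to_R2 (\<phi> (of_R2 x))" for x
  define g' where "g' = (\<lambda>x h. to_R2 (deriv \<phi> (of_R2 x) * of_R2 h))"
  define A where "A = to_R2 ` E"
  define J where "J x = (cmod (deriv \<phi> (of_R2 x)))\<^sup>2 * indicator A x" for x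
  have A: "A \<in> sets borel" unfolding A_def to_R2_image using E(1) measurable_sets_borel[OF of_R2_measurable] by simp
  have contd: "continuous_on S (deriv \<phi>)"
    by (intro holomorphic_on_imp_continuous_on holomorphic_deriv \<phi>)
  then have "compact (deriv \<phi> ` K)"
    by (intro compact_continuous_image K(1) continuous_on_subset[OF _ K(2)])
  then obtain M where M: "\<And>z. z \<in> K \<Longrightarrow> cmod (deriv \<phi> z) \<le> M"
    by (meson bounded_iff compact_imp_bounded image_eqI)
  have meas_d: "(\<lambda>z. indicator E z *\<^sub>R deriv \<phi> z) \<in> borel_measurable borel"
    using borel_measurable_continuous_on_indicator[OF E(1) continuous_on_subset[OF contd, of E]] E(2) K(2) by blast
  have J_eq: "J x = (cmod (indicator E (of_R2 x) *\<^sub>R deriv \<phi> (of_R2 x)))\<^sup>2" for x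
    by (auto simp: J_def A_def to_R2_image indicator_def)
  have J_meas: "J \<in> borel_measurable borel"
    unfolding J_eq using measurable_compose[OF of_R2_measurable meas_d] by measurable
  have "bounded A" unfolding A_def
    using bounded_linear_image[OF bounded_subset[OF compact_imp_bounded[OF K(1)] E(2)] linear_to_R2] .
  then have fin: "emeasure lborel A < \<infinity>"
    by (rule emeasure_bounded_finite)
  have Jint: "integrable lborel J"
  proof (rule Bochner_Integration.integrable_bound)
    show "integrable lborel (\<lambda>x. M\<^sup>2 * indicator A x)"
      using A fin by (intro integrable_mult_right) (simp add: integrable_indicator_iff)
    show "AE x in lborel. norm (J x) \<le> norm (M\<^sup>2 * indicator A x :: real)"
    proof (rule AE_I2)
      fix x
      show "norm (J x) \<le> norm (M\<^sup>2 * indicator A x :: real)"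
      proof (cases "x \<in> A")
        case True
        then have "of_R2 x \<in> K" using E(2) by (auto simp: A_def)
        then show ?thesis using True M by (auto simp: J_def intro!: power_mono)
      qed (simp add: J_def)
    qed
  qed (use J_meas in simp)
  define m where "m = integral\<^sup>L lborel J"
  have "(J has_integral m) UNIV"
    unfolding m_def by (rule has_integral_integral_lborel[OF Jint])
  then have "((\<lambda>x. (cmod (deriv \<phi> (of_R2 x)))\<^sup>2) has_integral m) A"
    unfolding J_def by (subst has_integral_restrict_UNIV[symmetric], rule has_integral_eq[rotated]) auto
  then have hi: "((\<lambda>x. \<bar>Determinants.det (matrix (g' x))\<bar>) has_integral m) A"
    by (simp add: g'_def det_matrix_complex_mult)
  have der: "(g has_derivative g' x) (at x within A)" if "x \<in> A" for x
  proof -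
    have "of_R2 x \<in> S" using that E(2) K(2) by (auto simp: A_def)
    then have "(\<phi> has_field_derivative deriv \<phi> (of_R2 x)) (at (of_R2 x))"
      using \<phi> holomorphic_derivI by blast
    then have d: "(\<phi> has_derivative (\<lambda>h. deriv \<phi> (of_R2 x) * h)) (at (of_R2 x))"
      by (simp add: has_field_derivative_def)
    have "(of_R2 has_derivative of_R2) (at x)" by (rule bounded_linear_imp_has_derivative[OF linear_of_R2])
    from has_derivative_compose[OF this d]
    have "((\<lambda>x. \<phi> (of_R2 x)) has_derivative (\<lambda>h. deriv \<phi> (of_R2 x) * of_R2 h)) (at x)" .
    from bounded_linear.has_derivative[OF linear_to_R2 this]
    show ?thesis unfolding g_def g'_def by (rule has_derivative_at_withinI)
  qed
  have inj': "inj_on g A"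
    using inj by (auto simp: g_def A_def inj_on_def) (metis of_to_R2)
  have "A \<in> sets lebesgue" using A by simp
  from has_measure_differentiable_image[OF this der inj'] hi
  have gm: "g ` A \<in> lmeasurable" "measure lebesgue (g ` A) = m" by blast+
  have gA: "g ` A = to_R2 ` \<phi> ` E" by (auto simp: g_def A_def image_iff)
  show "to_R2 ` \<phi> ` E \<in> sets lebesgue" using gm(1) by (simp add: gA fmeasurableD)
  have "emeasure lebesgue (to_R2 ` \<phi> ` E) = ennreal m"
    using gm by (simp add: gA emeasure_eq_measure2)
  also have "\<dots> = (\<integral>\<^sup>+x. ennreal (J x) \<partial>lborel)"
    unfolding m_def by (rule nn_integral_eq_integral[symmetric, OF Jint]) (simp add: J_def)
  also have "\<dots> = (\<integral>\<^sup>+z. ennreal (J (to_R2 z)) \<partial>lborel)"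
    using J_meas by (intro nn_integral_to_R2) measurable
  also have "\<dots> = (\<integral>\<^sup>+z. ennreal ((cmod (deriv \<phi> z))\<^sup>2) * indicator E z \<partial>lborel)"
    by (intro nn_integral_cong) (auto simp: J_def A_def to_R2_image indicator_def)
  finally show "emeasure lebesgue (to_R2 ` \<phi> ` E) = (\<integral>\<^sup>+z. ennreal ((cmod (deriv \<phi> z))\<^sup>2) * indicator E z \<partial>lborel)" .
qed

text \<open>The area formula with multiplicity. Countably many disjoint pieces cover the noncritical
  points, each with \<open>\<phi>\<close> injective and \<open>u\<close> nearly constant; at
  critical points the integrand is 0. The factor 2 pays for replacing \<open>u\<close> by a constant
  on each piece. Finite sets \<open>Z\<close> stand for fibres that may be infinite.\<close>

lemma nn_integral_deriv_fibers:
  fixes u :: "complex \<Rightarrow> real"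
  assumes \<phi>: "\<phi> holomorphic_on S" "open S" and R: "R \<in> sets borel"
    and u: "continuous_on S u" "\<And>z. z \<in> S \<Longrightarrow> 0 < u z"
    and fib: "\<And>w Z. w \<in> R \<Longrightarrow> finite Z \<Longrightarrow> Z \<subseteq> S \<Longrightarrow> (\<And>z. z \<in> Z \<Longrightarrow> \<phi> z = w) \<Longrightarrow> (\<Sum>z\<in>Z. u z) \<le> C"
    and C: "0 \<le> C"
  shows "(\<integral>\<^sup>+z. ennreal ((cmod (deriv \<phi> z))\<^sup>2 * u z) * indicator {z \<in> S. \<phi> z \<in> R} z \<partial>lborel) \<le>
    ennreal (2 * C) * emeasure lborel R"
proof -
  define N where "N = {z \<in> S. deriv \<phi> z \<noteq> 0}"
  have contd: "continuous_on S (deriv \<phi>)"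
    by (intro holomorphic_on_imp_continuous_on holomorphic_deriv \<phi>)
  have "\<exists>r c. 0 < r \<and> 0 < c \<and> cball z r \<subseteq> S \<and> inj_on \<phi> (cball z r) \<and> (\<forall>x\<in>cball z r. u x \<le> c \<and> c \<le> 2 * u x)"
    if z: "z \<in> N" for z
  proof -
    have zS: "z \<in> S" "deriv \<phi> z \<noteq> 0" using z by (auto simp: N_def)
    obtain r1 where r1: "0 < r1" "ball z r1 \<subseteq> S" "inj_on \<phi> (ball z r1)"
      by (rule has_complex_derivative_locally_injective[OF \<phi>(1) zS(1) \<phi>(2) zS(2)])
    obtain r2 where r2: "0 < r2" "ball z r2 \<subseteq> S" using \<phi>(2) zS(1) openE by blast
    \<comment> \<open>Near \<open>z\<close>, \<open>u\<close> stays between \<open>2/3 * u z\<close>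
      and \<open>4/3 * u z\<close>; the upper end is \<open>c\<close>, and it is twice the lower
      end.\<close>
    define c where "c = 4 / 3 * u z"
    have uz: "0 < u z" by (rule u(2)[OF zS(1)])
    have "isCont u z" using u(1) \<phi>(2) zS(1) continuous_on_eq_continuous_at by blast
    then obtain r3 where r3: "0 < r3" "\<And>x. dist x z < r3 \<Longrightarrow> dist (u x) (u z) < u z / 3"
    proof -
      have "0 < u z / 3" using uz by simp
      with \<open>isCont u z\<close> have "\<exists>d>0. \<forall>x. dist x z < d \<longrightarrow> dist (u x) (u z) < u z / 3"
        unfolding continuous_at_eps_delta by blast
      then show ?thesis using that by blast
    qed
    define r where "r = min (min r1 r2) r3 / 2"
    have r: "0 < r" "cball z r \<subseteq> ball z r1" "cball z r \<subseteq> ball z r2" "cball z r \<subseteq> ball z r3"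
      using r1 r2 r3 by (auto simp: r_def)
    have "u x \<le> c \<and> c \<le> 2 * u x" if "x \<in> cball z r" for x
    proof -
      have "x \<in> ball z r3" using that r(4) by blast
      then have "dist x z < r3" by (simp add: dist_commute)
      then have "\<bar>u x - u z\<bar> < u z / 3" using r3(2) by (simp add: dist_real_def)
      then show ?thesis unfolding c_def by linarith
    qed
    then show ?thesis using r r2(2) inj_on_subset[OF r1(3) r(2)] uz
      by (intro exI[of _ r] exI[of _ c]) (auto simp: c_def)
  qed
  then have "\<forall>z. \<exists>r c. z \<in> N \<longrightarrow> 0 < r \<and> 0 < c \<and> cball z r \<subseteq> S \<and> inj_on \<phi> (cball z r) \<and> (\<forall>x\<in>cball z r. u x \<le> c \<and> c \<le> 2 * u x)"
    by blast
  from choice[OF this] obtain r where "\<forall>z. \<exists>c. z \<in> N \<longrightarrow> 0 < r z \<and> 0 < c \<and> cball z (r z) \<subseteq> S \<and> inj_on \<phi> (cball z (r z)) \<and>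
      (\<forall>x\<in>cball z (r z). u x \<le> c \<and> c \<le> 2 * u x)" ..
  from choice[OF this] obtain c where rc: "\<forall>z. z \<in> N \<longrightarrow> 0 < r z \<and> 0 < c z \<and> cball z (r z) \<subseteq> S \<and> inj_on \<phi> (cball z (r z)) \<and>
      (\<forall>x\<in>cball z (r z). u x \<le> c z \<and> c z \<le> 2 * u x)" ..
  obtain \<F> where \<F>: "\<F> \<subseteq> (\<lambda>z. ball z (r z)) ` N" "countable \<F>" "\<Union>\<F> = \<Union>((\<lambda>z. ball z (r z)) ` N)"
    using Lindelof[of "(\<lambda>z. ball z (r z)) ` N"] by auto
  obtain N' where N': "countable N'" "N' \<subseteq> N" "\<F> = (\<lambda>z. ball z (r z)) ` N'"
    using countable_subset_image[THEN iffD1, OF conjI, OF \<F>(2,1)] by auto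
  show ?thesis
  proof (cases "N = {}")
    case True
    have "(\<integral>\<^sup>+z. ennreal ((cmod (deriv \<phi> z))\<^sup>2 * u z) * indicator {z \<in> S. \<phi> z \<in> R} z \<partial>lborel) = (\<integral>\<^sup>+z. 0 \<partial>(lborel :: complex measure))"
      using True by (intro nn_integral_cong) (auto simp: N_def indicator_def)
    then show ?thesis by simp
  next
    case False
    then obtain z0 where z0: "z0 \<in> N" by blast
    have "z0 \<in> ball z0 (r z0)" using rc[rule_format, OF z0] by simp
    then have "z0 \<in> \<Union>\<F>" unfolding \<F>(3) using z0 by blast
    then have "N' \<noteq> {}" using N'(3) by blast
    define p where "p = from_nat_into N'"
    have p: "range p = N'" unfolding p_def by (rule range_from_nat_into[OF \<open>N' \<noteq> {}\<close> N'(1)])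
    have pN: "p i \<in> N" for i using p N'(2) by blast
    define E where "E i = disjointed (\<lambda>i. ball (p i) (r (p i))) i \<inter> {z \<in> S. \<phi> z \<in> R}" for i
    have E_sub: "E i \<subseteq> ball (p i) (r (p i))" for i unfolding E_def by (rule le_infI1[OF disjointed_subset])
    have pre: "{z \<in> S. \<phi> z \<in> R} \<in> sets borel"
    proof -
      have "\<phi> \<in> borel_measurable (restrict_space borel S)"
        by (rule borel_measurable_continuous_on_restrict[OF holomorphic_on_imp_continuous_on[OF \<phi>(1)]])
      then have "\<phi> -` R \<inter> space (restrict_space borel S) \<in> sets (restrict_space borel S)"
        using R by (rule measurable_sets)
      then show ?thesis
        using \<phi>(2) by (simp add: sets_restrict_space_iff space_restrict_space vimage_def Int_def conj_commute)
    qed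
    have "disjointed (\<lambda>i. ball (p i) (r (p i))) i \<in> sets borel" for i
    proof -
      have "range (\<lambda>i. ball (p i) (r (p i))) \<subseteq> sets borel" by auto
      from sets.range_disjointed_sets[OF this] show ?thesis by (rule subsetD) (rule rangeI)
    qed
    then have E_meas: "E i \<in> sets borel" for i unfolding E_def using pre by (rule sets.Int)
    have disj: "disjoint_family E"
      using disjoint_family_disjointed[of "\<lambda>i. ball (p i) (r (p i))"]
      by (auto simp: disjoint_family_on_def E_def)
    have U: "\<Union>(range E) = {z \<in> N. \<phi> z \<in> R}"
    proof -
      have "(\<Union>i. ball (p i) (r (p i))) = \<Union>((\<lambda>z. ball z (r z)) ` N)"
        using \<F>(3) unfolding N'(3) p[symmetric] by (simp add: image_image)
      moreover have "N \<subseteq> \<Union>((\<lambda>z. ball z (r z)) ` N)"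
      proof
        fix z assume z: "z \<in> N"
        then have "z \<in> ball z (r z)" using rc[rule_format, OF z] by simp
        then show "z \<in> \<Union>((\<lambda>z. ball z (r z)) ` N)" using z by blast
      qed
      ultimately have cov: "N \<subseteq> (\<Union>i. disjointed (\<lambda>i. ball (p i) (r (p i))) i)"
        by (simp add: UN_disjointed_eq)
      have "z \<in> N" if "z \<in> E i" for i z
      proof -
        have zb: "z \<in> ball (p i) (r (p i))" using that E_sub by blast
        have ci: "inj_on \<phi> (cball (p i) (r (p i)))" "cball (p i) (r (p i)) \<subseteq> S"
          using rc[rule_format, OF pN] by auto
        have bi: "inj_on \<phi> (ball (p i) (r (p i)))" "ball (p i) (r (p i)) \<subseteq> S"
          by (rule inj_on_subset[OF ci(1) ball_subset_cball], rule order.trans[OF ball_subset_cball ci(2)])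
        have "deriv \<phi> z \<noteq> 0"
          by (rule holomorphic_injective_imp_regular[OF holomorphic_on_subset[OF \<phi>(1) bi(2)] open_ball bi(1) zb])
        then show ?thesis using that by (auto simp: N_def E_def)
      qed
      then show ?thesis using cov by (auto simp: E_def N_def)
    qed
    define f where "f z = ennreal ((cmod (deriv \<phi> z))\<^sup>2 * u z)" for z
    define I where "I i = to_R2 ` \<phi> ` E i" for i
    have EK: "E i \<subseteq> cball (p i) (r (p i))" for i using E_sub ball_subset_cball by blast
    have inj: "inj_on \<phi> (E i)" for i using rc[rule_format, OF pN] by (intro inj_on_subset[OF _ EK]) simp
    have KS: "cball (p i) (r (p i)) \<subseteq> S" for i using rc[rule_format, OF pN] by simp
    note im = emeasure_holomorphic_inj_image[OF \<phi> compact_cball KS E_meas EK inj]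
    have Imeas: "I i \<in> sets lebesgue" for i unfolding I_def by (rule im(1))
    have gmeas: "(\<lambda>z. ennreal ((cmod (deriv \<phi> z))\<^sup>2) * indicator (E i) z) \<in> borel_measurable borel" for i
    proof -
      have "(\<lambda>z. indicator (E i) z *\<^sub>R deriv \<phi> z) \<in> borel_measurable borel"
        by (rule borel_measurable_continuous_on_indicator[OF E_meas continuous_on_subset[OF contd order.trans[OF EK KS]]])
      then have m: "(\<lambda>z. ennreal ((cmod (indicator (E i) z *\<^sub>R deriv \<phi> z))\<^sup>2)) \<in> borel_measurable borel" by measurable
      have eq: "(\<lambda>z. ennreal ((cmod (indicator (E i) z *\<^sub>R deriv \<phi> z))\<^sup>2)) = (\<lambda>z. ennreal ((cmod (deriv \<phi> z))\<^sup>2) * indicator (E i) z)"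
        by (auto simp: fun_eq_iff indicator_def)
      show ?thesis using m unfolding eq .
    qed
    have "(\<integral>\<^sup>+z. f z * indicator {z \<in> S. \<phi> z \<in> R} z \<partial>lborel) \<le>
        (\<integral>\<^sup>+z. (\<Sum>i. ennreal (c (p i)) * (ennreal ((cmod (deriv \<phi> z))\<^sup>2) * indicator (E i) z)) \<partial>lborel)"
    proof (rule nn_integral_mono)
      fix z
      show "f z * indicator {z \<in> S. \<phi> z \<in> R} z \<le> (\<Sum>i. ennreal (c (p i)) * (ennreal ((cmod (deriv \<phi> z))\<^sup>2) * indicator (E i) z))"
      proof (cases "z \<in> {z \<in> N. \<phi> z \<in> R}")
        case True
        then obtain i where i: "z \<in> E i" using U by blast
        have "u z \<le> c (p i)" using rc pN[of i] i EK by blast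
        then have "f z * indicator {z \<in> S. \<phi> z \<in> R} z \<le> ennreal (c (p i) * (cmod (deriv \<phi> z))\<^sup>2)"
          using True by (auto simp: f_def N_def mult.commute intro!: ennreal_leI mult_right_mono)
        also have "\<dots> = (\<Sum>j\<in>{i}. ennreal (c (p j)) * (ennreal ((cmod (deriv \<phi> z))\<^sup>2) * indicator (E j) z))"
          using i rc pN[of i] by (simp add: ennreal_mult less_imp_le)
        also have "\<dots> \<le> (\<Sum>j. ennreal (c (p j)) * (ennreal ((cmod (deriv \<phi> z))\<^sup>2) * indicator (E j) z))"
          by (rule sum_le_suminf) auto
        finally show ?thesis .
      next
        case False
        then have eq: "f z * indicator {z \<in> S. \<phi> z \<in> R} z = 0" by (auto simp: f_def N_def indicator_def)
        show ?thesis unfolding eq by (rule zero_le)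
      qed
    qed
    also have "\<dots> = (\<Sum>i. ennreal (c (p i)) * emeasure lebesgue (I i))"
      unfolding I_def im(2) using gmeas
      by (subst nn_integral_suminf) (auto intro!: suminf_cong nn_integral_cmult)
    also have "\<dots> = (\<Sum>i. \<integral>\<^sup>+x. ennreal (c (p i)) * indicator (I i) x \<partial>lebesgue)"
      using Imeas by (simp add: nn_integral_cmult_indicator)
    also have "\<dots> = (\<integral>\<^sup>+x. (\<Sum>i. ennreal (c (p i)) * indicator (I i) x) \<partial>lebesgue)"
      using Imeas by (intro nn_integral_suminf[symmetric]) auto
    also have "\<dots> \<le> (\<integral>\<^sup>+x. ennreal (2 * C) * indicator (to_R2 ` R) x \<partial>lebesgue)"
    proof (rule nn_integral_mono)
      fix x
      define w where "w = of_R2 x"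
      \<comment> \<open>The pieces whose image contains \<open>w\<close>. Being disjoint they supply
        distinct preimages of \<open>w\<close>, so \<open>fib\<close> bounds every partial
        sum.\<close>
      define A where "A = {i. w \<in> \<phi> ` E i}"
      have ind: "indicator (I i) x = (indicator A i :: ennreal)" for i
        by (auto simp: I_def A_def w_def to_R2_image indicator_def)
      have "(\<Sum>i<n. ennreal (c (p i)) * indicator A i) \<le> ennreal (2 * C) * indicator (to_R2 ` R) x" for n
      proof (cases "w \<in> R")
        case True
        have "\<forall>i. \<exists>z. i \<in> A \<longrightarrow> z \<in> E i \<and> \<phi> z = w" by (auto simp: A_def)
        from choice[OF this] obtain z where z: "\<forall>i. i \<in> A \<longrightarrow> z i \<in> E i \<and> \<phi> (z i) = w" ..
        have injz: "inj_on z (A \<inter> {..<n})"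
        proof (rule inj_onI, rule ccontr)
          fix i j assume ij: "i \<in> A \<inter> {..<n}" "j \<in> A \<inter> {..<n}" "z i = z j" "i \<noteq> j"
          then have "z i \<in> E i \<inter> E j" using z by fastforce
          then show False using disj ij(4) unfolding disjoint_family_on_def by blast
        qed
        have "(\<Sum>x\<in>z ` (A \<inter> {..<n}). u x) \<le> C"
        proof (rule fib[OF True])
          show "finite (z ` (A \<inter> {..<n}))" by simp
          show "z ` (A \<inter> {..<n}) \<subseteq> S" using z by (auto simp: E_def)
          fix x assume "x \<in> z ` (A \<inter> {..<n})"
          then show "\<phi> x = w" using z by blast
        qed
        then have *: "(\<Sum>i\<in>A \<inter> {..<n}. u (z i)) \<le> C" by (simp add: sum.reindex[OF injz])
        have cu: "c (p i) \<le> 2 * u (z i)" "0 \<le> c (p i)" if "i \<in> A" for i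
        proof -
          have "z i \<in> cball (p i) (r (p i))" using z that EK by blast
          then show "c (p i) \<le> 2 * u (z i)" "0 \<le> c (p i)" using rc[rule_format, OF pN[of i]] by auto
        qed
        have "(\<Sum>i<n. ennreal (c (p i)) * indicator A i) = (\<Sum>i<n. if i \<in> A then ennreal (c (p i)) else 0)"
          by (intro sum.cong) auto
        also have "\<dots> = (\<Sum>i\<in>A \<inter> {..<n}. ennreal (c (p i)))"
          unfolding Int_commute[of A] by (rule sum.inter_restrict[symmetric]) simp
        also have "(\<Sum>i\<in>A \<inter> {..<n}. ennreal (c (p i))) = ennreal (\<Sum>i\<in>A \<inter> {..<n}. c (p i))" using cu by (intro sum_ennreal) auto
        also have "\<dots> \<le> ennreal (\<Sum>i\<in>A \<inter> {..<n}. 2 * u (z i))"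
          using cu by (intro ennreal_leI sum_mono) auto
        also have "\<dots> \<le> ennreal (2 * C)"
          using * by (intro ennreal_leI) (simp add: sum_distrib_left[symmetric])
        finally show ?thesis using True by (simp add: to_R2_image w_def)
      next
        case False
        then have "A = {}" by (auto simp: A_def E_def)
        then show ?thesis by simp
      qed
      then have "(\<Sum>i. ennreal (c (p i)) * indicator A i) \<le> ennreal (2 * C) * indicator (to_R2 ` R) x"
        by (intro suminf_le_const) auto
      then show "(\<Sum>i. ennreal (c (p i)) * indicator (I i) x) \<le> ennreal (2 * C) * indicator (to_R2 ` R) x"
        by (simp add: ind)
    qed
    also have "\<dots> = ennreal (2 * C) * emeasure lborel R"
    proof -
      have RR: "to_R2 ` R \<in> sets borel" unfolding to_R2_image using R measurable_sets_borel[OF of_R2_measurable] by simp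
      have "emeasure lebesgue (to_R2 ` R) = emeasure (distr lborel borel to_R2) (to_R2 ` R)"
        using RR by (simp add: lborel_distr_to_R2)
      also have "\<dots> = emeasure lborel R"
        using RR by (subst emeasure_distr) (auto simp: to_R2_image intro!: arg_cong[where f = "emeasure lborel"])
      finally show ?thesis using RR by (simp add: nn_integral_cmult_indicator)
    qed
    finally show ?thesis by (simp add: f_def)
  qed
qed

section \<open>The Bergman space\<close>

lemma emeasure_to_R2_image:
  assumes "A \<in> sets borel"
  shows "emeasure lebesgue (to_R2 ` A) = emeasure lborel A"
proof -
  have m: "to_R2 ` A \<in> sets borel"
    unfolding to_R2_image using assms measurable_sets_borel[OF of_R2_measurable] by simp
  have "emeasure lebesgue (to_R2 ` A) = emeasure (distr lborel borel to_R2) (to_R2 ` A)"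
    using m by (simp add: lborel_distr_to_R2)
  also have "\<dots> = emeasure lborel A"
    using m by (subst emeasure_distr) (auto simp: to_R2_image intro!: arg_cong[where f = "emeasure lborel"])
  finally show ?thesis .
qed

section \<open>Rotations, radial integrals and Parseval's identity\<close>

lemma lborel_distr_rotation:
  assumes \<zeta>: "cmod \<zeta> = 1"
  shows "distr lborel borel (\<lambda>z. \<zeta> * z) = (lborel :: complex measure)"
proof (rule lborel_eqI[symmetric])
  fix l u :: complex assume lu: "\<And>b. b \<in> Basis \<Longrightarrow> l \<bullet> b \<le> u \<bullet> b"
  have z0: "\<zeta> \<noteq> 0" using \<zeta> by auto
  have mult [measurable]: "(\<lambda>z. \<zeta> * z) \<in> borel_measurable borel" by measurable
  define E where "E = (\<lambda>z. \<zeta> * z) -` box l u"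
  have E: "E \<in> sets borel" unfolding E_def using measurable_sets_borel[OF mult] by simp
  obtain B where B: "\<And>z. z \<in> box l u \<Longrightarrow> cmod z \<le> B"
    using bounded_box[of l u] unfolding bounded_iff by auto
  have EB: "E \<subseteq> cball 0 B" using B \<zeta> by (auto simp: E_def norm_mult dest!: B)
  have im: "(\<lambda>z. \<zeta> * z) ` E = box l u"
  proof
    show "box l u \<subseteq> (\<lambda>z. \<zeta> * z) ` E"
    proof
      fix w assume "w \<in> box l u"
      then show "w \<in> (\<lambda>z. \<zeta> * z) ` E" using z0 by (intro image_eqI[of _ _ "w / \<zeta>"]) (auto simp: E_def)
    qed
  qed (auto simp: E_def)
  have inj: "inj_on (\<lambda>z. \<zeta> * z) E" using z0 by (auto simp: inj_on_def)
  have hol: "(\<lambda>z. \<zeta> * z) holomorphic_on UNIV" by (intro holomorphic_intros)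
  have der: "deriv (\<lambda>z. \<zeta> * z) z = \<zeta>" for z
    by (rule DERIV_imp_deriv) (auto intro!: derivative_eq_intros)
  have "emeasure (distr lborel borel (\<lambda>z. \<zeta> * z)) (box l u) = emeasure lborel E"
    by (subst emeasure_distr) (auto simp: E_def)
  also have "\<dots> = (\<integral>\<^sup>+z. ennreal ((cmod (deriv (\<lambda>z. \<zeta> * z) z))\<^sup>2) * indicator E z \<partial>lborel)"
    using E by (simp add: der \<zeta>)
  also have "\<dots> = emeasure lebesgue (to_R2 ` (\<lambda>z. \<zeta> * z) ` E)"
    by (rule emeasure_holomorphic_inj_image(2)[OF hol open_UNIV compact_cball subset_UNIV E EB inj, symmetric])
  also have "\<dots> = emeasure lborel (box l u)" unfolding im by (rule emeasure_to_R2_image) simp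
  also have "\<dots> = (\<Prod>b\<in>Basis. (u - l) \<bullet> b)" by (rule emeasure_lborel_box[OF lu])
  finally show "emeasure (distr lborel borel (\<lambda>z. \<zeta> * z)) (box l u) = (\<Prod>b\<in>Basis. (u - l) \<bullet> b)" .
qed simp

lemma integral_rotation:
  fixes F :: "complex \<Rightarrow> complex"
  assumes "cmod \<zeta> = 1" "F \<in> borel_measurable borel"
  shows "(\<integral>z. F (\<zeta> * z) \<partial>lborel) = (\<integral>z. F z \<partial>lborel)"
  using assms(2) by (subst (2) lborel_distr_rotation[OF assms(1), symmetric]) (simp add: integral_distr)

text \<open>A substitute for polar coordinates: the image of area on the disk under
  \<open>|z|^2\<close> is \<open>pi\<close> times Lebesgue measure on \<open>[0, 1]\<close>. It
  suffices to compare half-lines, whose preimages are differences of discs of known area.\<close>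

lemma nn_integral_radial:
  fixes h :: "real \<Rightarrow> ennreal"
  assumes h: "h \<in> borel_measurable borel"
  shows "(\<integral>\<^sup>+z. h ((cmod z)\<^sup>2) * indicator unit_disk z \<partial>lborel) =
    ennreal pi * (\<integral>\<^sup>+x. h x * indicator {0..1} x \<partial>lborel)"
proof -
  define M where "M = distr (density lborel (indicator unit_disk)) borel (\<lambda>z::complex. (cmod z)\<^sup>2)"
  define N where "N = density lborel (\<lambda>x. ennreal pi * indicator {0..1::real} x)"
  have sq [measurable]: "(\<lambda>z::complex. (cmod z)\<^sup>2) \<in> borel_measurable borel" by measurable
  have ball: "emeasure lborel (ball (0::complex) r) = ennreal (pi * r\<^sup>2)" if "0 \<le> r" for r
    using emeasure_ball[OF that, of "0::complex"] by (simp add: unit_ball_vol_2)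
  have cb: "emeasure lborel (cball (0::complex) r) = ennreal (pi * r\<^sup>2)" if "0 \<le> r" for r
    using emeasure_cball[OF that, of "0::complex"] by (simp add: unit_ball_vol_2)
  have EM: "emeasure M {x<..} = emeasure lborel {z \<in> unit_disk. x < (cmod z)\<^sup>2}" for x
  proof -
    have "emeasure M {x<..} = emeasure (density lborel (indicator unit_disk)) {z::complex. x < (cmod z)\<^sup>2}"
      unfolding M_def by (subst emeasure_distr) (auto simp: vimage_def)
    also have "\<dots> = (\<integral>\<^sup>+z. indicator unit_disk z * indicator {z::complex. x < (cmod z)\<^sup>2} z \<partial>lborel)"
      by (rule emeasure_density) (auto intro: borel_measurable_indicator)
    also have "\<dots> = (\<integral>\<^sup>+z. indicator {z \<in> unit_disk. x < (cmod z)\<^sup>2} z \<partial>lborel)"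
      by (rule nn_integral_cong) (auto simp: indicator_def)
    also have "\<dots> = emeasure lborel {z \<in> unit_disk. x < (cmod z)\<^sup>2}" by (rule nn_integral_indicator) simp
    finally show ?thesis .
  qed
  have EN: "emeasure N {x<..} = ennreal pi * emeasure lborel ({x<..} \<inter> {0..1})" for x
  proof -
    have "emeasure N {x<..} = (\<integral>\<^sup>+y. ennreal pi * indicator ({x<..} \<inter> {0..1}) y \<partial>lborel)"
      unfolding N_def by (subst emeasure_density) (auto intro!: nn_integral_cong simp: indicator_def)
    then show ?thesis by (simp add: nn_integral_cmult_indicator)
  qed
  have le1: "(cmod z)\<^sup>2 \<le> 1" if "cmod z < 1" for z :: complex using that by (simp add: power_le_one)
  have eq: "emeasure M {x<..} = emeasure N {x<..}" for x
  proof -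
    consider "x < 0" | "0 \<le> x" "x \<le> 1" | "1 < x" by linarith
    then show ?thesis
    proof cases
      case 1
      then have "{z \<in> unit_disk. x < (cmod z)\<^sup>2} = ball (0::complex) 1"
        by (auto intro: order.strict_trans2[OF _ zero_le_power2])
      moreover have "{x<..} \<inter> {0..1} = {0..1::real}" using 1 by auto
      ultimately show ?thesis unfolding EM EN by (simp add: ball)
    next
      case 2
      have eqs: "{z \<in> unit_disk. x < (cmod z)\<^sup>2} = ball (0::complex) 1 - cball 0 (sqrt x)"
      proof -
        have "x < (cmod z)\<^sup>2 \<longleftrightarrow> \<not> cmod z \<le> sqrt x" for z :: complex
          using real_sqrt_less_iff[of x "(cmod z)\<^sup>2"] by (simp add: not_le)
        then show ?thesis unfolding set_eq_iff Diff_iff mem_Collect_eq mem_cball_0 by blast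
      qed
      show ?thesis
      proof (cases "x = 1")
        case True
        have e1: "{z \<in> unit_disk. x < (cmod z)\<^sup>2} = ({} :: complex set)"
          using le1 True by fastforce
        have e2: "{x<..} \<inter> {0..1} = ({} :: real set)" using True by auto
        show ?thesis unfolding EM EN e1 e2 by simp
      next
        case False
        then have x1: "x < 1" using 2 by simp
        have "emeasure lborel (ball (0::complex) 1 - cball 0 (sqrt x)) = ennreal (pi * 1\<^sup>2) - ennreal (pi * (sqrt x)\<^sup>2)"
        proof -
          have sx: "sqrt x < 1" using x1 by simp
          have "cball (0::complex) (sqrt x) \<subseteq> ball 0 1"
            using order.strict_trans1[OF _ sx] by auto
          then show ?thesis using 2 by (subst emeasure_Diff) (auto simp: ball cb)
        qed
        also have "\<dots> = ennreal (pi * (1 - x))"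
          using 2 by (subst ennreal_minus) (auto simp: algebra_simps)
        also have "\<dots> = ennreal pi * emeasure lborel ({x<..1})"
          using x1 by (simp add: ennreal_mult)
        also have "{x<..1} = {x<..} \<inter> {0..1}" using 2 by auto
        finally show ?thesis unfolding EM EN eqs .
      qed
    next
      case 3
      have e1: "{z \<in> unit_disk. x < (cmod z)\<^sup>2} = ({} :: complex set)" using le1 3 by fastforce
      have e2: "{x<..} \<inter> {0..1} = ({} :: real set)" using 3 by auto
      show ?thesis unfolding EM EN e1 e2 by simp
    qed
  qed
  have "M = N"
  proof (rule measure_eqI_lessThan)
    show "emeasure M {x<..} < \<infinity>" for x
    proof -
      have "emeasure lborel {z \<in> unit_disk. x < (cmod z)\<^sup>2} \<le> emeasure lborel (ball (0::complex) 1)"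
        by (rule emeasure_mono) auto
      then show ?thesis unfolding EM using ball[of 1] by (simp add: order.strict_trans1)
    qed
  qed (use eq in \<open>auto simp: M_def N_def\<close>)
  have "(\<integral>\<^sup>+z. h ((cmod z)\<^sup>2) * indicator unit_disk z \<partial>lborel) = (\<integral>\<^sup>+x. h x \<partial>M)"
    unfolding M_def using h
    by (subst nn_integral_distr)
      (auto simp: nn_integral_density borel_measurable_indicator mult.commute intro!: measurable_compose[OF sq h])
  also have "\<dots> = (\<integral>\<^sup>+x. h x \<partial>N)" by (simp add: \<open>M = N\<close>)
  also have "\<dots> = (\<integral>\<^sup>+x. ennreal pi * (h x * indicator {0..1} x) \<partial>lborel)"
    unfolding N_def using h by (subst nn_integral_density) (auto intro!: nn_integral_cong simp: mult_ac)
  also have "\<dots> = ennreal pi * (\<integral>\<^sup>+x. h x * indicator {0..1} x \<partial>lborel)"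
    using h by (intro nn_integral_cmult) auto
  finally show ?thesis .
qed

text \<open>Rotation by the angle \<open>pi / (j - k)\<close> changes the sign of the integrand but
  preserves the integral.\<close>

lemma integral_monomials_orthogonal:
  fixes W :: "complex \<Rightarrow> real"
  assumes W: "W \<in> borel_measurable borel" and rot: "\<And>\<zeta> z. cmod \<zeta> = 1 \<Longrightarrow> W (\<zeta> * z) = W z"
    and jk: "j \<noteq> k"
  shows "(\<integral>z. z ^ j * cnj z ^ k * of_real (W z) \<partial>lborel) = 0"
proof -
  define I where "I = (\<integral>z. z ^ j * cnj z ^ k * of_real (W z) \<partial>lborel)"
  define \<zeta> where "\<zeta> = cis (pi / (real j - real k))"
  have \<zeta>: "cmod \<zeta> = 1" by (simp add: \<zeta>_def)
  have m: "(\<lambda>z. z ^ j * cnj z ^ k * of_real (W z)) \<in> borel_measurable borel"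
    using W by (intro borel_measurable_times borel_measurable_power)
      (auto intro!: borel_measurable_continuous_onI continuous_intros borel_measurable_of_real)
  have "\<zeta> ^ j * cnj \<zeta> ^ k = cis (real j * (pi / (real j - real k)) - real k * (pi / (real j - real k)))"
    by (simp add: \<zeta>_def cis_cnj Complex.DeMoivre cis_mult)
  also have "real j * (pi / (real j - real k)) - real k * (pi / (real j - real k)) = pi"
    unfolding left_diff_distrib[symmetric] using jk by simp
  finally have z: "\<zeta> ^ j * cnj \<zeta> ^ k = -1" by simp
  have "I = (\<integral>z. (\<zeta> * z) ^ j * cnj (\<zeta> * z) ^ k * of_real (W (\<zeta> * z)) \<partial>lborel)"
    unfolding I_def by (rule integral_rotation[OF \<zeta> m, symmetric])
  also have "\<dots> = (\<integral>z. (\<zeta> ^ j * cnj \<zeta> ^ k) * (z ^ j * cnj z ^ k * of_real (W z)) \<partial>lborel)"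
    by (intro Bochner_Integration.integral_cong refl) (simp only: rot[OF \<zeta>], simp add: power_mult_distrib mult_ac)
  also have "\<dots> = - I" unfolding z I_def by simp
  finally show ?thesis by (simp add: I_def)
qed

lemma integral_polynomial_radial:
  fixes W :: "complex \<Rightarrow> real"
  assumes W: "W \<in> borel_measurable borel" and rot: "\<And>\<zeta> z. cmod \<zeta> = 1 \<Longrightarrow> W (\<zeta> * z) = W z"
    and bound: "\<And>z. 0 \<le> W z" "\<And>z. W z \<le> 1" and supp: "\<And>z. 1 \<le> cmod z \<Longrightarrow> W z = 0"
  shows "integrable lborel (\<lambda>z. (cmod (\<Sum>k<n. c k * z ^ k))\<^sup>2 * W z)"
    "(\<integral>z. (cmod (\<Sum>k<n. c k * z ^ k))\<^sup>2 * W z \<partial>lborel) =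
      (\<Sum>k<n. (cmod (c k))\<^sup>2 * (\<integral>z. (cmod z) ^ (2 * k) * W z \<partial>lborel))"
proof -
  have fin: "emeasure lborel (ball (0::complex) 1) < \<infinity>" by (rule emeasure_bounded_finite) simp
  have cm: "(\<lambda>z. z ^ j * cnj z ^ k) \<in> borel_measurable (borel :: complex measure)" for j k
    by (auto intro!: borel_measurable_continuous_onI continuous_intros)
  have m: "(\<lambda>z. z ^ j * cnj z ^ k * of_real (W z)) \<in> borel_measurable borel" for j k
  proof -
    have "(\<lambda>z. complex_of_real (W z)) \<in> borel_measurable borel" using W by measurable
    with cm show ?thesis by (rule borel_measurable_times)
  qed
  have int: "integrable lborel (\<lambda>z. z ^ j * cnj z ^ k * of_real (W z))" for j k
  proof (rule Bochner_Integration.integrable_bound)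
    show "integrable lborel (indicator (ball (0::complex) 1) :: complex \<Rightarrow> real)"
      using fin by (simp add: integrable_indicator_iff)
    show "AE z in lborel. norm (z ^ j * cnj z ^ k * of_real (W z)) \<le> norm (indicator (ball (0::complex) 1) z :: real)"
    proof (rule AE_I2)
      fix z :: complex
      show "norm (z ^ j * cnj z ^ k * of_real (W z)) \<le> norm (indicator (ball (0::complex) 1) z :: real)"
      proof (cases "cmod z < 1")
        case True
        have "cmod z ^ j * cmod z ^ k * W z \<le> 1 * 1 * 1"
          using True bound by (intro mult_mono power_le_one mult_nonneg_nonneg) auto
        then show ?thesis using True bound(1)[of z] by (simp add: norm_mult norm_power)
      qed (use supp in auto)
    qed
  qed (use m in simp)
  define F where "F z = (cmod (\<Sum>k<n. c k * z ^ k))\<^sup>2 * W z" for z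
  have F: "complex_of_real (F z) = (\<Sum>j<n. \<Sum>k<n. c j * cnj (c k) * (z ^ j * cnj z ^ k * of_real (W z)))" for z
  proof -
    have "complex_of_real (F z) = (\<Sum>k<n. c k * z ^ k) * cnj (\<Sum>k<n. c k * z ^ k) * of_real (W z)"
      unfolding F_def of_real_mult complex_norm_square ..
    also have "\<dots> = (\<Sum>j<n. \<Sum>k<n. (c j * z ^ j) * cnj (c k * z ^ k) * of_real (W z))"
      by (simp only: cnj_sum sum_product) (simp only: sum_distrib_right)
    also have "\<dots> = (\<Sum>j<n. \<Sum>k<n. c j * cnj (c k) * (z ^ j * cnj z ^ k * of_real (W z)))"
      by (intro sum.cong refl) simp
    finally show ?thesis .
  qed
  have "integrable lborel (\<lambda>z. complex_of_real (F z))"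
    unfolding F by (intro Bochner_Integration.integrable_sum integrable_mult_right int)
  then show "integrable lborel (\<lambda>z. (cmod (\<Sum>k<n. c k * z ^ k))\<^sup>2 * W z)"
    unfolding F_def[symmetric] by (rule integrable_Re[of lborel "\<lambda>z. complex_of_real (F z)", simplified])
  have diag: "z ^ k * cnj z ^ k * of_real (W z) = complex_of_real ((cmod z) ^ (2 * k) * W z)" for z k
    by (simp add: power_mult_distrib[symmetric] complex_norm_square[symmetric] power_mult)
  have diagI: "(\<integral>z. z ^ k * cnj z ^ k * of_real (W z) \<partial>lborel) = complex_of_real (\<integral>z. (cmod z) ^ (2 * k) * W z \<partial>lborel)" for k
    unfolding diag by (rule integral_complex_of_real)
  have "complex_of_real (\<integral>z. F z \<partial>lborel) = (\<integral>z. complex_of_real (F z) \<partial>lborel)"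
    by (rule integral_complex_of_real[symmetric])
  also have "\<dots> = (\<Sum>j<n. \<Sum>k<n. c j * cnj (c k) * (\<integral>z. z ^ j * cnj z ^ k * of_real (W z) \<partial>lborel))"
    unfolding F using int by (simp add: Bochner_Integration.integral_sum)
  also have "\<dots> = (\<Sum>j<n. \<Sum>k<n. if k = j then c j * cnj (c j) * (\<integral>z. z ^ j * cnj z ^ j * of_real (W z) \<partial>lborel) else 0)"
    using integral_monomials_orthogonal[OF W rot] by (intro sum.cong refl) auto
  also have "\<dots> = (\<Sum>j<n. c j * cnj (c j) * (\<integral>z. z ^ j * cnj z ^ j * of_real (W z) \<partial>lborel))"
    by simp
  also have "\<dots> = complex_of_real (\<Sum>k<n. (cmod (c k))\<^sup>2 * (\<integral>z. (cmod z) ^ (2 * k) * W z \<partial>lborel))"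
    unfolding diagI of_real_sum of_real_mult complex_norm_square ..
  finally show "(\<integral>z. (cmod (\<Sum>k<n. c k * z ^ k))\<^sup>2 * W z \<partial>lborel) =
      (\<Sum>k<n. (cmod (c k))\<^sup>2 * (\<integral>z. (cmod z) ^ (2 * k) * W z \<partial>lborel))"
    unfolding of_real_eq_iff F_def .
qed

text \<open>On a disc of radius below 1 the Taylor polynomials are uniformly bounded, so dominated
  convergence carries the polynomial identity over to \<open>f\<close>; everything is finite there,
  which allows real-valued integrals.\<close>

lemma nn_integral_power_series_radial:
  fixes h :: "real \<Rightarrow> real"
  assumes f: "f holomorphic_on unit_disk" and h: "h \<in> borel_measurable borel"
    and hb: "\<And>x. 0 \<le> h x" "\<And>x. h x \<le> 1" and \<rho>: "0 < \<rho>" "\<rho> < 1"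
  shows "(\<integral>\<^sup>+z. ennreal ((cmod (f z))\<^sup>2 * h ((cmod z)\<^sup>2)) * indicator (ball 0 \<rho>) z \<partial>lborel) =
    (\<Sum>k. ennreal ((cmod (taylor_coeff f k))\<^sup>2) * (\<integral>\<^sup>+z. ennreal ((cmod z) ^ (2 * k) * h ((cmod z)\<^sup>2)) * indicator (ball (0::complex) \<rho>) z \<partial>lborel))"
proof -
  define W where "W z = h ((cmod z)\<^sup>2) * indicator (ball (0::complex) \<rho>) z" for z
  have W: "W \<in> borel_measurable borel"
    unfolding W_def using h by (intro borel_measurable_times borel_measurable_indicator measurable_compose[OF _ h]) auto
  have rot: "W (\<zeta> * z) = W z" if "cmod \<zeta> = 1" for \<zeta> z
    using that by (simp add: W_def norm_mult indicator_def)
  have bound: "0 \<le> W z" "W z \<le> 1" for z using hb by (auto simp: W_def indicator_def)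
  have supp: "W z = 0" if "1 \<le> cmod z" for z using that \<rho> by (auto simp: W_def indicator_def)
  note poly = integral_polynomial_radial[OF W rot bound supp]
  define m where "m k = (\<integral>z. (cmod z) ^ (2 * k) * W z \<partial>lborel)" for k
  define p where "p n z = (\<Sum>k<n. taylor_coeff f k * z ^ k)" for n z
  have mono: "integrable lborel (\<lambda>z. (cmod z) ^ (2 * k) * W z)" for k
    using poly(1)[of "\<lambda>i. if i = k then 1 else 0" "Suc k"]
    by (simp add: if_distrib[of "\<lambda>x. x * _"] norm_power power_mult[symmetric] mult.commute[of k 2] cong: if_cong)
  have sub: "cball 0 \<rho> \<subseteq> unit_disk" using \<rho> by auto
  have contf: "continuous_on (cball 0 \<rho>) f"
    by (rule holomorphic_on_imp_continuous_on[OF holomorphic_on_subset[OF f sub]])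
  have meas_fW: "(\<lambda>z. (cmod (f z))\<^sup>2 * W z) \<in> borel_measurable borel"
  proof -
    have "(\<lambda>z. indicator (ball 0 \<rho>) z *\<^sub>R f z) \<in> borel_measurable borel"
      by (rule borel_measurable_continuous_on_indicator) (auto intro: continuous_on_subset[OF contf])
    then have "(\<lambda>z. (cmod (indicator (ball 0 \<rho>) z *\<^sub>R f z))\<^sup>2 * W z) \<in> borel_measurable borel"
      using W by measurable
    moreover have "(\<lambda>z. (cmod (indicator (ball 0 \<rho>) z *\<^sub>R f z))\<^sup>2 * W z) = (\<lambda>z. (cmod (f z))\<^sup>2 * W z)"
      by (auto simp: fun_eq_iff W_def indicator_def)
    ultimately show ?thesis by simp
  qed
  have abs: "summable (\<lambda>k. cmod (taylor_coeff f k) * \<rho> ^ k)"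
  proof -
    define \<sigma> where "\<sigma> = (1 + \<rho>) / 2"
    have "(\<lambda>k. taylor_coeff f k * of_real \<sigma> ^ k) sums f (of_real \<sigma>)"
    proof (rule taylor_coeff_sums[OF f])
      have "\<bar>\<sigma>\<bar> < 1" using \<rho> by (simp add: \<sigma>_def)
      then show "complex_of_real \<sigma> \<in> unit_disk" by simp
    qed
    then have "summable (\<lambda>k. taylor_coeff f k * of_real \<sigma> ^ k)" by (rule sums_summable)
    moreover have "norm (complex_of_real \<rho>) < norm (complex_of_real \<sigma>)"
      using \<rho> by (simp only: norm_of_real) (simp add: \<sigma>_def)
    ultimately have "summable (\<lambda>k. norm (taylor_coeff f k * of_real \<rho> ^ k))" by (rule powser_insidea)
    then show ?thesis using \<rho> by (simp add: norm_mult norm_power)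
  qed
  define B where "B = (\<Sum>k. cmod (taylor_coeff f k) * \<rho> ^ k)"
  have pB: "cmod (p n z) \<le> B" if "z \<in> ball 0 \<rho>" for n z
  proof -
    have "cmod (p n z) \<le> (\<Sum>k<n. cmod (taylor_coeff f k) * \<rho> ^ k)"
      unfolding p_def using that by (intro sum_norm_le) (auto simp: norm_mult norm_power intro!: mult_left_mono power_mono)
    also have "\<dots> \<le> B" unfolding B_def by (rule sum_le_suminf[OF abs]) (use \<rho> in auto)
    finally show ?thesis .
  qed
  have lim: "(\<lambda>n. (cmod (p n z))\<^sup>2 * W z) \<longlonglongrightarrow> (cmod (f z))\<^sup>2 * W z" for z
  proof (cases "z \<in> ball 0 \<rho>")
    case True
    then have "z \<in> unit_disk" using \<rho> by auto
    from taylor_coeff_sums[OF f this] have "(\<lambda>n. p n z) \<longlonglongrightarrow> f z" unfolding sums_def p_def .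
    then show ?thesis by (intro tendsto_intros)
  qed (simp add: W_def)
  have dom: "norm ((cmod (p n z))\<^sup>2 * W z) \<le> B\<^sup>2 * W z" for n z
    using pB[of z n] bound(1)[of z] by (cases "z \<in> ball 0 \<rho>") (auto simp: W_def intro!: mult_right_mono power_mono)
  have intB: "integrable lborel (\<lambda>z. B\<^sup>2 * W z)" using mono[of 0] by simp
  have measp: "(\<lambda>z. (cmod (p n z))\<^sup>2 * W z) \<in> borel_measurable lborel" for n
    using poly(1)[of "taylor_coeff f" n] unfolding p_def by (rule borel_measurable_integrable)
  have intf: "integrable lborel (\<lambda>z. (cmod (f z))\<^sup>2 * W z)"
    and limI: "(\<lambda>n. \<integral>z. (cmod (p n z))\<^sup>2 * W z \<partial>lborel) \<longlonglongrightarrow> (\<integral>z. (cmod (f z))\<^sup>2 * W z \<partial>lborel)"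
    using integrable_dominated_convergence[of "\<lambda>z. (cmod (f z))\<^sup>2 * W z" lborel "\<lambda>n z. (cmod (p n z))\<^sup>2 * W z" "\<lambda>z. B\<^sup>2 * W z"]
      integral_dominated_convergence[of "\<lambda>z. (cmod (f z))\<^sup>2 * W z" lborel "\<lambda>n z. (cmod (p n z))\<^sup>2 * W z" "\<lambda>z. B\<^sup>2 * W z"]
      meas_fW measp intB lim dom by simp_all
  have "(\<integral>z. (cmod (p n z))\<^sup>2 * W z \<partial>lborel) = (\<Sum>k<n. (cmod (taylor_coeff f k))\<^sup>2 * m k)" for n
    unfolding p_def m_def by (rule poly(2))
  then have sums: "(\<lambda>k. (cmod (taylor_coeff f k))\<^sup>2 * m k) sums (\<integral>z. (cmod (f z))\<^sup>2 * W z \<partial>lborel)"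
    using limI by (simp add: sums_def)
  have m0: "0 \<le> m k" for k unfolding m_def using bound by (intro Bochner_Integration.integral_nonneg) auto
  have mE: "(\<integral>\<^sup>+z. ennreal ((cmod z) ^ (2 * k) * h ((cmod z)\<^sup>2)) * indicator (ball (0::complex) \<rho>) z \<partial>lborel) = ennreal (m k)" for k
  proof -
    have "(\<integral>\<^sup>+z. ennreal ((cmod z) ^ (2 * k) * h ((cmod z)\<^sup>2)) * indicator (ball (0::complex) \<rho>) z \<partial>lborel) =
        (\<integral>\<^sup>+z. ennreal ((cmod z) ^ (2 * k) * W z) \<partial>lborel)"
      by (intro nn_integral_cong) (auto simp: W_def indicator_def)
    also have "\<dots> = ennreal (m k)"
      unfolding m_def using bound by (intro nn_integral_eq_integral mono) auto
    finally show ?thesis .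
  qed
  have "(\<integral>\<^sup>+z. ennreal ((cmod (f z))\<^sup>2 * h ((cmod z)\<^sup>2)) * indicator (ball 0 \<rho>) z \<partial>lborel) =
      (\<integral>\<^sup>+z. ennreal ((cmod (f z))\<^sup>2 * W z) \<partial>lborel)"
    by (intro nn_integral_cong) (auto simp: W_def indicator_def)
  also have "\<dots> = ennreal (\<integral>z. (cmod (f z))\<^sup>2 * W z \<partial>lborel)"
    using bound by (intro nn_integral_eq_integral intf) auto
  also have "\<dots> = (\<Sum>k. ennreal ((cmod (taylor_coeff f k))\<^sup>2 * m k))"
    using sums m0 by (subst suminf_ennreal_eq[OF _ sums]) auto
  finally show ?thesis unfolding mE using m0 by (simp add: ennreal_mult)
qed

text \<open>The radii tend to 1, and monotone convergence admits infinite values on both sides. The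
  weight stays general for two uses: \<open>h = 1\<close> gives the Bergman norm, and
  \<open>(1 - x)^2\<close> on the unit interval gives the derivative integral of
  Littlewood-Paley.\<close>

theorem disk_parseval:
  fixes h :: "real \<Rightarrow> real"
  assumes f: "f holomorphic_on unit_disk" and h: "h \<in> borel_measurable borel"
    and hb: "\<And>x. 0 \<le> h x" "\<And>x. h x \<le> 1"
  shows "(\<integral>\<^sup>+z. ennreal ((cmod (f z))\<^sup>2 * h ((cmod z)\<^sup>2)) * indicator unit_disk z \<partial>lborel) =
    (\<Sum>k. ennreal ((cmod (taylor_coeff f k))\<^sup>2) * (ennreal pi * (\<integral>\<^sup>+x. ennreal (x ^ k * h x) * indicator {0..1} x \<partial>lborel)))"
proof -
  define \<rho> where "\<rho> n = 1 - 1 / real (n + 2)" for n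
  have \<rho>: "0 < \<rho> n" "\<rho> n < 1" for n by (auto simp: \<rho>_def field_simps)
  have inc: "incseq (\<lambda>n. ball (0::complex) (\<rho> n))"
    by (intro incseq_SucI subset_ball) (auto simp: \<rho>_def field_simps)
  have U: "(\<Union>n. ball (0::complex) (\<rho> n)) = unit_disk"
  proof
    show "unit_disk \<subseteq> (\<Union>n. ball (0::complex) (\<rho> n))"
    proof
      fix z :: complex assume "z \<in> unit_disk"
      then have z: "0 < 1 - cmod z" by simp
      obtain n where n: "inverse (real (Suc n)) < 1 - cmod z" using reals_Archimedean[OF z] by blast
      have "1 / real (n + 2) \<le> inverse (real (Suc n))" by (simp add: field_simps)
      then have "cmod z < \<rho> n" using n unfolding \<rho>_def by linarith
      then show "z \<in> (\<Union>n. ball (0::complex) (\<rho> n))" by auto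
    qed
    show "(\<Union>n. ball (0::complex) (\<rho> n)) \<subseteq> unit_disk" by (intro UN_least subset_ball less_imp_le \<rho>(2))
  qed
  have lim: "(\<lambda>n. \<integral>\<^sup>+z. g z * indicator (ball 0 (\<rho> n)) z \<partial>lborel) \<longlonglongrightarrow> (\<integral>\<^sup>+z. g z * indicator unit_disk z \<partial>lborel)"
    if g: "\<And>n. (\<lambda>z. g z * indicator (ball 0 (\<rho> n)) z) \<in> borel_measurable lborel" for g :: "complex \<Rightarrow> ennreal"
  proof (rule nn_integral_LIMSEQ)
    show "incseq (\<lambda>n z. g z * indicator (ball 0 (\<rho> n)) z)"
      unfolding incseq_def le_fun_def
    proof (intro allI impI mult_left_mono)
      fix m n :: nat and z :: complex assume "m \<le> n"
      then show "indicator (ball 0 (\<rho> m)) z \<le> (indicator (ball 0 (\<rho> n)) z :: ennreal)"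
        by (intro indicator_leI) (rule subsetD[OF incseqD[OF inc]])
    qed simp
    show "(\<lambda>n. g z * indicator (ball 0 (\<rho> n)) z) \<longlonglongrightarrow> g z * indicator unit_disk z" for z
    proof (cases "z \<in> unit_disk")
      case True
      then obtain N where N: "z \<in> ball 0 (\<rho> N)" using U by blast
      have "g z * indicator (ball 0 (\<rho> n)) z = g z * indicator unit_disk z" if "n \<ge> N" for n
      proof -
        have "z \<in> ball 0 (\<rho> n)" using incseqD[OF inc that] N by blast
        then show ?thesis using True by simp
      qed
      then show ?thesis by (intro tendsto_eventually) (auto simp: eventually_sequentially)
    next
      case False
      then have "z \<notin> ball 0 (\<rho> n)" for n using U by blast
      then show ?thesis using False by simp
    qed
  qed (rule g)
  define G where "G k z = ennreal ((cmod (taylor_coeff f k))\<^sup>2) * ennreal ((cmod z) ^ (2 * k) * h ((cmod z)\<^sup>2))" for k and z :: complex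
  have hm: "(\<lambda>z::complex. ennreal ((cmod z) ^ (2 * k) * h ((cmod z)\<^sup>2))) \<in> borel_measurable borel" for k
    by (intro measurable_compose[OF _ measurable_ennreal] borel_measurable_times measurable_compose[OF _ h]) auto
  have Gm: "G k \<in> borel_measurable borel" for k
    unfolding G_def by (intro borel_measurable_times_ennreal hm) auto
  have Gsum: "(\<integral>\<^sup>+z. (\<Sum>k. G k z) * indicator A z \<partial>lborel) = (\<Sum>k. \<integral>\<^sup>+z. G k z * indicator A z \<partial>lborel)" if A: "A \<in> sets borel" for A
  proof -
    have "(\<integral>\<^sup>+z. (\<Sum>k. G k z) * indicator A z \<partial>lborel) = (\<integral>\<^sup>+z. (\<Sum>k. G k z * indicator A z) \<partial>lborel)"
      by (simp add: ennreal_suminf_multc)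
    also have "\<dots> = (\<Sum>k. \<integral>\<^sup>+z. G k z * indicator A z \<partial>lborel)"
      using Gm A by (intro nn_integral_suminf) (auto intro!: borel_measurable_times_ennreal borel_measurable_indicator)
    finally show ?thesis .
  qed
  have Gk: "(\<integral>\<^sup>+z. G k z * indicator A z \<partial>lborel) = ennreal ((cmod (taylor_coeff f k))\<^sup>2) *
      (\<integral>\<^sup>+z. ennreal ((cmod z) ^ (2 * k) * h ((cmod z)\<^sup>2)) * indicator A z \<partial>lborel)" if A: "A \<in> sets borel" for A k
    unfolding G_def mult.assoc using hm A
    by (intro nn_integral_cmult) (auto intro!: borel_measurable_times_ennreal borel_measurable_indicator)
  have step: "(\<integral>\<^sup>+z. ennreal ((cmod (f z))\<^sup>2 * h ((cmod z)\<^sup>2)) * indicator (ball 0 (\<rho> n)) z \<partial>lborel) =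
      (\<integral>\<^sup>+z. (\<Sum>k. G k z) * indicator (ball 0 (\<rho> n)) z \<partial>lborel)" for n
    unfolding nn_integral_power_series_radial[OF f h hb \<rho>] by (simp add: Gsum Gk)
  have l1: "(\<lambda>n. \<integral>\<^sup>+z. ennreal ((cmod (f z))\<^sup>2 * h ((cmod z)\<^sup>2)) * indicator (ball 0 (\<rho> n)) z \<partial>lborel) \<longlonglongrightarrow>
      (\<integral>\<^sup>+z. ennreal ((cmod (f z))\<^sup>2 * h ((cmod z)\<^sup>2)) * indicator unit_disk z \<partial>lborel)"
  proof (rule lim)
    fix n
    have "(\<lambda>z. indicator (ball 0 (\<rho> n)) z *\<^sub>R f z) \<in> borel_measurable borel"
      by (rule borel_measurable_continuous_on_indicator)
        (use \<rho>(2)[of n] in \<open>auto intro!: holomorphic_on_imp_continuous_on holomorphic_on_subset[OF f]\<close>)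
    moreover have "(\<lambda>z::complex. h ((cmod z)\<^sup>2)) \<in> borel_measurable borel"
      by (intro measurable_compose[OF _ h]) auto
    ultimately have m: "(\<lambda>z. ennreal ((cmod (indicator (ball 0 (\<rho> n)) z *\<^sub>R f z))\<^sup>2 * h ((cmod z)\<^sup>2))) \<in> borel_measurable borel"
      by measurable
    have e: "(\<lambda>z. ennreal ((cmod (indicator (ball 0 (\<rho> n)) z *\<^sub>R f z))\<^sup>2 * h ((cmod z)\<^sup>2))) =
      (\<lambda>z. ennreal ((cmod (f z))\<^sup>2 * h ((cmod z)\<^sup>2)) * indicator (ball 0 (\<rho> n)) z)"
      by (auto simp: fun_eq_iff indicator_def)
    show "(\<lambda>z. ennreal ((cmod (f z))\<^sup>2 * h ((cmod z)\<^sup>2)) * indicator (ball 0 (\<rho> n)) z) \<in> borel_measurable lborel"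
      using m unfolding e by simp
  qed
  have l2: "(\<lambda>n. \<integral>\<^sup>+z. (\<Sum>k. G k z) * indicator (ball 0 (\<rho> n)) z \<partial>lborel) \<longlonglongrightarrow> (\<integral>\<^sup>+z. (\<Sum>k. G k z) * indicator unit_disk z \<partial>lborel)"
    by (rule lim) (use Gm in \<open>auto intro!: borel_measurable_times_ennreal borel_measurable_indicator borel_measurable_suminf_order\<close>)
  have "(\<integral>\<^sup>+z. ennreal ((cmod (f z))\<^sup>2 * h ((cmod z)\<^sup>2)) * indicator unit_disk z \<partial>lborel) = (\<integral>\<^sup>+z. (\<Sum>k. G k z) * indicator unit_disk z \<partial>lborel)"
    using LIMSEQ_unique[OF l1[unfolded step] l2] .
  also have "\<dots> = (\<Sum>k. ennreal ((cmod (taylor_coeff f k))\<^sup>2) *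
      (\<integral>\<^sup>+z. ennreal ((cmod z) ^ (2 * k) * h ((cmod z)\<^sup>2)) * indicator unit_disk z \<partial>lborel))"
    by (simp add: Gsum Gk)
  also have "\<dots> = (\<Sum>k. ennreal ((cmod (taylor_coeff f k))\<^sup>2) * (ennreal pi * (\<integral>\<^sup>+x. ennreal (x ^ k * h x) * indicator {0..1} x \<partial>lborel)))"
  proof (intro suminf_cong arg_cong2[where f = "(*)"] refl)
    fix k
    have "(\<lambda>x. ennreal (x ^ k * h x)) \<in> borel_measurable borel" using h by measurable
    from nn_integral_radial[OF this]
    show "(\<integral>\<^sup>+z. ennreal ((cmod z) ^ (2 * k) * h ((cmod z)\<^sup>2)) * indicator unit_disk z \<partial>lborel) =
        ennreal pi * (\<integral>\<^sup>+x. ennreal (x ^ k * h x) * indicator {0..1} x \<partial>lborel)"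
      by (simp add: power_mult)
  qed
  finally show ?thesis .
qed

lemma nn_integral_power_01: "(\<integral>\<^sup>+x. ennreal (x ^ k * 1) * indicator {0..1} x \<partial>lborel) = ennreal (1 / real (k + 1))"
proof -
  have "(\<integral>\<^sup>+x. ennreal (x ^ k * 1) * indicator {0..1} x \<partial>lborel) =
      ennreal (1 ^ (k + 1) / real (k + 1) - 0 ^ (k + 1) / real (k + 1))"
    by (rule nn_integral_FTC_Icc)
      (auto intro!: derivative_eq_intros simp del: of_nat_Suc power_Suc simp: power_Suc[symmetric])
  then show ?thesis by simp
qed

text \<open>The Beta integral with parameters \<open>k + 1\<close> and 3. The case distinction keeps
  the weight between 0 and 1 on the whole line, as \<open>disk_parseval\<close> demands.\<close>

lemma nn_integral_beta_01:
  "(\<integral>\<^sup>+x. ennreal (x ^ k * (if 0 \<le> x \<and> x \<le> 1 then (1 - x)\<^sup>2 else 0)) * indicator {0..1} x \<partial>lborel) =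
    ennreal (2 / (real (k + 1) * real (k + 2) * real (k + 3)))"
proof -
  define G where "G x = x ^ (k + 1) / real (k + 1) - 2 * (x ^ (k + 2) / real (k + 2)) + x ^ (k + 3) / real (k + 3)" for x :: real
  have "(\<integral>\<^sup>+x. ennreal (x ^ k * (if 0 \<le> x \<and> x \<le> 1 then (1 - x)\<^sup>2 else 0)) * indicator {0..1} x \<partial>lborel) =
      (\<integral>\<^sup>+x. ennreal (x ^ k * (1 - x)\<^sup>2) * indicator {0..1} x \<partial>lborel)"
    by (intro nn_integral_cong) (auto simp: indicator_def)
  also have "\<dots> = ennreal (G 1 - G 0)"
  proof (rule nn_integral_FTC_Icc)
    fix x :: real
    have d: "((\<lambda>x. x ^ (k + m) / real (k + m)) has_real_derivative x ^ (k + m - 1)) (at x within A)" if "0 < m" for m A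
      using that by (auto intro!: derivative_eq_intros)
    have "(G has_real_derivative x ^ (k + 1 - 1) - 2 * x ^ (k + 2 - 1) + x ^ (k + 3 - 1)) (at x)"
      unfolding G_def by (intro DERIV_add DERIV_diff DERIV_cmult d) auto
    then show "(G has_real_derivative x ^ k * (1 - x)\<^sup>2) (at x)"
      by (simp add: power2_eq_square algebra_simps eval_nat_numeral)
  qed auto
  also have "G 1 - G 0 = 2 / (real (k + 1) * real (k + 2) * real (k + 3))"
    by (simp add: G_def divide_simps zero_power) (simp add: algebra_simps zero_power)
  finally show ?thesis .
qed

section \<open>The Bergman norm in Taylor coefficients\<close>

definition bergman_weight :: "nat \<Rightarrow> real" where
  "bergman_weight k = 1 / real (k + 1)"

lemma bergman_parseval:
  assumes f: "f holomorphic_on unit_disk"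
  shows "(\<integral>\<^sup>+z. ennreal ((cmod (f z))\<^sup>2) * indicator unit_disk z \<partial>lborel) =
    ennreal pi * (\<Sum>k. ennreal (bergman_weight k * (cmod (taylor_coeff f k))\<^sup>2))"
proof -
  have "(\<integral>\<^sup>+z. ennreal ((cmod (f z))\<^sup>2) * indicator unit_disk z \<partial>lborel) =
      (\<Sum>k. ennreal ((cmod (taylor_coeff f k))\<^sup>2) * (ennreal pi * ennreal (bergman_weight k)))"
    using disk_parseval[OF f, of "\<lambda>_. 1"] by (simp only: nn_integral_power_01 bergman_weight_def) simp
  also have "\<dots> = (\<Sum>k. ennreal pi * ennreal (bergman_weight k * (cmod (taylor_coeff f k))\<^sup>2))"
    by (intro suminf_cong) (simp add: ennreal_mult[symmetric] bergman_weight_def mult_ac)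
  finally show ?thesis by simp
qed

lemma disk_measurable:
  assumes "f holomorphic_on unit_disk"
  shows "(\<lambda>z. indicator unit_disk z *\<^sub>R f z) \<in> borel_measurable borel"
  by (rule borel_measurable_continuous_on_indicator) (auto intro: holomorphic_on_imp_continuous_on assms)

lemma disk_nn_measurable:
  assumes "f holomorphic_on unit_disk"
  shows "(\<lambda>z. ennreal ((cmod (f z))\<^sup>2) * indicator unit_disk z) \<in> borel_measurable borel"
proof -
  have m: "(\<lambda>z. ennreal ((cmod (indicator unit_disk z *\<^sub>R f z))\<^sup>2)) \<in> borel_measurable borel"
    using disk_measurable[OF assms] by measurable
  have e: "(\<lambda>z. ennreal ((cmod (indicator unit_disk z *\<^sub>R f z))\<^sup>2)) = (\<lambda>z. ennreal ((cmod (f z))\<^sup>2) * indicator unit_disk z)"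
    by (auto simp: fun_eq_iff indicator_def)
  show ?thesis using m unfolding e .
qed

lemma set_integrable_disk_iff:
  assumes f: "f holomorphic_on unit_disk"
  shows "set_integrable lborel unit_disk (\<lambda>z. (cmod (f z))\<^sup>2) \<longleftrightarrow>
    (\<integral>\<^sup>+z. ennreal ((cmod (f z))\<^sup>2) * indicator unit_disk z \<partial>lborel) < \<infinity>"
proof -
  have m: "(\<lambda>z. indicator unit_disk z *\<^sub>R (cmod (f z))\<^sup>2) \<in> borel_measurable borel"
  proof -
    have m: "(\<lambda>z. (cmod (indicator unit_disk z *\<^sub>R f z))\<^sup>2) \<in> borel_measurable borel"
      using disk_measurable[OF f] by measurable
    have e: "(\<lambda>z. (cmod (indicator unit_disk z *\<^sub>R f z))\<^sup>2) = (\<lambda>z. indicator unit_disk z *\<^sub>R (cmod (f z))\<^sup>2)"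
      by (auto simp: fun_eq_iff indicator_def)
    show ?thesis using m unfolding e .
  qed
  have "(\<integral>\<^sup>+z. ennreal (norm (indicator unit_disk z *\<^sub>R (cmod (f z))\<^sup>2)) \<partial>lborel) =
      (\<integral>\<^sup>+z. ennreal ((cmod (f z))\<^sup>2) * indicator unit_disk z \<partial>lborel)"
    by (intro nn_integral_cong) (auto simp: indicator_def)
  then show ?thesis unfolding set_integrable_def integrable_iff_bounded using m by simp
qed

lemma set_lebesgue_integral_disk:
  assumes f: "f holomorphic_on unit_disk"
  shows "ennreal (LINT z:unit_disk|lborel. (cmod (f z))\<^sup>2) \<le>
    (\<integral>\<^sup>+z. ennreal ((cmod (f z))\<^sup>2) * indicator unit_disk z \<partial>lborel)"
   and "set_integrable lborel unit_disk (\<lambda>z. (cmod (f z))\<^sup>2) \<Longrightarrow>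
    (\<integral>\<^sup>+z. ennreal ((cmod (f z))\<^sup>2) * indicator unit_disk z \<partial>lborel) = ennreal (LINT z:unit_disk|lborel. (cmod (f z))\<^sup>2)"
proof -
  have e: "(\<integral>\<^sup>+z. ennreal ((cmod (f z))\<^sup>2) * indicator unit_disk z \<partial>lborel) =
      (\<integral>\<^sup>+z. ennreal (indicator unit_disk z *\<^sub>R (cmod (f z))\<^sup>2) \<partial>lborel)"
    by (intro nn_integral_cong) (auto simp: indicator_def)
  show *: "(\<integral>\<^sup>+z. ennreal ((cmod (f z))\<^sup>2) * indicator unit_disk z \<partial>lborel) = ennreal (LINT z:unit_disk|lborel. (cmod (f z))\<^sup>2)"
    if "set_integrable lborel unit_disk (\<lambda>z. (cmod (f z))\<^sup>2)"
    unfolding e set_lebesgue_integral_def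
    by (rule nn_integral_eq_integral) (use that in \<open>auto simp: set_integrable_def\<close>)
  show "ennreal (LINT z:unit_disk|lborel. (cmod (f z))\<^sup>2) \<le>
    (\<integral>\<^sup>+z. ennreal ((cmod (f z))\<^sup>2) * indicator unit_disk z \<partial>lborel)"
  proof (cases "set_integrable lborel unit_disk (\<lambda>z. (cmod (f z))\<^sup>2)")
    case False
    then show ?thesis
      unfolding set_lebesgue_integral_def set_integrable_def by (simp add: not_integrable_integral_eq)
  qed (use * in simp)
qed

lemma summable_iff_suminf_ennreal:
  fixes a :: "nat \<Rightarrow> real"
  assumes "\<And>k. 0 \<le> a k"
  shows "summable a \<longleftrightarrow> (\<Sum>k. ennreal (a k)) < \<infinity>"
proof
  assume "summable a"
  then show "(\<Sum>k. ennreal (a k)) < \<infinity>" unfolding suminf_ennreal2[OF assms \<open>summable a\<close>] by simp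
next
  assume "(\<Sum>k. ennreal (a k)) < \<infinity>"
  then have "(\<Sum>k. ennreal (a k)) \<noteq> top_class.top" by simp
  then show "summable a" by (rule summable_suminf_not_top[OF assms])
qed

lemma bergman_space_wspace: "bergman_space = wspace bergman_weight"
proof -
  have iff: "set_integrable lborel unit_disk (\<lambda>z. (cmod (f z))\<^sup>2) \<longleftrightarrow> summable (\<lambda>k. bergman_weight k * (cmod (taylor_coeff f k))\<^sup>2)"
    if f: "f holomorphic_on unit_disk" for f
  proof -
    have "summable (\<lambda>k. bergman_weight k * (cmod (taylor_coeff f k))\<^sup>2) \<longleftrightarrow> (\<Sum>k. ennreal (bergman_weight k * (cmod (taylor_coeff f k))\<^sup>2)) < \<infinity>"
      by (rule summable_iff_suminf_ennreal) (simp add: bergman_weight_def)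
    also have "\<dots> \<longleftrightarrow> ennreal pi * (\<Sum>k. ennreal (bergman_weight k * (cmod (taylor_coeff f k))\<^sup>2)) < \<infinity>"
      by (auto simp: ennreal_mult_less_top less_top[symmetric] ennreal_mult_eq_top_iff)
    finally show ?thesis unfolding set_integrable_disk_iff[OF f] bergman_parseval[OF f] by simp
  qed
  show ?thesis unfolding bergman_space_def wspace_def by (rule Collect_cong) (simp add: iff cong: conj_cong)
qed

lemma bergman_norm_wnorm:
  assumes "f \<in> bergman_space"
  shows "bergman_norm f = wnorm bergman_weight f"
proof -
  have f: "f holomorphic_on unit_disk" "set_integrable lborel unit_disk (\<lambda>z. (cmod (f z))\<^sup>2)"
    using assms by (auto simp: bergman_space_def)
  have s: "summable (\<lambda>k. bergman_weight k * (cmod (taylor_coeff f k))\<^sup>2)"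
    using assms unfolding bergman_space_wspace wspace_def by simp
  have w: "0 \<le> bergman_weight k * (cmod (taylor_coeff f k))\<^sup>2" for k by (simp add: bergman_weight_def)
  have "ennreal (LINT z:unit_disk|lborel. (cmod (f z))\<^sup>2) = ennreal pi * (\<Sum>k. ennreal (bergman_weight k * (cmod (taylor_coeff f k))\<^sup>2))"
    using set_lebesgue_integral_disk(2)[OF f] bergman_parseval[OF f(1)] by simp
  also have "\<dots> = ennreal (pi * (\<Sum>k. bergman_weight k * (cmod (taylor_coeff f k))\<^sup>2))"
    using suminf_ennreal2[OF w s] w s by (simp add: ennreal_mult suminf_nonneg)
  finally have "(LINT z:unit_disk|lborel. (cmod (f z))\<^sup>2) = pi * (\<Sum>k. bergman_weight k * (cmod (taylor_coeff f k))\<^sup>2)"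
    by (subst (asm) ennreal_inj) (auto intro!: mult_nonneg_nonneg suminf_nonneg s w integral_nonneg_AE simp: set_lebesgue_integral_def)
  then show ?thesis by (simp add: bergman_norm_def wnorm_def)
qed

lemma complex_ip_space_bergman: "complex_ip_space bergman_space (wip bergman_weight) bergman_norm"
proof -
  interpret w: complex_ip_space "wspace bergman_weight" "wip bergman_weight" "wnorm bergman_weight"
    by (rule complex_ip_space_wspace) (simp add: bergman_weight_def)
  show ?thesis
  proof
    show "cfun.subspace bergman_space" unfolding bergman_space_wspace by (rule w.subspace)
    fix f g h :: "complex \<Rightarrow> complex" and c :: complex
    show "wip bergman_weight (f + g) h = wip bergman_weight f h + wip bergman_weight g h"
      if "f \<in> bergman_space" "g \<in> bergman_space" "h \<in> bergman_space"
      using that unfolding bergman_space_wspace by (rule w.ip_add_left)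
    show "wip bergman_weight (cscale c f) h = c * wip bergman_weight f h"
      if "f \<in> bergman_space" "h \<in> bergman_space"
      using that unfolding bergman_space_wspace by (rule w.ip_scale_left)
    show "cnj (wip bergman_weight f g) = wip bergman_weight g f"
      if "f \<in> bergman_space" "g \<in> bergman_space"
      using that unfolding bergman_space_wspace by (rule w.ip_cnj)
    show "wip bergman_weight f f = of_real ((bergman_norm f)\<^sup>2)" if f: "f \<in> bergman_space"
      unfolding bergman_norm_wnorm[OF f] using f unfolding bergman_space_wspace by (rule w.ip_nrm)
    show "0 \<le> bergman_norm f" if f: "f \<in> bergman_space"
      unfolding bergman_norm_wnorm[OF f] using f unfolding bergman_space_wspace by (rule w.nrm_nonneg)
    show "f = 0" if f: "f \<in> bergman_space" "bergman_norm f = 0"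
      using f w.nrm_zeroD[of f] unfolding bergman_norm_wnorm[OF f(1)] bergman_space_wspace by simp
  qed
qed

interpretation bergman: complex_ip_space bergman_space "wip bergman_weight" bergman_norm
  by (rule complex_ip_space_bergman)

lemma bergman_nn_integral:
  assumes "f \<in> bergman_space"
  shows "(\<integral>\<^sup>+z. ennreal ((cmod (f z))\<^sup>2) * indicator unit_disk z \<partial>lborel) = ennreal (pi * (bergman_norm f)\<^sup>2)"
proof -
  have f: "f holomorphic_on unit_disk" "set_integrable lborel unit_disk (\<lambda>z. (cmod (f z))\<^sup>2)"
    using assms by (auto simp: bergman_space_def)
  have "0 \<le> (LINT z:unit_disk|lborel. (cmod (f z))\<^sup>2)"
    unfolding set_lebesgue_integral_def by (rule Bochner_Integration.integral_nonneg) auto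
  then have "pi * (bergman_norm f)\<^sup>2 = (LINT z:unit_disk|lborel. (cmod (f z))\<^sup>2)"
    by (simp add: bergman_norm_def)
  then show ?thesis using set_lebesgue_integral_disk(2)[OF f] by simp
qed

lemma bergman_spaceI:
  assumes "f holomorphic_on unit_disk" "\<And>z. z \<notin> unit_disk \<Longrightarrow> f z = 0"
    and "(\<integral>\<^sup>+z. ennreal ((cmod (f z))\<^sup>2) * indicator unit_disk z \<partial>lborel) \<le> ennreal (pi * B)" and B: "0 \<le> B"
  shows "f \<in> bergman_space" "(bergman_norm f)\<^sup>2 \<le> B"
proof -
  have "(\<integral>\<^sup>+z. ennreal ((cmod (f z))\<^sup>2) * indicator unit_disk z \<partial>lborel) < \<infinity>"
    using assms(3) by (rule order.strict_trans1) simp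
  then show f: "f \<in> bergman_space"
    using assms(1,2) set_integrable_disk_iff[OF assms(1)] by (simp add: bergman_space_def)
  have "ennreal (pi * (bergman_norm f)\<^sup>2) \<le> ennreal (pi * B)"
    using assms(3) unfolding bergman_nn_integral[OF f] .
  then show "(bergman_norm f)\<^sup>2 \<le> B" using B by (subst (asm) ennreal_le_iff) auto
qed

section \<open>Littlewood-Paley and local derivative estimates\<close>

lemma taylor_coeff_deriv:
  "taylor_coeff (deriv g) k = of_nat (k + 1) * taylor_coeff g (k + 1)"
proof -
  have "(deriv ^^ k) (deriv g) 0 = (deriv ^^ Suc k) g 0" by (simp add: funpow_swap1)
  moreover have "of_nat (Suc k) \<noteq> (0 :: complex)" by (simp del: of_nat_Suc)
  ultimately show ?thesis by (simp add: fps_expansion_def del: of_nat_Suc funpow.simps)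
qed

text \<open>A comparison of coefficients: index \<open>k + 1\<close> has weight
  \<open>1 / (k + 2)\<close> on the left and \<open>2 (k + 1) / ((k + 2) (k + 3))\<close> in the
  derivative integral. The quotient \<open>(k + 3) / (2 (k + 1))\<close> is largest at
  \<open>k = 0\<close>, where it is the constant \<open>3 / 2\<close>.\<close>

theorem littlewood_paley_upper:
  assumes g: "g holomorphic_on unit_disk"
  shows "(\<integral>\<^sup>+z. ennreal ((cmod (g z))\<^sup>2) * indicator unit_disk z \<partial>lborel) \<le>
    ennreal (pi * (cmod (g 0))\<^sup>2) +
    ennreal (3 / 2) * (\<integral>\<^sup>+z. ennreal ((cmod (deriv g z))\<^sup>2 * (1 - (cmod z)\<^sup>2)\<^sup>2) * indicator unit_disk z \<partial>lborel)"
proof -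
  define h where "h x = (if 0 \<le> x \<and> x \<le> 1 then (1 - x)\<^sup>2 else 0)" for x :: real
  have dg: "deriv g holomorphic_on unit_disk" by (intro holomorphic_deriv g) auto
  have hm: "h \<in> borel_measurable borel" unfolding h_def by measurable
  have hb: "0 \<le> h x" "h x \<le> 1" for x by (auto simp: h_def power_le_one)
  define a where "a k = (cmod (taylor_coeff g k))\<^sup>2" for k
  have a0: "0 \<le> a k" for k by (simp add: a_def)
  have "(\<integral>\<^sup>+z. ennreal ((cmod (deriv g z))\<^sup>2 * (1 - (cmod z)\<^sup>2)\<^sup>2) * indicator unit_disk z \<partial>lborel) =
      (\<integral>\<^sup>+z. ennreal ((cmod (deriv g z))\<^sup>2 * h ((cmod z)\<^sup>2)) * indicator unit_disk z \<partial>lborel)"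
    by (intro nn_integral_cong) (auto simp: h_def indicator_def power_le_one)
  also have "\<dots> = (\<Sum>k. ennreal ((cmod (taylor_coeff (deriv g) k))\<^sup>2) *
      (ennreal pi * ennreal (2 / (real (k + 1) * real (k + 2) * real (k + 3)))))"
    using disk_parseval[OF dg hm hb] unfolding h_def nn_integral_beta_01 .
  also have "\<dots> = (\<Sum>k. ennreal (pi * (2 * real (k + 1) / (real (k + 2) * real (k + 3)) * a (Suc k))))"
  proof (rule suminf_cong)
    fix k
    have "(cmod (taylor_coeff (deriv g) k))\<^sup>2 = (real (k + 1))\<^sup>2 * a (Suc k)"
      unfolding taylor_coeff_deriv by (simp add: norm_mult a_def power_mult_distrib del: of_nat_add of_nat_Suc)
    then have "(cmod (taylor_coeff (deriv g) k))\<^sup>2 * (pi * (2 / (real (k + 1) * real (k + 2) * real (k + 3)))) =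
        pi * (2 * real (k + 1) / (real (k + 2) * real (k + 3)) * a (Suc k))"
      by (simp add: power2_eq_square divide_simps)
    then show "ennreal ((cmod (taylor_coeff (deriv g) k))\<^sup>2) * (ennreal pi * ennreal (2 / (real (k + 1) * real (k + 2) * real (k + 3)))) =
      ennreal (pi * (2 * real (k + 1) / (real (k + 2) * real (k + 3)) * a (Suc k)))"
      by (simp add: ennreal_mult[symmetric] del: of_nat_add of_nat_Suc)
  qed
  finally have D: "(\<integral>\<^sup>+z. ennreal ((cmod (deriv g z))\<^sup>2 * (1 - (cmod z)\<^sup>2)\<^sup>2) * indicator unit_disk z \<partial>lborel) =
      (\<Sum>k. ennreal (pi * (2 * real (k + 1) / (real (k + 2) * real (k + 3)) * a (Suc k))))" .
  have "(\<integral>\<^sup>+z. ennreal ((cmod (g z))\<^sup>2) * indicator unit_disk z \<partial>lborel) =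
      (\<Sum>k. ennreal (pi * (bergman_weight k * a k)))"
    unfolding bergman_parseval[OF g] ennreal_suminf_cmult[symmetric]
    by (intro suminf_cong) (simp add: ennreal_mult[symmetric] bergman_weight_def a_def)
  also have "\<dots> = ennreal (pi * (bergman_weight 0 * a 0)) + (\<Sum>k. ennreal (pi * (bergman_weight (Suc k) * a (Suc k))))"
    using suminf_offset[of "\<lambda>k. ennreal (pi * (bergman_weight k * a k))" 1] by simp
  also have "\<dots> \<le> ennreal (pi * (cmod (g 0))\<^sup>2) +
      (\<Sum>k. ennreal (3 / 2) * ennreal (pi * (2 * real (k + 1) / (real (k + 2) * real (k + 3)) * a (Suc k))))"
  proof (intro add_mono suminf_le)
    show "ennreal (pi * (bergman_weight 0 * a 0)) \<le> ennreal (pi * (cmod (g 0))\<^sup>2)"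
      using taylor_coeff_0[OF g] by (simp add: bergman_weight_def a_def)
    fix k
    have "1 / real (k + 2) \<le> 3 / 2 * (2 * real (k + 1) / (real (k + 2) * real (k + 3)))"
      by (simp add: divide_simps)
    from mult_right_mono[OF this a0[of "Suc k"]]
    have "pi * (1 / real (k + 2) * a (Suc k)) \<le> pi * (3 / 2 * (2 * real (k + 1) / (real (k + 2) * real (k + 3))) * a (Suc k))"
      by (intro mult_left_mono) auto
    then show "ennreal (pi * (bergman_weight (Suc k) * a (Suc k))) \<le>
        ennreal (3 / 2) * ennreal (pi * (2 * real (k + 1) / (real (k + 2) * real (k + 3)) * a (Suc k)))"
      by (subst ennreal_mult[symmetric]) (auto intro!: ennreal_leI mult_nonneg_nonneg divide_nonneg_nonneg a0 simp: bergman_weight_def mult_ac)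
  qed auto
  also have "\<dots> = ennreal (pi * (cmod (g 0))\<^sup>2) + ennreal (3 / 2) *
      (\<integral>\<^sup>+z. ennreal ((cmod (deriv g z))\<^sup>2 * (1 - (cmod z)\<^sup>2)\<^sup>2) * indicator unit_disk z \<partial>lborel)"
    unfolding D by simp
  finally show ?thesis .
qed

text \<open>For \<open>f\<close> holomorphic on the disc around \<open>c\<close> of radius
  \<open>s > 0\<close>, this is \<open>s^k\<close> times the \<open>k\<close>-th Taylor coefficient
  of \<open>f\<close> at \<open>c\<close>; the rescaling lets results on the unit disk apply
  there.\<close>

definition local_coeff :: "complex \<Rightarrow> real \<Rightarrow> (complex \<Rightarrow> complex) \<Rightarrow> nat \<Rightarrow> complex" where
  "local_coeff c s f k = taylor_coeff (\<lambda>\<zeta>. f (c + of_real s * \<zeta>)) k"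

lemma local_coeff_holomorphic:
  assumes f: "f holomorphic_on unit_disk" and s: "0 < s" "ball c s \<subseteq> unit_disk"
  shows "(\<lambda>\<zeta>. f (c + of_real s * \<zeta>)) holomorphic_on unit_disk"
proof -
  have "c + of_real s * \<zeta> \<in> unit_disk" if "\<zeta> \<in> unit_disk" for \<zeta>
  proof -
    have "s * cmod \<zeta> < s * 1" using that s(1) by (intro mult_strict_left_mono) auto
    then have "c + of_real s * \<zeta> \<in> ball c s" using s(1) by (simp add: dist_norm norm_mult)
    then show ?thesis using s(2) by blast
  qed
  then have "f \<circ> (\<lambda>\<zeta>. c + of_real s * \<zeta>) holomorphic_on unit_disk"
    by (intro holomorphic_on_compose_gen[OF _ f] holomorphic_intros) auto
  then show ?thesis by (simp add: o_def)
qed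

lemma local_parseval:
  assumes f: "f holomorphic_on unit_disk" and s: "0 < s" "ball c s \<subseteq> unit_disk"
  shows "(\<integral>\<^sup>+z. ennreal ((cmod (f z))\<^sup>2) * indicator (ball c s) z \<partial>lborel) =
    ennreal (pi * s\<^sup>2) * (\<Sum>k. ennreal (bergman_weight k * (cmod (local_coeff c s f k))\<^sup>2))"
proof -
  note hol = local_coeff_holomorphic[OF f s]
  have "(\<lambda>z. indicator (ball c s) z *\<^sub>R f z) \<in> borel_measurable borel"
    by (rule borel_measurable_continuous_on_indicator)
      (auto intro!: holomorphic_on_imp_continuous_on holomorphic_on_subset[OF f s(2)])
  then have m: "(\<lambda>z. ennreal ((cmod (indicator (ball c s) z *\<^sub>R f z))\<^sup>2)) \<in> borel_measurable borel" by measurable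
  have e: "(\<lambda>z. ennreal ((cmod (indicator (ball c s) z *\<^sub>R f z))\<^sup>2)) = (\<lambda>z. ennreal ((cmod (f z))\<^sup>2) * indicator (ball c s) z)"
    by (auto simp: fun_eq_iff indicator_def)
  note m' = m[unfolded e]
  have "(\<integral>\<^sup>+z. ennreal ((cmod (f z))\<^sup>2) * indicator (ball c s) z \<partial>lborel) =
      (\<integral>\<^sup>+\<zeta>. ennreal (s\<^sup>2) * (ennreal ((cmod (f (c + s *\<^sub>R \<zeta>)))\<^sup>2) * indicator (ball c s) (c + s *\<^sub>R \<zeta>)) \<partial>lborel)"
    using s(1) m' by (subst lborel_affine[of s c])
      (auto simp: nn_integral_density nn_integral_distr DIM_complex)
  also have "\<dots> = (\<integral>\<^sup>+\<zeta>. ennreal (s\<^sup>2) * (ennreal ((cmod (f (c + of_real s * \<zeta>)))\<^sup>2) * indicator unit_disk \<zeta>) \<partial>lborel)"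
    using s(1) by (intro nn_integral_cong) (auto simp: indicator_def dist_norm scaleR_conv_of_real norm_mult)
  also have "\<dots> = ennreal (s\<^sup>2) * (\<integral>\<^sup>+\<zeta>. ennreal ((cmod (f (c + of_real s * \<zeta>)))\<^sup>2) * indicator unit_disk \<zeta> \<partial>lborel)"
    using disk_nn_measurable[OF hol] by (intro nn_integral_cmult) simp
  also have "\<dots> = ennreal (pi * s\<^sup>2) * (\<Sum>k. ennreal (bergman_weight k * (cmod (local_coeff c s f k))\<^sup>2))"
    unfolding bergman_parseval[OF hol] local_coeff_def[symmetric] by (simp add: ennreal_mult mult_ac)
  finally show ?thesis .
qed

text \<open>Arises from Cauchy-Schwarz in \<open>local_deriv_bound\<close>. With
  \<open>i = k + 1\<close>, the weights \<open>(k + 1)^2 (k + 2) 4^(-k)\<close> are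
  \<open>2^(-i)\<close> times the summand, and the factor \<open>2^(-i)\<close> is set aside to be
  bounded by \<open>2^(-J)\<close>.\<close>

definition taylor_const :: real where
  "taylor_const = (\<Sum>i. (real i)\<^sup>2 * real (i + 1) * 4 * (1 / 2) ^ i)"

lemma summable_taylor_const: "summable (\<lambda>i. (real i)\<^sup>2 * real (i + 1) * 4 * (1 / 2) ^ i)"
\<comment> \<open>The quotient of consecutive terms is \<open>(x + 1) (x + 2) / (2 x^2)\<close>,
  which is at most \<open>3 / 4\<close> as soon as \<open>6 x + 4 \<le> x^2\<close>, hence from 7
  on.\<close>
proof (rule summable_ratio_test[of "3 / 4" 7])
  fix n :: nat assume n: "7 \<le> n"
  define x where "x = real n"
  have x: "7 \<le> x" using n by (simp add: x_def)
  have "7 * x \<le> x * x" using x by (intro mult_right_mono) auto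
  then have "6 * x + 4 \<le> x * x" using x by linarith
  then have q: "2 * (x + 2) * (x + 1) \<le> 3 * x\<^sup>2" by (simp add: power2_eq_square algebra_simps)
  have "(x + 1)\<^sup>2 * (x + 2) / 2 = (2 * (x + 2) * (x + 1)) * ((x + 1) / 4)"
    by (simp add: power2_eq_square field_simps)
  also have "\<dots> \<le> (3 * x\<^sup>2) * ((x + 1) / 4)" using q x by (intro mult_right_mono) auto
  finally have "(x + 1)\<^sup>2 * (x + 2) / 2 \<le> 3 / 4 * (x\<^sup>2 * (x + 1))" by simp
  then have "((x + 1)\<^sup>2 * (x + 2) / 2) * (4 * (1 / 2) ^ n) \<le> (3 / 4 * (x\<^sup>2 * (x + 1))) * (4 * (1 / 2) ^ n)"
    by (rule mult_right_mono) simp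
  then show "norm ((real (Suc n))\<^sup>2 * real (Suc n + 1) * 4 * (1 / 2) ^ Suc n)
      \<le> 3 / 4 * norm ((real n)\<^sup>2 * real (n + 1) * 4 * (1 / 2) ^ n)"
    using x by (simp add: x_def[symmetric] abs_mult add.commute mult_ac abs_of_nonneg)
qed simp

lemma taylor_const_pos: "0 < taylor_const"
  unfolding taylor_const_def
  by (rule suminf_pos2[where i = 1, OF summable_taylor_const]) auto

text \<open>In the half-radius disc the rescaled variable has modulus at most \<open>1 / 2\<close>,
  so the terms of the derivative series decay geometrically, and Cauchy-Schwarz compares them with
  the local mass. Only coefficients from \<open>J\<close> on remain, which yields
  \<open>2^(-J)\<close>. In \<open>s^4\<close>, one \<open>s^2\<close> comes from the chain rule and
  one from the area of the disc.\<close>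

lemma local_deriv_bound:
  assumes f: "f holomorphic_on unit_disk" and s: "0 < s" "ball c s \<subseteq> unit_disk"
    and w: "dist c w \<le> s / 2" and J: "\<And>k. k < J \<Longrightarrow> local_coeff c s f k = 0"
  shows "ennreal (s ^ 4 * (cmod (deriv f w))\<^sup>2) \<le> ennreal (taylor_const * (1 / 2) ^ J) *
    (\<integral>\<^sup>+z. ennreal ((cmod (f z))\<^sup>2) * indicator (ball c s) z \<partial>lborel)"
proof -
  define F where "F \<zeta> = f (c + of_real s * \<zeta>)" for \<zeta>
  define b where "b k = local_coeff c s f k" for k
  have F: "F holomorphic_on unit_disk" unfolding F_def by (rule local_coeff_holomorphic[OF f s])
  have b: "taylor_coeff F k = b k" for k by (simp add: b_def local_coeff_def F_def[abs_def])
  define a where "a k = bergman_weight k * (cmod (b k))\<^sup>2" for k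
  have a0: "0 \<le> a k" for k by (simp add: a_def bergman_weight_def)
  have kpos: "0 < taylor_const * (1 / 2) ^ J" using taylor_const_pos by simp
  have P: "(\<integral>\<^sup>+z. ennreal ((cmod (f z))\<^sup>2) * indicator (ball c s) z \<partial>lborel) = ennreal (pi * s\<^sup>2) * (\<Sum>k. ennreal (a k))"
    unfolding local_parseval[OF f s] a_def b_def ..
  show ?thesis
  proof (cases "summable a")
    case False
    then have "(\<Sum>k. ennreal (a k)) = \<infinity>" using summable_iff_suminf_ennreal[OF a0] by (simp add: not_less top_unique)
    then show ?thesis unfolding P using taylor_const_pos s(1) by (simp add: ennreal_mult_top)
  next
    case sa: True
    define \<zeta> where "\<zeta> = (w - c) / of_real s"
    have w_eq: "w = c + of_real s * \<zeta>" using s(1) by (simp add: \<zeta>_def)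
    have \<zeta>: "cmod \<zeta> \<le> 1 / 2" using w s(1) by (simp add: \<zeta>_def dist_norm norm_divide norm_minus_commute field_simps)
    have wD: "w \<in> unit_disk" using w s by (intro subsetD[OF s(2)]) auto
    have "(f has_field_derivative deriv f w) (at w)" using holomorphic_derivI[OF f _ wD] by auto
    then have "(F has_field_derivative deriv f w * of_real s) (at \<zeta>)"
      unfolding F_def w_eq by (rule DERIV_chain2) (auto intro!: derivative_eq_intros)
    then have dF: "deriv F \<zeta> = deriv f w * of_real s" by (rule DERIV_imp_deriv)
    have "deriv F holomorphic_on unit_disk" by (intro holomorphic_deriv F) auto
    then have "(\<lambda>k. taylor_coeff (deriv F) k * \<zeta> ^ k) sums deriv F \<zeta>" using \<zeta> by (intro taylor_coeff_sums) auto
    then have lim: "(\<lambda>n. \<Sum>k<n. of_nat (k + 1) * b (k + 1) * \<zeta> ^ k) \<longlonglongrightarrow> deriv F \<zeta>"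
      unfolding sums_def taylor_coeff_deriv b .
    have part: "(cmod (\<Sum>k<n. of_nat (k + 1) * b (k + 1) * \<zeta> ^ k))\<^sup>2 \<le> suminf a * (taylor_const * (1 / 2) ^ J)" for n
    proof -
      define X where "X k = sqrt (a (k + 1))" for k
      \<comment> \<open>The \<open>k\<close>-th term of the derivative involves the coefficient
        \<open>k + 1\<close>, so it drops out when \<open>k + 1 < J\<close>. The square root undoes
        the Bergman weight contained in \<open>X\<close>.\<close>
      define Y where "Y k = (if J \<le> k + 1 then real (k + 1) * sqrt (real (k + 2)) * (1 / 2) ^ k else 0)" for k
      have XY: "cmod (of_nat (k + 1) * b (k + 1) * \<zeta> ^ k) \<le> X k * Y k" for k
      proof (cases "J \<le> k + 1")
        case True
        have "X k * sqrt (real (k + 2)) = cmod (b (k + 1))"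
          by (simp add: X_def a_def bergman_weight_def real_sqrt_mult real_sqrt_divide)
        then have "X k * Y k = real (k + 1) * cmod (b (k + 1)) * (1 / 2) ^ k"
          using True by (simp add: Y_def mult_ac)
        moreover have "cmod \<zeta> ^ k \<le> (1 / 2) ^ k" using \<zeta> by (intro power_mono) auto
        ultimately show ?thesis
          by (simp add: norm_mult norm_power mult_left_mono del: of_nat_add of_nat_Suc)
      next
        case False
        then show ?thesis using J[of "k + 1"] by (simp add: b_def Y_def)
      qed
      have "cmod (\<Sum>k<n. of_nat (k + 1) * b (k + 1) * \<zeta> ^ k) \<le> (\<Sum>k<n. X k * Y k)"
        by (intro sum_norm_le XY)
      then have "(cmod (\<Sum>k<n. of_nat (k + 1) * b (k + 1) * \<zeta> ^ k))\<^sup>2 \<le> (\<Sum>k<n. X k * Y k)\<^sup>2"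
        by (intro power_mono) auto
      also have "\<dots> \<le> (\<Sum>k<n. (X k)\<^sup>2) * (\<Sum>k<n. (Y k)\<^sup>2)" by (rule Cauchy_Schwarz_ineq_sum)
      also have "\<dots> \<le> suminf a * (taylor_const * (1 / 2) ^ J)"
      proof (intro mult_mono)
        have "(\<Sum>k<n. (X k)\<^sup>2) = (\<Sum>k\<in>Suc ` {..<n}. a k)"
          using a0 by (subst sum.reindex) (auto simp: X_def)
        also have "\<dots> \<le> suminf a" by (rule sum_le_suminf[OF sa]) (use a0 in auto)
        finally show "(\<Sum>k<n. (X k)\<^sup>2) \<le> suminf a" .
        define t where "t i = (real i)\<^sup>2 * real (i + 1) * 4 * (1 / 2) ^ i" for i
        have t0: "0 \<le> t i" for i by (simp add: t_def)
        have "(Y k)\<^sup>2 \<le> (1 / 2) ^ J * t (Suc k)" for k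
        proof (cases "J \<le> k + 1")
          case True
          have "(Y k)\<^sup>2 = (real (k + 1))\<^sup>2 * real (k + 2) * ((1 / 2) ^ k * (1 / 2) ^ k)"
            using True by (simp add: Y_def power_mult_distrib power2_eq_square[of "(1 / 2) ^ k"] power_divide power2_eq_square[of "2 ^ k"])
          also have "(1 / 2) ^ k * (1 / 2) ^ k = ((1 / 2) ^ Suc k * 4) * (1 / 2 :: real) ^ Suc k" by simp
          also have "(real (k + 1))\<^sup>2 * real (k + 2) * (((1 / 2) ^ Suc k * 4) * (1 / 2 :: real) ^ Suc k) = (1 / 2) ^ Suc k * t (Suc k)"
            by (simp add: t_def)
          also have "\<dots> \<le> (1 / 2) ^ J * t (Suc k)"
            using True t0 by (intro mult_right_mono power_decreasing) auto
          finally show ?thesis .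
        qed (simp add: Y_def t0)
        then have "(\<Sum>k<n. (Y k)\<^sup>2) \<le> (\<Sum>k<n. (1 / 2) ^ J * t (Suc k))" by (intro sum_mono)
        also have "\<dots> = (1 / 2) ^ J * (\<Sum>k\<in>Suc ` {..<n}. t k)"
          by (subst sum.reindex) (auto simp: sum_distrib_left)
        also have "(\<Sum>k\<in>Suc ` {..<n}. t k) \<le> taylor_const"
          unfolding taylor_const_def t_def by (rule sum_le_suminf[OF summable_taylor_const]) auto
        finally show "(\<Sum>k<n. (Y k)\<^sup>2) \<le> taylor_const * (1 / 2) ^ J" by (simp add: mult.commute)
        show "0 \<le> suminf a" using a0 by (intro suminf_nonneg sa)
      qed (auto intro!: sum_nonneg)
      finally show ?thesis .
    qed
    have "(\<lambda>n. (cmod (\<Sum>k<n. of_nat (k + 1) * b (k + 1) * \<zeta> ^ k))\<^sup>2) \<longlonglongrightarrow> (cmod (deriv F \<zeta>))\<^sup>2"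
      by (intro tendsto_intros lim)
    then have "(cmod (deriv F \<zeta>))\<^sup>2 \<le> suminf a * (taylor_const * (1 / 2) ^ J)"
      by (rule LIMSEQ_le_const2) (use part in auto)
    then have "s\<^sup>2 * (s\<^sup>2 * (cmod (deriv f w))\<^sup>2) \<le> s\<^sup>2 * (suminf a * (taylor_const * (1 / 2) ^ J))"
      unfolding dF by (intro mult_left_mono) (auto simp: norm_mult power_mult_distrib mult.commute)
    also have "\<dots> \<le> pi * (s\<^sup>2 * (suminf a * (taylor_const * (1 / 2) ^ J)))"
    proof -
      have "1 * (s\<^sup>2 * (suminf a * (taylor_const * (1 / 2) ^ J))) \<le> pi * (s\<^sup>2 * (suminf a * (taylor_const * (1 / 2) ^ J)))"
        using pi_gt3 less_imp_le[OF taylor_const_pos] a0 by (intro mult_right_mono mult_nonneg_nonneg suminf_nonneg sa) auto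
      then show ?thesis by simp
    qed
    finally have "s ^ 4 * (cmod (deriv f w))\<^sup>2 \<le> taylor_const * (1 / 2) ^ J * (pi * s\<^sup>2 * suminf a)"
      by (simp add: mult_ac power2_eq_square eval_nat_numeral)
    then have "ennreal (s ^ 4 * (cmod (deriv f w))\<^sup>2) \<le> ennreal (taylor_const * (1 / 2) ^ J * (pi * s\<^sup>2 * suminf a))"
      by (rule ennreal_leI)
    also have "\<dots> = ennreal (taylor_const * (1 / 2) ^ J) * (ennreal (pi * s\<^sup>2) * (\<Sum>k. ennreal (a k)))"
      unfolding suminf_ennreal2[OF a0 sa] using kpos a0 sa by (simp add: ennreal_mult suminf_nonneg)
    finally show ?thesis unfolding P .
  qed
qed

section \<open>Polynomials and bounded functionals on the Bergman space\<close>

definition monomial :: "nat \<Rightarrow> complex \<Rightarrow> complex" where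
  "monomial n = (\<lambda>z. if z \<in> unit_disk then z ^ n else 0)"

lemma monomial_holomorphic: "monomial n holomorphic_on unit_disk"
  by (rule holomorphic_transform[of "\<lambda>z. z ^ n"]) (auto simp: monomial_def intro: holomorphic_intros)

lemma taylor_coeff_monomial: "taylor_coeff (monomial n) k = (if k = n then 1 else 0)"
proof (rule taylor_coeff_eqI)
  fix z :: complex assume "z \<in> unit_disk"
  moreover have "(\<lambda>k. (if k = n then 1 else 0) * z ^ k) sums (z ^ n)"
    using sums_single[of n "\<lambda>k. z ^ k"] by (rule sums_cong[THEN iffD1, rotated]) auto
  ultimately show "(\<lambda>k. (if k = n then 1 else 0) * z ^ k) sums monomial n z" by (simp add: monomial_def)
qed

lemma monomial_bergman: "monomial n \<in> bergman_space"
proof -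
  have "summable (\<lambda>k. bergman_weight k * (cmod (taylor_coeff (monomial n) k))\<^sup>2)"
    by (rule summable_finite[of "{n}"]) (auto simp: taylor_coeff_monomial)
  then show ?thesis
    unfolding bergman_space_wspace wspace_def using monomial_holomorphic by (auto simp: monomial_def)
qed

definition taylor_poly :: "(nat \<Rightarrow> complex) \<Rightarrow> nat \<Rightarrow> complex \<Rightarrow> complex" where
  "taylor_poly c n = (\<Sum>i<n. cscale (c i) (monomial i))"

lemma taylor_poly_bergman: "taylor_poly c n \<in> bergman_space"
  unfolding taylor_poly_def by (intro bergman.V_sum bergman.V_scale monomial_bergman)

lemma taylor_coeff_taylor_poly: "taylor_coeff (taylor_poly c n) k = (if k < n then c k else 0)"
proof (induction n)
  case 0
  have "taylor_coeff 0 k = 0" by (rule taylor_coeff_eqI) (simp add: zero_fun_def)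
  then show ?case unfolding taylor_poly_def lessThan_0 sum.empty by (simp only: not_less0 if_False)
next
  case (Suc n)
  have h: "taylor_poly c n holomorphic_on unit_disk" "cscale (c n) (monomial n) holomorphic_on unit_disk"
    using taylor_poly_bergman[of c n] bergman.V_scale[OF monomial_bergman[of n], of "c n"]
    by (auto simp: bergman_space_def)
  have "taylor_poly c (Suc n) = taylor_poly c n + cscale (c n) (monomial n)" by (simp add: taylor_poly_def)
  then have "taylor_coeff (taylor_poly c (Suc n)) k = taylor_coeff (taylor_poly c n) k + c n * taylor_coeff (monomial n) k"
    using taylor_coeff_add[OF h] taylor_coeff_scale[OF monomial_holomorphic] by simp
  then show ?case using Suc by (simp add: taylor_coeff_monomial less_Suc_eq)
qed

lemma bergman_norm_sq:
  "f \<in> bergman_space \<Longrightarrow> (bergman_norm f)\<^sup>2 = (\<Sum>k. bergman_weight k * (cmod (taylor_coeff f k))\<^sup>2)"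
  using wnorm_sq[of f bergman_weight] bergman_norm_wnorm[of f]
  by (simp add: bergman_space_wspace bergman_weight_def)

text \<open>Completeness of the Bergman space on the level of coefficients. For convergence in the
  disk each term is split as \<open>x * t\<close>, where the squares of the \<open>t\<close> sum to
  \<open>1 / (1 - |z|^2)^2\<close>.\<close>

lemma power_series_bergman:
  assumes s: "summable (\<lambda>k. bergman_weight k * (cmod (a k))\<^sup>2)"
  obtains y where "y \<in> bergman_space" "\<And>k. taylor_coeff y k = a k"
proof -
  have conv: "summable (\<lambda>k. a k * z ^ k)" if z: "z \<in> unit_disk" for z
  proof (rule summable_comparison_test'[of _ 0])
    have "(\<lambda>k. of_nat (Suc k) * ((cmod z)\<^sup>2) ^ k) sums (1 / (1 - (cmod z)\<^sup>2)\<^sup>2)"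
      by (rule geometric_deriv_sums) (use z in \<open>simp add: power_less_one_iff abs_square_less_1\<close>)
    then have "summable (\<lambda>k. real (Suc k) * ((cmod z)\<^sup>2) ^ k)" by (simp add: sums_iff)
    then show "summable (\<lambda>k. bergman_weight k * (cmod (a k))\<^sup>2 + real (Suc k) * ((cmod z)\<^sup>2) ^ k)"
      by (intro summable_add s)
    fix k
    define x where "x = cmod (a k) / sqrt (real (Suc k))"
    define t where "t = sqrt (real (Suc k)) * cmod z ^ k"
    have "x * t = cmod (a k) * cmod z ^ k" by (simp add: x_def t_def)
    moreover have "x\<^sup>2 = bergman_weight k * (cmod (a k))\<^sup>2"
      by (simp add: x_def power_divide bergman_weight_def)
    moreover have "t\<^sup>2 = real (Suc k) * ((cmod z)\<^sup>2) ^ k"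
      by (simp add: t_def power_mult_distrib power_mult[symmetric] mult.commute[of k 2])
    moreover have "x * t \<le> x\<^sup>2 + t\<^sup>2"
    proof -
      have "0 \<le> x * t" by (simp add: x_def t_def)
      then show ?thesis using sum_squares_bound[of x t] by linarith
    qed
    ultimately show "norm (a k * z ^ k) \<le> bergman_weight k * (cmod (a k))\<^sup>2 + real (Suc k) * ((cmod z)\<^sup>2) ^ k"
      by (simp add: norm_mult norm_power)
  qed
  define y where "y z = (if z \<in> unit_disk then (\<Sum>k. a k * z ^ k) else 0)" for z
  have sums: "(\<lambda>k. a k * z ^ k) sums y z" if "z \<in> unit_disk" for z
    using summable_sums[OF conv[OF that]] that by (simp add: y_def)
  have ty: "taylor_coeff y k = a k" for k by (rule taylor_coeff_eqI) (rule sums)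
  have "y \<in> bergman_space"
    unfolding bergman_space_wspace wspace_def
  proof (intro CollectI conjI allI impI)
    show "y holomorphic_on unit_disk" by (rule holomorphic_on_disk_sumsI[OF sums])
  qed (use s ty in \<open>simp_all add: y_def\<close>)
  then show ?thesis using that ty by blast
qed

text \<open>The representing function is written down, since the values of \<open>L\<close> on
  monomials dictate its coefficients. Testing \<open>L\<close> on its own truncations gives square
  summability, and the density of polynomials extends the formula to every \<open>f\<close>.\<close>

lemma bergman_riesz:
  fixes L :: "(complex \<Rightarrow> complex) \<Rightarrow> complex"
  assumes add: "\<And>f g. f \<in> bergman_space \<Longrightarrow> g \<in> bergman_space \<Longrightarrow> L (f + g) = L f + L g"
    and scale: "\<And>c f. f \<in> bergman_space \<Longrightarrow> L (cscale c f) = c * L f"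
    and bd: "\<And>f. f \<in> bergman_space \<Longrightarrow> cmod (L f) \<le> C * bergman_norm f" and C: "0 \<le> C"
  obtains y where "y \<in> bergman_space" "\<And>f. f \<in> bergman_space \<Longrightarrow> L f = wip bergman_weight f y"
proof -
  define l where "l k = L (monomial k)" for k
  define a where "a k = cnj (l k) * of_nat (k + 1)" for k
  have L0: "L 0 = 0" using scale[OF bergman.V_zero, of 0] by simp
  have Lpart: "L (taylor_poly c n) = (\<Sum>k<n. c k * l k)" for c n
  proof (induction n)
    case (Suc n)
    have "taylor_poly c (Suc n) = taylor_poly c n + cscale (c n) (monomial n)" by (simp add: taylor_poly_def)
    then have "L (taylor_poly c (Suc n)) = L (taylor_poly c n) + L (cscale (c n) (monomial n))"
      by (simp only: add[OF taylor_poly_bergman bergman.V_scale[OF monomial_bergman]])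
    then show ?case unfolding Suc scale[OF monomial_bergman] by (simp add: l_def)
  next
    case 0
    show ?case unfolding taylor_poly_def lessThan_0 sum.empty by (rule L0)
  qed
  define q where "q k = bergman_weight k * (cmod (a k))\<^sup>2" for k
  have q0: "0 \<le> q k" for k by (simp add: q_def bergman_weight_def)
  have al: "a k * l k = of_real (q k)" for k
  proof -
    have "(cmod (a k))\<^sup>2 = (cmod (l k))\<^sup>2 * (real (k + 1))\<^sup>2"
      by (simp add: a_def norm_mult power_mult_distrib del: of_nat_add of_nat_Suc)
    then have "q k = real (k + 1) * (cmod (l k))\<^sup>2"
      by (simp add: q_def bergman_weight_def power2_eq_square)
    then show ?thesis
      unfolding a_def by (simp only: of_real_mult complex_norm_square of_real_of_nat_eq mult_ac)
  qed
  \<comment> \<open>\<open>S\<close> is both the value of \<open>L\<close> on the truncation and the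
    squared norm of the truncation, so boundedness of \<open>L\<close> reads
    \<open>S^2 \<le> C^2 * S\<close>.\<close>
  have bound: "(\<Sum>k<n. q k) \<le> C\<^sup>2" for n
  proof -
    define S where "S = (\<Sum>k<n. q k)"
    have S0: "0 \<le> S" unfolding S_def using q0 by (intro sum_nonneg) auto
    have "L (taylor_poly a n) = of_real S" unfolding Lpart S_def using al by simp
    then have 1: "S \<le> C * bergman_norm (taylor_poly a n)"
      using bd[OF taylor_poly_bergman[of a n]] S0 by simp
    have "(bergman_norm (taylor_poly a n))\<^sup>2 = (\<Sum>k. if k < n then q k else 0)"
      unfolding bergman_norm_sq[OF taylor_poly_bergman] taylor_coeff_taylor_poly by (intro suminf_cong) (simp add: q_def)
    also have "\<dots> = S"
      unfolding S_def by (subst suminf_finite[of "{..<n}"]) auto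
    finally have 2: "(bergman_norm (taylor_poly a n))\<^sup>2 = S" .
    have "S\<^sup>2 \<le> (C * bergman_norm (taylor_poly a n))\<^sup>2" using 1 S0 by (intro power_mono) auto
    also have "\<dots> = C\<^sup>2 * S" by (simp add: power_mult_distrib 2)
    finally have 3: "S * S \<le> C\<^sup>2 * S" by (simp add: power2_eq_square)
    show ?thesis
    proof (cases "S = 0")
      case True
      then show ?thesis unfolding S_def by simp
    next
      case False
      then have "S \<le> C\<^sup>2" using 3 S0 by (simp add: mult_le_cancel_right)
      then show ?thesis by (simp add: S_def)
    qed
  qed
  have sq: "summable (\<lambda>k. bergman_weight k * (cmod (a k))\<^sup>2)"
    unfolding q_def[symmetric] by (rule summableI_nonneg_bounded[of _ "C\<^sup>2"]) (use q0 bound in auto)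
  obtain y where y: "y \<in> bergman_space" "\<And>k. taylor_coeff y k = a k"
    using power_series_bergman[OF sq] by auto
  have "L f = wip bergman_weight f y" if f: "f \<in> bergman_space" for f
  proof -
    define p where "p n = taylor_poly (taylor_coeff f) n" for n
    define b where "b k = bergman_weight k * (cmod (taylor_coeff f k))\<^sup>2" for k
    have sb: "summable b" using f unfolding b_def bergman_space_wspace wspace_def by simp
    have hol: "f holomorphic_on unit_disk" "p n holomorphic_on unit_disk" for n
      using f taylor_poly_bergman[of "taylor_coeff f" n] by (auto simp: bergman_space_def p_def)
    have n2: "(bergman_norm (f - p n))\<^sup>2 = suminf b - (\<Sum>k<n. b k)" for n
    proof -
      have e: "(f - p n) + p n = f" by simp
      have d: "f - p n \<in> bergman_space" unfolding p_def by (intro bergman.V_diff f taylor_poly_bergman)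
      have "taylor_coeff f k = taylor_coeff (f - p n) k + taylor_coeff (p n) k" for k
      proof -
        have "f - p n holomorphic_on unit_disk" using d by (simp add: bergman_space_def)
        from taylor_coeff_add[OF this hol(2)[of n]] show ?thesis unfolding e .
      qed
      then have t0: "taylor_coeff (f - p n) k = taylor_coeff f k - taylor_coeff (p n) k" for k
        unfolding eq_diff_eq by (rule sym)
      have t: "taylor_coeff (f - p n) k = (if k < n then 0 else taylor_coeff f k)" for k
        using t0[of k] unfolding p_def taylor_coeff_taylor_poly by simp
      have "(bergman_norm (f - p n))\<^sup>2 = (\<Sum>k. b k - (if k < n then b k else 0))"
        unfolding bergman_norm_sq[OF d] t b_def by (intro suminf_cong) simp
      also have "\<dots> = suminf b - (\<Sum>k. if k < n then b k else 0)"
        by (rule suminf_diff[symmetric, OF sb]) (rule summable_finite[of "{..<n}"], auto)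
      also have "(\<Sum>k. if k < n then b k else 0) = (\<Sum>k<n. b k)"
        by (subst suminf_finite[of "{..<n}"]) auto
      finally show ?thesis .
    qed
    have "(\<lambda>n. suminf b - (\<Sum>k<n. b k)) \<longlonglongrightarrow> suminf b - suminf b"
      by (intro tendsto_intros summable_LIMSEQ sb)
    then have "(\<lambda>n. sqrt ((bergman_norm (f - p n))\<^sup>2)) \<longlonglongrightarrow> sqrt 0"
      unfolding n2 by (intro tendsto_real_sqrt) simp
    moreover have "sqrt ((bergman_norm (f - p n))\<^sup>2) = bergman_norm (f - p n)" for n
      using bergman.nrm_nonneg[OF bergman.V_diff[OF f taylor_poly_bergman]] by (simp add: p_def)
    ultimately have "(\<lambda>n. bergman_norm (f - p n)) \<longlonglongrightarrow> 0" by simp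
    then have "(\<lambda>n. C * bergman_norm (f - p n)) \<longlonglongrightarrow> C * 0" by (intro tendsto_intros)
    then have "(\<lambda>n. L (f - p n)) \<longlonglongrightarrow> 0"
      using bd[OF bergman.V_diff[OF f taylor_poly_bergman]] unfolding p_def
      by (intro Lim_null_comparison[of "\<lambda>n. L (f - taylor_poly (taylor_coeff f) n)"]) auto
    moreover have "L (f - p n) = L f - L (p n)" for n
    proof -
      have "L (f - p n + p n) = L (f - p n) + L (p n)"
        unfolding p_def by (intro add bergman.V_diff f taylor_poly_bergman)
      then show ?thesis by simp
    qed
    ultimately have "(\<lambda>n. L f - (L f - L (p n))) \<longlonglongrightarrow> L f - 0" by (intro tendsto_intros) simp
    then have l1: "(\<lambda>n. L (p n)) \<longlonglongrightarrow> L f" by simp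
    have w: "of_real (bergman_weight k) * taylor_coeff f k * cnj (taylor_coeff y k) = taylor_coeff f k * l k" for k
      by (simp add: y(2) a_def bergman_weight_def del: of_nat_add of_nat_Suc)
    have "summable (\<lambda>k. of_real (bergman_weight k) * taylor_coeff f k * cnj (taylor_coeff y k))"
      using f y(1) unfolding bergman_space_wspace wspace_def
      by (intro summable_product_l2) (auto simp: bergman_weight_def)
    from summable_LIMSEQ[OF this]
    have "(\<lambda>n. \<Sum>k<n. taylor_coeff f k * l k) \<longlonglongrightarrow> wip bergman_weight f y"
      unfolding wip_def w .
    then have "(\<lambda>n. L (p n)) \<longlonglongrightarrow> wip bergman_weight f y" unfolding p_def Lpart .
    with l1 show ?thesis by (rule LIMSEQ_unique)
  qed
  then show ?thesis using that y(1) by blast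
qed

section \<open>Composition operators on the Bergman space\<close>

lemma disk_preimage_measurable:
  assumes "\<phi> holomorphic_on unit_disk" "R \<in> sets borel"
  shows "{z \<in> unit_disk. \<phi> z \<in> R} \<in> sets borel"
proof -
  have "\<phi> \<in> borel_measurable (restrict_space borel unit_disk)"
    by (rule borel_measurable_continuous_on_restrict[OF holomorphic_on_imp_continuous_on[OF assms(1)]])
  then have "\<phi> -` R \<inter> space (restrict_space borel unit_disk) \<in> sets (restrict_space borel unit_disk)"
    using assms(2) by (rule measurable_sets)
  then have "\<phi> -` R \<inter> unit_disk \<in> sets borel"
    by (simp add: sets_restrict_space_iff space_restrict_space)
  moreover have "\<phi> -` R \<inter> unit_disk = {z \<in> unit_disk. \<phi> z \<in> R}" by auto
  ultimately show ?thesis by simp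
qed

lemma local_coeff_add:
  assumes "f \<in> bergman_space" "g \<in> bergman_space" "0 < s" "ball c s \<subseteq> unit_disk"
  shows "local_coeff c s (f + g) k = local_coeff c s f k + local_coeff c s g k"
proof -
  have "(\<lambda>\<zeta>. (f + g) (c + of_real s * \<zeta>)) = (\<lambda>\<zeta>. f (c + of_real s * \<zeta>)) + (\<lambda>\<zeta>. g (c + of_real s * \<zeta>))"
    by (simp add: fun_eq_iff)
  then show ?thesis
    unfolding local_coeff_def using assms by (simp only: taylor_coeff_add local_coeff_holomorphic bergman_space_def mem_Collect_eq)
qed

lemma local_coeff_scale:
  assumes "f \<in> bergman_space" "0 < s" "ball c s \<subseteq> unit_disk"
  shows "local_coeff c s (cscale a f) k = a * local_coeff c s f k"
proof -
  have "(\<lambda>\<zeta>. cscale a f (c + of_real s * \<zeta>)) = cscale a (\<lambda>\<zeta>. f (c + of_real s * \<zeta>))"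
    by (simp add: fun_eq_iff cscale_def)
  then show ?thesis
    unfolding local_coeff_def using assms by (simp only: taylor_coeff_scale local_coeff_holomorphic bergman_space_def mem_Collect_eq)
qed

lemma local_coeff_bound:
  assumes f: "f holomorphic_on unit_disk" and s: "0 < s" "ball c s \<subseteq> unit_disk"
  shows "ennreal (pi * s\<^sup>2 * (bergman_weight k * (cmod (local_coeff c s f k))\<^sup>2)) \<le>
    (\<integral>\<^sup>+z. ennreal ((cmod (f z))\<^sup>2) * indicator (ball c s) z \<partial>lborel)"
proof -
  have "ennreal (bergman_weight k * (cmod (local_coeff c s f k))\<^sup>2) = (\<Sum>j\<in>{k}. ennreal (bergman_weight j * (cmod (local_coeff c s f j))\<^sup>2))"
    by simp
  also have "\<dots> \<le> (\<Sum>j. ennreal (bergman_weight j * (cmod (local_coeff c s f j))\<^sup>2))" by (rule sum_le_suminf) auto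
  finally have "ennreal (pi * s\<^sup>2) * ennreal (bergman_weight k * (cmod (local_coeff c s f k))\<^sup>2) \<le>
      ennreal (pi * s\<^sup>2) * (\<Sum>j. ennreal (bergman_weight j * (cmod (local_coeff c s f j))\<^sup>2))"
    by (rule mult_left_mono) simp
  then show ?thesis
    unfolding local_parseval[OF f s] by (subst ennreal_mult) (auto simp: bergman_weight_def)
qed

lemma ball_nn_integral_le:
  assumes "f \<in> bergman_space" "ball c s \<subseteq> unit_disk"
  shows "(\<integral>\<^sup>+z. ennreal ((cmod (f z))\<^sup>2) * indicator (ball c s) z \<partial>lborel) \<le> ennreal (pi * (bergman_norm f)\<^sup>2)"
  unfolding bergman_nn_integral[OF assms(1), symmetric]
  by (intro nn_integral_mono mult_left_mono indicator_leI) (use assms(2) in auto)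

lemma local_coeff_bounded:
  assumes f: "f \<in> bergman_space" and s: "0 < s" "ball c s \<subseteq> unit_disk"
  shows "cmod (local_coeff c s f k) \<le> sqrt (real (k + 1)) / s * bergman_norm f"
proof -
  have hol: "f holomorphic_on unit_disk" using f by (simp add: bergman_space_def)
  have "ennreal (pi * s\<^sup>2 * (bergman_weight k * (cmod (local_coeff c s f k))\<^sup>2)) \<le> ennreal (pi * (bergman_norm f)\<^sup>2)"
    by (rule order.trans[OF local_coeff_bound[OF hol s] ball_nn_integral_le[OF f s(2)]])
  then have "pi * s\<^sup>2 * (bergman_weight k * (cmod (local_coeff c s f k))\<^sup>2) \<le> pi * (bergman_norm f)\<^sup>2"
    by (subst (asm) ennreal_le_iff) auto
  then have "pi * (s\<^sup>2 * (cmod (local_coeff c s f k))\<^sup>2) \<le> pi * (real (k + 1) * (bergman_norm f)\<^sup>2)"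
    by (simp add: bergman_weight_def field_simps)
  then have "s\<^sup>2 * (cmod (local_coeff c s f k))\<^sup>2 \<le> real (k + 1) * (bergman_norm f)\<^sup>2"
    by (rule mult_left_le_imp_le) simp
  then have "(cmod (local_coeff c s f k))\<^sup>2 \<le> (sqrt (real (k + 1)) / s * bergman_norm f)\<^sup>2"
    using s(1) by (simp add: power_mult_distrib power_divide field_simps)
  then show ?thesis
    by (rule power2_le_imp_le) (use s(1) bergman.nrm_nonneg[OF f] in auto)
qed

lemma local_coeff_0: "f holomorphic_on unit_disk \<Longrightarrow> 0 < s \<Longrightarrow> ball c s \<subseteq> unit_disk \<Longrightarrow> local_coeff c s f 0 = f c"
  using taylor_coeff_0[OF local_coeff_holomorphic[of f s c]] by (simp add: local_coeff_def)

text \<open>A weak form of Schwarz-Pick from Cauchy's estimate on discs inside the unit disk, with 4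
  bounding \<open>(1 + |z|)^2\<close>. It serves to make the masses \<open>V n\<close>
  finite.\<close>

lemma deriv_self_map_bound:
  assumes \<phi>: "\<phi> holomorphic_on unit_disk" "\<phi> ` unit_disk \<subseteq> unit_disk" and z: "z \<in> unit_disk"
  shows "(cmod (deriv \<phi> z))\<^sup>2 * (1 - (cmod z)\<^sup>2)\<^sup>2 \<le> 4"
proof -
  define r where "r = 1 - cmod z"
  have r: "0 < r" using z by (simp add: r_def)
  have sub: "ball z r \<subseteq> unit_disk"
  proof
    fix w assume "w \<in> ball z r"
    then have "cmod (w - z) < r" by (simp add: dist_norm norm_minus_commute)
    then show "w \<in> unit_disk" using norm_triangle_ineq[of z "w - z"] by (simp add: r_def)
  qed
  have le: "r * cmod (deriv \<phi> z) \<le> 1"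
  proof -
    have "\<rho> * cmod (deriv \<phi> z) \<le> 1" if \<rho>: "0 < \<rho>" "\<rho> < r" for \<rho>
    proof -
      have cb: "cball z \<rho> \<subseteq> unit_disk" using sub \<rho> by (auto simp: subset_iff)
      have "cmod ((deriv ^^ 1) \<phi> z) \<le> fact 1 * 1 / \<rho> ^ 1"
      proof (rule Cauchy_inequality)
        show "\<phi> holomorphic_on ball z \<rho>" using cb by (intro holomorphic_on_subset[OF \<phi>(1)]) auto
        show "continuous_on (cball z \<rho>) \<phi>"
          by (rule holomorphic_on_imp_continuous_on[OF holomorphic_on_subset[OF \<phi>(1) cb]])
        show "cmod (\<phi> w) \<le> 1" if "cmod (z - w) = \<rho>" for w
        proof -
          have "w \<in> unit_disk" using that cb by (auto simp: dist_norm)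
          then have "\<phi> w \<in> unit_disk" using \<phi>(2) by blast
          then show ?thesis by simp
        qed
      qed (use \<rho> in auto)
      then show ?thesis using \<rho> by (simp add: field_simps)
    qed
    then have "\<forall>\<^sub>F \<rho> in at_left r. \<rho> * cmod (deriv \<phi> z) \<le> 1"
      using eventually_at_left_real[OF r] by (auto elim!: eventually_mono)
    moreover have "((\<lambda>\<rho>. \<rho> * cmod (deriv \<phi> z)) \<longlongrightarrow> r * cmod (deriv \<phi> z)) (at_left r)"
      by (intro tendsto_intros)
    ultimately show ?thesis by (intro tendsto_upperbound) auto
  qed
  have "1 - (cmod z)\<^sup>2 = r * (1 + cmod z)" by (simp add: r_def power2_eq_square algebra_simps)
  then have "cmod (deriv \<phi> z) * (1 - (cmod z)\<^sup>2) = (r * cmod (deriv \<phi> z)) * (1 + cmod z)" by simp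
  also have "\<dots> \<le> 1 * 2" using le z r by (intro mult_mono) auto
  finally have "(cmod (deriv \<phi> z) * (1 - (cmod z)\<^sup>2))\<^sup>2 \<le> 2\<^sup>2"
    using z by (intro power_mono mult_nonneg_nonneg) (auto simp: power_le_one)
  then show ?thesis by (simp add: power_mult_distrib)
qed

text \<open>The properties of a decomposition that the norm estimates rest on: a cell lies in a disc
  of half the radius, where \<open>local_deriv_bound\<close> applies, and at most \<open>M\<close>
  of the full discs meet at a point, so the local masses add up to at most \<open>M\<close> times
  the total mass.\<close>

locale disk_cells =
  fixes \<phi> :: "complex \<Rightarrow> complex" and cell :: "complex \<Rightarrow> nat"
    and c :: "nat \<Rightarrow> complex" and s :: "nat \<Rightarrow> real" and M :: nat
  assumes \<phi>_hol: "\<phi> holomorphic_on unit_disk" and \<phi>_maps: "\<phi> ` unit_disk \<subseteq> unit_disk"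
    and cell_meas: "\<And>n. {w \<in> unit_disk. cell w = n} \<in> sets borel"
    and s_pos: "\<And>n. n \<in> cell ` unit_disk \<Longrightarrow> 0 < s n"
    and cball_sub: "\<And>n. n \<in> cell ` unit_disk \<Longrightarrow> cball (c n) (s n) \<subseteq> unit_disk"
    and cell_sub: "\<And>w. w \<in> unit_disk \<Longrightarrow> dist (c (cell w)) w \<le> s (cell w) / 2"
    and overlap: "\<And>\<zeta>. finite {n \<in> cell ` unit_disk. \<zeta> \<in> ball (c n) (s n)} \<and>
        card {n \<in> cell ` unit_disk. \<zeta> \<in> ball (c n) (s n)} \<le> M"
begin

abbreviation active :: "nat set" where "active \<equiv> cell ` unit_disk"

lemma ball_sub: "n \<in> active \<Longrightarrow> ball (c n) (s n) \<subseteq> unit_disk"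
  using cball_sub[of n] ball_subset_cball[of "c n" "s n"] by blast

definition V :: "nat \<Rightarrow> ennreal" where
  "V n = (\<integral>\<^sup>+z. ennreal ((cmod (deriv \<phi> z))\<^sup>2 * (1 - (cmod z)\<^sup>2)\<^sup>2) * indicator {z \<in> unit_disk. cell (\<phi> z) = n} z \<partial>lborel)"

text \<open>The power is the one in \<open>local_deriv_bound\<close>. It makes the mass scale free:
  for the identity map and dyadic cells, the area and the weight \<open>(1 - |z|^2)^2\<close> are
  each of order \<open>s^2\<close>.\<close>

definition \<tau> :: "nat \<Rightarrow> real" where
  "\<tau> n = enn2real (V n) / s n ^ 4"

lemma preimage_cell: "{z \<in> unit_disk. cell (\<phi> z) = n} \<in> sets borel"
proof -
  have "{z \<in> unit_disk. cell (\<phi> z) = n} = {z \<in> unit_disk. \<phi> z \<in> {w \<in> unit_disk. cell w = n}}"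
    using \<phi>_maps by blast
  then show ?thesis using disk_preimage_measurable[OF \<phi>_hol cell_meas[of n]] by simp
qed

lemma V_finite: "V n < \<infinity>"
proof -
  have "V n \<le> (\<integral>\<^sup>+z. 4 * indicator (ball (0::complex) 1) z \<partial>lborel)"
    unfolding V_def
  proof (rule nn_integral_mono)
    fix z :: complex
    show "ennreal ((cmod (deriv \<phi> z))\<^sup>2 * (1 - (cmod z)\<^sup>2)\<^sup>2) * indicator {z \<in> unit_disk. cell (\<phi> z) = n} z
        \<le> 4 * indicator (ball (0::complex) 1) z"
    proof (cases "z \<in> unit_disk")
      case True
      have "ennreal ((cmod (deriv \<phi> z))\<^sup>2 * (1 - (cmod z)\<^sup>2)\<^sup>2) \<le> ennreal 4"
        by (rule ennreal_leI[OF deriv_self_map_bound[OF \<phi>_hol \<phi>_maps True]])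
      then show ?thesis using True by (auto simp: indicator_def)
    qed simp
  qed
  also have "\<dots> = 4 * emeasure lborel (ball (0::complex) 1)" by (simp add: nn_integral_cmult_indicator)
  also have "\<dots> < \<infinity>" using emeasure_bounded_finite[of "ball (0::complex) 1"] by (simp add: ennreal_mult_less_top)
  finally show ?thesis .
qed

lemma \<tau>_nonneg: "n \<in> active \<Longrightarrow> 0 \<le> \<tau> n"
  using s_pos[of n] by (simp add: \<tau>_def)

definition local_mass :: "(complex \<Rightarrow> complex) \<Rightarrow> nat \<Rightarrow> ennreal" where
  "local_mass f n = (if n \<in> active then \<integral>\<^sup>+z. ennreal ((cmod (f z))\<^sup>2) * indicator (ball (c n) (s n)) z \<partial>lborel else 0)"

text \<open>By the chain rule, Littlewood-Paley for \<open>f \<circ> \<phi>\<close> integrates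
  \<open>|deriv f (\<phi> z)|^2\<close> against the density that defines \<open>V\<close>. Sorting
  the points by the cell of \<open>\<phi> z\<close> makes \<open>local_deriv_bound\<close>
  applicable, and division by its \<open>s^4\<close> turns \<open>V\<close> into
  \<open>\<tau>\<close>.\<close>

lemma composition_nn_integral_bound:
  assumes f: "f holomorphic_on unit_disk"
    and J: "\<And>n k. n \<in> active \<Longrightarrow> k < J n \<Longrightarrow> local_coeff (c n) (s n) f k = 0"
  shows "(\<integral>\<^sup>+z. ennreal ((cmod (f (\<phi> z)))\<^sup>2) * indicator unit_disk z \<partial>lborel) \<le>
    ennreal (pi * (cmod (f (\<phi> 0)))\<^sup>2) +
    ennreal (3 / 2) * (\<Sum>n. ennreal (taylor_const * (\<tau> n * (1 / 2) ^ J n)) * local_mass f n)"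
proof -
  define g where "g z = f (\<phi> z)" for z
  have g: "g holomorphic_on unit_disk"
    unfolding g_def using holomorphic_on_compose_gen[OF \<phi>_hol f \<phi>_maps] by (simp add: o_def)
  define u where "u z = ennreal ((cmod (deriv \<phi> z))\<^sup>2 * (1 - (cmod z)\<^sup>2)\<^sup>2)" for z
  define H where "H z = ennreal ((cmod (deriv g z))\<^sup>2 * (1 - (cmod z)\<^sup>2)\<^sup>2)" for z
  define E where "E n = {z \<in> unit_disk. cell (\<phi> z) = n}" for n
  have dg: "deriv g z = deriv f (\<phi> z) * deriv \<phi> z" if z: "z \<in> unit_disk" for z
  proof -
    have "\<phi> z \<in> unit_disk" using \<phi>_maps z by blast
    then have "(f has_field_derivative deriv f (\<phi> z)) (at (\<phi> z))" by (intro holomorphic_derivI[OF f]) auto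
    moreover have "(\<phi> has_field_derivative deriv \<phi> z) (at z)" by (rule holomorphic_derivI[OF \<phi>_hol _ z]) auto
    ultimately have "(g has_field_derivative deriv f (\<phi> z) * deriv \<phi> z) (at z)"
      unfolding g_def by (rule DERIV_chain2)
    then show ?thesis by (rule DERIV_imp_deriv)
  qed
  have meas: "(\<lambda>z. ennreal ((cmod (deriv F z))\<^sup>2 * (1 - (cmod z)\<^sup>2)\<^sup>2) * indicator (E n) z) \<in> borel_measurable borel"
    if F: "F holomorphic_on unit_disk" for F n
  proof -
    have "deriv F holomorphic_on unit_disk" by (intro holomorphic_deriv F) auto
    from disk_measurable[OF this]
    have "(\<lambda>z. ennreal ((cmod (indicator unit_disk z *\<^sub>R deriv F z))\<^sup>2 * (1 - (cmod z)\<^sup>2)\<^sup>2) * indicator (E n) z) \<in> borel_measurable borel"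
      using preimage_cell[of n, folded E_def] by measurable
    moreover have "(\<lambda>z. ennreal ((cmod (indicator unit_disk z *\<^sub>R deriv F z))\<^sup>2 * (1 - (cmod z)\<^sup>2)\<^sup>2) * indicator (E n) z) =
        (\<lambda>z. ennreal ((cmod (deriv F z))\<^sup>2 * (1 - (cmod z)\<^sup>2)\<^sup>2) * indicator (E n) z)"
      by (auto simp: fun_eq_iff indicator_def E_def)
    ultimately show ?thesis by simp
  qed
  have "(\<integral>\<^sup>+z. H z * indicator unit_disk z \<partial>lborel) = (\<integral>\<^sup>+z. (\<Sum>n. H z * indicator (E n) z) \<partial>lborel)"
  proof (rule nn_integral_cong)
    fix z
    have "(\<Sum>n. indicator (E n) z) = (indicator unit_disk z :: ennreal)"
    proof (cases "z \<in> unit_disk")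
      case True
      then have "(\<Sum>n. indicator (E n) z) = (\<Sum>n\<in>{cell (\<phi> z)}. indicator (E n) z :: ennreal)"
        by (intro suminf_finite) (auto simp: E_def)
      then show ?thesis using True by (simp add: E_def)
    qed (simp add: E_def)
    then show "H z * indicator unit_disk z = (\<Sum>n. H z * indicator (E n) z)" by simp
  qed
  also have "\<dots> = (\<Sum>n. \<integral>\<^sup>+z. H z * indicator (E n) z \<partial>lborel)"
    by (rule nn_integral_suminf) (use meas[OF g] in \<open>simp add: H_def\<close>)
  also have "\<dots> \<le> (\<Sum>n. ennreal (taylor_const * (\<tau> n * (1 / 2) ^ J n)) * local_mass f n)"
  proof (intro suminf_le allI)
    fix n
    show "(\<integral>\<^sup>+z. H z * indicator (E n) z \<partial>lborel) \<le> ennreal (taylor_const * (\<tau> n * (1 / 2) ^ J n)) * local_mass f n"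
    proof (cases "n \<in> active")
      case False
      have "z \<notin> E n" for z
      proof
        assume "z \<in> E n"
        then have "z \<in> unit_disk" "cell (\<phi> z) = n" by (auto simp: E_def)
        moreover from this have "\<phi> z \<in> unit_disk" using \<phi>_maps by blast
        ultimately show False using False by blast
      qed
      then have "E n = {}" by blast
      then show ?thesis by simp
    next
      case n: True
      define A where "A = ennreal (taylor_const * (1 / 2) ^ J n / s n ^ 4) * local_mass f n"
      have s4: "0 < s n ^ 4" using s_pos[OF n] by simp
      have "H z * indicator (E n) z \<le> A * (u z * indicator (E n) z)" for z
      proof (cases "z \<in> E n")
        case True
        then have z: "z \<in> unit_disk" "cell (\<phi> z) = n" by (auto simp: E_def)
        then have "\<phi> z \<in> unit_disk" using \<phi>_maps by blast
        then have d: "dist (c n) (\<phi> z) \<le> s n / 2" using cell_sub z(2) by blast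
        have "ennreal (s n ^ 4 * (cmod (deriv f (\<phi> z)))\<^sup>2) \<le> ennreal (taylor_const * (1 / 2) ^ J n) * local_mass f n"
          using local_deriv_bound[OF f s_pos[OF n] ball_sub[OF n] d J[OF n]] n by (simp add: local_mass_def)
        then have "ennreal (1 / s n ^ 4) * ennreal (s n ^ 4 * (cmod (deriv f (\<phi> z)))\<^sup>2) \<le>
            ennreal (1 / s n ^ 4) * (ennreal (taylor_const * (1 / 2) ^ J n) * local_mass f n)"
          by (rule mult_left_mono) simp
        moreover have "ennreal (1 / s n ^ 4) * ennreal (s n ^ 4 * (cmod (deriv f (\<phi> z)))\<^sup>2) = ennreal ((cmod (deriv f (\<phi> z)))\<^sup>2)"
          using s4 by (subst ennreal_mult[symmetric]) auto
        moreover have "ennreal (1 / s n ^ 4) * (ennreal (taylor_const * (1 / 2) ^ J n) * local_mass f n) = A"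
          unfolding A_def mult.assoc[symmetric] using s4 less_imp_le[OF taylor_const_pos]
          by (subst ennreal_mult[symmetric]) auto
        ultimately have "ennreal ((cmod (deriv f (\<phi> z)))\<^sup>2) \<le> A" by simp
        then have "ennreal ((cmod (deriv f (\<phi> z)))\<^sup>2) * u z \<le> A * u z" by (rule mult_right_mono) simp
        moreover have "H z = ennreal ((cmod (deriv f (\<phi> z)))\<^sup>2) * u z"
          unfolding H_def u_def dg[OF z(1)] by (subst ennreal_mult[symmetric]) (auto simp: norm_mult power_mult_distrib mult_ac)
        ultimately show ?thesis using True by simp
      qed simp
      then have "(\<integral>\<^sup>+z. H z * indicator (E n) z \<partial>lborel) \<le> (\<integral>\<^sup>+z. A * (u z * indicator (E n) z) \<partial>lborel)"
        by (intro nn_integral_mono)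
      also have "\<dots> = A * V n"
        unfolding V_def E_def[symmetric] u_def by (rule nn_integral_cmult) (use meas[OF \<phi>_hol] in simp)
      also have "\<dots> = ennreal (taylor_const * (1 / 2) ^ J n / s n ^ 4) * ennreal (enn2real (V n)) * local_mass f n"
        using V_finite[of n] by (simp add: A_def mult_ac)
      also have "ennreal (taylor_const * (1 / 2) ^ J n / s n ^ 4) * ennreal (enn2real (V n)) = ennreal (taylor_const * (\<tau> n * (1 / 2) ^ J n))"
        using less_imp_le[OF taylor_const_pos] s4 by (subst ennreal_mult[symmetric]) (auto simp: \<tau>_def)
      finally show ?thesis .
    qed
  qed auto
  finally have "(\<integral>\<^sup>+z. H z * indicator unit_disk z \<partial>lborel) \<le> (\<Sum>n. ennreal (taylor_const * (\<tau> n * (1 / 2) ^ J n)) * local_mass f n)" .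
  then have "ennreal (3 / 2) * (\<integral>\<^sup>+z. H z * indicator unit_disk z \<partial>lborel) \<le>
      ennreal (3 / 2) * (\<Sum>n. ennreal (taylor_const * (\<tau> n * (1 / 2) ^ J n)) * local_mass f n)"
    by (rule mult_left_mono) simp
  then show ?thesis
    using littlewood_paley_upper[OF g] unfolding g_def[symmetric] H_def by (meson add_left_mono order.trans)
qed

lemma suminf_local_mass_le:
  assumes f: "f holomorphic_on unit_disk"
  shows "(\<Sum>n. local_mass f n) \<le> of_nat M * (\<integral>\<^sup>+z. ennreal ((cmod (f z))\<^sup>2) * indicator unit_disk z \<partial>lborel)"
proof -
  define B where "B n = (if n \<in> active then ball (c n) (s n) else {})" for n
  have BD: "B n \<subseteq> unit_disk" for n using ball_sub by (auto simp: B_def)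
  have lm: "local_mass f n = (\<integral>\<^sup>+z. ennreal ((cmod (f z))\<^sup>2) * indicator (B n) z \<partial>lborel)" for n
    by (simp add: local_mass_def B_def)
  have m: "(\<lambda>z. ennreal ((cmod (f z))\<^sup>2) * indicator (B n) z) \<in> borel_measurable borel" for n
  proof -
    have "(\<lambda>z. (ennreal ((cmod (f z))\<^sup>2) * indicator unit_disk z) * indicator (B n) z) \<in> borel_measurable borel"
      by (intro borel_measurable_times_ennreal disk_nn_measurable[OF f] borel_measurable_indicator) (simp add: B_def)
    moreover have "(\<lambda>z. (ennreal ((cmod (f z))\<^sup>2) * indicator unit_disk z) * indicator (B n) z) = (\<lambda>z. ennreal ((cmod (f z))\<^sup>2) * indicator (B n) z)"
      using BD[of n] by (auto simp: fun_eq_iff indicator_def)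
    ultimately show ?thesis by simp
  qed
  have "(\<Sum>n. local_mass f n) = (\<Sum>n. \<integral>\<^sup>+z. ennreal ((cmod (f z))\<^sup>2) * indicator (B n) z \<partial>lborel)"
    by (intro suminf_cong lm)
  also have "\<dots> = (\<integral>\<^sup>+z. (\<Sum>n. ennreal ((cmod (f z))\<^sup>2) * indicator (B n) z) \<partial>lborel)"
    by (rule nn_integral_suminf[symmetric]) (use m in simp)
  also have "\<dots> \<le> (\<integral>\<^sup>+z. of_nat M * (ennreal ((cmod (f z))\<^sup>2) * indicator unit_disk z) \<partial>lborel)"
  proof (rule nn_integral_mono)
    fix z
    define S where "S = {n \<in> active. z \<in> ball (c n) (s n)}"
    have S: "finite S" "card S \<le> M" using overlap[of z] by (auto simp: S_def)
    have "(\<Sum>n. indicator (B n) z) = (\<Sum>n\<in>S. indicator (B n) z :: ennreal)"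
      by (rule suminf_finite[OF S(1)]) (auto simp: S_def B_def)
    also have "\<dots> = (\<Sum>n\<in>S. 1)" by (intro sum.cong) (auto simp: S_def B_def)
    also have "\<dots> \<le> of_nat M" using S(2) by simp
    finally have a: "(\<Sum>n. indicator (B n) z :: ennreal) \<le> of_nat M" .
    show "(\<Sum>n. ennreal ((cmod (f z))\<^sup>2) * indicator (B n) z) \<le> of_nat M * (ennreal ((cmod (f z))\<^sup>2) * indicator unit_disk z)"
    proof (cases "z \<in> unit_disk")
      case True
      then show ?thesis using mult_left_mono[OF a, of "ennreal ((cmod (f z))\<^sup>2)"] by (simp add: mult.commute)
    next
      case False
      then have "z \<notin> B n" for n using BD by blast
      then show ?thesis by simp
    qed
  qed
  also have "\<dots> = of_nat M * (\<integral>\<^sup>+z. ennreal ((cmod (f z))\<^sup>2) * indicator unit_disk z \<partial>lborel)"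
    by (rule nn_integral_cmult) (use disk_nn_measurable[OF f] in simp)
  finally show ?thesis .
qed

definition norm_const :: real where
  "norm_const = 3 / 2 * taylor_const * real M"

lemma norm_const_nonneg: "0 \<le> norm_const"
  using taylor_const_pos by (simp add: norm_const_def)

lemma composition_bergman_bound:
  assumes f: "f \<in> bergman_space"
    and J: "\<And>n k. n \<in> active \<Longrightarrow> k < J n \<Longrightarrow> local_coeff (c n) (s n) f k = 0"
    and t: "\<And>n. n \<in> active \<Longrightarrow> \<tau> n * (1 / 2) ^ J n \<le> t" and t0: "0 \<le> t"
  shows "composition_operator \<phi> f \<in> bergman_space"
    "(bergman_norm (composition_operator \<phi> f))\<^sup>2 \<le> (cmod (f (\<phi> 0)))\<^sup>2 + norm_const * t * (bergman_norm f)\<^sup>2"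
proof -
  have hol: "f holomorphic_on unit_disk" using f by (simp add: bergman_space_def)
  have K: "0 \<le> taylor_const" using taylor_const_pos by simp
  have g: "composition_operator \<phi> f holomorphic_on unit_disk"
    using holomorphic_on_compose_gen[OF \<phi>_hol hol \<phi>_maps]
    by (rule holomorphic_transform) (simp add: composition_operator_def)
  have "(\<Sum>n. ennreal (taylor_const * (\<tau> n * (1 / 2) ^ J n)) * local_mass f n) \<le> (\<Sum>n. ennreal (taylor_const * t) * local_mass f n)"
  proof (intro suminf_le allI)
    fix n
    show "ennreal (taylor_const * (\<tau> n * (1 / 2) ^ J n)) * local_mass f n \<le> ennreal (taylor_const * t) * local_mass f n"
    proof (cases "n \<in> active")
      case True
      then show ?thesis using t[OF True] K by (intro mult_right_mono ennreal_leI mult_left_mono) auto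
    qed (simp add: local_mass_def)
  qed auto
  also have "\<dots> = ennreal (taylor_const * t) * (\<Sum>n. local_mass f n)" by simp
  also have "\<dots> \<le> ennreal (taylor_const * t) * (of_nat M * ennreal (pi * (bergman_norm f)\<^sup>2))"
    using suminf_local_mass_le[OF hol] unfolding bergman_nn_integral[OF f] by (rule mult_left_mono) simp
  also have "\<dots> = ennreal (taylor_const * t * (real M * (pi * (bergman_norm f)\<^sup>2)))"
    using K t0 by (simp add: ennreal_mult ennreal_of_nat_eq_real_of_nat)
  finally have S: "(\<Sum>n. ennreal (taylor_const * (\<tau> n * (1 / 2) ^ J n)) * local_mass f n) \<le>
      ennreal (taylor_const * t * (real M * (pi * (bergman_norm f)\<^sup>2)))" .
  have "(\<integral>\<^sup>+z. ennreal ((cmod (composition_operator \<phi> f z))\<^sup>2) * indicator unit_disk z \<partial>lborel) =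
      (\<integral>\<^sup>+z. ennreal ((cmod (f (\<phi> z)))\<^sup>2) * indicator unit_disk z \<partial>lborel)"
    by (intro nn_integral_cong) (auto simp: composition_operator_def indicator_def)
  also have "\<dots> \<le> ennreal (pi * (cmod (f (\<phi> 0)))\<^sup>2) +
    ennreal (3 / 2) * (\<Sum>n. ennreal (taylor_const * (\<tau> n * (1 / 2) ^ J n)) * local_mass f n)"
    by (rule composition_nn_integral_bound[OF hol J])
  also have "\<dots> \<le> ennreal (pi * (cmod (f (\<phi> 0)))\<^sup>2) +
    ennreal (3 / 2) * ennreal (taylor_const * t * (real M * (pi * (bergman_norm f)\<^sup>2)))"
    by (intro add_left_mono mult_left_mono S) simp
  also have "\<dots> = ennreal (pi * ((cmod (f (\<phi> 0)))\<^sup>2 + norm_const * t * (bergman_norm f)\<^sup>2))"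
    using K t0 by (simp add: norm_const_def ennreal_mult[symmetric] ennreal_plus[symmetric] algebra_simps del: ennreal_plus)
  finally have le: "(\<integral>\<^sup>+z. ennreal ((cmod (composition_operator \<phi> f z))\<^sup>2) * indicator unit_disk z \<partial>lborel) \<le>
      ennreal (pi * ((cmod (f (\<phi> 0)))\<^sup>2 + norm_const * t * (bergman_norm f)\<^sup>2))" .
  have nn: "0 \<le> (cmod (f (\<phi> 0)))\<^sup>2 + norm_const * t * (bergman_norm f)\<^sup>2"
    using norm_const_nonneg t0 by simp
  show "composition_operator \<phi> f \<in> bergman_space"
    "(bergman_norm (composition_operator \<phi> f))\<^sup>2 \<le> (cmod (f (\<phi> 0)))\<^sup>2 + norm_const * t * (bergman_norm f)\<^sup>2"
    using bergman_spaceI[OF g _ le nn] by (auto simp: composition_operator_def)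
qed

section \<open>Boundedness, approximation numbers and compactness\<close>

lemma center_ball: "0 < 1 - cmod (\<phi> 0)" "ball (\<phi> 0) (1 - cmod (\<phi> 0)) \<subseteq> unit_disk"
proof -
  have "\<phi> 0 \<in> unit_disk" by (rule subsetD[OF \<phi>_maps imageI]) simp
  then show "0 < 1 - cmod (\<phi> 0)" by simp
  show "ball (\<phi> 0) (1 - cmod (\<phi> 0)) \<subseteq> unit_disk"
  proof
    fix w assume "w \<in> ball (\<phi> 0) (1 - cmod (\<phi> 0))"
    then have "cmod (w - \<phi> 0) < 1 - cmod (\<phi> 0)" by (simp add: dist_norm norm_minus_commute)
    then show "w \<in> unit_disk" using norm_triangle_ineq[of "\<phi> 0" "w - \<phi> 0"] by simp
  qed
qed

lemma composition_add: "composition_operator \<phi> (f + g) = composition_operator \<phi> f + composition_operator \<phi> g"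
  and composition_scale: "composition_operator \<phi> (cscale a f) = cscale a (composition_operator \<phi> f)"
  by (simp_all add: fun_eq_iff composition_operator_def cscale_def)

lemma composition_bounded:
  assumes t: "\<And>n. n \<in> active \<Longrightarrow> \<tau> n \<le> t" "0 \<le> t"
  shows "bounded_operator bergman_space bergman_norm (composition_operator \<phi>)"
proof -
  define C where "C = 1 / (1 - cmod (\<phi> 0))"
  have b: "composition_operator \<phi> f \<in> bergman_space"
    "(bergman_norm (composition_operator \<phi> f))\<^sup>2 \<le> (cmod (f (\<phi> 0)))\<^sup>2 + norm_const * t * (bergman_norm f)\<^sup>2"
    if f: "f \<in> bergman_space" for f
    using composition_bergman_bound[OF f, of "\<lambda>_. 0" t] t by simp_all
  have "bergman_norm (composition_operator \<phi> f) \<le> sqrt (C\<^sup>2 + norm_const * t) * bergman_norm f"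
    if f: "f \<in> bergman_space" for f
  proof (rule power2_le_imp_le)
    have hol: "f holomorphic_on unit_disk" using f by (simp add: bergman_space_def)
    have "cmod (f (\<phi> 0)) \<le> C * bergman_norm f"
      using local_coeff_bounded[OF f center_ball, of 0] local_coeff_0[OF hol center_ball] by (simp add: C_def)
    then have "(cmod (f (\<phi> 0)))\<^sup>2 \<le> (C * bergman_norm f)\<^sup>2" by (intro power_mono) auto
    then have "(bergman_norm (composition_operator \<phi> f))\<^sup>2 \<le> (C * bergman_norm f)\<^sup>2 + norm_const * t * (bergman_norm f)\<^sup>2"
      using b(2)[OF f] by linarith
    also have "\<dots> = (sqrt (C\<^sup>2 + norm_const * t) * bergman_norm f)\<^sup>2"
      using norm_const_nonneg t(2) by (simp add: power_mult_distrib distrib_right)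
    finally show "(bergman_norm (composition_operator \<phi> f))\<^sup>2 \<le> (sqrt (C\<^sup>2 + norm_const * t) * bergman_norm f)\<^sup>2" .
    show "0 \<le> sqrt (C\<^sup>2 + norm_const * t) * bergman_norm f"
      using norm_const_nonneg t(2) bergman.nrm_nonneg[OF f] by simp
  qed
  then show ?thesis
    unfolding bounded_operator_def using b(1) composition_add composition_scale by blast
qed

text \<open>Vanishing of local coefficients is orthogonality to the representers from
  \<open>bergman_riesz\<close>. Of the two \<open>Suc\<close>, one comes from the strict inequality
  in \<open>rank_less\<close>, and the other pays for the condition \<open>f (\<phi> 0) = 0\<close>,
  which removes the first term of \<open>composition_bergman_bound\<close>.\<close>

lemma composition_approximation_number:
  fixes J :: "nat \<Rightarrow> nat"
  assumes T: "bounded_operator bergman_space bergman_norm (composition_operator \<phi>)"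
    and I: "finite I" "I \<subseteq> active" and J: "\<And>n. n \<notin> I \<Longrightarrow> J n = 0"
    and t: "\<And>n. n \<in> active \<Longrightarrow> \<tau> n * (1 / 2) ^ J n \<le> t" and t0: "0 \<le> t"
  shows "approximation_number bergman_space bergman_norm (Suc (Suc (\<Sum>n\<in>I. J n))) (composition_operator \<phi>)
    \<le> sqrt (norm_const * t)"
proof -
  define Q where "Q = Sigma I (\<lambda>n. {..<J n})"
  have fQ: "finite Q" using I(1) by (simp add: Q_def)
  have cQ: "card Q = (\<Sum>n\<in>I. J n)" using I(1) by (simp add: Q_def card_SigmaI)
  obtain e where e: "bij_betw e {0..<card Q} Q" using ex_bij_betw_nat_finite[OF fQ] by blast
  \<comment> \<open>Index 0 encodes the value at \<open>\<phi> 0\<close> as a zeroth local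
    coefficient on the disc of radius \<open>1 - |\<phi> 0|\<close>; the remaining indices enumerate
    \<open>Q\<close>.\<close>
  define c' where "c' i = (case i of 0 \<Rightarrow> \<phi> 0 | Suc j \<Rightarrow> c (fst (e j)))" for i
  define s' where "s' i = (case i of 0 \<Rightarrow> 1 - cmod (\<phi> 0) | Suc j \<Rightarrow> s (fst (e j)))" for i
  define k' where "k' i = (case i of 0 \<Rightarrow> 0 | Suc j \<Rightarrow> snd (e j))" for i
  have good: "0 < s' i \<and> ball (c' i) (s' i) \<subseteq> unit_disk" if i: "i < Suc (card Q)" for i
  proof (cases i)
    case 0
    then show ?thesis using center_ball by (simp add: s'_def c'_def)
  next
    case (Suc j)
    then have "e j \<in> Q" using i bij_betwE[OF e] by auto
    then have "fst (e j) \<in> active" using I(2) by (auto simp: Q_def)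
    then show ?thesis using s_pos ball_sub Suc by (simp add: s'_def c'_def)
  qed
  have "\<exists>y. y \<in> bergman_space \<and> (\<forall>f\<in>bergman_space. local_coeff (c' i) (s' i) f (k' i) = wip bergman_weight f y)"
    if i: "i < Suc (card Q)" for i
  proof -
    have s: "0 < s' i" "ball (c' i) (s' i) \<subseteq> unit_disk" using good[OF i] by auto
    show ?thesis
    proof (rule bergman_riesz[of "\<lambda>f. local_coeff (c' i) (s' i) f (k' i)" "sqrt (real (k' i + 1)) / s' i"])
      show "local_coeff (c' i) (s' i) (f + g) (k' i) = local_coeff (c' i) (s' i) f (k' i) + local_coeff (c' i) (s' i) g (k' i)"
        if "f \<in> bergman_space" "g \<in> bergman_space" for f g by (rule local_coeff_add[OF that s])
      show "local_coeff (c' i) (s' i) (cscale a f) (k' i) = a * local_coeff (c' i) (s' i) f (k' i)"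
        if "f \<in> bergman_space" for a f by (rule local_coeff_scale[OF that s])
      show "cmod (local_coeff (c' i) (s' i) f (k' i)) \<le> sqrt (real (k' i + 1)) / s' i * bergman_norm f"
        if "f \<in> bergman_space" for f by (rule local_coeff_bounded[OF that s])
      show "0 \<le> sqrt (real (k' i + 1)) / s' i" using s(1) by simp
      fix y assume "y \<in> bergman_space" "\<And>f. f \<in> bergman_space \<Longrightarrow> local_coeff (c' i) (s' i) f (k' i) = wip bergman_weight f y"
      then show ?thesis by (intro exI[of _ y]) simp
    qed
  qed
  then have "\<forall>i. \<exists>y. i < Suc (card Q) \<longrightarrow> y \<in> bergman_space \<and> (\<forall>f\<in>bergman_space. local_coeff (c' i) (s' i) f (k' i) = wip bergman_weight f y)"
    by simp
  from choice[OF this] obtain y where y: "\<forall>i. i < Suc (card Q) \<longrightarrow> y i \<in> bergman_space \<and>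
      (\<forall>f\<in>bergman_space. local_coeff (c' i) (s' i) f (k' i) = wip bergman_weight f (y i))" ..
  have "approximation_number bergman_space bergman_norm (Suc (Suc (card Q))) (composition_operator \<phi>) \<le> sqrt (norm_const * t)"
  proof (rule bergman.approximation_number_le_on_orthogonal_complement[OF T])
    show "y i \<in> bergman_space" if "i < Suc (card Q)" for i using y that by simp
    show "0 \<le> sqrt (norm_const * t)" using norm_const_nonneg t0 by simp
    fix f assume f: "f \<in> bergman_space" and orth: "\<And>i. i < Suc (card Q) \<Longrightarrow> wip bergman_weight f (y i) = 0"
    have hol: "f holomorphic_on unit_disk" using f by (simp add: bergman_space_def)
    have lc0: "local_coeff (c' i) (s' i) f (k' i) = 0" if "i < Suc (card Q)" for i
      using y orth f that by simp
    have f0: "f (\<phi> 0) = 0" using lc0[of 0] local_coeff_0[OF hol center_ball] by (simp add: c'_def s'_def k'_def)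
    have "local_coeff (c n) (s n) f k = 0" if "n \<in> active" "k < J n" for n k
    proof -
      have "n \<in> I" using J[of n] that(2) by force
      then have "(n, k) \<in> Q" using that(2) by (simp add: Q_def)
      then obtain j where j: "j < card Q" "e j = (n, k)" using e unfolding bij_betw_def by force
      then show ?thesis using lc0[of "Suc j"] by (simp add: c'_def s'_def k'_def)
    qed
    from composition_bergman_bound(2)[OF f this t t0]
    have "(bergman_norm (composition_operator \<phi> f))\<^sup>2 \<le> norm_const * t * (bergman_norm f)\<^sup>2"
      using f0 by simp
    also have "\<dots> = (sqrt (norm_const * t) * bergman_norm f)\<^sup>2"
      using norm_const_nonneg t0 by (simp add: power_mult_distrib)
    finally show "bergman_norm (composition_operator \<phi> f) \<le> sqrt (norm_const * t) * bergman_norm f"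
      by (rule power2_le_imp_le) (use norm_const_nonneg t0 bergman.nrm_nonneg[OF f] in simp)
  qed
  then show ?thesis by (simp only: cQ)
qed

text \<open>The estimate behind compactness: \<open>h\<close> is uniformly small on the finitely
  many cells of \<open>S\<close>, and on the other cells the masses are small.\<close>

lemma composition_bound_split:
  assumes h: "h \<in> bergman_space" and S: "finite S" "S \<subseteq> active"
    and eps: "\<And>n. n \<in> active - S \<Longrightarrow> \<tau> n \<le> \<epsilon>" "0 \<le> \<epsilon>"
    and t: "\<And>n. n \<in> active \<Longrightarrow> \<tau> n \<le> t" "0 \<le> t"
    and \<sigma>: "cmod (h (\<phi> 0)) \<le> \<sigma>" "\<And>n z. n \<in> S \<Longrightarrow> z \<in> cball (c n) (s n) \<Longrightarrow> cmod (h z) \<le> \<sigma>"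
    and T: "bounded_operator bergman_space bergman_norm (composition_operator \<phi>)"
  shows "(bergman_norm (composition_operator \<phi> h))\<^sup>2 \<le>
    \<sigma>\<^sup>2 * (1 + 3 / 2 * (real (card S) * (taylor_const * t))) + norm_const * \<epsilon> * (bergman_norm h)\<^sup>2"
proof -
  have hol: "h holomorphic_on unit_disk" using h by (simp add: bergman_space_def)
  have K: "0 \<le> taylor_const" using taylor_const_pos by simp
  have \<sigma>0: "0 \<le> \<sigma>" using \<sigma>(1) norm_ge_zero order.trans by blast
  have area: "emeasure lborel (ball (0::complex) 1) = ennreal pi"
    using emeasure_ball[of 1 "0::complex"] by (simp add: unit_ball_vol_2)
  have mass: "local_mass h n \<le> ennreal (pi * \<sigma>\<^sup>2)" if n: "n \<in> S" for n
  proof -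
    have nA: "n \<in> active" using n S by blast
    have "local_mass h n \<le> (\<integral>\<^sup>+z. ennreal (\<sigma>\<^sup>2) * indicator (ball (0::complex) 1) z \<partial>lborel)"
      unfolding local_mass_def using nA
    proof (simp only: if_True, intro nn_integral_mono)
      fix z
      show "ennreal ((cmod (h z))\<^sup>2) * indicator (ball (c n) (s n)) z \<le> ennreal (\<sigma>\<^sup>2) * indicator (ball (0::complex) 1) z"
      proof (cases "z \<in> ball (c n) (s n)")
        case True
        then have "z \<in> ball 0 1" "cmod (h z) \<le> \<sigma>" using ball_sub[OF nA] \<sigma>(2)[OF n, of z] by auto
        then show ?thesis using True by (auto intro!: ennreal_leI power_mono)
      qed simp
    qed
    also have "\<dots> = ennreal (\<sigma>\<^sup>2) * ennreal pi" by (simp add: nn_integral_cmult_indicator area)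
    finally show ?thesis by (simp add: ennreal_mult mult.commute)
  qed
  have "(\<Sum>n. ennreal (taylor_const * \<tau> n) * local_mass h n) \<le>
      (\<Sum>n. ennreal (taylor_const * t) * (if n \<in> S then ennreal (pi * \<sigma>\<^sup>2) else 0) + ennreal (taylor_const * \<epsilon>) * local_mass h n)"
  proof (intro suminf_le allI)
    fix n
    show "ennreal (taylor_const * \<tau> n) * local_mass h n \<le>
      ennreal (taylor_const * t) * (if n \<in> S then ennreal (pi * \<sigma>\<^sup>2) else 0) + ennreal (taylor_const * \<epsilon>) * local_mass h n"
    proof (cases "n \<in> S")
      case True
      then have "ennreal (taylor_const * \<tau> n) * local_mass h n \<le> ennreal (taylor_const * t) * ennreal (pi * \<sigma>\<^sup>2)"
        using t(1)[of n] S(2) K by (intro mult_mono ennreal_leI mult_left_mono mass) auto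
      then show ?thesis using True by (simp add: add_increasing2)
    next
      case False
      show ?thesis
      proof (cases "n \<in> active")
        case True
        then have "ennreal (taylor_const * \<tau> n) * local_mass h n \<le> ennreal (taylor_const * \<epsilon>) * local_mass h n"
          using eps(1)[of n] False K by (intro mult_right_mono ennreal_leI mult_left_mono) auto
        then show ?thesis using False by simp
      qed (simp add: local_mass_def)
    qed
  qed auto
  also have "\<dots> = (\<Sum>n. ennreal (taylor_const * t) * (if n \<in> S then ennreal (pi * \<sigma>\<^sup>2) else 0)) + (\<Sum>n. ennreal (taylor_const * \<epsilon>) * local_mass h n)"
    by (rule suminf_add[symmetric]) auto
  also have "(\<Sum>n. ennreal (taylor_const * t) * (if n \<in> S then ennreal (pi * \<sigma>\<^sup>2) else 0)) = (\<Sum>n\<in>S. ennreal (taylor_const * t) * ennreal (pi * \<sigma>\<^sup>2))"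
    by (subst suminf_finite[OF S(1)]) auto
  also have "\<dots> = ennreal (real (card S) * (taylor_const * t) * (pi * \<sigma>\<^sup>2))"
    using K t(2) by (simp add: ennreal_mult ennreal_of_nat_eq_real_of_nat mult_ac)
  also have "(\<Sum>n. ennreal (taylor_const * \<epsilon>) * local_mass h n) = ennreal (taylor_const * \<epsilon>) * (\<Sum>n. local_mass h n)" by simp
  also have "ennreal (real (card S) * (taylor_const * t) * (pi * \<sigma>\<^sup>2)) + ennreal (taylor_const * \<epsilon>) * (\<Sum>n. local_mass h n) \<le>
     ennreal (real (card S) * (taylor_const * t) * (pi * \<sigma>\<^sup>2)) + ennreal (taylor_const * \<epsilon>) * (of_nat M * ennreal (pi * (bergman_norm h)\<^sup>2))"
    using suminf_local_mass_le[OF hol] unfolding bergman_nn_integral[OF h] by (intro add_left_mono mult_left_mono) auto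
  also have "\<dots> = ennreal (real (card S) * (taylor_const * t) * (pi * \<sigma>\<^sup>2) + taylor_const * \<epsilon> * (real M * (pi * (bergman_norm h)\<^sup>2)))"
    using K t(2) eps(2) by (simp add: ennreal_mult ennreal_of_nat_eq_real_of_nat)
  finally have sum: "(\<Sum>n. ennreal (taylor_const * \<tau> n) * local_mass h n) \<le>
    ennreal (real (card S) * (taylor_const * t) * (pi * \<sigma>\<^sup>2) + taylor_const * \<epsilon> * (real M * (pi * (bergman_norm h)\<^sup>2)))" .
  define X where "X = real (card S) * (taylor_const * t) * (pi * \<sigma>\<^sup>2) + taylor_const * \<epsilon> * (real M * (pi * (bergman_norm h)\<^sup>2))"
  have X0: "0 \<le> X" using K t(2) eps(2) by (simp add: X_def)
  have "ennreal (pi * (bergman_norm (composition_operator \<phi> h))\<^sup>2) =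
      (\<integral>\<^sup>+z. ennreal ((cmod (composition_operator \<phi> h z))\<^sup>2) * indicator unit_disk z \<partial>lborel)"
    by (rule bergman_nn_integral[symmetric, OF bergman.bounded_operator_range[OF T h]])
  also have "\<dots> = (\<integral>\<^sup>+z. ennreal ((cmod (h (\<phi> z)))\<^sup>2) * indicator unit_disk z \<partial>lborel)"
    by (intro nn_integral_cong) (auto simp: composition_operator_def indicator_def)
  also have "\<dots> \<le> ennreal (pi * (cmod (h (\<phi> 0)))\<^sup>2) +
    ennreal (3 / 2) * (\<Sum>n. ennreal (taylor_const * (\<tau> n * (1 / 2) ^ 0)) * local_mass h n)"
    by (rule composition_nn_integral_bound[OF hol]) simp
  also have "\<dots> \<le> ennreal (pi * \<sigma>\<^sup>2) + ennreal (3 / 2) * ennreal X"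
    using sum \<sigma>(1) by (intro add_mono mult_left_mono ennreal_leI power_mono) (auto simp: X_def)
  also have "\<dots> = ennreal (pi * \<sigma>\<^sup>2 + 3 / 2 * X)"
    using X0 by (simp add: ennreal_mult[symmetric] ennreal_plus[symmetric] del: ennreal_plus)
  finally have "pi * (bergman_norm (composition_operator \<phi> h))\<^sup>2 \<le> pi * \<sigma>\<^sup>2 + 3 / 2 * X"
    using X0 by (subst (asm) ennreal_le_iff) auto
  also have "\<dots> = pi * (\<sigma>\<^sup>2 * (1 + 3 / 2 * (real (card S) * (taylor_const * t))) + norm_const * \<epsilon> * (bergman_norm h)\<^sup>2)"
    by (simp add: X_def norm_const_def algebra_simps)
  finally show ?thesis by (rule mult_left_le_imp_le) simp
qed

lemma bergman_pointwise_bound: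
  assumes f: "f \<in> bergman_space" and z: "cmod z \<le> r" "r < 1"
  shows "cmod (f z) \<le> 1 / (1 - r) * bergman_norm f"
proof -
  have hol: "f holomorphic_on unit_disk" using f by (simp add: bergman_space_def)
  have s: "0 < 1 - r" "ball z (1 - r) \<subseteq> unit_disk"
  proof -
    show "ball z (1 - r) \<subseteq> unit_disk"
    proof
      fix w assume "w \<in> ball z (1 - r)"
      then have "cmod (w - z) < 1 - r" by (simp add: dist_norm norm_minus_commute)
      then show "w \<in> unit_disk" using norm_triangle_ineq[of z "w - z"] z by simp
    qed
  qed (use z in simp)
  show ?thesis using local_coeff_bounded[OF f s, of 0] local_coeff_0[OF hol s] by simp
qed

lemma compact_subset_disk:
  assumes "compact K" "K \<subseteq> unit_disk"
  obtains r where "r < 1" "\<And>z. z \<in> K \<Longrightarrow> cmod z \<le> r"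
proof (cases "K = {}")
  case True
  then show ?thesis using that[of 0] by auto
next
  case False
  obtain x where "x \<in> K" "\<And>y. y \<in> K \<Longrightarrow> cmod y \<le> cmod x"
    using continuous_attains_sup[OF assms(1) False, of cmod] by (auto intro: continuous_intros)
  then show ?thesis using that[of "cmod x"] assms(2) by auto
qed

text \<open>Montel's theorem extracts a locally uniform limit, which stays in the unit ball by
  Fatou's lemma. The discs of the finitely many cells above a threshold form a compact set on which
  convergence is uniform; \<open>composition_bound_split\<close> absorbs the other cells.\<close>

lemma composition_compact:
  assumes small: "\<And>\<epsilon>. 0 < \<epsilon> \<Longrightarrow> finite {n \<in> active. \<tau> n > \<epsilon>}"
    and t: "\<And>n. n \<in> active \<Longrightarrow> \<tau> n \<le> t" "0 \<le> t"
  shows "compact_operator bergman_space bergman_norm (composition_operator \<phi>)"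
proof -
  have T: "bounded_operator bergman_space bergman_norm (composition_operator \<phi>)"
    by (rule composition_bounded[OF t])
  have "\<exists>r g. strict_mono r \<and> g \<in> bergman_space \<and>
      (\<lambda>n. bergman_norm (composition_operator \<phi> (F (r n)) - g)) \<longlonglongrightarrow> 0"
    if F: "\<forall>n. F n \<in> bergman_space \<and> bergman_norm (F n) \<le> 1" for F :: "nat \<Rightarrow> complex \<Rightarrow> complex"
  proof -
    define H where "H = {f \<in> bergman_space. bergman_norm f \<le> 1}"
    have bd: "\<exists>B. \<forall>h\<in>H. \<forall>z\<in>K. cmod (h z) \<le> B" if K: "compact K" "K \<subseteq> unit_disk" for K
    proof -
      obtain r where r: "r < 1" "\<And>z. z \<in> K \<Longrightarrow> cmod z \<le> r" using compact_subset_disk[OF K] by auto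
      have "cmod (h z) \<le> 1 / (1 - r)" if h: "h \<in> H" and z: "z \<in> K" for h z
      proof -
        have "cmod (h z) \<le> 1 / (1 - r) * bergman_norm h"
          using h by (intro bergman_pointwise_bound[OF _ r(2)[OF z] r(1)]) (simp add: H_def)
        also have "\<dots> \<le> 1 / (1 - r) * 1" using h r(1) by (intro mult_left_mono) (auto simp: H_def)
        finally show ?thesis by simp
      qed
      then show ?thesis by (intro exI[of _ "1 / (1 - r)"]) simp
    qed
    have holH: "h holomorphic_on unit_disk" if "h \<in> H" for h using that by (simp add: H_def bergman_space_def)
    have rng: "range F \<subseteq> H" using F by (auto simp: H_def)
    obtain g r where g: "g holomorphic_on unit_disk" "strict_mono (r :: nat \<Rightarrow> nat)"
      "\<And>x. x \<in> unit_disk \<Longrightarrow> (\<lambda>n. F (r n) x) \<longlonglongrightarrow> g x"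
      "\<And>K. compact K \<Longrightarrow> K \<subseteq> unit_disk \<Longrightarrow> uniform_limit K (F \<circ> r) g sequentially"
      using Montel[OF open_ball holH bd rng] by blast
    define G where "G z = (if z \<in> unit_disk then g z else 0)" for z
    have Ghol: "G holomorphic_on unit_disk" by (rule holomorphic_transform[OF g(1)]) (simp add: G_def)
    have Gle: "(\<integral>\<^sup>+z. ennreal ((cmod (G z))\<^sup>2) * indicator unit_disk z \<partial>lborel) \<le> ennreal (pi * 1)"
    proof -
      define U where "U n z = ennreal ((cmod (F (r n) z))\<^sup>2) * indicator unit_disk z" for n z
      have holF: "F n holomorphic_on unit_disk" for n using F by (simp add: bergman_space_def)
      have lim: "(\<lambda>n. U n z) \<longlonglongrightarrow> ennreal ((cmod (G z))\<^sup>2) * indicator unit_disk z" for z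
      proof (cases "z \<in> unit_disk")
        case True
        have "(\<lambda>n. ennreal ((cmod (F (r n) z))\<^sup>2)) \<longlonglongrightarrow> ennreal ((cmod (g z))\<^sup>2)"
          by (intro tendsto_ennrealI tendsto_intros g(3)[OF True])
        then show ?thesis using True by (simp add: U_def G_def)
      qed (simp add: U_def)
      have "(\<integral>\<^sup>+z. ennreal ((cmod (G z))\<^sup>2) * indicator unit_disk z \<partial>lborel) = (\<integral>\<^sup>+z. liminf (\<lambda>n. U n z) \<partial>lborel)"
        by (rule nn_integral_cong) (rule lim_imp_Liminf[OF _ lim, symmetric], simp)
      also have "\<dots> \<le> liminf (\<lambda>n. \<integral>\<^sup>+z. U n z \<partial>lborel)"
        unfolding U_def by (intro nn_integral_liminf) (use disk_nn_measurable[OF holF] in simp)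
      also have "\<dots> \<le> ennreal (pi * 1)"
      proof (rule Liminf_le)
        show "\<forall>\<^sub>F n in sequentially. (\<integral>\<^sup>+z. U n z \<partial>lborel) \<le> ennreal (pi * 1)"
        proof (intro always_eventually allI)
          fix n
          have "(bergman_norm (F (r n)))\<^sup>2 \<le> 1\<^sup>2" using F bergman.nrm_nonneg by (intro power_mono) auto
          then show "(\<integral>\<^sup>+z. U n z \<partial>lborel) \<le> ennreal (pi * 1)"
            unfolding U_def using F by (subst bergman_nn_integral) (auto intro!: ennreal_leI mult_left_mono)
        qed
      qed simp
      finally show ?thesis .
    qed
    have G: "G \<in> bergman_space" "(bergman_norm G)\<^sup>2 \<le> 1"
    proof -
      have "G z = 0" if "z \<notin> unit_disk" for z using that by (simp add: G_def)
      then show "G \<in> bergman_space" "(bergman_norm G)\<^sup>2 \<le> 1"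
        using bergman_spaceI[OF Ghol _ Gle] by simp_all
    qed
    define h where "h n = F (r n) - G" for n
    have hV: "h n \<in> bergman_space" for n unfolding h_def using F G(1) by (intro bergman.V_diff) auto
    have hn: "(bergman_norm (h n))\<^sup>2 \<le> 4" for n
    proof -
      have FV: "F (r n) \<in> bergman_space" using F by simp
      have "(bergman_norm (F (r n)))\<^sup>2 \<le> 1" using F bergman.nrm_nonneg[OF FV] by (simp add: power_le_one)
      then show ?thesis
        using bergman.parallelogram[OF FV G(1)] G(2) zero_le_power2[of "bergman_norm (F (r n) + G)"]
        unfolding h_def by linarith
    qed
    have lim: "(\<lambda>n. (bergman_norm (composition_operator \<phi> (h n)))\<^sup>2) \<longlonglongrightarrow> 0"
    proof (rule LIMSEQ_I)
      fix e :: real assume e: "0 < e"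
      \<comment> \<open>Since 4 bounds the squared norm of \<open>h n\<close>, the light cells
        contribute less than \<open>e / 2\<close>; \<open>\<sigma>\<close> below is chosen so that
        the heavy ones contribute \<open>e / 4\<close>. The summand 8 keeps the denominator
        positive.\<close>
      define \<epsilon> where "\<epsilon> = e / (8 * norm_const + 8)"
      have \<epsilon>: "0 < \<epsilon>" using e norm_const_nonneg by (simp add: \<epsilon>_def)
      have \<epsilon>e: "norm_const * \<epsilon> * 4 < e / 2"
        using e norm_const_nonneg by (simp add: \<epsilon>_def field_simps)
      define S where "S = {n \<in> active. \<tau> n > \<epsilon>}"
      have S: "finite S" "S \<subseteq> active" using small[OF \<epsilon>] by (auto simp: S_def)
      have outS: "\<tau> n \<le> \<epsilon>" if "n \<in> active - S" for n using that by (auto simp: S_def)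
      define D where "D = 1 + 3 / 2 * (real (card S) * (taylor_const * t))"
      have D: "1 \<le> D" using t(2) taylor_const_pos by (simp add: D_def)
      define \<sigma> where "\<sigma> = sqrt (e / (4 * D))"
      have \<sigma>: "0 < \<sigma>" "\<sigma>\<^sup>2 * D < e / 2" using e D by (auto simp: \<sigma>_def field_simps)
      define K where "K = insert (\<phi> 0) (\<Union>n\<in>S. cball (c n) (s n))"
      have "compact K" unfolding K_def using S(1) by (intro compact_insert compact_UN) auto
      moreover have "\<phi> 0 \<in> unit_disk" by (rule subsetD[OF \<phi>_maps imageI]) simp
      then have KD: "K \<subseteq> unit_disk" unfolding K_def using cball_sub S(2) by blast
      ultimately have "uniform_limit K (F \<circ> r) g sequentially" using g(4) by blast
      then have "\<forall>\<^sub>F n in sequentially. \<forall>x\<in>K. dist ((F \<circ> r) n x) (g x) < \<sigma>"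
        using \<sigma>(1) unfolding uniform_limit_iff by blast
      then obtain N where N: "\<And>n x. n \<ge> N \<Longrightarrow> x \<in> K \<Longrightarrow> dist (F (r n) x) (g x) < \<sigma>"
        unfolding eventually_sequentially by auto
      have "norm ((bergman_norm (composition_operator \<phi> (h n)))\<^sup>2 - 0) < e" if n: "n \<ge> N" for n
      proof -
        have hK: "cmod (h n x) \<le> \<sigma>" if "x \<in> K" for x
        proof -
          have "x \<in> unit_disk" using that KD by blast
          then have "h n x = F (r n) x - g x" by (simp add: h_def G_def)
          then show ?thesis using N[OF n that] by (simp add: dist_norm)
        qed
        have "(bergman_norm (composition_operator \<phi> (h n)))\<^sup>2 \<le> \<sigma>\<^sup>2 * D + norm_const * \<epsilon> * (bergman_norm (h n))\<^sup>2"
          unfolding D_def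
        proof (rule composition_bound_split[OF hV S outS _ t _ _ T])
          show "cmod (h n (\<phi> 0)) \<le> \<sigma>" by (rule hK) (simp add: K_def)
          show "cmod (h n z) \<le> \<sigma>" if "m \<in> S" "z \<in> cball (c m) (s m)" for m z
            by (rule hK) (use that in \<open>auto simp: K_def\<close>)
        qed (use \<epsilon> in auto)
        also have "norm_const * \<epsilon> * (bergman_norm (h n))\<^sup>2 \<le> norm_const * \<epsilon> * 4"
          using hn[of n] norm_const_nonneg \<epsilon> by (intro mult_left_mono) auto
        finally show ?thesis using \<sigma>(2) \<epsilon>e by simp
      qed
      then show "\<exists>N. \<forall>n\<ge>N. norm ((bergman_norm (composition_operator \<phi> (h n)))\<^sup>2 - 0) < e" by blast
    qed
    have "(\<lambda>n. sqrt ((bergman_norm (composition_operator \<phi> (h n)))\<^sup>2)) \<longlonglongrightarrow> sqrt 0"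
      by (intro tendsto_real_sqrt lim)
    moreover have "sqrt ((bergman_norm (composition_operator \<phi> (h n)))\<^sup>2) = bergman_norm (composition_operator \<phi> (F (r n)) - composition_operator \<phi> G)" for n
    proof -
      have FV: "F (r n) \<in> bergman_space" using F by simp
      have "composition_operator \<phi> (h n) = composition_operator \<phi> (F (r n)) - composition_operator \<phi> G"
        unfolding h_def by (rule bergman.operator_diff[OF T FV G(1)])
      then show ?thesis using bergman.nrm_nonneg[OF bergman.bounded_operator_range[OF T hV[of n]]] by simp
    qed
    ultimately have "(\<lambda>n. bergman_norm (composition_operator \<phi> (F (r n)) - composition_operator \<phi> G)) \<longlonglongrightarrow> 0" by simp
    then show ?thesis
      using g(2) bergman.bounded_operator_range[OF T G(1)]
      by (intro exI[of _ r] exI[of _ "composition_operator \<phi> G"]) simp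
  qed
  then show ?thesis unfolding compact_operator_def using T by simp
qed

end

section \<open>Dyadic cells\<close>

definition in_sector :: "nat \<Rightarrow> complex \<Rightarrow> bool" where
  "in_sector j w \<longleftrightarrow> \<bar>Re (w * \<i> ^ j)\<bar> \<le> Im (w * \<i> ^ j)"

text \<open>The four closed sectors of opening \<open>pi / 2\<close> overlap on their boundaries;
  the order of the tests assigns every point to one of them.\<close>

definition sector :: "complex \<Rightarrow> nat" where
  "sector w = (if in_sector 0 w then 0 else if in_sector 1 w then 1 else if in_sector 2 w then 2 else 3)"

lemma in_sector_sector: "in_sector (sector w) w"
  unfolding sector_def in_sector_def by (auto simp: eval_nat_numeral)

lemma sector_less: "sector w < 4"
  by (simp add: sector_def)

definition gen :: "complex \<Rightarrow> nat" where
  "gen w = (LEAST g. (1 / 2) ^ Suc g < 1 - cmod w)"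

lemma gen:
  assumes "w \<in> unit_disk"
  shows "(1 / 2) ^ Suc (gen w) < 1 - cmod w" "1 - cmod w \<le> (1 / 2) ^ gen w"
proof -
  have "0 < 1 - cmod w" using assms by simp
  then obtain n where n: "(1 / 2) ^ n < 1 - cmod w" using real_arch_pow_inv[of "1 - cmod w" "1 / 2"] by auto
  have "(1 / 2 :: real) ^ Suc n \<le> (1 / 2) ^ n" by simp
  then have "(1 / 2) ^ Suc n < 1 - cmod w" using n by linarith
  then show "(1 / 2) ^ Suc (gen w) < 1 - cmod w" unfolding gen_def by (rule LeastI)
  show "1 - cmod w \<le> (1 / 2) ^ gen w"
  proof (cases "gen w")
    case (Suc m)
    then have "\<not> (1 / 2) ^ Suc m < 1 - cmod w" unfolding gen_def by (intro not_less_Least) simp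
    then show ?thesis by (simp only: Suc not_less)
  qed simp
qed

lemma gen_eq_iff:
  assumes "w \<in> unit_disk"
  shows "gen w = g \<longleftrightarrow> (1 / 2) ^ Suc g < 1 - cmod w \<and> 1 - cmod w \<le> (1 / 2) ^ g"
proof
  assume r: "(1 / 2) ^ Suc g < 1 - cmod w \<and> 1 - cmod w \<le> (1 / 2) ^ g"
  show "gen w = g"
  proof (rule ccontr)
    assume "gen w \<noteq> g"
    then consider "Suc (gen w) \<le> g" | "Suc g \<le> gen w" by linarith
    then show False
    proof cases
      case 1
      then have "(1 / 2 :: real) ^ g \<le> (1 / 2) ^ Suc (gen w)" by (intro power_decreasing) auto
      then show False using r gen(1)[OF assms] by linarith
    next
      case 2
      then have "(1 / 2 :: real) ^ gen w \<le> (1 / 2) ^ Suc g" by (intro power_decreasing) auto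
      then show False using r gen(2)[OF assms] by linarith
    qed
  qed
qed (use gen[OF assms] in auto)

text \<open>Multiplication by \<open>\<i> ^ j\<close> rotates the \<open>j\<close>-th sector to the one around the positive imaginary axis,
  where a point is determined by its real part and its modulus.\<close>

definition abscissa :: "nat \<Rightarrow> nat \<Rightarrow> complex \<Rightarrow> int" where
  "abscissa j g w = \<lfloor>64 * 2 ^ g * (Re (w * \<i> ^ j) + 1)\<rfloor>"

text \<open>Cuts the annulus of a generation into shells of width \<open>1 / 32\<close> relative to
  its scale, with at most 33 values on the disk. The scales 32 here and 64 in
  \<open>abscissa\<close> are fine enough for the constant in \<open>cell_diameter\<close>.\<close>

definition depth :: "complex \<Rightarrow> int" where
  "depth w = \<lfloor>32 * 2 ^ gen w * (1 - cmod w)\<rfloor>"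

definition cell_index :: "complex \<Rightarrow> nat \<times> nat \<times> int \<times> int" where
  "cell_index w = (sector w, gen w, depth w, abscissa (sector w) (gen w) w)"

definition cell :: "complex \<Rightarrow> nat" where
  "cell w = to_nat (cell_index w)"

lemma cell_eq_iff: "cell w = cell w' \<longleftrightarrow> cell_index w = cell_index w'"
  by (simp add: cell_def)

lemma cmod_i_power [simp]: "cmod (\<i> ^ j) = 1"
  by (simp add: norm_power)

lemma cell_measurable: "{w \<in> unit_disk. cell w = n} \<in> sets borel"
proof -
  have sec: "{w. in_sector j w} \<in> sets borel" for j
    unfolding in_sector_def by measurable
  have "{w. sector w = j} \<in> sets borel" for j
  proof -
    have "{w. sector w = j} = (if j = 0 then {w. in_sector 0 w} else if j = 1 then - {w. in_sector 0 w} \<inter> {w. in_sector 1 w}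
       else if j = 2 then - {w. in_sector 0 w} \<inter> - {w. in_sector 1 w} \<inter> {w. in_sector 2 w}
       else if j = 3 then - {w. in_sector 0 w} \<inter> - {w. in_sector 1 w} \<inter> - {w. in_sector 2 w} else {})"
      by (auto simp: sector_def)
    moreover have "\<dots> \<in> sets borel" using sec by (auto intro!: sets.Int borel_comp)
    ultimately show ?thesis by simp
  qed
  moreover have "{w \<in> unit_disk. gen w = g} \<in> sets borel" for g
  proof -
    have "{w \<in> unit_disk. gen w = g} = {w. cmod w < 1 \<and> (1 / 2) ^ Suc g < 1 - cmod w \<and> 1 - cmod w \<le> (1 / 2) ^ g}"
      using gen_eq_iff by auto
    also have "\<dots> \<in> sets borel" by measurable
    finally show ?thesis .
  qed
  moreover have "{w. \<lfloor>32 * 2 ^ g * (1 - cmod w)\<rfloor> = d} \<in> sets borel" for g :: nat and d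
    unfolding floor_eq_iff by measurable
  moreover have "{w. abscissa j g w = a} \<in> sets borel" for j g a
    unfolding abscissa_def floor_eq_iff by measurable
  ultimately have m: "{w. sector w = j} \<inter> {w \<in> unit_disk. gen w = g} \<inter> {w. \<lfloor>32 * 2 ^ g * (1 - cmod w)\<rfloor> = d} \<inter> {w. abscissa j g w = a} \<in> sets borel"
    for j g d a by (intro sets.Int)
  show ?thesis
  proof (cases "\<exists>t :: nat \<times> nat \<times> int \<times> int. n = to_nat t")
    case True
    then obtain u :: "nat \<times> nat \<times> int \<times> int" where u: "n = to_nat u" by blast
    obtain j g d a where "u = (j, g, d, a)" by (rule prod_cases4)
    with u have t: "n = to_nat (j, g, d, a)" by simp
    have "{w \<in> unit_disk. cell w = n} = {w. sector w = j} \<inter> {w \<in> unit_disk. gen w = g} \<inter> {w. \<lfloor>32 * 2 ^ g * (1 - cmod w)\<rfloor> = d} \<inter> {w. abscissa j g w = a}"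
      unfolding t by (auto simp: cell_def cell_index_def depth_def)
    then show ?thesis using m by simp
  next
    case False
    then have "cell w \<noteq> n" for w unfolding cell_def by blast
    then have e: "{w \<in> unit_disk. cell w = n} = {}" by blast
    show ?thesis unfolding e by simp
  qed
qed

text \<open>In units of \<open>\<delta>\<close>, moduli differ by at most \<open>1 / 32\<close> and
  real parts by at most \<open>1 / 64\<close>. Imaginary parts are recovered from the difference of
  their squares, divided by their sum \<open>Y\<close>; in the rotated sector the modulus is at most
  \<open>3 / 2\<close> times the imaginary part. The total is \<open>5 / 64\<close>, below
  \<open>1 / 10\<close>.\<close>

lemma cell_diameter:
  assumes w: "w \<in> unit_disk" "w' \<in> unit_disk" and c: "cell w = cell w'"
  shows "dist w w' \<le> (1 / 10) * (1 / 2) ^ gen w"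
proof -
  define j where "j = sector w"
  define \<delta> where "\<delta> = (1 / 2 :: real) ^ gen w"
  have \<delta>: "0 < \<delta>" "2 ^ gen w * \<delta> = 1" by (simp_all add: \<delta>_def power_mult_distrib[symmetric])
  have eqs: "sector w' = j" "gen w' = gen w" "depth w' = depth w" "abscissa j (gen w) w' = abscissa j (gen w) w"
    using c by (auto simp: cell_eq_iff cell_index_def j_def)
  define W where "W = w * \<i> ^ j"
  define W' where "W' = w' * \<i> ^ j"
  have nW: "cmod W = cmod w" "cmod W' = cmod w'" by (simp_all add: W_def W'_def norm_mult)
  have sec: "\<bar>Re W\<bar> \<le> Im W" "\<bar>Re W'\<bar> \<le> Im W'"
    using in_sector_sector[of w] in_sector_sector[of w'] eqs(1) by (simp_all add: in_sector_def W_def W'_def j_def)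
  have "\<bar>32 * 2 ^ gen w * (1 - cmod w) - 32 * 2 ^ gen w * (1 - cmod w')\<bar> < 1"
    using eqs(3) unfolding depth_def eqs(2) by linarith
  then have "\<delta> * \<bar>32 * 2 ^ gen w * (1 - cmod w) - 32 * 2 ^ gen w * (1 - cmod w')\<bar> \<le> \<delta> * 1"
    using \<delta>(1) by (intro mult_left_mono) auto
  moreover have "\<delta> * \<bar>32 * 2 ^ gen w * (1 - cmod w) - 32 * 2 ^ gen w * (1 - cmod w')\<bar> = 32 * \<bar>cmod W - cmod W'\<bar>"
  proof -
    have "\<delta> * \<bar>32 * 2 ^ gen w * (1 - cmod w) - 32 * 2 ^ gen w * (1 - cmod w')\<bar> =
        \<bar>(2 ^ gen w * \<delta>) * (32 * (cmod W' - cmod W))\<bar>"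
      using \<delta>(1) by (subst abs_of_pos[OF \<delta>(1), symmetric], subst abs_mult[symmetric]) (simp add: nW algebra_simps)
    then show ?thesis unfolding \<delta>(2) mult_1 abs_mult by (simp add: abs_minus_commute)
  qed
  ultimately have r: "\<bar>cmod W - cmod W'\<bar> \<le> \<delta> / 32" by simp
  have "\<bar>64 * 2 ^ gen w * (Re W + 1) - 64 * 2 ^ gen w * (Re W' + 1)\<bar> < 1"
    using eqs(4) unfolding abscissa_def W_def W'_def by linarith
  then have "\<delta> * \<bar>64 * 2 ^ gen w * (Re W + 1) - 64 * 2 ^ gen w * (Re W' + 1)\<bar> \<le> \<delta> * 1"
    using \<delta>(1) by (intro mult_left_mono) auto
  moreover have "\<delta> * \<bar>64 * 2 ^ gen w * (Re W + 1) - 64 * 2 ^ gen w * (Re W' + 1)\<bar> = 64 * \<bar>Re W - Re W'\<bar>"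
  proof -
    have "\<delta> * \<bar>64 * 2 ^ gen w * (Re W + 1) - 64 * 2 ^ gen w * (Re W' + 1)\<bar> =
        \<bar>(2 ^ gen w * \<delta>) * (64 * (Re W - Re W'))\<bar>"
      using \<delta>(1) by (subst abs_of_pos[OF \<delta>(1), symmetric], subst abs_mult[symmetric]) (simp add: algebra_simps)
    then show ?thesis unfolding \<delta>(2) mult_1 abs_mult by simp
  qed
  ultimately have x: "\<bar>Re W - Re W'\<bar> \<le> \<delta> / 64" by simp
  have le: "cmod z \<le> 3 / 2 * Im z" if "\<bar>Re z\<bar> \<le> Im z" for z
  proof -
    have "(Re z)\<^sup>2 \<le> (Im z)\<^sup>2" using that by (simp add: abs_le_square_iff[symmetric])
    moreover have "(3 / 2 * Im z)\<^sup>2 = 9 / 4 * (Im z)\<^sup>2" by (simp add: power_mult_distrib power_divide)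
    ultimately have "(cmod z)\<^sup>2 \<le> (3 / 2 * Im z)\<^sup>2"
      unfolding cmod_power2 using zero_le_power2[of "Im z"] by linarith
    then show ?thesis by (rule power2_le_imp_le) (use that in auto)
  qed
  define Y where "Y = Im W + Im W'"
  have Y: "0 \<le> Y" using sec by (simp add: Y_def)
  have "\<bar>Im W - Im W'\<bar> \<le> 3 / 2 * (\<delta> / 32) + \<delta> / 64"
  proof (cases "Y = 0")
    case True
    then have "Im W = 0" "Im W' = 0" using sec by (auto simp: Y_def)
    then show ?thesis using \<delta>(1) by simp
  next
    case False
    have "(Im W - Im W') * Y = (cmod W - cmod W') * (cmod W + cmod W') - (Re W - Re W') * (Re W + Re W')"
      using cmod_power2[of W] cmod_power2[of W'] by (simp add: Y_def power2_eq_square algebra_simps)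
    then have "\<bar>Im W - Im W'\<bar> * Y \<le> \<bar>cmod W - cmod W'\<bar> * \<bar>cmod W + cmod W'\<bar> + \<bar>Re W - Re W'\<bar> * \<bar>Re W + Re W'\<bar>"
      using Y abs_triangle_ineq4[of "(cmod W - cmod W') * (cmod W + cmod W')" "(Re W - Re W') * (Re W + Re W')"]
      by (simp add: abs_mult[symmetric]) (simp add: abs_mult)
    also have "\<dots> \<le> (\<delta> / 32) * (3 / 2 * Y) + (\<delta> / 64) * Y"
    proof (intro add_mono mult_mono r x)
      show "\<bar>cmod W + cmod W'\<bar> \<le> 3 / 2 * Y" using le[OF sec(1)] le[OF sec(2)] by (simp add: Y_def)
      show "\<bar>Re W + Re W'\<bar> \<le> Y" using sec by (simp add: Y_def)
    qed (use \<delta>(1) in auto)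
    also have "\<dots> = (3 / 2 * (\<delta> / 32) + \<delta> / 64) * Y" by (simp add: algebra_simps)
    finally show ?thesis using False Y by (simp add: mult_le_cancel_right)
  qed
  then have "cmod (W - W') \<le> \<delta> / 64 + (3 / 2 * (\<delta> / 32) + \<delta> / 64)"
    using cmod_le[of "W - W'"] x by simp
  moreover have "cmod (W - W') = dist w w'"
    by (simp add: W_def W'_def dist_norm norm_mult left_diff_distrib[symmetric])
  ultimately show ?thesis using \<delta>(1) unfolding \<delta>_def[symmetric] by linarith
qed

section \<open>Discs around the cells and their overlap\<close>

definition center :: "nat \<Rightarrow> complex" where
  "center n = (SOME w. w \<in> unit_disk \<and> cell w = n)"

text \<open>Twice the bound of \<open>cell_diameter\<close>, so a cell lies in the half-radius disc
  around any of its points; and less than half of \<open>2^(-gen)\<close>, so the disc stays inside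
  the unit disk.\<close>

definition radius :: "nat \<Rightarrow> real" where
  "radius n = (1 / 5) * (1 / 2) ^ gen (center n)"

lemma center: "n \<in> cell ` unit_disk \<Longrightarrow> center n \<in> unit_disk \<and> cell (center n) = n"
  unfolding center_def by (rule someI_ex) auto

lemma gen_center: "w \<in> unit_disk \<Longrightarrow> gen (center (cell w)) = gen w"
  using center[of "cell w"] by (auto simp: cell_eq_iff cell_index_def)

lemma depth_bounds:
  assumes "w \<in> unit_disk"
  shows "depth w \<in> {0..32}"
proof -
  have "2 ^ gen w * (1 - cmod w) \<le> 2 ^ gen w * (1 / 2) ^ gen w" using gen(2)[OF assms] by (intro mult_left_mono) auto
  then have "2 ^ gen w * (1 - cmod w) \<le> 1" by (simp add: power_mult_distrib[symmetric])
  moreover have "0 \<le> 2 ^ gen w * (1 - cmod w)" using assms by simp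
  ultimately have "0 \<le> depth w \<and> depth w \<le> 32" unfolding depth_def mult.assoc by linarith
  then show ?thesis by simp
qed

text \<open>If a disc of generation \<open>g\<close> contains \<open>\<zeta>\<close>, then
  \<open>1 - |\<zeta>|\<close> lies between \<open>1/2 - 1/5 = 3/10\<close> and
  \<open>1 + 1/5 = 6/5\<close> times \<open>2^(-g)\<close>. The ratio of these ends is 4, so the
  generations differ from \<open>g0\<close> by at most 1. Abscissae lie within 14 of that of
  \<open>\<zeta>\<close>, as \<open>64 / 5 < 13\<close> before rounding. This leaves at most
  \<open>4 * 3 * 33 * 29\<close> indices, for which 100000 is a round bound.\<close>

lemma card_overlap:
  "finite {n \<in> cell ` unit_disk. \<zeta> \<in> ball (center n) (radius n)} \<and>
   card {n \<in> cell ` unit_disk. \<zeta> \<in> ball (center n) (radius n)} \<le> 100000"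
proof (cases "{n \<in> cell ` unit_disk. \<zeta> \<in> ball (center n) (radius n)} = {}")
  case True
  show ?thesis unfolding True by simp
next
  case False
  then obtain n0 where n0: "n0 \<in> cell ` unit_disk" "\<zeta> \<in> ball (center n0) (radius n0)" by blast
  have shell: "3 / 10 * (1 / 2) ^ gen (center n) < 1 - cmod \<zeta> \<and> 1 - cmod \<zeta> < 6 / 5 * (1 / 2) ^ gen (center n)"
    if n: "n \<in> cell ` unit_disk" "\<zeta> \<in> ball (center n) (radius n)" for n
  proof -
    have "cmod (center n - \<zeta>) < (1 / 5) * (1 / 2) ^ gen (center n)" using n(2) by (simp add: dist_norm radius_def)
    moreover have "\<bar>cmod (center n) - cmod \<zeta>\<bar> \<le> cmod (center n - \<zeta>)" by (rule norm_triangle_ineq3)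
    moreover have "center n \<in> unit_disk" using center[OF n(1)] by simp
    from gen[OF this] have "1 / 2 * (1 / 2) ^ gen (center n) < 1 - cmod (center n)" "1 - cmod (center n) \<le> (1 / 2) ^ gen (center n)"
      by simp_all
    ultimately show ?thesis by linarith
  qed
  define g0 where "g0 = gen (center n0)"
  have near: "gen (center n) \<in> {g0 - 1..g0 + 1}" if n: "n \<in> cell ` unit_disk" "\<zeta> \<in> ball (center n) (radius n)" for n
  proof -
    have 1: "False" if "Suc (Suc g) \<le> h" "3 / 10 * (1 / 2) ^ g < x" "x < 6 / 5 * (1 / 2) ^ h" for g h :: nat and x :: real
    proof -
      have "(1 / 2 :: real) ^ h \<le> (1 / 2) ^ Suc (Suc g)" using that(1) by (intro power_decreasing) auto
      then show False using that(2,3) by simp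
    qed
    have "\<not> Suc (Suc g0) \<le> gen (center n)" "\<not> Suc (Suc (gen (center n))) \<le> g0"
      using 1 shell[OF n] shell[OF n0] unfolding g0_def by blast+
    then show ?thesis by auto
  qed
  define b where "b j g = abscissa j g \<zeta>" for j g
  define S where "S = (SIGMA j:{..<4::nat}. SIGMA g:{g0 - 1..g0 + 1}. {0..32::int} \<times> {b j g - 14..b j g + 14})"
  have fS: "finite S" unfolding S_def by auto
  have cS: "card S \<le> 4 * (3 * (33 * 29))"
  proof -
    have "card {g0 - 1..g0 + 1} \<le> 3" by simp
    then have "card (SIGMA g:{g0 - 1..g0 + 1}. {0..32::int} \<times> {b j g - 14..b j g + 14}) \<le> 3 * (33 * 29)" for j
      by (simp add: card_SigmaI card_cartesian_product)
    then have "(\<Sum>j<4. card (SIGMA g:{g0 - 1..g0 + 1}. {0..32::int} \<times> {b j g - 14..b j g + 14})) \<le> (\<Sum>j<4::nat. 3 * (33 * 29))"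
      by (rule sum_mono)
    then show ?thesis unfolding S_def by (subst card_SigmaI) auto
  qed
  have sub: "{n \<in> cell ` unit_disk. \<zeta> \<in> ball (center n) (radius n)} \<subseteq> to_nat ` S"
  proof
    fix n assume "n \<in> {n \<in> cell ` unit_disk. \<zeta> \<in> ball (center n) (radius n)}"
    then have n: "n \<in> cell ` unit_disk" "\<zeta> \<in> ball (center n) (radius n)" by auto
    define w where "w = center n"
    have w: "w \<in> unit_disk" "cell w = n" using center[OF n(1)] by (auto simp: w_def)
    define g where "g = gen w"
    define j where "j = sector w"
    have g: "g \<in> {g0 - 1..g0 + 1}" using near[OF n] by (simp add: g_def w_def)
    have dw: "0 \<le> depth w \<and> depth w \<le> 32" using depth_bounds[OF w(1)] by simp
    have "\<bar>Re (w * \<i> ^ j) - Re (\<zeta> * \<i> ^ j)\<bar> \<le> (1 / 5) * (1 / 2) ^ g"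
    proof -
      have "\<bar>Re (w * \<i> ^ j) - Re (\<zeta> * \<i> ^ j)\<bar> = \<bar>Re ((w - \<zeta>) * \<i> ^ j)\<bar>" by (simp only: left_diff_distrib minus_complex.sel)
      also have "\<dots> \<le> cmod (w - \<zeta>)" using abs_Re_le_cmod[of "(w - \<zeta>) * \<i> ^ j"] by (simp add: norm_mult)
      also have "\<dots> \<le> (1 / 5) * (1 / 2) ^ g" using n(2) by (simp add: dist_norm radius_def w_def g_def)
      finally show ?thesis .
    qed
    then have "2 ^ g * \<bar>Re (w * \<i> ^ j) - Re (\<zeta> * \<i> ^ j)\<bar> \<le> 2 ^ g * ((1 / 5) * (1 / 2) ^ g)" by (intro mult_left_mono) auto
    then have "\<bar>2 ^ g * Re (w * \<i> ^ j) - 2 ^ g * Re (\<zeta> * \<i> ^ j)\<bar> \<le> 1 / 5"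
      by (simp add: power_mult_distrib[symmetric] abs_mult right_diff_distrib[symmetric])
    then have "\<bar>abscissa j g w - abscissa j g \<zeta>\<bar> \<le> 14"
      unfolding abscissa_def distrib_left mult.assoc by linarith
    then have "(j, g, depth w, abscissa j g w) \<in> S"
      using g dw sector_less[of w] by (auto simp: S_def j_def b_def)
    then show "n \<in> to_nat ` S" unfolding w(2)[symmetric] cell_def cell_index_def j_def g_def by blast
  qed
  have "card {n \<in> cell ` unit_disk. \<zeta> \<in> ball (center n) (radius n)} \<le> card (to_nat ` S)"
    by (rule card_mono[OF finite_imageI[OF fS] sub])
  also have "\<dots> \<le> card S" by (rule card_image_le[OF fS])
  finally show ?thesis using cS finite_subset[OF sub finite_imageI[OF fS]] by simp
qed

lemma disk_cells_cell:
  assumes "\<phi> holomorphic_on unit_disk" "\<phi> ` unit_disk \<subseteq> unit_disk"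
  shows "disk_cells \<phi> cell center radius 100000"
proof
  show "\<phi> holomorphic_on unit_disk" "\<phi> ` unit_disk \<subseteq> unit_disk" by (rule assms)+
  show "{w \<in> unit_disk. cell w = n} \<in> sets borel" for n by (rule cell_measurable)
  show "0 < radius n" for n by (simp add: radius_def)
  show "cball (center n) (radius n) \<subseteq> unit_disk" if "n \<in> cell ` unit_disk" for n
  proof
    fix z assume "z \<in> cball (center n) (radius n)"
    then have "cmod (z - center n) \<le> (1 / 5) * (1 / 2) ^ gen (center n)"
      by (simp add: dist_norm radius_def norm_minus_commute)
    moreover have "center n \<in> unit_disk" using center[OF that] by simp
    from gen(1)[OF this] have "1 / 2 * (1 / 2) ^ gen (center n) < 1 - cmod (center n)" by simp
    moreover have "0 < (1 / 2 :: real) ^ gen (center n)" by simp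
    moreover have "cmod z \<le> cmod (center n) + cmod (z - center n)" using norm_triangle_ineq[of "center n" "z - center n"] by simp
    ultimately have "cmod z < 1" by linarith
    then show "z \<in> unit_disk" by simp
  qed
  show "dist (center (cell w)) w \<le> radius (cell w) / 2" if "w \<in> unit_disk" for w
  proof -
    have "center (cell w) \<in> unit_disk" "cell (center (cell w)) = cell w" using center[of "cell w"] that by auto
    from cell_diameter[OF this(1) that this(2)] show ?thesis by (simp add: radius_def)
  qed
  show "finite {n \<in> cell ` unit_disk. \<zeta> \<in> ball (center n) (radius n)} \<and>
    card {n \<in> cell ` unit_disk. \<zeta> \<in> ball (center n) (radius n)} \<le> 100000" for \<zeta> by (rule card_overlap)
qed

section \<open>Separation of cells of one colour\<close>

lemma sum_inverse_squares_int:
  fixes A :: "int set"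
  assumes "finite A"
  shows "(\<Sum>a\<in>A. 1 / max 1 ((real_of_int (a - b))\<^sup>2)) \<le> 5"
proof -
  define f where "f m = 1 / max 1 ((real_of_int m)\<^sup>2)" for m :: int
  have f0: "0 \<le> f m" for m by (simp add: f_def)
  have sq: "f (int (Suc N)) = 1 / (real (Suc N))\<^sup>2" "f (- int (Suc N)) = 1 / (real (Suc N))\<^sup>2" for N
  proof -
    have "1 \<le> (real (Suc N))\<^sup>2" by (rule one_le_power) simp
    then show "f (int (Suc N)) = 1 / (real (Suc N))\<^sup>2" "f (- int (Suc N)) = 1 / (real (Suc N))\<^sup>2"
      by (simp_all add: f_def max_def del: of_nat_Suc)
  qed
  have ends: "{- int (Suc N)..int (Suc N)} = insert (- int (Suc N)) (insert (int (Suc N)) {- int N..int N})" for N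
    by auto
  \<comment> \<open>The term at 0 counts 1 and each of the two tails at most 2, because
    \<open>1 / n^2\<close> is dominated by a telescoping difference; hence 5 in the limit.\<close>
  have main: "(\<Sum>m\<in>{- int (Suc N)..int (Suc N)}. f m) \<le> 5 - 2 / real (Suc N)" for N
  proof (induction N)
    case 0
    have "{- int (Suc 0)..int (Suc 0)} = {-1, 0, 1}" by auto
    then show ?case by (simp add: f_def)
  next
    case (Suc N)
    have "2 * (1 / (real (Suc (Suc N)))\<^sup>2) \<le> 2 / real (Suc N) - 2 / real (Suc (Suc N))"
      by (simp add: divide_simps power2_eq_square)
    then show ?case using Suc unfolding ends[of "Suc N"] by (simp add: sq del: of_nat_Suc)
  qed
  obtain N where N: "\<forall>a\<in>A. \<bar>a - b\<bar> \<le> int N"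
  proof -
    have "finite ((\<lambda>a. nat \<bar>a - b\<bar>) ` A)" using assms by simp
    then obtain N where "\<forall>x\<in>(\<lambda>a. nat \<bar>a - b\<bar>) ` A. x \<le> N" using finite_nat_set_iff_bounded_le by blast
    then show ?thesis by (intro that[of N]) auto
  qed
  have "(\<Sum>a\<in>A. f (a - b)) = (\<Sum>m\<in>(\<lambda>a. a - b) ` A. f m)"
    by (subst sum.reindex) (auto simp: inj_on_def)
  also have "\<dots> \<le> (\<Sum>m\<in>{- int (Suc N)..int (Suc N)}. f m)"
  proof (rule sum_mono2)
    show "(\<lambda>a. a - b) ` A \<subseteq> {- int (Suc N)..int (Suc N)}"
    proof
      fix m assume "m \<in> (\<lambda>a. a - b) ` A"
      then have "\<bar>m\<bar> \<le> int N" using N by auto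
      then show "m \<in> {- int (Suc N)..int (Suc N)}" by auto
    qed
  qed (use f0 in auto)
  also have "\<dots> \<le> 5" using main[of N] by (rule order.trans) simp
  finally show ?thesis by (simp add: f_def)
qed

text \<open>For distinct points of the disk this is \<open>1 / \<rho>^2 - 1\<close>, where
  \<open>\<rho>\<close> is their pseudo-hyperbolic distance.\<close>

definition interaction :: "complex \<Rightarrow> complex \<Rightarrow> real" where
  "interaction a b = (1 - (cmod a)\<^sup>2) * (1 - (cmod b)\<^sup>2) / (cmod (a - b))\<^sup>2"

lemma interaction_commute: "interaction a b = interaction b a"
  by (simp add: interaction_def norm_minus_commute mult.commute)

lemma interaction_nonneg: "a \<in> unit_disk \<Longrightarrow> b \<in> unit_disk \<Longrightarrow> 0 \<le> interaction a b"
  by (simp add: interaction_def power_le_one)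

text \<open>The squared distance is \<open>1 / (1 + interaction a b)\<close>, and
  \<open>1 + x \<le> exp x\<close> turns products of distances into sums of interactions.\<close>

lemma pseudo_hyperbolic_ge_exp:
  assumes ab: "a \<in> unit_disk" "b \<in> unit_disk" "a \<noteq> b"
  shows "exp (- interaction a b) \<le> (cmod ((b - a) / (1 - cnj a * b)))\<^sup>2"
proof -
  have id: "(cmod (1 - cnj a * b))\<^sup>2 = (cmod (a - b))\<^sup>2 + (1 - (cmod a)\<^sup>2) * (1 - (cmod b)\<^sup>2)"
    unfolding cmod_power2 by (simp add: power2_eq_square algebra_simps)
  have pos: "0 < (cmod (a - b))\<^sup>2" using ab(3) by simp
  have X: "0 \<le> interaction a b" by (rule interaction_nonneg[OF ab(1,2)])
  have "(cmod ((b - a) / (1 - cnj a * b)))\<^sup>2 = (cmod (a - b))\<^sup>2 / ((cmod (a - b))\<^sup>2 + (1 - (cmod a)\<^sup>2) * (1 - (cmod b)\<^sup>2))"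
    by (simp add: norm_divide power_divide id norm_minus_commute)
  also have "\<dots> = 1 / (1 + interaction a b)"
  proof -
    have "(cmod (a - b))\<^sup>2 + (1 - (cmod a)\<^sup>2) * (1 - (cmod b)\<^sup>2) = (cmod (a - b))\<^sup>2 * (1 + interaction a b)"
      using pos by (simp add: interaction_def distrib_left)
    then show ?thesis using pos by simp
  qed
  finally have eq: "(cmod ((b - a) / (1 - cnj a * b)))\<^sup>2 = 1 / (1 + interaction a b)" .
  have "exp (- interaction a b) = 1 / exp (interaction a b)" by (simp add: exp_minus inverse_eq_divide)
  also have "\<dots> \<le> 1 / (1 + interaction a b)"
    using X exp_ge_add_one_self[of "interaction a b"] by (intro divide_left_mono) auto
  finally show ?thesis unfolding eq .
qed

text \<open>Both abscissae are measured at the coarser generation \<open>gen w\<close>; let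
  \<open>m\<close> be their difference. If \<open>2 \<le> |m|\<close>, the points are at least
  \<open>\<delta> |m| / 128\<close> apart, which gives \<open>4 * 128^2 = 65536\<close>. If
  \<open>|m| \<le> 1\<close>, the parities force the generations to differ by at least 2, and then
  the moduli alone differ by \<open>\<delta> / 4\<close>. The decay in the difference of generations
  comes from the factor \<open>1 - |v|^2\<close>.\<close>

lemma interaction_bound:
  assumes v: "v \<in> unit_disk" and w: "w \<in> unit_disk" and j: "sector v = j" "sector w = j"
    and d: "depth v = depth w" and ne: "cell v \<noteq> cell w"
    and par: "even (gen v) = even (gen w)" "even (abscissa j (gen v) v) = even (abscissa j (gen w) w)"
    and le: "gen w \<le> gen v"
  shows "interaction v w \<le> 65536 * (1 / 2) ^ (gen v - gen w) /
    max 1 ((real_of_int (abscissa j (gen w) w - abscissa j (gen w) v))\<^sup>2)"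
proof -
  define \<delta> where "\<delta> = (1 / 2 :: real) ^ gen w"
  define q where "q = (1 / 2 :: real) ^ (gen v - gen w)"
  have \<delta>v: "(1 / 2 :: real) ^ gen v = \<delta> * q" using le by (simp add: \<delta>_def q_def power_add[symmetric])
  have \<delta>0: "0 < \<delta>" "2 ^ gen w * \<delta> = 1" by (simp_all add: \<delta>_def power_mult_distrib[symmetric])
  have q0: "0 < q" by (simp add: q_def)
  define m where "m = abscissa j (gen w) w - abscissa j (gen w) v"
  have one: "1 - (cmod z)\<^sup>2 \<le> 2 * (1 / 2) ^ gen z \<and> 0 \<le> 1 - (cmod z)\<^sup>2" if z: "z \<in> unit_disk" for z
  proof -
    have "1 - (cmod z)\<^sup>2 = (1 - cmod z) * (1 + cmod z)" by (simp add: power2_eq_square algebra_simps)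
    also have "\<dots> \<le> (1 / 2) ^ gen z * 2" using gen(2)[OF z] z by (intro mult_mono) auto
    finally show ?thesis using z by (simp add: power_le_one)
  qed
  have num: "(1 - (cmod v)\<^sup>2) * (1 - (cmod w)\<^sup>2) \<le> (2 * (\<delta> * q)) * (2 * \<delta>)"
    using one[OF v] one[OF w] \<delta>v \<delta>0 q0 unfolding \<delta>_def[symmetric] by (intro mult_mono) auto
  have dist_x: "\<delta> * (\<bar>real_of_int m\<bar> - 1) / 64 \<le> cmod (v - w)"
  proof -
    have "\<bar>real_of_int m\<bar> - 1 \<le> \<bar>64 * 2 ^ gen w * (Re (w * \<i> ^ j) + 1) - 64 * 2 ^ gen w * (Re (v * \<i> ^ j) + 1)\<bar>"
      unfolding m_def abscissa_def by linarith
    also have "\<dots> = 64 * 2 ^ gen w * \<bar>Re ((w - v) * \<i> ^ j)\<bar>"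
    proof -
      have "64 * 2 ^ gen w * (Re (w * \<i> ^ j) + 1) - 64 * 2 ^ gen w * (Re (v * \<i> ^ j) + 1) = 64 * 2 ^ gen w * Re ((w - v) * \<i> ^ j)"
        by (simp only: left_diff_distrib minus_complex.sel) (simp add: algebra_simps)
      then show ?thesis by (simp add: abs_mult)
    qed
    also have "\<dots> \<le> 64 * 2 ^ gen w * cmod (v - w)"
      using abs_Re_le_cmod[of "(w - v) * \<i> ^ j"] by (intro mult_left_mono) (simp_all add: norm_mult norm_minus_commute)
    finally have "\<delta> * (\<bar>real_of_int m\<bar> - 1) \<le> \<delta> * (64 * 2 ^ gen w * cmod (v - w))"
      using \<delta>0(1) by (intro mult_left_mono) auto
    also have "\<dots> = (2 ^ gen w * \<delta>) * (64 * cmod (v - w))" by simp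
    finally show ?thesis unfolding \<delta>0(2) by simp
  qed
  have concl: "interaction v w \<le> 65536 * q / M" if D: "\<delta> * x \<le> cmod (v - w)" "0 < x" "4 / x\<^sup>2 \<le> 65536 / M" for x M
  proof -
    have dx: "0 < \<delta> * x" using D(2) \<delta>0 by simp
    have "interaction v w \<le> (2 * (\<delta> * q)) * (2 * \<delta>) / (cmod (v - w))\<^sup>2"
      unfolding interaction_def using num by (intro divide_right_mono) auto
    also have "\<dots> \<le> (2 * (\<delta> * q)) * (2 * \<delta>) / (\<delta> * x)\<^sup>2"
    proof (rule divide_left_mono)
      show "(\<delta> * x)\<^sup>2 \<le> (cmod (v - w))\<^sup>2" using D(1) dx by (intro power_mono) auto
      have "0 < cmod (v - w)" using D(1) dx by linarith
      then have "0 < (cmod (v - w))\<^sup>2" by (rule zero_less_power)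
      moreover have "0 < (\<delta> * x)\<^sup>2" using dx by (rule zero_less_power)
      ultimately show "0 < (cmod (v - w))\<^sup>2 * (\<delta> * x)\<^sup>2" by (rule mult_pos_pos)
    qed (use \<delta>0 q0 in auto)
    also have "\<dots> = q * (4 / x\<^sup>2)" using \<delta>0(1) D(2) by (simp add: power2_eq_square)
    also have "\<dots> \<le> q * (65536 / M)" using D(3) q0 by (intro mult_left_mono) auto
    finally show ?thesis by (simp add: mult.commute)
  qed
  show ?thesis
  proof (cases "2 \<le> \<bar>m\<bar>")
    case True
    then have m2: "2 \<le> \<bar>real_of_int m\<bar>" by linarith
    have "max 1 ((real_of_int m)\<^sup>2) = (real_of_int m)\<^sup>2"
      using m2 power_mono[of 1 "\<bar>real_of_int m\<bar>" 2] by simp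
    moreover have "interaction v w \<le> 65536 * q / (real_of_int m)\<^sup>2"
    proof (rule concl[of "\<bar>real_of_int m\<bar> / 128"])
      have "\<delta> * (\<bar>real_of_int m\<bar> / 128) \<le> \<delta> * ((\<bar>real_of_int m\<bar> - 1) / 64)"
        using m2 \<delta>0 by (intro mult_left_mono) auto
      then show "\<delta> * (\<bar>real_of_int m\<bar> / 128) \<le> cmod (v - w)" using dist_x by simp
    qed (use m2 in \<open>auto simp: power_divide\<close>)
    ultimately show ?thesis by (simp add: m_def q_def)
  next
    case False
    have "gen w \<noteq> gen v"
    proof
      assume eq: "gen w = gen v"
      then have "abscissa j (gen w) w \<noteq> abscissa j (gen w) v"
        using ne j d by (auto simp: cell_eq_iff cell_index_def)
      then have "m \<noteq> 0" by (simp add: m_def)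
      moreover have "even m" using par(2) eq by (simp add: m_def)
      ultimately show False using False by presburger
    qed
    then have g2: "gen w + 2 \<le> gen v" using le par(1) by presburger
    have "q \<le> (1 / 2) ^ 2" unfolding q_def using g2 by (intro power_decreasing) auto
    then have "\<delta> * q \<le> \<delta> * (1 / 4)" using \<delta>0 by (intro mult_left_mono) (auto simp: power2_eq_square)
    moreover have "1 - cmod v \<le> \<delta> * q" using gen(2)[OF v] \<delta>v by simp
    moreover have "\<delta> / 2 < 1 - cmod w" using gen(1)[OF w] by (simp add: \<delta>_def)
    moreover have "cmod v - cmod w \<le> cmod (v - w)" by (rule norm_triangle_ineq2)
    ultimately have dd: "\<delta> * (1 / 4) \<le> cmod (v - w)" by linarith
    have "\<bar>real_of_int m\<bar> \<le> 1" using False by linarith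
    then have "max 1 ((real_of_int m)\<^sup>2) = 1" using power_le_one[of "\<bar>real_of_int m\<bar>" 2] by simp
    moreover have "interaction v w \<le> 65536 * q / 1"
      by (rule concl[OF dd]) (auto simp: power2_eq_square)
    ultimately show ?thesis by (simp add: m_def q_def)
  qed
qed

text \<open>The parities keep distinct cells of one colour apart: their generations differ by at least \<open>2\<close>, or
  they are equal and the abscissae differ by at least \<open>2\<close>.\<close>

definition colour :: "complex \<Rightarrow> nat \<times> int \<times> bool \<times> bool" where
  "colour w = (sector w, depth w, even (gen w), even (abscissa (sector w) (gen w) w))"

text \<open>Each pair is charged to its member of the finer generation. A row then sums over the
  coarser generations and their abscissae to \<open>65536 * 5 * 2\<close>, with 5 from the inverse
  squares and 2 from the geometric series. The total is linear in \<open>n\<close>, that is, a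
  constant factor per cell.\<close>

theorem pseudo_hyperbolic_product_bound:
  fixes w :: "nat \<Rightarrow> complex"
  assumes w: "\<And>i. i < n \<Longrightarrow> w i \<in> unit_disk" and inj: "inj_on (\<lambda>i. cell (w i)) {..<n}"
    and col: "\<And>i. i < n \<Longrightarrow> colour (w i) = \<kappa>"
  shows "exp (- 655360 * real n) \<le> (\<Prod>k<n. \<Prod>i<k. (cmod ((w k - w i) / (1 - cnj (w i) * w k)))\<^sup>2)"
proof -
  obtain j d P Q where \<kappa>: "\<kappa> = (j, d, P, Q)" by (rule prod_cases4)
  have c: "sector (w i) = j" "depth (w i) = d" "even (gen (w i)) = P" "even (abscissa j (gen (w i)) (w i)) = Q" if "i < n" for i
    using col[OF that] by (auto simp: \<kappa> colour_def)
  have cne: "cell (w i) \<noteq> cell (w k)" if "i < n" "k < n" "i \<noteq> k" for i k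
    using inj that by (auto simp: inj_on_def)
  \<comment> \<open>A pair of equal generation is charged to both members, which only enlarges the
    sum.\<close>
  define Y where "Y k i = (if i \<noteq> k \<and> gen (w i) \<le> gen (w k) then interaction (w k) (w i) else 0)" for k i
  have Y0: "0 \<le> Y k i" if "i < n" "k < n" for i k
    using interaction_nonneg[OF w w] that by (simp add: Y_def)
  have tri: "(\<Sum>k<N. \<Sum>i<k. Y k i + Y i k) = (\<Sum>k<N. \<Sum>i<N. Y k i)" for N
  proof (induction N)
    case (Suc N)
    have "Y N N = 0" by (simp add: Y_def)
    then show ?case using Suc by (simp add: sum.distrib)
  qed simp
  have row: "(\<Sum>i<n. Y k i) \<le> 655360" if k: "k < n" for k
  proof -
    define G where "G = gen (w k)"
    define b where "b g = abscissa j g (w k)" for g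
    define B where "B = (\<lambda>(g, a). 65536 * (1 / 2) ^ (G - g) * (1 / max 1 ((real_of_int (a - b g))\<^sup>2)) :: real)"
    have B0: "0 \<le> B p" for p by (auto simp: B_def split: prod.splits)
    define I where "I = {i. i < n \<and> i \<noteq> k \<and> gen (w i) \<le> G}"
    define h where "h i = (gen (w i), abscissa j (gen (w i)) (w i))" for i
    have fI: "finite I" by (simp add: I_def)
    have "(\<Sum>i<n. Y k i) = (\<Sum>i\<in>I. Y k i)"
      by (rule sum.mono_neutral_right) (auto simp: I_def Y_def G_def)
    also have "\<dots> \<le> (\<Sum>i\<in>I. B (h i))"
    proof (rule sum_mono)
      fix i assume "i \<in> I"
      then have i: "i < n" "i \<noteq> k" "gen (w i) \<le> gen (w k)" by (auto simp: I_def G_def)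
      have "interaction (w k) (w i) \<le> 65536 * (1 / 2) ^ (gen (w k) - gen (w i)) /
        max 1 ((real_of_int (abscissa j (gen (w i)) (w i) - abscissa j (gen (w i)) (w k)))\<^sup>2)"
        using c[OF i(1)] c[OF k] cne[OF k i(1)] i by (intro interaction_bound w k) auto
      then show "Y k i \<le> B (h i)" using i by (simp add: Y_def B_def h_def G_def b_def)
    qed
    also have "\<dots> = (\<Sum>p\<in>h ` I. B p)"
    proof (rule sum.reindex[symmetric, unfolded o_def])
      show "inj_on h I"
      proof (rule inj_onI, rule ccontr)
        fix i i' assume i: "i \<in> I" "i' \<in> I" "h i = h i'" "i \<noteq> i'"
        then have "i < n" "i' < n" by (auto simp: I_def)
        with i c[of i] c[of i'] cne[of i i'] show False by (auto simp: cell_eq_iff cell_index_def h_def)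
      qed
    qed
    \<comment> \<open>\<open>B\<close> is nonnegative and depends on generation and abscissa only,
      so the sum may be enlarged to a rectangle and evaluated one generation at a time.\<close>
    also have "\<dots> \<le> (\<Sum>p\<in>{..G} \<times> snd ` h ` I. B p)"
    proof (rule sum_mono2)
      show "h ` I \<subseteq> {..G} \<times> snd ` h ` I"
      proof
        fix p assume p: "p \<in> h ` I"
        then have "fst p \<le> G" by (auto simp: h_def I_def)
        then show "p \<in> {..G} \<times> snd ` h ` I" using p by (metis SigmaI atMost_iff image_eqI prod.collapse)
      qed
    qed (use fI B0 in auto)
    also have "\<dots> = (\<Sum>g\<le>G. \<Sum>a\<in>snd ` h ` I. B (g, a))" by (subst sum.cartesian_product) simp
    also have "\<dots> = (\<Sum>g\<le>G. 65536 * (1 / 2) ^ (G - g) * (\<Sum>a\<in>snd ` h ` I. 1 / max 1 ((real_of_int (a - b g))\<^sup>2)))"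
      by (intro sum.cong refl) (simp add: B_def sum_distrib_left)
    also have "\<dots> \<le> (\<Sum>g\<le>G. 65536 * (1 / 2) ^ (G - g) * 5)"
      using fI by (intro sum_mono mult_left_mono sum_inverse_squares_int) auto
    also have "\<dots> = 65536 * 5 * (\<Sum>g\<le>G. (1 / 2) ^ (G - g))" by (simp add: sum_distrib_right[symmetric] mult_ac)
    also have "(\<Sum>g\<le>G. (1 / 2 :: real) ^ (G - g)) = (\<Sum>g\<le>G. (1 / 2) ^ g)"
      by (rule sum.nat_diff_reindex[of "\<lambda>g. (1 / 2) ^ g" "Suc G", unfolded lessThan_Suc_atMost, simplified])
    also have "(\<Sum>g\<le>G. (1 / 2 :: real) ^ g) \<le> 2"
      unfolding lessThan_Suc_atMost[symmetric] by (subst sum_gp_strict) auto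
    finally show ?thesis by simp
  qed
  have "(\<Sum>k<n. \<Sum>i<k. interaction (w i) (w k)) \<le> (\<Sum>k<n. \<Sum>i<k. Y k i + Y i k)"
  proof (intro sum_mono)
    fix k i assume "k \<in> {..<n}" "i \<in> {..<k}"
    then have ki: "k < n" "i < n" "i \<noteq> k" by auto
    show "interaction (w i) (w k) \<le> Y k i + Y i k"
      using ki Y0[of i k] Y0[of k i] interaction_commute[of "w i" "w k"] by (auto simp: Y_def)
  qed
  also have "\<dots> = (\<Sum>k<n. \<Sum>i<n. Y k i)" by (rule tri)
  also have "\<dots> \<le> (\<Sum>k<n. 655360)" by (intro sum_mono row) simp
  finally have S: "(\<Sum>k<n. \<Sum>i<k. interaction (w i) (w k)) \<le> 655360 * real n" by simp
  then have "exp (- 655360 * real n) \<le> exp (\<Sum>k<n. \<Sum>i<k. - interaction (w i) (w k))"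
    by (simp add: sum_negf)
  also have "\<dots> = (\<Prod>k<n. \<Prod>i<k. exp (- interaction (w i) (w k)))"
    by (simp add: exp_sum)
  also have "\<dots> \<le> (\<Prod>k<n. \<Prod>i<k. (cmod ((w k - w i) / (1 - cnj (w i) * w k)))\<^sup>2)"
  proof (intro prod_mono conjI prod_nonneg)
    fix k i assume "k \<in> {..<n}" "i \<in> {..<k}"
    then have ki: "k < n" "i < n" "i \<noteq> k" by auto
    then have "w i \<noteq> w k" using cne[of i k] by auto
    then show "exp (- interaction (w i) (w k)) \<le> (cmod ((w k - w i) / (1 - cnj (w i) * w k)))\<^sup>2"
      by (intro pseudo_hyperbolic_ge_exp w ki)
  qed auto
  finally show ?thesis .
qed

section \<open>Carleman's inequality and rearrangements\<close>

text \<open>Roots are written with \<open>powr\<close>, which is 0 at base 0, so the identity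
  includes \<open>t = 0\<close>.\<close>

lemma power_Suc_powr_inverse:
  fixes t :: real
  assumes "0 \<le> t"
  shows "(t ^ Suc n) powr (1 / real (Suc n)) = t"
proof (cases "t = 0")
  case False
  then have "0 < t" using assms by simp
  then have "t ^ Suc n = t powr real (Suc n)" by (simp only: powr_realpow)
  then show ?thesis using \<open>0 < t\<close> by (simp only: powr_powr) simp
qed simp

text \<open>Polya's argument: the inequality of the means is applied to the products
  \<open>c j * a j\<close>. After exchanging sums, the tail over \<open>k\<close> telescopes to at
  most \<open>1 / (j + 1)\<close>, and \<open>c j / (j + 1)\<close> is
  \<open>(1 + 1 / (j + 1))^(j + 1)\<close>, hence at most \<open>exp 1\<close>.\<close>

lemma carleman_inequality:
  fixes a :: "nat \<Rightarrow> real"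
  assumes a: "\<And>j. 0 \<le> a j"
  shows "(\<Sum>k<N. (\<Prod>j<Suc k. a j) powr (1 / real (Suc k))) \<le> exp 1 * (\<Sum>j<N. a j)"
proof -
  define c where "c j = real (j + 2) ^ Suc j / real (Suc j) ^ j" for j
    \<comment> \<open>Carleman's weights: the product of the first \<open>k\<close> of them is \<open>(k + 1) ^ k\<close>\<close>
  have c0: "0 < c j" for j by (simp add: c_def)
  have cprod: "(\<Prod>j<Suc k. c j) = real (k + 2) ^ Suc k" for k
  proof (induction k)
    case (Suc k)
    have "(\<Prod>j<Suc (Suc k). c j) = real (k + 2) ^ Suc k * (real (k + 3) ^ Suc (Suc k) / real (k + 2) ^ Suc k)"
      unfolding prod.lessThan_Suc[of _ "Suc k"] Suc by (simp add: c_def eval_nat_numeral)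
    then show ?case by (simp add: eval_nat_numeral)
  qed (simp add: c_def)
  have termk: "(\<Prod>j<Suc k. a j) powr (1 / real (Suc k)) \<le> (\<Sum>j<Suc k. c j * a j) * (1 / (real (Suc k) * real (k + 2)))" for k
  proof -
    have "(\<Prod>j<Suc k. c j * a j) powr (1 / real (card {..<Suc k})) \<le> (\<Sum>j<Suc k. c j * a j / real (card {..<Suc k}))"
      using a c0 by (intro arith_geom_mean) (auto intro: mult_nonneg_nonneg less_imp_le)
    also have "\<dots> = (\<Sum>j<Suc k. c j * a j) / real (Suc k)" by (simp only: sum_divide_distrib card_lessThan)
    finally have 1: "(\<Prod>j<Suc k. c j * a j) powr (1 / real (Suc k)) \<le> (\<Sum>j<Suc k. c j * a j) / real (Suc k)"
      by simp
    have "(\<Prod>j<Suc k. c j * a j) powr (1 / real (Suc k)) =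
        (real (k + 2) ^ Suc k) powr (1 / real (Suc k)) * (\<Prod>j<Suc k. a j) powr (1 / real (Suc k))"
      unfolding prod.distrib cprod by (rule powr_mult)
    also have "(real (k + 2) ^ Suc k) powr (1 / real (Suc k)) = real (k + 2)"
      by (rule power_Suc_powr_inverse) simp
    finally have "real (k + 2) * (\<Prod>j<Suc k. a j) powr (1 / real (Suc k)) \<le> (\<Sum>j<Suc k. c j * a j) / real (Suc k)"
      using 1 by simp
    then have "(real (k + 2) * (\<Prod>j<Suc k. a j) powr (1 / real (Suc k))) / real (k + 2) \<le> ((\<Sum>j<Suc k. c j * a j) / real (Suc k)) / real (k + 2)"
      by (rule divide_right_mono) simp
    moreover have "real (k + 2) * u / real (k + 2) = u" for u by simp
    ultimately show ?thesis by (simp only: divide_divide_eq_left times_divide_eq_right mult_1_right)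
  qed
  have tel: "(\<Sum>k\<in>{j..<N}. 1 / (real (Suc k) * real (k + 2))) \<le> 1 / real (Suc j)" for j
  proof (cases "j \<le> N")
    case True
    have "(\<Sum>k\<in>{j..<N}. 1 / (real (Suc k) * real (k + 2))) = (\<Sum>k\<in>{j..<N}. 1 / real (Suc k) - 1 / real (Suc (Suc k)))"
      by (intro sum.cong refl) (simp add: divide_simps)
    also have "\<dots> = - (\<Sum>k\<in>{j..<N}. 1 / real (Suc (Suc k)) - 1 / real (Suc k))"
      by (simp add: sum_negf[symmetric])
    also have "(\<Sum>k\<in>{j..<N}. 1 / real (Suc (Suc k)) - 1 / real (Suc k)) = 1 / real (Suc N) - 1 / real (Suc j)"
      by (rule sum_Suc_diff'[OF True])
    finally show ?thesis by simp
  qed simp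
  have ce: "c j / real (Suc j) \<le> exp 1" for j
  proof -
    have "c j / real (Suc j) = (1 + 1 / real (Suc j)) ^ Suc j"
    proof -
      have "1 + 1 / real (Suc j) = real (j + 2) / real (Suc j)" by (simp add: field_simps)
      then show ?thesis by (simp add: c_def power_divide)
    qed
    also have "\<dots> \<le> (exp (1 / real (Suc j))) ^ Suc j"
      by (intro power_mono exp_ge_add_one_self) simp
    also have "\<dots> = exp 1" by (simp add: exp_of_nat_mult[symmetric] del: of_nat_Suc power_Suc)
    finally show ?thesis .
  qed
  have "(\<Sum>k<N. (\<Prod>j<Suc k. a j) powr (1 / real (Suc k))) \<le> (\<Sum>k<N. \<Sum>j<Suc k. c j * a j * (1 / (real (Suc k) * real (k + 2))))"
    by (intro sum_mono order.trans[OF termk]) (simp only: sum_distrib_right order.refl)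
  also have "\<dots> = (\<Sum>k<N. \<Sum>j<N. if j \<le> k then c j * a j * (1 / (real (Suc k) * real (k + 2))) else 0)"
  proof (rule sum.cong[OF refl])
    fix k assume "k \<in> {..<N}"
    then have "{..<Suc k} = {..<N} \<inter> {j. j \<le> k}" by auto
    then show "(\<Sum>j<Suc k. c j * a j * (1 / (real (Suc k) * real (k + 2)))) =
      (\<Sum>j<N. if j \<le> k then c j * a j * (1 / (real (Suc k) * real (k + 2))) else 0)"
      using sum.inter_restrict[of "{..<N}" "\<lambda>j. c j * a j * (1 / (real (Suc k) * real (k + 2)))" "{j. j \<le> k}"] by simp
  qed
  also have "\<dots> = (\<Sum>j<N. \<Sum>k<N. if j \<le> k then c j * a j * (1 / (real (Suc k) * real (k + 2))) else 0)"
    by (rule sum.swap)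
  also have "\<dots> = (\<Sum>j<N. c j * a j * (\<Sum>k\<in>{j..<N}. 1 / (real (Suc k) * real (k + 2))))"
  proof (rule sum.cong[OF refl])
    fix j assume "j \<in> {..<N}"
    have "{j..<N} = {..<N} \<inter> {k. j \<le> k}" by auto
    then show "(\<Sum>k<N. if j \<le> k then c j * a j * (1 / (real (Suc k) * real (k + 2))) else 0) =
      c j * a j * (\<Sum>k\<in>{j..<N}. 1 / (real (Suc k) * real (k + 2)))"
      using sum.inter_restrict[of "{..<N}" "\<lambda>k. c j * a j * (1 / (real (Suc k) * real (k + 2)))" "{k. j \<le> k}"]
      by (simp add: sum_distrib_left)
  qed
  also have "\<dots> \<le> (\<Sum>j<N. exp 1 * a j)"
  proof (rule sum_mono)
    fix j assume "j \<in> {..<N}"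
    have "c j * a j * (\<Sum>k\<in>{j..<N}. 1 / (real (Suc k) * real (k + 2))) \<le> c j * a j * (1 / real (Suc j))"
      using tel[of j] a c0 by (intro mult_left_mono mult_nonneg_nonneg) (auto intro: less_imp_le)
    also have "\<dots> = c j / real (Suc j) * a j" by simp
    also have "\<dots> \<le> exp 1 * a j" by (intro mult_right_mono ce a)
    finally show "c j * a j * (\<Sum>k\<in>{j..<N}. 1 / (real (Suc k) * real (k + 2))) \<le> exp 1 * a j" .
  qed
  finally show ?thesis by (simp add: sum_distrib_left)
qed

text \<open>Removing a smallest element from \<open>F\<close> turns the bound on products into a bound on sums, by
  Carleman's inequality.\<close>

lemma sum_le_of_prod_le:
  fixes a :: "nat \<Rightarrow> real" and y :: "'i \<Rightarrow> real"
  assumes a: "\<And>j. 0 \<le> a j" and y: "\<And>i. i \<in> F \<Longrightarrow> 0 \<le> y i" and C: "0 \<le> C" and F: "finite F"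
    and prod: "\<And>G. G \<subseteq> F \<Longrightarrow> (\<Prod>i\<in>G. y i) \<le> C ^ card G * (\<Prod>j<card G. a j)"
  shows "(\<Sum>i\<in>F. y i) \<le> C * exp 1 * (\<Sum>j<card F. a j)"
proof -
  have "(\<Sum>i\<in>G. y i) \<le> C * (\<Sum>k<card G. (\<Prod>j<Suc k. a j) powr (1 / real (Suc k)))" if "G \<subseteq> F" "card G = n" for G n
    using that
  proof (induction n arbitrary: G)
    case 0
    then have "G = {}" using F finite_subset by fastforce
    then show ?case by simp
  next
    case (Suc n)
    have fG: "finite G" using Suc.prems F finite_subset by blast
    have "G \<noteq> {}" using Suc.prems by auto
    then obtain x where x: "x \<in> G" "\<And>i. i \<in> G \<Longrightarrow> y x \<le> y i"
      using finite_has_minimal[of "y ` G"] fG by (metis (no_types) Min_le finite_imageI image_eqI image_is_empty Min_in imageE)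
    have y0: "0 \<le> y x" using y x(1) Suc.prems(1) by blast
    have "y x ^ Suc n = (\<Prod>i\<in>G. y x)" by (simp add: Suc.prems(2))
    also have "\<dots> \<le> (\<Prod>i\<in>G. y i)" using x(2) y0 by (intro prod_mono) auto
    also have "\<dots> \<le> C ^ Suc n * (\<Prod>j<Suc n. a j)" using prod[OF Suc.prems(1)] Suc.prems(2) by simp
    finally have "(y x ^ Suc n) powr (1 / real (Suc n)) \<le> (C ^ Suc n * (\<Prod>j<Suc n. a j)) powr (1 / real (Suc n))"
      using y0 by (intro powr_mono2) auto
    also have "\<dots> = (C ^ Suc n) powr (1 / real (Suc n)) * (\<Prod>j<Suc n. a j) powr (1 / real (Suc n))"
      by (rule powr_mult)
    finally have "y x \<le> C * (\<Prod>j<Suc n. a j) powr (1 / real (Suc n))"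
    proof -
      assume le: "(y x ^ Suc n) powr (1 / real (Suc n)) \<le> (C ^ Suc n) powr (1 / real (Suc n)) * (\<Prod>j<Suc n. a j) powr (1 / real (Suc n))"
      show ?thesis using le unfolding power_Suc_powr_inverse[OF y0] power_Suc_powr_inverse[OF C] .
    qed
    moreover have "(\<Sum>i\<in>G - {x}. y i) \<le> C * (\<Sum>k<card (G - {x}). (\<Prod>j<Suc k. a j) powr (1 / real (Suc k)))"
      using Suc.prems x(1) fG by (intro Suc.IH) auto
    moreover have "card (G - {x}) = n" using Suc.prems x(1) fG by simp
    ultimately have "y x + (\<Sum>i\<in>G - {x}. y i) \<le> C * (\<Sum>k<n. (\<Prod>j<Suc k. a j) powr (1 / real (Suc k))) + C * (\<Prod>j<Suc n. a j) powr (1 / real (Suc n))"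
      by simp
    moreover have "(\<Sum>i\<in>G. y i) = y x + (\<Sum>i\<in>G - {x}. y i)" using fG x(1) by (rule sum.remove)
    ultimately show ?case unfolding Suc.prems(2) sum.lessThan_Suc distrib_left by simp
  qed
  from this[OF order.refl refl]
  have "(\<Sum>i\<in>F. y i) \<le> C * (\<Sum>k<card F. (\<Prod>j<Suc k. a j) powr (1 / real (Suc k)))" .
  also have "\<dots> \<le> C * (exp 1 * (\<Sum>j<card F. a j))"
    by (intro mult_left_mono carleman_inequality a C)
  finally show ?thesis by simp
qed

text \<open>The hypothesis on \<open>b\<close> makes \<open>b n\<close> at most the
  \<open>(n + 1)\<close>-st largest value of \<open>x\<close>, expressed without sorting.
  \<open>F\<close> grows by a maximal outside element; a maximum exists because bounded sums leave
  only finitely many values above a given positive one. When no positive value is left outside,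
  \<open>F\<close> stops growing and \<open>b N\<close> is at most 0.\<close>

lemma sum_le_of_greedy:
  fixes x :: "'i \<Rightarrow> real" and b :: "nat \<Rightarrow> real"
  assumes x: "\<And>i. 0 \<le> x i" and S: "\<And>F. finite F \<Longrightarrow> (\<Sum>i\<in>F. x i) \<le> S"
    and b: "\<And>n F t. finite F \<Longrightarrow> card F \<le> n \<Longrightarrow> 0 \<le> t \<Longrightarrow> (\<And>i. i \<notin> F \<Longrightarrow> x i \<le> t) \<Longrightarrow> b n \<le> t"
  shows "(\<Sum>n<N. b n) \<le> S"
proof -
  have "\<exists>F. finite F \<and> card F \<le> N \<and> (\<Sum>n<N. b n) \<le> (\<Sum>i\<in>F. x i)"
  proof (induction N)
    case 0
    show ?case by (rule exI[of _ "{}"]) simp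
  next
    case (Suc N)
    then obtain F where F: "finite F" "card F \<le> N" "(\<Sum>n<N. b n) \<le> (\<Sum>i\<in>F. x i)" by blast
    show ?case
    proof (cases "\<exists>i. i \<notin> F \<and> 0 < x i")
      case False
      then have "b N \<le> 0" using F by (intro b[OF F(1,2)]) (auto simp: not_less)
      then show ?thesis using F by (intro exI[of _ F]) simp
    next
      case True
      then obtain i0 where i0: "i0 \<notin> F" "0 < x i0" by blast
      define A where "A = {i. i \<notin> F \<and> x i0 \<le> x i}"
      have fA: "finite A"
      proof (rule ccontr)
        assume inf: "infinite A"
        obtain n where n: "S < real n * x i0" using i0(2) reals_Archimedean3 by blast
        obtain B where B: "B \<subseteq> A" "finite B" "card B = n" using infinite_arbitrarily_large[OF inf] by blast
        have "real n * x i0 = (\<Sum>i\<in>B. x i0)" by (simp add: B)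
        also have "\<dots> \<le> (\<Sum>i\<in>B. x i)" using B(1) by (intro sum_mono) (auto simp: A_def)
        also have "\<dots> \<le> S" by (rule S[OF B(2)])
        finally show False using n by simp
      qed
      have "Max (x ` A) \<in> x ` A" using fA i0 by (intro Max_in) (auto simp: A_def)
      then obtain m where m: "m \<in> A" "x m = Max (x ` A)" by auto
      have top: "x i \<le> x m" if "i \<notin> F" for i
      proof (cases "x i0 \<le> x i")
        case True
        then have "i \<in> A" using that by (simp add: A_def)
        then show ?thesis unfolding m(2) using fA by (intro Max_ge) auto
      next
        case False
        then show ?thesis using m(1) by (simp add: A_def)
      qed
      have "b N \<le> x m" by (rule b[OF F(1,2) x top])
      moreover have "m \<notin> F" using m(1) by (simp add: A_def)
      ultimately show ?thesis using F by (intro exI[of _ "insert m F"]) simp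
    qed
  qed
  then obtain F where "finite F" "(\<Sum>n<N. b n) \<le> (\<Sum>i\<in>F. x i)" by blast
  then show ?thesis using S by (meson order.trans)
qed

section \<open>Masses of cells and approximation numbers on the Hardy space\<close>

context disk_cells
begin

lemma \<tau>_inactive: "n \<notin> active \<Longrightarrow> \<tau> n = 0"
proof -
  assume n: "n \<notin> active"
  then have "{z \<in> unit_disk. cell (\<phi> z) = n} = {}" using \<phi>_maps by blast
  then show ?thesis by (simp add: \<tau>_def V_def)
qed

text \<open>If all fibres over the cell were lighter, the change of variables \<open>nn_integral_deriv_fibers\<close>
  would bound \<open>V n\<close> by a constant less than \<open>1\<close> times itself.\<close>

lemma heavy_fiber:
  assumes n: "n \<in> active" and pos: "0 < \<tau> n"
  obtains w Z where "w \<in> unit_disk" "cell w = n" "finite Z" "Z \<subseteq> unit_disk" "\<And>z. z \<in> Z \<Longrightarrow> \<phi> z = w"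
    "s n * sqrt (\<tau> n) / 4 \<le> (\<Sum>z\<in>Z. 1 - (cmod z)\<^sup>2)"
proof (rule ccontr)
  assume neg: "\<not> thesis"
  \<comment> \<open>The divisor 4 makes the factor in the final comparison
    \<open>2 * pi / 16 = pi / 8\<close>, which is below 1.\<close>
  define \<sigma> where "\<sigma> = s n * sqrt (\<tau> n) / 4"
  define R where "R = {w \<in> unit_disk. cell w = n}"
  have s0: "0 < s n" by (rule s_pos[OF n])
  have \<sigma>0: "0 \<le> \<sigma>" using s0 pos by (simp add: \<sigma>_def)
  have V: "enn2real (V n) = \<tau> n * s n ^ 4" using s0 by (simp add: \<tau>_def)
  have Rb: "R \<in> sets borel" unfolding R_def by (rule cell_meas)
  have "(\<integral>\<^sup>+z. ennreal ((cmod (deriv \<phi> z))\<^sup>2 * (1 - (cmod z)\<^sup>2)\<^sup>2) * indicator {z \<in> unit_disk. \<phi> z \<in> R} z \<partial>lborel) \<le>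
      ennreal (2 * \<sigma>\<^sup>2) * emeasure lborel R"
  proof (rule nn_integral_deriv_fibers[OF \<phi>_hol _ Rb])
    show "continuous_on unit_disk (\<lambda>z. (1 - (cmod z)\<^sup>2)\<^sup>2)" by (intro continuous_intros)
    show "0 < (1 - (cmod z)\<^sup>2)\<^sup>2" if "z \<in> unit_disk" for z
    proof -
      have "(cmod z)\<^sup>2 < 1" using that by (simp add: power_less_one_iff)
      then show ?thesis by (simp add: zero_less_power)
    qed
    fix w Z assume w: "w \<in> R" and Z: "finite Z" "Z \<subseteq> unit_disk" "\<And>z. z \<in> Z \<Longrightarrow> \<phi> z = w"
    have u: "0 \<le> 1 - (cmod z)\<^sup>2" if "z \<in> Z" for z
    proof -
      have "cmod z < 1" using that Z(2) by auto
      then show ?thesis by (simp add: power_le_one)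
    qed
    define S where "S = (\<Sum>z\<in>Z. 1 - (cmod z)\<^sup>2)"
    have S0: "0 \<le> S" unfolding S_def by (intro sum_nonneg u)
    have S: "S \<le> \<sigma>"
    proof (rule ccontr)
      assume "\<not> S \<le> \<sigma>"
      then have "s n * sqrt (\<tau> n) / 4 \<le> (\<Sum>z\<in>Z. 1 - (cmod z)\<^sup>2)" by (simp add: S_def \<sigma>_def)
      with neg that[of w Z] w Z show False by (auto simp: R_def)
    qed
    \<comment> \<open>The sum of squares is at most the square of the sum. Here the squared weight
      of the Bergman side becomes the fibre sum of the Hardy side, which is why
      \<open>sqrt (\<tau> n)\<close> appears.\<close>
    have "(\<Sum>z\<in>Z. (1 - (cmod z)\<^sup>2)\<^sup>2) \<le> (\<Sum>z\<in>Z. (1 - (cmod z)\<^sup>2) * S)"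
      unfolding power2_eq_square[of "1 - _"] S_def
      using Z(1) u by (intro sum_mono mult_left_mono member_le_sum) auto
    also have "\<dots> = S * S" by (simp add: S_def sum_distrib_right)
    also have "\<dots> \<le> \<sigma> * \<sigma>" using S S0 \<sigma>0 by (intro mult_mono)
    finally show "(\<Sum>z\<in>Z. (1 - (cmod z)\<^sup>2)\<^sup>2) \<le> \<sigma>\<^sup>2" by (simp add: power2_eq_square)
  qed auto
  also have "{z \<in> unit_disk. \<phi> z \<in> R} = {z \<in> unit_disk. cell (\<phi> z) = n}"
    using \<phi>_maps by (auto simp: R_def image_subset_iff)
  finally have "V n \<le> ennreal (2 * \<sigma>\<^sup>2) * emeasure lborel R" by (simp only: V_def)
  also have "\<dots> \<le> ennreal (2 * \<sigma>\<^sup>2) * emeasure lborel (ball (c n) (s n))"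
  proof (intro mult_left_mono emeasure_mono)
    show "R \<subseteq> ball (c n) (s n)"
    proof
      fix w assume "w \<in> R"
      then have "dist (c n) w \<le> s n / 2" using cell_sub[of w] by (auto simp: R_def)
      then show "w \<in> ball (c n) (s n)" using s0 by simp
    qed
  qed auto
  also have "emeasure lborel (ball (c n) (s n)) = ennreal (pi * (s n)\<^sup>2)"
    using s0 by (subst emeasure_ball) (simp_all add: unit_ball_vol_2 ennreal_mult)
  also have "ennreal (2 * \<sigma>\<^sup>2) * ennreal (pi * (s n)\<^sup>2) = ennreal (2 * \<sigma>\<^sup>2 * (pi * (s n)\<^sup>2))"
    by (rule ennreal_mult[symmetric]) auto
  finally have "enn2real (V n) \<le> 2 * \<sigma>\<^sup>2 * (pi * (s n)\<^sup>2)"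
    by (intro enn2real_leI) auto
  also have "\<dots> = (\<tau> n * s n ^ 4) * (pi / 8)"
    using pos by (simp add: \<sigma>_def power_divide power_mult_distrib eval_nat_numeral)
  finally have "1 * (\<tau> n * s n ^ 4) \<le> (pi / 8) * (\<tau> n * s n ^ 4)" unfolding V by (simp add: mult_ac)
  moreover have "(pi / 8) * (\<tau> n * s n ^ 4) < 1 * (\<tau> n * s n ^ 4)"
    using pos s0 pi_less_4 by (intro mult_strict_right_mono mult_pos_pos zero_less_power) auto
  ultimately show False by linarith
qed

end

text \<open>Combines \<open>|z|^2 \<le> exp (- (1 - |z|^2))\<close> with
  \<open>exp (- m) \<le> 1 / (1 + m) \<le> 1 - m / 2\<close>; the last estimate holds for
  \<open>m\<close> between 0 and 1, hence the minimum. For infinite \<open>Z\<close> the sum is 0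
  and the product 1, so both sides are 0.\<close>

lemma min_sum_le_one_minus_prod:
  assumes "Z \<subseteq> unit_disk"
  shows "min 1 (\<Sum>z\<in>Z. 1 - (cmod z)\<^sup>2) / 2 \<le> 1 - (\<Prod>z\<in>Z. cmod z)\<^sup>2"
proof -
  define m where "m = min 1 (\<Sum>z\<in>Z. 1 - (cmod z)\<^sup>2)"
  have "0 \<le> 1 - (cmod z)\<^sup>2" if "z \<in> Z" for z
  proof -
    have "cmod z < 1" using that assms by auto
    then show ?thesis by (simp add: power_le_one)
  qed
  then have m: "0 \<le> m" "m \<le> 1" unfolding m_def by (auto intro!: sum_nonneg)
  show ?thesis
  proof (cases "finite Z")
    case True
    have "(\<Prod>z\<in>Z. cmod z)\<^sup>2 = (\<Prod>z\<in>Z. (cmod z)\<^sup>2)" by (simp add: prod_power_distrib)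
    also have "\<dots> \<le> (\<Prod>z\<in>Z. exp (- (1 - (cmod z)\<^sup>2)))"
    proof (intro prod_mono conjI)
      fix z
      show "(cmod z)\<^sup>2 \<le> exp (- (1 - (cmod z)\<^sup>2))" using exp_ge_add_one_self[of "- (1 - (cmod z)\<^sup>2)"] by simp
    qed simp
    also have "\<dots> = exp (- (\<Sum>z\<in>Z. 1 - (cmod z)\<^sup>2))" unfolding sum_negf[symmetric] exp_sum[OF True] ..
    also have "\<dots> \<le> exp (- m)" by (simp add: m_def)
    also have "\<dots> \<le> 1 / (1 + m)"
      using exp_ge_add_one_self[of m] m by (simp add: exp_minus inverse_eq_divide frac_le)
    also have "\<dots> \<le> 1 - m / 2"
    proof -
      have "m * m \<le> m * 1" using m by (intro mult_left_mono) auto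
      then show ?thesis using m by (simp add: field_simps)
    qed
    finally show ?thesis by (simp add: m_def)
  qed (simp)
qed

lemma colour_cong: "cell v = cell w \<Longrightarrow> colour v = colour w"
  by (auto simp: cell_eq_iff cell_index_def colour_def)

definition colours :: "(nat \<times> int \<times> bool \<times> bool) set" where
  "colours = {..<4} \<times> {0..32} \<times> UNIV \<times> UNIV"

lemma finite_colours: "finite colours"
  by (simp add: colours_def)

lemma colour_in_colours: "w \<in> unit_disk \<Longrightarrow> colour w \<in> colours"
  using sector_less[of w] depth_bounds[of w] by (simp add: colour_def colours_def)

text \<open>Allows the cells of large radius, which \<open>heavy_fiber_ratio\<close> does not cover,
  to be set aside. A bound on the generation bounds every component of the cell index.\<close>

lemma finite_cells_gen_less: "finite {n \<in> cell ` unit_disk. gen (center n) < g}"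
proof -
  define S where "S = {..<4::nat} \<times> {..<g} \<times> {0..32::int} \<times> {0..128 * 2 ^ g :: int}"
  have "n \<in> to_nat ` S" if n: "n \<in> cell ` unit_disk" "gen (center n) < g" for n
  proof -
    define w where "w = center n"
    have w: "w \<in> unit_disk" "cell w = n" using center[OF n(1)] by (auto simp: w_def)
    define x where "x = Re (w * \<i> ^ sector w)"
    have "\<bar>x\<bar> \<le> cmod (w * \<i> ^ sector w)" unfolding x_def by (rule abs_Re_le_cmod)
    also have "\<dots> \<le> 1" using w(1) by (simp add: norm_mult)
    finally have x: "0 \<le> x + 1" "x + 1 \<le> 2" by linarith+
    have "(2::real) ^ gen w \<le> 2 ^ g" using n(2) by (intro power_increasing) (auto simp: w_def)
    then have "64 * 2 ^ gen w * (x + 1) \<le> 64 * 2 ^ g * 2" using x by (intro mult_mono) auto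
    then have "64 * 2 ^ gen w * (x + 1) \<le> of_int (128 * 2 ^ g)" by simp
    then have 1: "abscissa (sector w) (gen w) w \<le> 128 * 2 ^ g"
      unfolding abscissa_def x_def by linarith
    have "0 \<le> 64 * 2 ^ gen w * (x + 1)" using x by simp
    then have "0 \<le> abscissa (sector w) (gen w) w" unfolding abscissa_def x_def by simp
    with 1 have "cell_index w \<in> S"
      using sector_less[of w] depth_bounds[OF w(1)] n(2) by (simp add: cell_index_def S_def w_def)
    then show ?thesis unfolding w(2)[symmetric] cell_def by (rule imageI)
  qed
  then have "{n \<in> cell ` unit_disk. gen (center n) < g} \<subseteq> to_nat ` S" by blast
  then show ?thesis by (rule finite_subset) (simp add: S_def)
qed

section \<open>Cell masses against Hardy approximation numbers\<close>

locale bounded_hardy_composition =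
  fixes \<phi> :: "complex \<Rightarrow> complex"
  assumes hol: "\<phi> holomorphic_on unit_disk" and maps: "\<phi> ` unit_disk \<subseteq> unit_disk"
    and bounded_hardy: "bounded_operator hardy_space hardy_norm (composition_operator \<phi>)"
begin

sublocale disk_cells \<phi> cell center radius 100000
  by (rule disk_cells_cell[OF hol maps])

definition a :: "nat \<Rightarrow> real" where
  "a k = approximation_number hardy_space hardy_norm (Suc k) (composition_operator \<phi>)"

text \<open>Smallness removes the minimum in \<open>min_sum_le_one_minus_prod\<close>: the fibre
  bound for one point keeps the ratio below \<open>(a 0)^2\<close>, so \<open>m < 1\<close> and
  \<open>m\<close> is the fibre sum. In \<open>80 = 4 * 2 * 10\<close>, 4 comes from
  \<open>heavy_fiber\<close>, 2 from halving the minimum, and 10 from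
  \<open>1 - |w|^2 \<le> 2 * 2^(-gen w) = 10 * radius n\<close>.\<close>

lemma heavy_fiber_ratio:
  assumes n: "n \<in> active" "0 < \<tau> n" and small: "20 * radius n * (a 0)\<^sup>2 < 1"
  obtains w Z where "w \<in> unit_disk" "cell w = n" "finite Z" "Z \<subseteq> unit_disk" "\<And>z. z \<in> Z \<Longrightarrow> \<phi> z = w"
    "sqrt (\<tau> n) / 80 \<le> (1 - (\<Prod>z\<in>Z. cmod z)\<^sup>2) / (1 - (cmod w)\<^sup>2)"
proof -
  obtain w Z where w: "w \<in> unit_disk" "cell w = n" and Z: "finite Z" "Z \<subseteq> unit_disk" "\<And>z. z \<in> Z \<Longrightarrow> \<phi> z = w"
    and S: "radius n * sqrt (\<tau> n) / 4 \<le> (\<Sum>z\<in>Z. 1 - (cmod z)\<^sup>2)"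
    by (rule heavy_fiber[OF n]) (rule that; assumption)
  define m where "m = min 1 (\<Sum>z\<in>Z. 1 - (cmod z)\<^sup>2)"
  define N where "N = 1 - (\<Prod>z\<in>Z. cmod z)\<^sup>2"
  define D where "D = 1 - (cmod w)\<^sup>2"
  have s0: "0 < radius n" by (rule s_pos[OF n(1)])
  have cw: "cmod w < 1" using w(1) by simp
  have mN: "m / 2 \<le> N" unfolding m_def N_def by (rule min_sum_le_one_minus_prod[OF Z(2)])
  have "0 \<le> radius n * sqrt (\<tau> n) / 4" using s0 n(2) by simp
  then have m0: "0 \<le> m" unfolding m_def using S by linarith
  have D0: "0 < D" using cw by (simp add: D_def power_less_one_iff)
  have "D = (1 - cmod w) * (1 + cmod w)" by (simp add: D_def power2_eq_square algebra_simps)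
  also have "\<dots> \<le> (1 / 2) ^ gen w * 2" using gen(2)[OF w(1)] cw by (intro mult_mono) auto
  also have "(1 / 2) ^ gen w = 5 * radius n" using gen_center[OF w(1)] w(2) by (simp add: radius_def)
  finally have D: "D \<le> 10 * radius n" by simp
  have low: "m / (20 * radius n) \<le> N / D"
  proof -
    have "m / 2 / (10 * radius n) \<le> N / D"
      using mN m0 D D0 by (intro frac_le) auto
    then show ?thesis by simp
  qed
  have "(\<Prod>k<1::nat. N / D * (\<Prod>i<k. (cmod ((w - w) / (1 - cnj w * w)))\<^sup>2)) \<le> (\<Prod>k<1::nat. (a k)\<^sup>2)"
    unfolding N_def D_def a_def
    by (rule hardy_fiber_product_bound[OF bounded_hardy, where w = "\<lambda>_. w" and Z = "\<lambda>_. Z"]) (use cw Z in auto)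
  then have "N / D \<le> (a 0)\<^sup>2" by simp
  with low have "m / (20 * radius n) \<le> (a 0)\<^sup>2" by linarith
  then have "m \<le> 20 * radius n * (a 0)\<^sup>2" using s0 by (simp add: field_simps)
  with small have "m < 1" by linarith
  then have "m = (\<Sum>z\<in>Z. 1 - (cmod z)\<^sup>2)" by (auto simp: m_def min_def split: if_splits)
  with S have "radius n * sqrt (\<tau> n) / 4 / (20 * radius n) \<le> m / (20 * radius n)"
    using s0 by (intro divide_right_mono) auto
  then have "sqrt (\<tau> n) / 80 \<le> m / (20 * radius n)" using s0 by simp
  with low have "sqrt (\<tau> n) / 80 \<le> N / D" by linarith
  then show ?thesis using that[OF w Z] by (simp add: N_def D_def)
qed

text \<open>Multiplies the ratios over cells of one colour. Each cell costs a factor 80 from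
  \<open>heavy_fiber_ratio\<close> and a factor \<open>exp 655360\<close> from the pseudo-hyperbolic
  distances in \<open>hardy_fiber_product_bound\<close>.\<close>

lemma prod_sqrt_le:
  assumes G: "finite G" "G \<subseteq> active" and col: "\<And>n. n \<in> G \<Longrightarrow> colour (center n) = \<kappa>"
    and small: "\<And>n. n \<in> G \<Longrightarrow> 20 * radius n * (a 0)\<^sup>2 < 1"
  shows "(\<Prod>n\<in>G. sqrt (\<tau> n)) \<le> (80 * exp 655360) ^ card G * (\<Prod>j<card G. (a j)\<^sup>2)"
proof (cases "\<exists>n\<in>G. \<tau> n = 0")
  case True
  then have "(\<Prod>n\<in>G. sqrt (\<tau> n)) = 0" using G(1) by (auto intro!: prod_zero)
  also have "0 \<le> (80 * exp 655360) ^ card G * (\<Prod>j<card G. (a j)\<^sup>2)"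
    by (intro mult_nonneg_nonneg prod_nonneg) auto
  finally show ?thesis .
next
  case False
  have pos: "0 < \<tau> n" if "n \<in> G" for n
  proof -
    have "n \<in> active" using that G(2) by blast
    from \<tau>_nonneg[OF this] show ?thesis using False that by (simp add: less_le)
  qed
  define k where "k = card G"
  obtain h where h: "bij_betw h {..<k} G"
    using ex_bij_betw_nat_finite[OF G(1)] unfolding k_def atLeast0LessThan by blast
  have hG: "h i \<in> G" if "i < k" for i using bij_betwE[OF h] that by simp
  have "\<forall>i. \<exists>p. i < k \<longrightarrow> fst p \<in> unit_disk \<and> cell (fst p) = h i \<and> finite (snd p) \<and> snd p \<subseteq> unit_disk \<and>
      (\<forall>z\<in>snd p. \<phi> z = fst p) \<and>
      sqrt (\<tau> (h i)) / 80 \<le> (1 - (\<Prod>z\<in>snd p. cmod z)\<^sup>2) / (1 - (cmod (fst p))\<^sup>2)"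
  proof
    fix i
    show "\<exists>p. i < k \<longrightarrow> fst p \<in> unit_disk \<and> cell (fst p) = h i \<and> finite (snd p) \<and> snd p \<subseteq> unit_disk \<and>
      (\<forall>z\<in>snd p. \<phi> z = fst p) \<and>
      sqrt (\<tau> (h i)) / 80 \<le> (1 - (\<Prod>z\<in>snd p. cmod z)\<^sup>2) / (1 - (cmod (fst p))\<^sup>2)"
    proof (cases "i < k")
      case True
      have "h i \<in> active" using hG[OF True] G(2) by blast
      then obtain w Z where "w \<in> unit_disk" "cell w = h i" "finite Z" "Z \<subseteq> unit_disk" "\<And>z. z \<in> Z \<Longrightarrow> \<phi> z = w"
        "sqrt (\<tau> (h i)) / 80 \<le> (1 - (\<Prod>z\<in>Z. cmod z)\<^sup>2) / (1 - (cmod w)\<^sup>2)"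
        using heavy_fiber_ratio[OF _ pos[OF hG[OF True]] small[OF hG[OF True]]] by metis
      then show ?thesis by (intro exI[of _ "(w, Z)"]) simp
    qed simp
  qed
  from choice[OF this] obtain p where p: "\<forall>i. i < k \<longrightarrow> fst (p i) \<in> unit_disk \<and> cell (fst (p i)) = h i \<and> finite (snd (p i)) \<and> snd (p i) \<subseteq> unit_disk \<and>
      (\<forall>z\<in>snd (p i). \<phi> z = fst (p i)) \<and>
      sqrt (\<tau> (h i)) / 80 \<le> (1 - (\<Prod>z\<in>snd (p i). cmod z)\<^sup>2) / (1 - (cmod (fst (p i)))\<^sup>2)" ..
  define w where "w i = fst (p i)" for i
  define Z where "Z i = snd (p i)" for i
  define q where "q i = (1 - (\<Prod>z\<in>Z i. cmod z)\<^sup>2) / (1 - (cmod (w i))\<^sup>2)" for i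
  define \<rho> where "\<rho> j i = (cmod ((w j - w i) / (1 - cnj (w i) * w j)))\<^sup>2" for j i
  have w: "w i \<in> unit_disk" "cell (w i) = h i" and Z: "finite (Z i)" "Z i \<subseteq> unit_disk" "\<And>z. z \<in> Z i \<Longrightarrow> \<phi> z = w i"
    and q: "sqrt (\<tau> (h i)) / 80 \<le> q i" if "i < k" for i
    using p[rule_format, OF that] by (simp_all add: w_def Z_def q_def)
  have sep: "exp (- 655360 * real k) \<le> (\<Prod>j<k. \<Prod>i<j. \<rho> j i)"
    unfolding \<rho>_def
  proof (rule pseudo_hyperbolic_product_bound)
    show "w i \<in> unit_disk" if "i < k" for i by (rule w(1)[OF that])
    have "inj_on h {..<k}" using h by (rule bij_betw_imp_inj_on)
    then show "inj_on (\<lambda>i. cell (w i)) {..<k}"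
      using w(2) by (subst inj_on_cong[of _ _ h]) auto
    show "colour (w i) = \<kappa>" if "i < k" for i
    proof -
      have "h i \<in> active" using hG[OF that] G(2) by blast
      then have "cell (center (h i)) = cell (w i)" using center w(2)[OF that] by simp
      from colour_cong[OF this] col[OF hG[OF that]] show ?thesis by simp
    qed
  qed
  have "(\<Prod>n\<in>G. sqrt (\<tau> n)) = (\<Prod>i<k. sqrt (\<tau> (h i)))"
    by (rule prod.reindex_bij_betw[OF h, symmetric])
  also have "\<dots> = 80 ^ k * (\<Prod>i<k. sqrt (\<tau> (h i)) / 80)"
    by (simp add: prod_dividef)
  also have "\<dots> \<le> 80 ^ k * (\<Prod>i<k. q i)"
  proof (intro mult_left_mono prod_mono conjI)
    fix i assume "i \<in> {..<k}"
    then have "i < k" by simp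
    then show "sqrt (\<tau> (h i)) / 80 \<le> q i" by (rule q)
    show "0 \<le> sqrt (\<tau> (h i)) / 80" using pos[OF hG[OF \<open>i < k\<close>]] by simp
  qed simp
  also have "\<dots> = 80 ^ k * exp 655360 ^ k * (exp (- 655360 * real k) * (\<Prod>i<k. q i))"
  proof -
    have "exp 655360 ^ k * exp (- 655360 * real k) = (1 :: real)"
      by (simp add: exp_of_nat_mult[symmetric] exp_add[symmetric] mult.commute)
    then show ?thesis by simp
  qed
  also have "\<dots> \<le> 80 ^ k * exp 655360 ^ k * ((\<Prod>j<k. \<Prod>i<j. \<rho> j i) * (\<Prod>i<k. q i))"
  proof (intro mult_left_mono mult_right_mono sep prod_nonneg)
    fix i assume "i \<in> {..<k}"
    then have i: "i < k" by simp
    have "0 \<le> sqrt (\<tau> (h i)) / 80" using pos[OF hG[OF i]] by simp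
    with q[OF i] show "0 \<le> q i" by linarith
  qed auto
  also have "(\<Prod>j<k. \<Prod>i<j. \<rho> j i) * (\<Prod>i<k. q i) = (\<Prod>j<k. q j * (\<Prod>i<j. \<rho> j i))"
    by (simp add: prod.distrib mult.commute)
  also have "\<dots> \<le> (\<Prod>j<k. (a j)\<^sup>2)"
    unfolding q_def \<rho>_def a_def
    by (rule hardy_fiber_product_bound[OF bounded_hardy]) (use w Z in auto)
  finally show ?thesis by (simp add: k_def power_mult_distrib mult_left_mono)
qed

text \<open>The finitely many cells of large radius go into the constant. The others split into
  finitely many colours, and \<open>sum_le_of_prod_le\<close> is applied to each after raising
  \<open>prod_sqrt_le\<close> to the power \<open>p / 2\<close>: \<open>sqrt \<tau>\<close> becomes
  \<open>\<tau> powr (p / 4)\<close>, and the squared numbers become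
  \<open>a powr p\<close>.\<close>

lemma sum_powr_bound:
  assumes p: "0 < p" and sm: "summable (\<lambda>k. a k powr p)"
  shows "\<exists>S. \<forall>F. finite F \<longrightarrow> (\<Sum>n\<in>F. \<tau> n powr (p / 4)) \<le> S"
proof -
  define C where "C = (80 * exp 655360 :: real) powr (p / 2)"
  define B where "B = C * exp 1 * (\<Sum>k. a k powr p)"
  define \<theta> where "\<theta> n = \<tau> n powr (p / 4)" for n
  have \<theta>0: "0 \<le> \<theta> n" for n by (simp add: \<theta>_def)
  \<comment> \<open>\<open>20 * radius n\<close> is \<open>4 * 2^(-gen (center n))\<close>, so the
    smallness condition holds from generation \<open>g\<close> on; adding 1 keeps the denominator
    positive.\<close>
  obtain g where g: "(1 / 2) ^ g < 1 / (4 * (a 0)\<^sup>2 + 1)"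
    using real_arch_pow_inv[of "1 / (4 * (a 0)\<^sup>2 + 1)" "1 / 2"] by (auto simp: add_nonneg_pos)
  define E where "E = {n \<in> active. gen (center n) < g}"
  have fE: "finite E" unfolding E_def by (rule finite_cells_gen_less)
  have small: "20 * radius n * (a 0)\<^sup>2 < 1" if "g \<le> gen (center n)" for n
  proof -
    have "(1 / 2 :: real) ^ gen (center n) \<le> (1 / 2) ^ g" using that by (intro power_decreasing) auto
    then have "(1 / 2) ^ gen (center n) * (4 * (a 0)\<^sup>2) \<le> (1 / 2) ^ g * (4 * (a 0)\<^sup>2 + 1)"
      by (intro mult_mono) auto
    also have "\<dots> < 1 / (4 * (a 0)\<^sup>2 + 1) * (4 * (a 0)\<^sup>2 + 1)"
      using g by (intro mult_strict_right_mono) (auto simp: add_nonneg_pos)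
    also have "\<dots> = 1" by (simp add: add_nonneg_pos less_imp_neq[symmetric])
    finally show ?thesis by (simp add: radius_def)
  qed
  have mono: "(\<Sum>n\<in>F. \<theta> n) \<le> B"
    if F: "finite F" "F \<subseteq> active - E" and col: "\<And>n. n \<in> F \<Longrightarrow> colour (center n) = \<kappa>" for F \<kappa>
  proof -
    have "(\<Sum>n\<in>F. \<theta> n) \<le> C * exp 1 * (\<Sum>j<card F. a j powr p)"
    proof (rule sum_le_of_prod_le)
      fix G assume G: "G \<subseteq> F"
      have fG: "finite G" using G F(1) finite_subset by blast
      have GA: "G \<subseteq> active" using G F(2) by blast
      have "(\<Prod>n\<in>G. sqrt (\<tau> n)) \<le> (80 * exp 655360) ^ card G * (\<Prod>j<card G. (a j)\<^sup>2)"
      proof (rule prod_sqrt_le[OF fG GA])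
        fix n assume n: "n \<in> G"
        show "colour (center n) = \<kappa>" using n G col by blast
        show "20 * radius n * (a 0)\<^sup>2 < 1" using n G F(2) by (intro small) (auto simp: E_def)
      qed
      moreover have "0 \<le> (\<Prod>n\<in>G. sqrt (\<tau> n))" using GA by (intro prod_nonneg) (auto intro: \<tau>_nonneg)
      ultimately have "(\<Prod>n\<in>G. sqrt (\<tau> n)) powr (p / 2) \<le> ((80 * exp 655360) ^ card G * (\<Prod>j<card G. (a j)\<^sup>2)) powr (p / 2)"
        using p by (intro powr_mono2) auto
      also have "\<dots> = C ^ card G * (\<Prod>j<card G. (a j)\<^sup>2 powr (p / 2))"
      proof -
        have "((80 * exp 655360 :: real) ^ card G) powr (p / 2) = (\<Prod>j<card G. C)"
          unfolding C_def prod_powr_distrib[symmetric] by simp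
        then show ?thesis by (simp add: powr_mult prod_powr_distrib)
      qed
      also have "(\<Prod>j<card G. (a j)\<^sup>2 powr (p / 2)) = (\<Prod>j<card G. a j powr p)"
      proof (intro prod.cong refl)
        fix j
        have "(a j)\<^sup>2 powr (p / 2) = (a j powr (p / 2)) * (a j powr (p / 2))" by (simp add: power2_eq_square powr_mult)
        then show "(a j)\<^sup>2 powr (p / 2) = a j powr p" by (simp add: powr_add[symmetric])
      qed
      also have "(\<Prod>n\<in>G. sqrt (\<tau> n)) powr (p / 2) = (\<Prod>n\<in>G. \<theta> n)"
        unfolding prod_powr_distrib
      proof (intro prod.cong refl)
        fix n assume "n \<in> G"
        then have "n \<in> active" using GA by blast
        from \<tau>_nonneg[OF this] have "sqrt (\<tau> n) = \<tau> n powr (1 / 2)" by (simp add: powr_half_sqrt)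
        then show "sqrt (\<tau> n) powr (p / 2) = \<theta> n" by (simp add: powr_powr \<theta>_def)
      qed
      finally show "(\<Prod>n\<in>G. \<theta> n) \<le> C ^ card G * (\<Prod>j<card G. a j powr p)" .
    qed (use F in \<open>auto simp: \<theta>_def C_def\<close>)
    also have "\<dots> \<le> B"
      unfolding B_def using sm by (intro mult_left_mono sum_le_suminf) (auto simp: C_def)
    finally show ?thesis .
  qed
  have "(\<Sum>n\<in>F. \<theta> n) \<le> (\<Sum>n\<in>E. \<theta> n) + real (card colours) * B" if F: "finite F" for F
  proof -
    define F' where "F' = F \<inter> (active - E)"
    have fF': "finite F'" using F by (simp add: F'_def)
    have z: "\<theta> n = 0" if "n \<notin> active" for n using \<tau>_inactive[OF that] by (simp add: \<theta>_def)
    have "(\<Sum>n\<in>F. \<theta> n) = (\<Sum>n\<in>F \<inter> active. \<theta> n)"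
      using F z by (intro sum.mono_neutral_right) auto
    also have "\<dots> \<le> (\<Sum>n\<in>E \<union> F'. \<theta> n)"
      using fE fF' \<theta>0 by (intro sum_mono2) (auto simp: F'_def)
    also have "\<dots> = (\<Sum>n\<in>E. \<theta> n) + (\<Sum>n\<in>F'. \<theta> n)"
      using fE fF' by (intro sum.union_disjoint) (auto simp: F'_def)
    also have "(\<Sum>n\<in>F'. \<theta> n) = (\<Sum>\<kappa>\<in>colours. \<Sum>n\<in>{n \<in> F'. colour (center n) = \<kappa>}. \<theta> n)"
    proof (rule sum.group[symmetric, OF fF' finite_colours])
      show "(\<lambda>n. colour (center n)) ` F' \<subseteq> colours"
      proof
        fix \<kappa> assume "\<kappa> \<in> (\<lambda>n. colour (center n)) ` F'"
        then obtain n where n: "n \<in> active" "\<kappa> = colour (center n)" by (auto simp: F'_def)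
        have "center n \<in> unit_disk" using center[OF n(1)] by simp
        then show "\<kappa> \<in> colours" unfolding n(2) by (rule colour_in_colours)
      qed
    qed
    also have "\<dots> \<le> (\<Sum>\<kappa>\<in>colours. B)"
    proof (rule sum_mono)
      fix \<kappa> assume "\<kappa> \<in> colours"
      show "(\<Sum>n\<in>{n \<in> F'. colour (center n) = \<kappa>}. \<theta> n) \<le> B"
      proof (rule mono[of _ \<kappa>])
        show "finite {n \<in> F'. colour (center n) = \<kappa>}" using fF' by simp
      qed (auto simp: F'_def)
    qed
    finally show ?thesis by simp
  qed
  then show ?thesis unfolding \<theta>_def by blast
qed

end

section \<open>From cell masses to the Bergman Schatten class\<close>

context disk_cells
begin

text \<open>\<open>x (n, j)\<close> in the proof is the \<open>q\<close>-th power of the bound left on cell \<open>n\<close> after \<open>j\<close> vanishing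
  conditions. A finite set \<open>F\<close> of pairs is spent on the conditions \<open>j < J n\<close>, where \<open>J n\<close> is the first
  \<open>j\<close> with \<open>(n, j) \<notin> F\<close>.\<close>

lemma schatten_class_of_summable:
  assumes q: "0 < q" and S: "\<And>F. finite F \<Longrightarrow> (\<Sum>n\<in>F. \<tau> n powr (q / 2)) \<le> S"
  shows "composition_operator \<phi> \<in> schatten_class q bergman_space bergman_norm"
proof -
  have \<tau>0: "0 \<le> \<tau> n" for n using \<tau>_nonneg \<tau>_inactive by (cases "n \<in> active") auto
  have root: "x \<le> t powr (2 / q)" if "x powr (q / 2) \<le> t" "0 \<le> x" for x t
  proof -
    have "(x powr (q / 2)) powr (2 / q) \<le> t powr (2 / q)" using that q by (intro powr_mono2) auto
    then show ?thesis using that q by (simp add: powr_powr)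
  qed
  have small: "finite {n \<in> active. \<tau> n > \<epsilon>}" if \<epsilon>: "0 < \<epsilon>" for \<epsilon>
  proof (rule ccontr)
    assume inf: "infinite {n \<in> active. \<tau> n > \<epsilon>}"
    have e0: "0 < \<epsilon> powr (q / 2)" using \<epsilon> by simp
    obtain m where m: "S < real m * \<epsilon> powr (q / 2)" using reals_Archimedean3[OF e0] by blast
    obtain B where B: "B \<subseteq> {n \<in> active. \<tau> n > \<epsilon>}" "finite B" "card B = m"
      using infinite_arbitrarily_large[OF inf] by blast
    have "real m * \<epsilon> powr (q / 2) = (\<Sum>n\<in>B. \<epsilon> powr (q / 2))" by (simp add: B)
    also have "\<dots> \<le> (\<Sum>n\<in>B. \<tau> n powr (q / 2))"
      using B(1) \<epsilon> q by (intro sum_mono powr_mono2) auto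
    also have "\<dots> \<le> S" by (rule S[OF B(2)])
    finally show False using m by simp
  qed
  have bnd: "\<tau> n \<le> S powr (2 / q)" for n
    using S[of "{n}"] \<tau>0 by (intro root) auto
  have compact: "compact_operator bergman_space bergman_norm (composition_operator \<phi>)"
    by (rule composition_compact[OF small bnd]) auto
  have T: "bounded_operator bergman_space bergman_norm (composition_operator \<phi>)"
    by (rule composition_bounded[OF bnd]) simp
  \<comment> \<open>\<open>K\<close> is a divisor below; adding 1 keeps it positive.\<close>
  define K where "K = norm_const + 1"
  have K: "0 < K" "norm_const \<le> K" using norm_const_nonneg by (simp_all add: K_def)
  \<comment> \<open>The factor by which one more vanishing condition shrinks \<open>x\<close>; the
    sum of \<open>x\<close> over a cell is then a geometric series.\<close>
  define r where "r = (1 / 2 :: real) powr (q / 2)"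
  have r: "0 \<le> r" "r < 1" using q powr_less_mono2_neg[of "- (q / 2)" 1 2] by (auto simp: r_def powr_divide powr_less_one)
  define x where "x i = (K * (\<tau> (fst i) * (1 / 2) ^ snd i)) powr (q / 2)" for i :: "nat \<times> nat"
  have x_eq: "x (n, j) = K powr (q / 2) * (\<tau> n powr (q / 2) * r ^ j)" for n j
  proof -
    have "((1 / 2 :: real) ^ j) powr (q / 2) = (\<Prod>i<j. r)"
      unfolding r_def prod_powr_distrib[symmetric] by simp
    then show ?thesis by (simp add: x_def powr_mult)
  qed
  have S0: "0 \<le> S" using S[of "{}"] by simp
  have x_sum: "(\<Sum>i\<in>F. x i) \<le> K powr (q / 2) * (S * (1 / (1 - r)))" if F: "finite F" for F
  proof -
    obtain N where N: "snd ` F \<subseteq> {..<N}"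
      using finite_nat_iff_bounded[of "snd ` F"] F by auto
    have "F \<subseteq> fst ` F \<times> {..<N}" using N by (auto simp: image_subset_iff intro: rev_image_eqI)
    then have "(\<Sum>i\<in>F. x i) \<le> (\<Sum>i\<in>fst ` F \<times> {..<N}. x i)"
      using F by (intro sum_mono2) (auto simp: x_def)
    also have "\<dots> = (\<Sum>n\<in>fst ` F. \<Sum>j<N. x (n, j))" by (subst sum.cartesian_product) simp
    also have "\<dots> = K powr (q / 2) * ((\<Sum>n\<in>fst ` F. \<tau> n powr (q / 2)) * (\<Sum>j<N. r ^ j))"
      unfolding sum_product by (simp only: x_eq sum_distrib_left)
    also have "\<dots> \<le> K powr (q / 2) * (S * (1 / (1 - r)))"
    proof (intro mult_left_mono mult_mono)
      show "(\<Sum>n\<in>fst ` F. \<tau> n powr (q / 2)) \<le> S" using F by (intro S) simp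
      have "(\<Sum>j<N. r ^ j) \<le> (\<Sum>j. r ^ j)" using r by (intro sum_le_suminf) auto
      then show "(\<Sum>j<N. r ^ j) \<le> 1 / (1 - r)" using r suminf_geometric[of r] by simp
    qed (use S0 r in \<open>auto intro!: sum_nonneg\<close>)
    finally show ?thesis .
  qed
  define b where "b n = approximation_number bergman_space bergman_norm (Suc n) (composition_operator \<phi>)" for n
  have b0: "0 \<le> b n" for n unfolding b_def by (rule bergman.approximation_number_nonneg[OF T])
  have greedy: "b (Suc n) powr q \<le> t"
    if F: "finite F" "card F \<le> n" and t0: "0 \<le> t" and t: "\<And>i. i \<notin> F \<Longrightarrow> x i \<le> t" for n F t
  proof -
    define I where "I = active \<inter> fst ` F"
    define J where "J n = (if n \<in> I then LEAST j. (n, j) \<notin> F else 0)" for n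
    have fI: "finite I" using F(1) by (simp add: I_def)
    have ex: "\<exists>j. (m, j) \<notin> F" for m
    proof (rule ccontr)
      assume "\<not> (\<exists>j. (m, j) \<notin> F)"
      then have "Pair m ` UNIV \<subseteq> F" by auto
      then have "finite (Pair m ` (UNIV :: nat set))" using F(1) finite_subset by blast
      then show False by (simp add: finite_image_iff inj_on_def)
    qed
    have J: "(m, J m) \<notin> F" if m: "m \<in> active" for m
    proof (cases "m \<in> I")
      case True
      then show ?thesis using LeastI_ex[OF ex] by (simp add: J_def)
    next
      case False
      then show ?thesis using m by (force simp: I_def)
    qed
    have "(SIGMA m:I. {..<J m}) \<subseteq> F"
      by (auto simp: J_def dest: not_less_Least)
    then have "card (SIGMA m:I. {..<J m}) \<le> card F" by (rule card_mono[OF F(1)])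
    then have sumJ: "(\<Sum>m\<in>I. J m) \<le> n" using fI F(2) by (simp add: card_SigmaI)
    \<comment> \<open>The index is \<open>Suc n\<close> because one rank goes to the value at
      \<open>\<phi> 0\<close>; the omitted first term is restored at the end.\<close>
    have "b (Suc n) \<le> b (Suc (\<Sum>m\<in>I. J m))"
      unfolding b_def using sumJ by (intro bergman.approximation_number_antimono[OF T]) simp
    also have "\<dots> \<le> sqrt (norm_const * (t powr (2 / q) / K))"
      unfolding b_def
    proof (rule composition_approximation_number[OF T fI])
      show "I \<subseteq> active" by (simp add: I_def)
      show "J m = 0" if "m \<notin> I" for m using that by (simp add: J_def)
      show "\<tau> m * (1 / 2) ^ J m \<le> t powr (2 / q) / K" if "m \<in> active" for m
      proof -
        have "x (m, J m) \<le> t" by (rule t[OF J[OF that]])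
        then have "K * (\<tau> m * (1 / 2) ^ J m) \<le> t powr (2 / q)"
          unfolding x_def using K(1) \<tau>0[of m] by (intro root) auto
        then show ?thesis using K(1) by (simp add: field_simps)
      qed
    qed (use K in auto)
    also have "\<dots> \<le> sqrt (t powr (2 / q))"
    proof (rule real_sqrt_le_mono)
      have "norm_const * (t powr (2 / q) / K) \<le> K * (t powr (2 / q) / K)"
        using K by (intro mult_right_mono) auto
      then show "norm_const * (t powr (2 / q) / K) \<le> t powr (2 / q)" using K(1) by simp
    qed
    also have "\<dots> = t powr (1 / q)" by (simp add: powr_half_sqrt[symmetric] powr_powr)
    finally have "b (Suc n) powr q \<le> (t powr (1 / q)) powr q" using q b0 by (intro powr_mono2) auto
    then show ?thesis using q t0 by (simp add: powr_powr)
  qed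
  have "(\<Sum>n<N. b (Suc n) powr q) \<le> K powr (q / 2) * (S * (1 / (1 - r)))" for N
  proof (rule sum_le_of_greedy[where x = x])
    show "0 \<le> x i" for i by (simp add: x_def)
    show "(\<Sum>i\<in>F. x i) \<le> K powr (q / 2) * (S * (1 / (1 - r)))" if "finite F" for F by (rule x_sum[OF that])
    show "b (Suc n) powr q \<le> t" if "finite F" "card F \<le> n" "0 \<le> t" "\<And>i. i \<notin> F \<Longrightarrow> x i \<le> t" for n F t
      using that by (rule greedy)
  qed
  then have "summable (\<lambda>n. b (Suc n) powr q)"
    by (intro summableI_nonneg_bounded) auto
  then have "summable (\<lambda>n. b n powr q)" by (rule iffD1[OF summable_Suc_iff])
  with compact show ?thesis by (simp add: schatten_class_def b_def)
qed

end

theorem theorem4p4: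
  fixes p :: real and \<phi> :: "complex \<Rightarrow> complex"
  assumes "p > 0"
    and "\<phi> holomorphic_on unit_disk"
    and "\<phi> ` unit_disk \<subseteq> unit_disk"
    and "\<not> \<phi> constant_on unit_disk"
    and "composition_operator \<phi> \<in> schatten_class p hardy_space hardy_norm"
  shows "composition_operator \<phi> \<in> schatten_class (p / 2) bergman_space bergman_norm"
proof -
  interpret bounded_hardy_composition \<phi>
    using assms(2,3,5) by unfold_locales (simp_all add: schatten_class_def compact_operator_def)
  have "summable (\<lambda>k. a k powr p)" using assms(5) by (simp add: schatten_class_def a_def)
  from sum_powr_bound[OF assms(1) this]
  obtain S where "\<forall>F. finite F \<longrightarrow> (\<Sum>n\<in>F. \<tau> n powr (p / 4)) \<le> S" ..
  then have "(\<Sum>n\<in>F. \<tau> n powr (p / 2 / 2)) \<le> S" if "finite F" for F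
    using that by simp
  then show ?thesis using assms(1) by (intro schatten_class_of_summable) auto
qed

end
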